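(* Let $0<p<\infty$ and $F\in H^p(\Omega_+)$. Then $F(w)$ has a non-tangential boundary limit $F(\zeta)\in L^p(\Gamma,|\mathrm{d}\zeta|)$ a.e. on $\Gamma$, $\lVert F\rVert_{L^p(\Gamma,|\mathrm{d}\zeta|)}\leqslant\lVert F\rVert_{H^p(\Omega_+)}$, and $\lVert F_{\sigma-\tau,\tau}-\chi_\Gamma F\rVert_{L^p(\gamma,|\mathrm{d}\zeta|)}\to0$ as $\tau\to0$, where $0<\tau<\sigma$. Besides, if $1\leqslant p<\infty$, then $$\frac1{2\pi\mathrm{i}}\int_\Gamma\frac{F(\zeta)}{\zeta-w}\,\mathrm{d}\zeta=\begin{cases}F(w)&\text{if } w\in\Omega_+,\\ 0&\text{if } w\in\Omega_-.\end{cases}$$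
   Context: Fix $\sigma>0$. For $s>0$, $t\in\mathbb{R}$ let $D_{s,t}=\{u+\mathrm{i}v: |u|<s,\ v>t\}$ and let $\Gamma_{s,t}=\partial D_{s,t}=\Gamma_{s,t,1}\cup\Gamma_{s,t,2}\cup\Gamma_{s,t,3}$ with $\Gamma_{s,t,1}=\{-s+\mathrm{i}v: v>t\}$, $\Gamma_{s,t,2}=\{u+\mathrm{i}t: |u|\leqslant s\}$, $\Gamma_{s,t,3}=\{s+\mathrm{i}v: v>t\}$, oriented so that $D_{s,t}$ lies on its left. Put $\Omega_+=D_{\sigma,0}$, $\Omega_-=\mathbb{C}\setminus\overline{D_{\sigma,0}}$, $\Gamma=\Gamma_{\sigma,0}$, $\Gamma_j=\Gamma_{\sigma,0,j}$. $H^p(\Omega_+)$ is the set of $F$ analytic on $\Omega_+$ with $\lVert F\rVert_{H^p(\Omega_+)}=\sup_{0<s<\sigma,\,t>0}\big(\int_{\Gamma_{s,t}}|F(w)|^p|\mathrm{d}w|\big)^{1/p}<\infty$. For $0<p<1$, $\lVert\cdot\rVert_{L^p}$ and $\lVert\cdot\rVert_{H^p}$ are given by the same formulas though not norms. Non-tangential limits: for $\alpha>0$ and $\zeta\in\Gamma\setminus\{\pm\sigma\}$ let $\Omega_{\alpha+}(\zeta)$ be $\zeta+\{x+\mathrm{i}y: x>0,|y|<\alpha x\}$ if $\zeta\in\Gamma_1$, $\zeta+\{x+\mathrm{i}y: y>0,|x|<\alpha y\}$ if $\zeta\in\Gamma_2\setminus\{\pm\sigma\}$, $\zeta+\{x+\mathrm{i}y: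 x<0,|y|<-\alpha x\}$ if $\zeta\in\Gamma_3$. $F$ on $\Omega_+$ has non-tangential boundary limit $F(\zeta_0)$ at $\zeta_0$ if for all $\alpha>0$, $F(w)\to F(\zeta_0)$ as $w\to\zeta_0$, $w\in\Omega_{\alpha+}(\zeta_0)\cap\Omega_+$. Transported functions: let $\gamma_1=\{\mathrm{Re}\,w=-\sigma\}$, $\gamma_2=\mathbb{R}$, $\gamma_3=\{\mathrm{Re}\,w=\sigma\}$, $\gamma=\gamma_1\cup\gamma_2\cup\gamma_3$; $\gamma_{s,t,1}=\gamma_1\cap\{\mathrm{Im}\,w>t\}$, $\gamma_{s,t,2}=\gamma_2\cap\{|\mathrm{Re}\,w|\leqslant s\}$, $\gamma_{s,t,3}=\gamma_3\cap\{\mathrm{Im}\,w>t\}$, $\gamma_{s,t}=\bigcup_j\gamma_{s,t,j}$. Define $P_{s,t}:\gamma_{s,t}\to\Gamma_{s,t}$ by $P_{s,t}(\zeta)=\zeta+(\sigma-s)$ on $\gamma_{s,t,1}$, $\zeta+\mathrm{i}t$ on $\gamma_{s,t,2}$, $\zeta-(\sigma-s)$ on $\gamma_{s,t,3}$. For $G$ defined on $\Gamma_{s,t}$, $G_{s,t}(\zeta)=G(P_{s,t}(\zeta))$ for $\zeta\in\gamma_{s,t}$ and $G_{s,t}(\zeta)=0$ for $\zeta\in\gamma\setminus\gamma_{s,t}$. $\chi_\Gamma F$ denotes $F$ on $\Gamma\subset\gamma$ extended by $0$ to $\gamma$. *)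

theory Defs
  imports "HOL-Complex_Analysis.Complex_Analysis"
begin

section \<open>Half-strips and their boundaries\<close>

definition half_strip :: "real \<Rightarrow> real \<Rightarrow> complex set" where
  "half_strip s t = {w. \<bar>Re w\<bar> < s \<and> Im w > t}"

definition Gamma1 :: "real \<Rightarrow> real \<Rightarrow> complex set" where
  "Gamma1 s t = {w. Re w = - s \<and> Im w > t}"

definition Gamma2 :: "real \<Rightarrow> real \<Rightarrow> complex set" where
  "Gamma2 s t = {w. \<bar>Re w\<bar> \<le> s \<and> Im w = t}"

definition Gamma3 :: "real \<Rightarrow> real \<Rightarrow> complex set" where
  "Gamma3 s t = {w. Re w = s \<and> Im w > t}"

definition bdry :: "real \<Rightarrow> real \<Rightarrow> complex set" where
  "bdry s t = Gamma1 s t \<union> Gamma2 s t \<union> Gamma3 s t"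

definition Omega_plus :: "real \<Rightarrow> complex set" where
  "Omega_plus \<sigma> = half_strip \<sigma> 0"

definition Omega_minus :: "real \<Rightarrow> complex set" where
  "Omega_minus \<sigma> = - closure (half_strip \<sigma> 0)"

lemma closure_half_strip:
  assumes "s > 0"
  shows "closure (half_strip s t) = {w. \<bar>Re w\<bar> \<le> s \<and> Im w \<ge> t}" (is "_ = ?C")
proof
  have "?C = {w. Re w \<le> s} \<inter> {w. Re w \<ge> - s} \<inter> {w. Im w \<ge> t}"
    by auto
  then have "closed ?C"
    by (simp add: closed_halfspace_Re_le closed_halfspace_Re_ge closed_halfspace_Im_ge closed_Int)
  then show "closure (half_strip s t) \<subseteq> ?C"
    by (intro closure_minimal) (auto simp: half_strip_def)
next
  show "?C \<subseteq> closure (half_strip s t)"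
  proof
    fix w assume w: "w \<in> ?C"
    let ?f = "\<lambda>e::real. w + of_real e * (Complex 0 (t + 1) - w)"
    have "(?f \<longlongrightarrow> w + of_real 0 * (Complex 0 (t + 1) - w)) (at_right 0)"
      by (intro tendsto_intros)
    then have lim: "(?f \<longlongrightarrow> w) (at_right 0)"
      by simp
    have mem: "?f e \<in> closure (half_strip s t)" if e: "0 < e" "e < 1" for e
    proof -
      have "Re (?f e) = (1 - e) * Re w"
        by (simp add: algebra_simps)
      then have "\<bar>Re (?f e)\<bar> = (1 - e) * \<bar>Re w\<bar>"
        using e by (simp add: abs_mult)
      also have "\<dots> \<le> (1 - e) * s"
        using w e by (intro mult_left_mono) auto
      also have "\<dots> < s"
        using assms e by (simp add: algebra_simps)
      finally have 1: "\<bar>Re (?f e)\<bar> < s" .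
      have "(1 - e) * t + e * (t + 1) \<le> (1 - e) * Im w + e * (t + 1)"
        using w e by (intro add_right_mono mult_left_mono) auto
      then have "Im (?f e) > t"
        using e by (simp add: algebra_simps)
      with 1 show ?thesis
        using closure_subset[of "half_strip s t"] by (auto simp: half_strip_def)
    qed
    have ev: "\<forall>\<^sub>F e in at_right 0. ?f e \<in> closure (half_strip s t)"
      using eventually_at_right_real[of 0 "1::real"] by (auto elim!: eventually_mono intro!: mem)
    show "w \<in> closure (half_strip s t)"
      by (rule Lim_in_closed_set[OF closed_closure ev _ lim]) simp
  qed
qed

lemma frontier_half_strip:
  assumes "s > 0"
  shows "frontier (half_strip s t) = bdry s t"
proof -
  have "half_strip s t = {w. Re w < s} \<inter> {w. Re w > - s} \<inter> {w. Im w > t}"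
    by (auto simp: half_strip_def)
  then have "open (half_strip s t)"
    by (simp add: open_halfspace_Re_lt open_halfspace_Re_gt open_halfspace_Im_gt open_Int)
  then show ?thesis
    unfolding frontier_def closure_half_strip[OF assms] interior_open
    using assms by (auto simp: half_strip_def bdry_def Gamma1_def Gamma2_def Gamma3_def interior_open)
qed

section \<open>Arc length and integration along the boundary\<close>

text \<open>
  The three lines \<open>Re w = -s\<close>, \<open>Im w = t\<close>, \<open>Re w = s\<close>, parametrised by arc length
  and indexed by 1, 2, 3.
\<close>

definition line :: "real \<Rightarrow> real \<Rightarrow> nat \<Rightarrow> real \<Rightarrow> complex" where
  "line s t j x = (if j = 1 then Complex (- s) x else if j = 2 then Complex x t else Complex s x)"

text \<open>
  Arc length on the union of the three lines: the completion of the sum of the images of Lebesgue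
  measure under the three parametrisations (the lemma \<open>nn_integral_lines_measure\<close> below makes
  this explicit). The two crossing points, which lie on two lines each, are null sets.
\<close>

definition lines_measure :: "real \<Rightarrow> real \<Rightarrow> complex measure" where
  "lines_measure s t =
     completion (distr (count_space {1, 2, 3} \<Otimes>\<^sub>M lborel) borel (\<lambda>(j, x). line s t j x))"

definition arc_measure :: "real \<Rightarrow> real \<Rightarrow> complex measure" where
  "arc_measure s t = restrict_space (lines_measure s t) (bdry s t)"

lemma line_measurable:
  "(\<lambda>(j, x). line s t j x) \<in> measurable (count_space {1, 2, 3} \<Otimes>\<^sub>M lborel) borel"
proof (rule measurable_pair_measure_countable1)
  fix j :: nat
  have "continuous_on UNIV (\<lambda>x. line s t j x)"
    unfolding line_def Complex_eq by (cases "j = 1"; cases "j = 2") (auto intro!: continuous_intros)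
  then show "(\<lambda>x. case (j, x) of (j, x) \<Rightarrow> line s t j x) \<in> borel_measurable lborel"
    by (simp add: borel_measurable_continuous_onI)
qed simp

lemma nn_integral_lines_measure:
  assumes g: "g \<in> borel_measurable borel"
  shows "(\<integral>\<^sup>+ \<zeta>. g \<zeta> \<partial>lines_measure s t) =
    (\<integral>\<^sup>+ v. g (Complex (- s) v) \<partial>lborel) + (\<integral>\<^sup>+ u. g (Complex u t) \<partial>lborel)
      + (\<integral>\<^sup>+ v. g (Complex s v) \<partial>lborel)"
proof -
  let ?M = "count_space {1, 2, 3 :: nat} \<Otimes>\<^sub>M (lborel :: real measure)"
  have m: "(\<lambda>z. g (case z of (j, x) \<Rightarrow> line s t j x)) \<in> borel_measurable ?M"
    using measurable_compose[OF line_measurable g] .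
  have "(\<integral>\<^sup>+ \<zeta>. g \<zeta> \<partial>lines_measure s t) = (\<integral>\<^sup>+ z. g (case z of (j, x) \<Rightarrow> line s t j x) \<partial>?M)"
    unfolding lines_measure_def nn_integral_completion
    by (rule nn_integral_distr[OF line_measurable]) (use g in simp)
  also have "\<dots> = (\<integral>\<^sup>+ j. \<integral>\<^sup>+ x. g (line s t j x) \<partial>lborel \<partial>count_space {1, 2, 3})"
    using lborel.nn_integral_fst[OF m] by simp
  also have "\<dots> = (\<Sum>j\<in>{1, 2, 3}. \<integral>\<^sup>+ x. g (line s t j x) \<partial>lborel)"
    by (rule nn_integral_count_space_finite) simp
  finally show ?thesis
    by (simp add: line_def add.assoc)
qed

lemma bdry_sets: "bdry s t \<in> sets (lines_measure s t)"
proof -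
  have "bdry s t \<in> sets borel"
    unfolding bdry_def Gamma1_def Gamma2_def Gamma3_def by measurable
  then show ?thesis
    unfolding lines_measure_def by auto
qed

text \<open>
  Unit tangent of \<open>bdry s t\<close>, oriented with the half-strip on its left: down the left side, from
  left to right along the bottom, up the right side. Thus \<open>d\<zeta> = tangent s t \<zeta> * |d\<zeta>|\<close>.
\<close>

definition tangent :: "real \<Rightarrow> real \<Rightarrow> complex \<Rightarrow> complex" where
  "tangent s t \<zeta> =
     (if \<zeta> \<in> Gamma1 s t then - \<i> else if \<zeta> \<in> Gamma2 s t then 1 else \<i>)"

definition bdry_integrable :: "real \<Rightarrow> real \<Rightarrow> (complex \<Rightarrow> complex) \<Rightarrow> bool" where
  "bdry_integrable s t g \<longleftrightarrow> integrable (arc_measure s t) (\<lambda>\<zeta>. g \<zeta> * tangent s t \<zeta>)"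

definition bdry_integral :: "real \<Rightarrow> real \<Rightarrow> (complex \<Rightarrow> complex) \<Rightarrow> complex" where
  "bdry_integral s t g = (LINT \<zeta>|arc_measure s t. g \<zeta> * tangent s t \<zeta>)"

section \<open>Lebesgue and Hardy classes\<close>

text \<open>Only used for positive exponents.\<close>

definition ennpowr :: "ennreal \<Rightarrow> real \<Rightarrow> ennreal" where
  "ennpowr x r = (if x = top then top else ennreal (enn2real x powr r))"

definition Lp_norm :: "real \<Rightarrow> complex measure \<Rightarrow> (complex \<Rightarrow> complex) \<Rightarrow> ennreal" where
  "Lp_norm p M f = ennpowr (\<integral>\<^sup>+ \<zeta>. ennreal (cmod (f \<zeta>) powr p) \<partial>M) (1 / p)"

definition Lp :: "real \<Rightarrow> complex measure \<Rightarrow> (complex \<Rightarrow> complex) set" where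
  "Lp p M = {f \<in> borel_measurable M. Lp_norm p M f < top}"

definition Hp_norm :: "real \<Rightarrow> real \<Rightarrow> (complex \<Rightarrow> complex) \<Rightarrow> ennreal" where
  "Hp_norm p \<sigma> F = (SUP s\<in>{0<..<\<sigma>}. SUP t\<in>{0<..}. Lp_norm p (arc_measure s t) F)"

definition Hp :: "real \<Rightarrow> real \<Rightarrow> (complex \<Rightarrow> complex) set" where
  "Hp p \<sigma> = {F. F analytic_on Omega_plus \<sigma> \<and> Hp_norm p \<sigma> F < top}"

section \<open>Non-tangential limits\<close>

text \<open>Only meaningful for \<open>\<zeta>\<close> on the boundary and different from the corners.\<close>

definition cone :: "real \<Rightarrow> real \<Rightarrow> complex \<Rightarrow> complex set" where
  "cone \<sigma> \<alpha> \<zeta> = (\<lambda>z. \<zeta> + z) `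
     (if \<zeta> \<in> Gamma1 \<sigma> 0 then {z. Re z > 0 \<and> \<bar>Im z\<bar> < \<alpha> * Re z}
      else if \<zeta> \<in> Gamma2 \<sigma> 0 then {z. Im z > 0 \<and> \<bar>Re z\<bar> < \<alpha> * Im z}
      else {z. Re z < 0 \<and> \<bar>Im z\<bar> < - \<alpha> * Re z})"

definition has_nt_limit :: "real \<Rightarrow> (complex \<Rightarrow> complex) \<Rightarrow> complex \<Rightarrow> complex \<Rightarrow> bool" where
  "has_nt_limit \<sigma> F \<zeta> l \<longleftrightarrow>
     \<zeta> \<in> bdry \<sigma> 0 - {- of_real \<sigma>, of_real \<sigma>} \<and>
     (\<forall>\<alpha>>0. (F \<longlongrightarrow> l) (at \<zeta> within cone \<sigma> \<alpha> \<zeta> \<inter> Omega_plus \<sigma>))"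

section \<open>Transport to the fixed lines\<close>

definition gam1 :: "real \<Rightarrow> complex set" where
  "gam1 \<sigma> = {w. Re w = - \<sigma>}"

definition gam2 :: "complex set" where
  "gam2 = {w. Im w = 0}"

definition gam3 :: "real \<Rightarrow> complex set" where
  "gam3 \<sigma> = {w. Re w = \<sigma>}"

definition gam :: "real \<Rightarrow> complex set" where
  "gam \<sigma> = gam1 \<sigma> \<union> gam2 \<union> gam3 \<sigma>"

definition gam_measure :: "real \<Rightarrow> complex measure" where
  "gam_measure \<sigma> = restrict_space (lines_measure \<sigma> 0) (gam \<sigma>)"

text \<open>
  \<open>G\<close> on \<open>bdry s t\<close>, transported to the parts of the three fixed lines lying over it and extended
  by 0. For \<open>0 < s < \<sigma>\<close> and \<open>t > 0\<close> the three parts are pairwise disjoint.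
\<close>

definition transport ::
    "real \<Rightarrow> real \<Rightarrow> real \<Rightarrow> (complex \<Rightarrow> complex) \<Rightarrow> complex \<Rightarrow> complex" where
  "transport \<sigma> s t G \<zeta> =
     (if \<zeta> \<in> gam1 \<sigma> \<inter> {w. Im w > t} then G (\<zeta> + of_real (\<sigma> - s))
      else if \<zeta> \<in> gam2 \<inter> {w. \<bar>Re w\<bar> \<le> s} then G (\<zeta> + \<i> * of_real t)
      else if \<zeta> \<in> gam3 \<sigma> \<inter> {w. Im w > t} then G (\<zeta> - of_real (\<sigma> - s))
      else 0)"

end

theory Submission
  imports Defs "HOL-Probability.Sinc_Integral"
begin

text \<open>
  Everything is reduced to the Hardy class \<open>H\<^sup>2\<close> of the upper half-plane (\<open>hardy2\<close>), where
  mean squares can be computed with; the exponent \<open>p\<close> enters only through a power of a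
  holomorphic function with positive real part.

  Put \<open>q = p / 2\<close>. On a rectangle inside the half-strip, \<open>|F|\<^sup>q\<close> is
  dominated by a sum of four Poisson integrals, one for the half-plane bounded by each side, with
  data \<open>2 |F|\<^sup>q\<close> on that side. Each of them is the imaginary part of a Cauchy transform of square
  integrable data, and such transforms lie in \<open>H\<^sup>2\<close> with a bound that does not depend on the
  rectangle (\<open>cauchy_transform_hardy2\<close>). When the rectangles exhaust the half-strip, a normal
  family argument turns three of the transforms into \<open>H\<^sup>2\<close> functions of the half-planes bounded by
  the lines \<open>Re w = -\<sigma>\<close>, \<open>Im w = 0\<close>, \<open>Re w = \<sigma>\<close>, and the one of the top side disappears. So
  \<open>|F|\<^sup>q \<le> Re K\<close> with \<open>K\<close> a sum of three \<open>H\<^sup>2\<close> functions (\<open>half_strip_majorant\<close>). The quotient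
  \<open>F / K\<^bsup>2/p\<^esup>\<close> is then bounded; divided by \<open>w + \<i>\<close> it is square integrable along the sides, so that
  the same exhaustion, applied to Cauchy's formula, makes it a sum \<open>B\<close> of three \<open>H\<^sup>2\<close> functions as
  well (\<open>half_strip_decomposition\<close>). Altogether \<open>F = B (w + \<i>) K\<^bsup>2/p\<^esup>\<close> with \<open>Re K > 0\<close>
  (\<open>Hp_factorization\<close>).

  Functions in \<open>H\<^sup>2\<close> have non-tangential limits almost everywhere by the maximal
  theorem (\<open>hardy2_nontangential_limit\<close>); hence so do \<open>B\<close>, \<open>K\<close> and \<open>F\<close>. The inequality of norms is
  Fatou's lemma.

  On the boundary of the shrunken half-strip \<open>|F|\<^sup>p \<le> |K|\<^sup>2\<close>, and \<open>K\<close> converges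
  in mean square to its boundary values: each of the three summands is seen along lines that
  approach the boundary of its half-plane, or a parallel line inside it, or a line perpendicular to
  it. The last case rests on an inequality of Fejer-Riesz type (\<open>hardy2_transversal\<close>), the others
  on the continuity of translations. A dominated convergence theorem with varying majorants
  (\<open>nn_integral_generalized_dominated\<close>) carries the convergence over to \<open>F\<close> in the \<open>p\<close>-th mean.

  For \<open>p \<ge> 1\<close> the formula for rectangles passes to the limit by the same
  theorem, since \<open>a / (1 + |x|) \<le> (1 + |x|)\<^bsup>-1-1/p\<^esup> + a\<^sup>p\<close> makes the product of \<open>F\<close> and the Cauchy
  kernel dominated by an integrable function and \<open>|K|\<^sup>2\<close>.

  Instead of the Fourier transform, the theory of \<open>H\<^sup>2\<close> uses contour shifts. They show that
  squared norms on horizontal lines satisfy a parallelogram identity (\<open>hardy2_parallelogram\<close>),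
  which gives mean convergence at the boundary, and that the square of a Cauchy transform has
  integral 0, so that its real and imaginary parts have the same norm.
\<close>

section \<open>Integrals over rectangles\<close>

lemma has_contour_integral_linepath_same_Im_iff:
  assumes "a < b"
  shows "(f has_contour_integral I) (linepath (Complex a c) (Complex b c)) \<longleftrightarrow>
    ((\<lambda>x. f (Complex x c)) has_integral I) {a..b}"
proof -
  have "(f has_contour_integral I) (linepath (Complex a c) (Complex b c)) \<longleftrightarrow>
      ((\<lambda>x. f (Complex (a + (b - a) * x) c) * (b - a)) has_integral I) {0..1}"
    unfolding has_contour_integral_linepath
    by (intro has_integral_cong arg_cong2[of _ _ _ _ "(*)"] arg_cong[of _ _ f])
      (auto simp: linepath_def complex_eq_iff algebra_simps)
  also have "{0..1} = (\<lambda>x. x / (b - a)) ` {0..b-a}"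
    using assms by simp
  also have "((\<lambda>x. f (Complex (a + (b - a) * x) c) * (b - a)) has_integral I) \<dots> \<longleftrightarrow>
      ((\<lambda>x. f (Complex (a + x) c) * (b - a)) has_integral ((b-a) *\<^sub>R I)) {0..b-a}"
    by (subst has_integral_stretch_real_iff) (use assms in simp_all)
  also have "\<dots> \<longleftrightarrow> ((\<lambda>x. of_real (b-a) * f (Complex x c)) has_integral (b-a) *\<^sub>R I) {a..b}"
    by (subst has_integral_shift_real_ivl_iff[where c = "-a"])
       (simp_all add: scaleR_conv_of_real mult_ac)
  also have "\<dots> \<longleftrightarrow> ((\<lambda>x. f (Complex x c)) has_integral I) {a..b}"
    by (subst has_integral_mult_right_iff) (use assms in \<open>auto simp: scaleR_conv_of_real\<close>)
  finally show ?thesis .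
qed

text \<open>
  The contour integral over the boundary of the rectangle with opposite corners \<open>Complex x1 a\<close> and
  \<open>Complex x2 b\<close>, counterclockwise, in terms of real integrals over the four sides.
\<close>

definition rect_integral :: "(complex \<Rightarrow> complex) \<Rightarrow> real \<Rightarrow> real \<Rightarrow> real \<Rightarrow> real \<Rightarrow> complex" where
  "rect_integral g x1 x2 a b =
     integral {x1..x2} (\<lambda>x. g (Complex x a)) + \<i> * integral {a..b} (\<lambda>y. g (Complex x2 y))
     - integral {x1..x2} (\<lambda>x. g (Complex x b)) - \<i> * integral {a..b} (\<lambda>y. g (Complex x1 y))"

lemma rect_integral_eq_contour_integral:
  assumes "x1 < x2" "a < b"
    and g: "continuous_on (path_image (rectpath (Complex x1 a) (Complex x2 b))) g"
    and I: "(g has_contour_integral I) (rectpath (Complex x1 a) (Complex x2 b))"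
  shows "rect_integral g x1 x2 a b = I"
proof -
  let ?P = "path_image (rectpath (Complex x1 a) (Complex x2 b))"
  have P: "?P = {z. Re z \<in> {x1, x2} \<and> Im z \<in> {a..b}} \<union> {z. Im z \<in> {a, b} \<and> Re z \<in> {x1..x2}}"
    using assms(1,2) by (subst path_image_rectpath) auto
  have sub: "closed_segment (Complex x1 a) (Complex x2 a) \<subseteq> ?P"
    "closed_segment (Complex x2 a) (Complex x2 b) \<subseteq> ?P"
    "closed_segment (Complex x1 b) (Complex x2 b) \<subseteq> ?P"
    "closed_segment (Complex x1 a) (Complex x1 b) \<subseteq> ?P"
    unfolding P using assms(1,2)
    by (auto simp: closed_segment_same_Re closed_segment_same_Im closed_segment_eq_real_ivl)
  have c: "(g has_contour_integral contour_integral (linepath u v) g) (linepath u v)"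
    if "closed_segment u v \<subseteq> ?P" for u v
    by (intro has_contour_integral_integral contour_integrable_continuous_linepath
        continuous_on_subset[OF g that])
  note c' = c[OF sub(1)] c[OF sub(2)] c[OF sub(3)] c[OF sub(4)]
  have 1: "contour_integral (linepath (Complex x1 a) (Complex x2 a)) g
      = integral {x1..x2} (\<lambda>x. g (Complex x a))"
    using c'(1) by (subst (asm) has_contour_integral_linepath_same_Im_iff[OF assms(1)])
      (auto dest: integral_unique)
  have 3: "contour_integral (linepath (Complex x1 b) (Complex x2 b)) g
      = integral {x1..x2} (\<lambda>x. g (Complex x b))"
    using c'(3) by (subst (asm) has_contour_integral_linepath_same_Im_iff[OF assms(1)])
      (auto dest: integral_unique)
  have 2: "contour_integral (linepath (Complex x2 a) (Complex x2 b)) g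
      = \<i> * integral {a..b} (\<lambda>y. g (Complex x2 y))"
    using c'(2) by (subst (asm) has_contour_integral_linepath_same_Re_iff[where c = x2 and a = a and b = b])
      (use assms(2) in \<open>auto dest!: integral_unique\<close>)
  have 4: "contour_integral (linepath (Complex x1 a) (Complex x1 b)) g
      = \<i> * integral {a..b} (\<lambda>y. g (Complex x1 y))"
    using c'(4) by (subst (asm) has_contour_integral_linepath_same_Re_iff[where c = x1 and a = a and b = b])
      (use assms(2) in \<open>auto dest!: integral_unique\<close>)
  have r: "contour_integral (linepath u v) g = - contour_integral (linepath v u) g"
    if "closed_segment v u \<subseteq> ?P" for u v
    using contour_integral_reverse_linepath[OF continuous_on_subset[OF g that]] by simp
  have "(g has_contour_integral
      (contour_integral (linepath (Complex x1 a) (Complex x2 a)) g +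
       (contour_integral (linepath (Complex x2 a) (Complex x2 b)) g +
        (contour_integral (linepath (Complex x2 b) (Complex x1 b)) g +
         contour_integral (linepath (Complex x1 b) (Complex x1 a)) g))))
      (rectpath (Complex x1 a) (Complex x2 b))"
    unfolding rectpath_def Let_def complex.sel
    using sub by (intro has_contour_integral_join c valid_path_join) (auto simp: closed_segment_commute)
  from has_contour_integral_unique[OF this I] show ?thesis
    unfolding rect_integral_def
    using r[of "Complex x1 b" "Complex x2 b"] r[of "Complex x1 a" "Complex x1 b"] sub 1 2 3 4
    by (simp add: algebra_simps)
qed

lemma path_image_rectpath_subset:
  assumes "x1 < x2" "a < b" "cbox (Complex x1 a) (Complex x2 b) \<subseteq> S"
  shows "path_image (rectpath (Complex x1 a) (Complex x2 b)) \<subseteq> S"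
  using path_image_rectpath_subset_cbox[of "Complex x1 a" "Complex x2 b"] assms by auto

lemma rect_integral_zero:
  assumes "x1 < x2" "a < b" "convex S" "g holomorphic_on S"
    and "cbox (Complex x1 a) (Complex x2 b) \<subseteq> S"
  shows "rect_integral g x1 x2 a b = 0"
proof -
  note P = path_image_rectpath_subset[OF assms(1,2,5)]
  show ?thesis
    using assms P
    by (intro rect_integral_eq_contour_integral Cauchy_theorem_convex_simple[where S = S])
      (auto intro: continuous_on_subset holomorphic_on_imp_continuous_on)
qed

lemma rect_integral_Cauchy:
  assumes "x1 < x2" "a < b" "convex S" "open S" "g holomorphic_on S"
    and "cbox (Complex x1 a) (Complex x2 b) \<subseteq> S"
    and w: "x1 < Re w" "Re w < x2" "a < Im w" "Im w < b"
  shows "rect_integral (\<lambda>\<zeta>. g \<zeta> / (\<zeta> - w)) x1 x2 a b = 2 * pi * \<i> * g w"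
proof -
  let ?g = "rectpath (Complex x1 a) (Complex x2 b)"
  note P = path_image_rectpath_subset[OF assms(1,2,6)]
  have wb: "w \<in> box (Complex x1 a) (Complex x2 b)"
    using w by (simp add: in_box_complex_iff)
  have wn: "w \<notin> path_image ?g"
    using w by (subst path_image_rectpath) auto
  have "w \<in> S"
    using wb assms(6) box_subset_cbox by blast
  have "((\<lambda>\<zeta>. g \<zeta> / (\<zeta> - w)) has_contour_integral (2*pi * \<i> * winding_number ?g w * g w)) ?g"
    using assms P \<open>w \<in> S\<close> wn
    by (intro Cauchy_integral_formula_convex_simple[where S = S]) (auto simp: interior_open)
  then have "((\<lambda>\<zeta>. g \<zeta> / (\<zeta> - w)) has_contour_integral (2*pi * \<i> * g w)) ?g"
    using winding_number_rectpath[OF wb] by simp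
  then show ?thesis
    using P wn assms
    by (intro rect_integral_eq_contour_integral continuous_intros)
      (auto intro: continuous_on_subset holomorphic_on_imp_continuous_on)
qed

lemma emeasure_lborel_Ioi: "emeasure lborel {X::real<..} = top"
proof (rule ccontr)
  assume "emeasure lborel {X<..} \<noteq> top"
  then obtain r where r: "emeasure lborel {X<..} = ennreal r" "0 \<le> r"
    using ennreal_cases by auto
  have "emeasure lborel {X<..<X + (r + 1)} \<le> emeasure lborel {X<..}"
    by (intro emeasure_mono) auto
  then show False
    using r by simp
qed

text \<open>
  Contours are closed by vertical sides chosen far out where an integrable function is small.
\<close>

lemma exists_small_value:
  fixes V :: "real \<Rightarrow> ennreal"
  assumes V: "V \<in> borel_measurable borel" "(\<integral>\<^sup>+x. V x \<partial>lborel) < top" and "e > 0"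
  shows "\<exists>R>X. V R < e"
proof (rule ccontr)
  assume "\<not> ?thesis"
  then have *: "V R \<ge> e" if "R > X" for R
    using that by force
  have "top = e * emeasure lborel {X<..}"
    using \<open>e > 0\<close> by (simp add: emeasure_lborel_Ioi ennreal_mult_top)
  also have "\<dots> = (\<integral>\<^sup>+x. e * indicator {X<..} x \<partial>lborel)"
    by (simp add: nn_integral_cmult_indicator)
  also have "\<dots> \<le> (\<integral>\<^sup>+x. V x \<partial>lborel)"
    by (intro nn_integral_mono) (use * in \<open>auto simp: indicator_def\<close>)
  finally show False
    using V(2) by (simp add: top_unique)
qed

lemma continuous_integral_lborel:
  fixes g :: "real \<Rightarrow> complex"
  assumes "continuous_on {a..b} g"
  shows "integrable lborel (\<lambda>x. indicator {a..b} x *\<^sub>R g x)"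
    and "integral {a..b} g = (LINT x|lborel. indicator {a..b} x *\<^sub>R g x)"
proof -
  have "set_integrable lborel {a..b} g"
    by (rule borel_integrable_compact[unfolded set_integrable_def[symmetric]]) (use assms in auto)
  then show "integrable lborel (\<lambda>x. indicator {a..b} x *\<^sub>R g x)"
    and "integral {a..b} g = (LINT x|lborel. indicator {a..b} x *\<^sub>R g x)"
    using set_borel_integral_eq_integral(2)[of "{a..b}" g]
    by (auto simp: set_integrable_def set_lebesgue_integral_def)
qed

lemma norm_integral_le_nn_integral:
  fixes g :: "real \<Rightarrow> complex"
  assumes "continuous_on {a..b} g" "\<And>x. x \<in> {a..b} \<Longrightarrow> ennreal (cmod (g x)) \<le> \<phi> x"
  shows "ennreal (cmod (integral {a..b} g)) \<le> (\<integral>\<^sup>+x. indicator {a..b} x * \<phi> x \<partial>lborel)"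
proof -
  have "ennreal (cmod (integral {a..b} g)) \<le> (\<integral>\<^sup>+x. cmod (indicator {a..b} x *\<^sub>R g x) \<partial>lborel)"
    unfolding continuous_integral_lborel(2)[OF assms(1)]
    by (rule integral_norm_bound_ennreal[OF continuous_integral_lborel(1)[OF assms(1)]])
  also have "\<dots> \<le> (\<integral>\<^sup>+x. indicator {a..b} x * \<phi> x \<partial>lborel)"
    by (intro nn_integral_mono) (use assms(2) in \<open>auto simp: indicator_def\<close>)
  finally show ?thesis .
qed

lemma integral_symmetric_tendsto:
  fixes g :: "real \<Rightarrow> complex"
  assumes "continuous_on UNIV g" "integrable lborel g" "\<And>n. R n > real n"
  shows "(\<lambda>n. integral {- R n..R n} g) \<longlonglongrightarrow> (LINT x|lborel. g x)"
proof -
  have "(\<lambda>n. LINT x|lborel. indicator {- R n..R n} x *\<^sub>R g x) \<longlonglongrightarrow> (LINT x|lborel. g x)"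
  proof (rule integral_dominated_convergence[where w = "\<lambda>x. cmod (g x)"])
    show "AE x in lborel. (\<lambda>n. indicator {- R n..R n} x *\<^sub>R g x) \<longlonglongrightarrow> g x"
    proof (rule AE_I2)
      fix x
      obtain N where N: "real N > \<bar>x\<bar>" using reals_Archimedean2 by blast
      have "indicator {- R n..R n} x *\<^sub>R g x = g x" if "n \<ge> N" for n
        using N assms(3)[of n] that by (auto simp: indicator_def)
      then show "(\<lambda>n. indicator {- R n..R n} x *\<^sub>R g x) \<longlonglongrightarrow> g x"
        by (intro tendsto_eventually) (auto simp: eventually_sequentially)
    qed
  qed (use assms in \<open>auto simp: indicator_def\<close>)
  then show ?thesis
    using continuous_integral_lborel(2)[of "- R n" "R n" g for n] continuous_on_subset[OF assms(1)]
    by simp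
qed

lemma continuous_on_horizontal:
  assumes "f holomorphic_on S" "\<And>x. x \<in> A \<Longrightarrow> Complex x y \<in> S"
  shows "continuous_on A (\<lambda>x. f (Complex x y))"
proof -
  have "continuous_on A (\<lambda>x. Complex x y)"
    unfolding Complex_eq by (intro continuous_intros)
  then show ?thesis
    using assms by (intro continuous_on_compose2[OF holomorphic_on_imp_continuous_on[OF assms(1)]]) auto
qed

lemma continuous_on_vertical:
  assumes "f holomorphic_on S" "\<And>y. y \<in> A \<Longrightarrow> Complex x y \<in> S"
  shows "continuous_on A (\<lambda>y. f (Complex x y))"
proof -
  have "continuous_on A (\<lambda>y. Complex x y)"
    unfolding Complex_eq by (intro continuous_intros)
  then show ?thesis
    using assms by (intro continuous_on_compose2[OF holomorphic_on_imp_continuous_on[OF assms(1)]]) auto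
qed

lemma measurable_Complex [measurable (raw)]:
  assumes "f \<in> borel_measurable M" "g \<in> borel_measurable M"
  shows "(\<lambda>x. Complex (f x) (g x)) \<in> borel_measurable M"
  using assms unfolding Complex_eq by measurable

lemma nn_integral_reflect:
  fixes V :: "real \<Rightarrow> ennreal"
  assumes "V \<in> borel_measurable borel"
  shows "(\<integral>\<^sup>+x. V (- x) \<partial>lborel) = (\<integral>\<^sup>+x. V x \<partial>lborel)"
  using nn_integral_real_affine[OF assms, of "-1" 0] by simp

lemma nn_integral_translate:
  fixes V :: "real \<Rightarrow> ennreal"
  assumes "V \<in> borel_measurable borel"
  shows "(\<integral>\<^sup>+x. V (t + x) \<partial>lborel) = (\<integral>\<^sup>+x. V x \<partial>lborel)"
  using nn_integral_real_affine[OF assms, of 1 t] by simp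

text \<open>
  Cauchy's theorem on the rectangles \<open>[-R, R] \<times> [a, b]\<close>. By Fubini the integral of \<open>|h|\<close> over a
  vertical segment is an integrable function of the abscissa, so for suitable large \<open>R\<close> both vertical
  sides contribute little.
\<close>

lemma horizontal_integral_shift:
  assumes h: "h holomorphic_on S" "convex S" "h \<in> borel_measurable borel"
    and S: "\<And>x y. a \<le> y \<Longrightarrow> y \<le> b \<Longrightarrow> Complex x y \<in> S" and "a < b"
    and fin: "(\<integral>\<^sup>+y. indicator {a..b} y * (\<integral>\<^sup>+x. cmod (h (Complex x y)) \<partial>lborel) \<partial>lborel) < top"
    and ia: "integrable lborel (\<lambda>x. h (Complex x a))"
    and ib: "integrable lborel (\<lambda>x. h (Complex x b))"
  shows "(LINT x|lborel. h (Complex x a)) = (LINT x|lborel. h (Complex x b))"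
proof -
  note [measurable] = h(3)
  define V where "V x = (\<integral>\<^sup>+y. indicator {a..b} y * ennreal (cmod (h (Complex x y))) \<partial>lborel)" for x
  have [measurable]: "V \<in> borel_measurable borel"
    unfolding V_def by measurable
  have "(\<integral>\<^sup>+x. V x \<partial>lborel) =
      (\<integral>\<^sup>+y. \<integral>\<^sup>+x. indicator {a..b} y * ennreal (cmod (h (Complex x y))) \<partial>lborel \<partial>lborel)"
    unfolding V_def by (rule lborel_pair.Fubini'[symmetric]) measurable
  also have "\<dots> = (\<integral>\<^sup>+y. indicator {a..b} y * (\<integral>\<^sup>+x. cmod (h (Complex x y)) \<partial>lborel) \<partial>lborel)"
    by (intro nn_integral_cong nn_integral_cmult) measurable
  finally have Vfin: "(\<integral>\<^sup>+x. V x \<partial>lborel) < top"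
    using fin by simp
  have "(\<integral>\<^sup>+x. V x + V (- x) \<partial>lborel) = (\<integral>\<^sup>+x. V x \<partial>lborel) + (\<integral>\<^sup>+x. V (- x) \<partial>lborel)"
    by (rule nn_integral_add) measurable
  then have fin2: "(\<integral>\<^sup>+x. V x + V (- x) \<partial>lborel) < top"
    using Vfin nn_integral_reflect[of V] by simp
  have "\<exists>R>real n. V R + V (- R) < ennreal (1 / (real n + 1))" for n
    by (rule exists_small_value[OF _ fin2]) auto
  then obtain R where R: "\<And>n. R n > real n"
    "\<And>n. V (R n) + V (- R n) < ennreal (1 / (real n + 1))"
    by metis
  have bound: "cmod (integral {- R n..R n} (\<lambda>x. h (Complex x a)) - integral {- R n..R n} (\<lambda>x. h (Complex x b)))
      \<le> 1 / (real n + 1)" for n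
  proof -
    have Rn: "- R n < R n" using R(1)[of n] by auto
    have "rect_integral h (- R n) (R n) a b = 0"
      using S by (intro rect_integral_zero[OF Rn \<open>a < b\<close> h(2,1)])
        (auto simp: in_cbox_complex_iff, metis complex.collapse)
    then have eq: "integral {- R n..R n} (\<lambda>x. h (Complex x a)) - integral {- R n..R n} (\<lambda>x. h (Complex x b))
       = \<i> * integral {a..b} (\<lambda>y. h (Complex (- R n) y)) - \<i> * integral {a..b} (\<lambda>y. h (Complex (R n) y))"
      unfolding rect_integral_def by (simp add: algebra_simps)
    have v: "ennreal (cmod (integral {a..b} (\<lambda>y. h (Complex x y)))) \<le> V x" for x
      unfolding V_def using S
      by (intro norm_integral_le_nn_integral continuous_on_vertical[OF h(1)]) auto
    have "ennreal (cmod (\<i> * integral {a..b} (\<lambda>y. h (Complex (- R n) y)) - \<i> * integral {a..b} (\<lambda>y. h (Complex (R n) y))))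
      \<le> ennreal (cmod (integral {a..b} (\<lambda>y. h (Complex (- R n) y))) + cmod (integral {a..b} (\<lambda>y. h (Complex (R n) y))))"
      by (intro ennreal_leI order.trans[OF norm_triangle_ineq4]) (simp add: norm_mult)
    also have "\<dots> \<le> V (- R n) + V (R n)"
      using v by (subst ennreal_plus) (auto intro: add_mono)
    also have "\<dots> \<le> ennreal (1 / (real n + 1))"
      using R(2)[of n] by (simp add: add.commute less_imp_le)
    finally show ?thesis
      unfolding eq by (subst (asm) ennreal_le_iff) auto
  qed
  have "(\<lambda>n. 1 / (real n + 1)) \<longlonglongrightarrow> 0"
    using LIMSEQ_inverse_real_of_nat by (simp add: inverse_eq_divide add.commute)
  then have "(\<lambda>n. integral {- R n..R n} (\<lambda>x. h (Complex x a)) - integral {- R n..R n} (\<lambda>x. h (Complex x b))) \<longlonglongrightarrow> 0"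
    by (rule Lim_null_comparison[rotated]) (use bound in auto)
  moreover have "(\<lambda>n. integral {- R n..R n} (\<lambda>x. h (Complex x a)) - integral {- R n..R n} (\<lambda>x. h (Complex x b)))
      \<longlonglongrightarrow> (LINT x|lborel. h (Complex x a)) - (LINT x|lborel. h (Complex x b))"
    using S \<open>a < b\<close>
    by (intro tendsto_diff integral_symmetric_tendsto continuous_on_horizontal[OF h(1)] ia ib R(1)) auto
  ultimately show ?thesis
    using LIMSEQ_unique by fastforce
qed

section \<open>Poisson kernel\<close>

definition poisson :: "real \<Rightarrow> real \<Rightarrow> real" where
  "poisson y t = y / (pi * (t\<^sup>2 + y\<^sup>2))"

lemma poisson_measurable [measurable (raw)]:
  assumes [measurable]: "f \<in> borel_measurable M" "g \<in> borel_measurable M"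
  shows "(\<lambda>x. poisson (f x) (g x)) \<in> borel_measurable M"
  unfolding poisson_def by measurable

lemma poisson_nonneg: "y \<ge> 0 \<Longrightarrow> poisson y t \<ge> 0"
  by (simp add: poisson_def)

lemma nn_integral_inverse_1_plus_square: "(\<integral>\<^sup>+t. ennreal (inverse (1 + t\<^sup>2)) \<partial>lborel) = ennreal pi"
proof -
  have 1: "integrable lborel (\<lambda>t::real. inverse (1 + t\<^sup>2))"
    using integrable_inverse_1_plus_square by (simp add: set_integrable_def)
  have 2: "(LINT t|lborel. inverse (1 + t\<^sup>2)) = pi"
    using LBINT_inverse_1_plus_square by (simp add: interval_lebesgue_integral_def set_lebesgue_integral_def)
  show ?thesis
    using nn_integral_eq_integral[OF 1] 2 by simp
qed

lemma nn_integral_poisson: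
  assumes "y > 0"
  shows "(\<integral>\<^sup>+t. ennreal (poisson y (x - t)) \<partial>lborel) = 1"
proof -
  have "(\<integral>\<^sup>+t. ennreal (poisson y (x - t)) \<partial>lborel) =
      ennreal \<bar>y\<bar> * (\<integral>\<^sup>+t. ennreal (poisson y (x - (x + y * t))) \<partial>lborel)"
    by (rule nn_integral_real_affine) (use assms in auto)
  also have "\<dots> = (\<integral>\<^sup>+t. ennreal \<bar>y\<bar> * ennreal (poisson y (x - (x + y * t))) \<partial>lborel)"
    by (rule nn_integral_cmult[symmetric]) auto
  also have "\<dots> = (\<integral>\<^sup>+t. ennreal (1 / pi) * ennreal (inverse (1 + t\<^sup>2)) \<partial>lborel)"
  proof (intro nn_integral_cong)
    fix t :: real
    have "1 + t\<^sup>2 > 0"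
      using zero_le_power2[of t] by linarith
    have "(y * t)\<^sup>2 + y\<^sup>2 = y * y * (1 + t\<^sup>2)"
      by (simp add: algebra_simps power2_eq_square)
    then have "\<bar>y\<bar> * poisson y (x - (x + y * t)) = y * y / (pi * (y * y * (1 + t\<^sup>2)))"
      using assms by (simp add: poisson_def)
    also have "\<dots> = 1 / pi * inverse (1 + t\<^sup>2)"
      using assms \<open>1 + t\<^sup>2 > 0\<close> by (simp add: divide_simps)
    finally have "\<bar>y\<bar> * poisson y (x - (x + y * t)) = 1 / pi * inverse (1 + t\<^sup>2)" .
    then show "ennreal \<bar>y\<bar> * ennreal (poisson y (x - (x + y * t))) = ennreal (1 / pi) * ennreal (inverse (1 + t\<^sup>2))"
      using assms by (simp flip: ennreal_mult add: poisson_nonneg)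
  qed
  also have "\<dots> = ennreal (1 / pi) * ennreal pi"
    by (subst nn_integral_cmult) (auto simp: nn_integral_inverse_1_plus_square)
  also have "\<dots> = 1"
    by (simp flip: ennreal_mult)
  finally show ?thesis .
qed

lemma nn_integral_inverse_quadratic:
  assumes "y > 0"
  shows "(\<integral>\<^sup>+t. ennreal (1 / ((x - t)\<^sup>2 + y\<^sup>2)) \<partial>lborel) = ennreal (pi / y)"
proof -
  have "(\<integral>\<^sup>+t. ennreal (1 / ((x - t)\<^sup>2 + y\<^sup>2)) \<partial>lborel) =
      (\<integral>\<^sup>+t. ennreal (pi / y) * ennreal (poisson y (x - t)) \<partial>lborel)"
    using assms by (intro nn_integral_cong) (simp flip: ennreal_mult add: poisson_nonneg, simp add: poisson_def)
  also have "\<dots> = ennreal (pi / y)"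
    by (subst nn_integral_cmult) (use nn_integral_poisson[OF assms] in auto)
  finally show ?thesis .
qed

text \<open>
  The Cauchy-Schwarz inequality for the factors \<open>sqrt k\<close> and \<open>sqrt k * g\<close>.
\<close>

lemma nn_integral_average_square:
  fixes k g :: "'a \<Rightarrow> real"
  assumes [measurable]: "k \<in> borel_measurable M" "g \<in> borel_measurable M"
    and "\<And>t. k t \<ge> 0" "\<And>t. g t \<ge> 0" and k1: "(\<integral>\<^sup>+t. k t \<partial>M) \<le> 1"
  shows "(\<integral>\<^sup>+t. k t * g t \<partial>M)\<^sup>2 \<le> (\<integral>\<^sup>+t. k t * (g t)\<^sup>2 \<partial>M)"
proof -
  have "(\<integral>\<^sup>+t. k t * g t \<partial>M) = (\<integral>\<^sup>+t. ennreal (sqrt (k t)) * ennreal (sqrt (k t) * g t) \<partial>M)"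
    using assms by (intro nn_integral_cong) (simp flip: ennreal_mult add: mult.assoc[symmetric])
  also have "\<dots>\<^sup>2 \<le> (\<integral>\<^sup>+t. (ennreal (sqrt (k t)))\<^sup>2 \<partial>M) * (\<integral>\<^sup>+t. (ennreal (sqrt (k t) * g t))\<^sup>2 \<partial>M)"
    by (rule Cauchy_Schwarz_nn_integral) auto
  also have "\<dots> = (\<integral>\<^sup>+t. k t \<partial>M) * (\<integral>\<^sup>+t. k t * (g t)\<^sup>2 \<partial>M)"
    using assms by (simp add: ennreal_power power_mult_distrib)
  also have "\<dots> \<le> 1 * (\<integral>\<^sup>+t. k t * (g t)\<^sup>2 \<partial>M)"
    using k1 by (intro mult_right_mono) auto
  finally show ?thesis by simp
qed

section \<open>The Hardy space of the upper half-plane\<close>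

abbreviation upper_half_plane :: "complex set" where
  "upper_half_plane \<equiv> {z. 0 < Im z}"

definition sqnorm :: "(real \<Rightarrow> complex) \<Rightarrow> ennreal" where
  "sqnorm g = (\<integral>\<^sup>+x. ennreal ((cmod (g x))\<^sup>2) \<partial>lborel)"

text \<open>
  The bound is a parameter because closeness of \<open>f\<close> and \<open>g\<close> is expressed below as \<open>f - g\<close> having a
  small bound. Measurability on the whole plane makes integrals along all lines meaningful.
\<close>

definition hardy2 :: "real \<Rightarrow> (complex \<Rightarrow> complex) \<Rightarrow> bool" where
  "hardy2 M f \<longleftrightarrow> f holomorphic_on upper_half_plane \<and> f \<in> borel_measurable borel \<and>
     (\<forall>y>0. sqnorm (\<lambda>x. f (Complex x y)) \<le> ennreal M)"

lemma hardy2_holomorphic: "hardy2 M f \<Longrightarrow> f holomorphic_on upper_half_plane"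
  and hardy2_measurable: "hardy2 M f \<Longrightarrow> f \<in> borel_measurable borel"
  and hardy2_sqnorm: "hardy2 M f \<Longrightarrow> y > 0 \<Longrightarrow> sqnorm (\<lambda>x. f (Complex x y)) \<le> ennreal M"
  by (auto simp: hardy2_def)

lemma open_upper_half_plane: "open upper_half_plane"
  and convex_upper_half_plane: "convex upper_half_plane"
  by (simp_all add: open_halfspace_Im_gt convex_halfspace_Im_gt)

lemma sqnorm_integrable:
  fixes g :: "real \<Rightarrow> complex"
  assumes "g \<in> borel_measurable borel" "sqnorm g < top"
  shows "integrable lborel (\<lambda>x. (cmod (g x))\<^sup>2)"
  by (rule integrableI_bounded) (use assms in \<open>auto simp: sqnorm_def\<close>)

lemma le_1_plus_square: "(x::real) \<le> 1 + x\<^sup>2"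
proof -
  have "0 \<le> (x - 1/2)\<^sup>2" by simp
  then show ?thesis by (simp add: power2_eq_square algebra_simps)
qed

text \<open>
  Cauchy's formula at \<open>w = x + \<i> (a + y)\<close> for the function \<open>g\<close> obtained from \<open>f\<close> by the factor
  \<open>(w - w') / (\<zeta> - w')\<close>, where \<open>w'\<close> is the mirror image of \<open>w\<close> in the line \<open>Im \<zeta> = a\<close>. The factor is 1
  at \<open>w\<close>, combines with the Cauchy kernel to the Poisson kernel on that line, and improves the decay of
  the integrand enough for the other three sides of a large rectangle to vanish in the limit.
\<close>

theorem hardy2_poisson:
  assumes f: "hardy2 M f" and "a > 0" "y > 0"
  shows "f (Complex x (a + y)) = (LINT t|lborel. poisson y (x - t) *\<^sub>R f (Complex t a))"
    and "integrable lborel (\<lambda>t. poisson y (x - t) *\<^sub>R f (Complex t a))"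
proof -
  note hol = hardy2_holomorphic[OF f]
  note [measurable] = hardy2_measurable[OF f]
  define M' where "M' = max M 0"
  have M': "M' \<ge> 0" "sqnorm (\<lambda>x. f (Complex x \<eta>)) \<le> ennreal M'" if "\<eta> > 0" for \<eta>
    using hardy2_sqnorm[OF f that] by (auto simp: M'_def max_def ennreal_neg)
  define w w' where "w = Complex x (a + y)" and "w' = Complex x (a - y)"
  define g where "g \<zeta> = f \<zeta> * (w - w') / (\<zeta> - w')" for \<zeta>
  define h where "h \<zeta> = g \<zeta> / (\<zeta> - w)" for \<zeta>
  define S where "S = upper_half_plane \<inter> {z. a - y < Im z}"
  have S: "convex S" "open S"
    by (auto simp: S_def open_halfspace_Im_gt convex_halfspace_Im_gt intro!: convex_Int open_Int)
  have g: "g holomorphic_on S"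
    unfolding g_def using hol
    by (intro holomorphic_intros) (auto simp: S_def w'_def intro: holomorphic_on_subset)
  have gk: "cmod (h \<zeta>) = cmod (f \<zeta>) * (2 * y / (cmod (\<zeta> - w) * cmod (\<zeta> - w')))" for \<zeta>
  proof -
    have "w - w' = \<i> * of_real (2 * y)"
      by (simp add: w_def w'_def complex_eq_iff)
    then have "cmod (w - w') = 2 * y"
      using \<open>y > 0\<close> by (simp only: norm_mult norm_of_real) simp
    then show ?thesis
      by (simp add: h_def g_def norm_mult norm_divide)
  qed
  have h: "h holomorphic_on S - {w}"
    unfolding h_def using g by (intro holomorphic_intros) (auto intro: holomorphic_on_subset)
  have bottom: "h (Complex t a) = 2 * pi * \<i> * (poisson y (x - t) *\<^sub>R f (Complex t a))" for t
  proof -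
    have 1: "(Complex t a - w') * (Complex t a - w) = of_real ((x - t)\<^sup>2 + y\<^sup>2)"
      by (simp add: w_def w'_def complex_eq_iff power2_eq_square algebra_simps)
    have 2: "w - w' = 2 * \<i> * of_real y"
      by (simp add: w_def w'_def complex_eq_iff)
    have "h (Complex t a) = f (Complex t a) * (2 * \<i> * of_real y) / of_real ((x - t)\<^sup>2 + y\<^sup>2)"
      unfolding h_def g_def 1[symmetric] 2 by simp
    also have "\<dots> = 2 * pi * \<i> * (poisson y (x - t) *\<^sub>R f (Complex t a))"
      by (simp add: poisson_def scaleR_conv_of_real)
    finally show ?thesis .
  qed
  have sq: "integrable lborel (\<lambda>t. (cmod (f (Complex t a)))\<^sup>2)"
    using M'(2)[OF \<open>a > 0\<close>] by (intro sqnorm_integrable) (auto simp: top.not_eq_extremum intro: le_less_trans)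
  have pI: "integrable lborel (\<lambda>t. poisson y (x - t))"
    using nn_integral_poisson[OF \<open>y > 0\<close>, of x] \<open>y > 0\<close>
    by (intro integrableI_bounded) (auto simp: poisson_nonneg)
  have pb: "poisson y s \<le> 1 / (pi * y)" for s
  proof -
    have "poisson y s \<le> y / (pi * y\<^sup>2)"
      unfolding poisson_def using \<open>y > 0\<close> by (intro divide_left_mono mult_left_mono) (auto intro!: mult_pos_pos add_nonneg_pos)
    also have "\<dots> = 1 / (pi * y)"
      using \<open>y > 0\<close> by (simp add: power2_eq_square)
    finally show ?thesis .
  qed
  show int: "integrable lborel (\<lambda>t. poisson y (x - t) *\<^sub>R f (Complex t a))"
  proof (rule Bochner_Integration.integrable_bound)
    show "integrable lborel (\<lambda>t. poisson y (x - t) + 1 / (pi * y) * (cmod (f (Complex t a)))\<^sup>2)"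
      using sq pI by auto
    have "norm (poisson y (x - t) *\<^sub>R f (Complex t a)) \<le> norm (poisson y (x - t) + 1 / (pi * y) * (cmod (f (Complex t a)))\<^sup>2)" for t
    proof -
      have "norm (poisson y (x - t) *\<^sub>R f (Complex t a)) = poisson y (x - t) * cmod (f (Complex t a))"
        using \<open>y > 0\<close> by (simp add: poisson_nonneg)
      also have "\<dots> \<le> poisson y (x - t) * (1 + (cmod (f (Complex t a)))\<^sup>2)"
        using \<open>y > 0\<close> by (intro mult_left_mono le_1_plus_square poisson_nonneg) auto
      also have "\<dots> \<le> poisson y (x - t) + 1 / (pi * y) * (cmod (f (Complex t a)))\<^sup>2"
        using mult_right_mono[OF pb[of "x - t"], of "(cmod (f (Complex t a)))\<^sup>2"] by (simp add: algebra_simps)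
      finally show ?thesis by simp
    qed
    then show "AE t in lborel. norm (poisson y (x - t) *\<^sub>R f (Complex t a)) \<le> norm (poisson y (x - t) + 1 / (pi * y) * (cmod (f (Complex t a)))\<^sup>2)"
      by simp
  qed auto
  \<comment> \<open>On the vertical sides, of length about \<open>n\<close>, the kernel is of order \<open>1 / (R n)\<^sup>2\<close>.\<close>
  define b where "b n = a + y + (real n + 1)" for n
  define V where "V n s = (\<integral>\<^sup>+\<eta>. indicator {a..b n} \<eta> * ennreal ((cmod (f (Complex s \<eta>)))\<^sup>2) \<partial>lborel)" for n s
  have [measurable]: "V n \<in> borel_measurable borel" for n
    unfolding V_def by measurable
  have "(\<integral>\<^sup>+s. V n s \<partial>lborel) < top" for n
  proof -
    have "(\<integral>\<^sup>+s. V n s \<partial>lborel) =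
        (\<integral>\<^sup>+\<eta>. \<integral>\<^sup>+s. indicator {a..b n} \<eta> * ennreal ((cmod (f (Complex s \<eta>)))\<^sup>2) \<partial>lborel \<partial>lborel)"
      unfolding V_def by (rule lborel_pair.Fubini'[symmetric]) measurable
    also have "\<dots> = (\<integral>\<^sup>+\<eta>. indicator {a..b n} \<eta> * sqnorm (\<lambda>s. f (Complex s \<eta>)) \<partial>lborel)"
      unfolding sqnorm_def by (intro nn_integral_cong nn_integral_cmult) measurable
    also have "\<dots> \<le> (\<integral>\<^sup>+\<eta>. ennreal M' * indicator {a..b n} \<eta> \<partial>lborel)"
      using M'(2) \<open>a > 0\<close> by (intro nn_integral_mono) (auto simp: indicator_def)
    also have "\<dots> < top"
      by (subst nn_integral_cmult_indicator) (auto simp: ennreal_mult_less_top emeasure_lborel_Icc_eq)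
    finally show ?thesis .
  qed
  then have "(\<integral>\<^sup>+s. V n s + V n (- s) \<partial>lborel) < top" for n
    using nn_integral_reflect[of "V n"] by (subst nn_integral_add) auto
  then have "\<exists>R>(real n)\<^sup>2 + 2 * \<bar>x\<bar> + 2. V n R + V n (- R) < 1" for n
    by (intro exists_small_value) auto
  then obtain R where R: "\<And>n. R n > (real n)\<^sup>2 + 2 * \<bar>x\<bar> + 2" "\<And>n. V n (R n) + V n (- R n) < 1"
    by metis
  have Rgt: "R n > real n" "R n > 0" "R n > \<bar>x\<bar>" for n
    using R(1)[of n] le_1_plus_square[of "real n"] by auto
  have side: "cmod (integral {a..b n} (\<lambda>\<eta>. h (Complex s \<eta>)))
      \<le> 2 * y / (R n - \<bar>x\<bar>)\<^sup>2 * (y + real n + 2)" if s: "\<bar>s\<bar> = R n" for s n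
  proof -
    have nz: "cmod (Complex s \<eta> - w) \<ge> R n - \<bar>x\<bar>" "cmod (Complex s \<eta> - w') \<ge> R n - \<bar>x\<bar>" for \<eta>
      using abs_Re_le_cmod[of "Complex s \<eta> - w"] abs_Re_le_cmod[of "Complex s \<eta> - w'"] s
      by (auto simp: w_def w'_def)
    have "ennreal (cmod (integral {a..b n} (\<lambda>\<eta>. h (Complex s \<eta>))))
      \<le> (\<integral>\<^sup>+\<eta>. indicator {a..b n} \<eta> * ennreal (2 * y / (R n - \<bar>x\<bar>)\<^sup>2 * (1 + (cmod (f (Complex s \<eta>)))\<^sup>2)) \<partial>lborel)"
    proof (rule norm_integral_le_nn_integral)
      have "Complex s \<eta> \<in> S - {w}" if "\<eta> \<in> {a..b n}" for \<eta>
        using that \<open>a > 0\<close> \<open>y > 0\<close> s Rgt(3)[of n] by (auto simp: S_def w_def)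
      then show "continuous_on {a..b n} (\<lambda>\<eta>. h (Complex s \<eta>))"
        by (rule continuous_on_vertical[OF h])
      fix \<eta>
      have "cmod (h (Complex s \<eta>)) = cmod (f (Complex s \<eta>)) * (2 * y / (cmod (Complex s \<eta> - w) * cmod (Complex s \<eta> - w')))"
        by (rule gk)
      also have "\<dots> \<le> (1 + (cmod (f (Complex s \<eta>)))\<^sup>2) * (2 * y / (R n - \<bar>x\<bar>)\<^sup>2)"
        using nz[of \<eta>] Rgt(3)[of n] \<open>y > 0\<close> unfolding power2_eq_square[of "R n - _"]
        by (intro mult_mono le_1_plus_square divide_left_mono mult_pos_pos) (auto intro!: divide_nonneg_nonneg mult_nonneg_nonneg)
      finally show "ennreal (cmod (h (Complex s \<eta>))) \<le> ennreal (2 * y / (R n - \<bar>x\<bar>)\<^sup>2 * (1 + (cmod (f (Complex s \<eta>)))\<^sup>2))"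
        by (intro ennreal_leI) (simp add: mult.commute)
    qed
    also have "\<dots> = (\<integral>\<^sup>+\<eta>. ennreal (2 * y / (R n - \<bar>x\<bar>)\<^sup>2) * (indicator {a..b n} \<eta> + indicator {a..b n} \<eta> * ennreal ((cmod (f (Complex s \<eta>)))\<^sup>2)) \<partial>lborel)"
    proof (intro nn_integral_cong)
      fix \<eta>
      have "ennreal (c * (1 + q)) = ennreal c * (1 + ennreal q)" if "c \<ge> 0" "q \<ge> 0" for c q :: real
        using that by (simp add: ennreal_mult ennreal_plus[of 1 q, simplified])
      then show "indicator {a..b n} \<eta> * ennreal (2 * y / (R n - \<bar>x\<bar>)\<^sup>2 * (1 + (cmod (f (Complex s \<eta>)))\<^sup>2)) =
        ennreal (2 * y / (R n - \<bar>x\<bar>)\<^sup>2) * (indicator {a..b n} \<eta> + indicator {a..b n} \<eta> * ennreal ((cmod (f (Complex s \<eta>)))\<^sup>2))"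
        using \<open>y > 0\<close> by (auto simp: indicator_def simp del: times_divide_eq_left)
    qed
    also have "\<dots> = ennreal (2 * y / (R n - \<bar>x\<bar>)\<^sup>2) * (emeasure lborel {a..b n} + V n s)"
      unfolding V_def by (subst nn_integral_cmult, simp, subst nn_integral_add) auto
    also have "\<dots> \<le> ennreal (2 * y / (R n - \<bar>x\<bar>)\<^sup>2) * (ennreal (y + real n + 1) + ennreal 1)"
    proof (intro mult_left_mono add_mono)
      show "emeasure lborel {a..b n} \<le> ennreal (y + real n + 1)"
        using \<open>y > 0\<close> by (simp add: b_def emeasure_lborel_Icc_eq add.assoc)
      have "V n s \<le> V n (R n) + V n (- R n)"
      proof -
        have "s = R n \<or> s = - R n"
          using s by auto
        then show ?thesis by auto
      qed
      then show "V n s \<le> ennreal 1"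
        using R(2)[of n] by simp
    qed auto
    also have "\<dots> = ennreal (2 * y / (R n - \<bar>x\<bar>)\<^sup>2 * (y + real n + 2))"
      using \<open>y > 0\<close> by (simp flip: ennreal_plus ennreal_mult ennreal_1 add: add.assoc)
    finally show ?thesis
      using \<open>y > 0\<close> by (subst (asm) ennreal_le_iff) auto
  qed
  have top: "cmod (integral {- R n..R n} (\<lambda>t. h (Complex t (b n))))
      \<le> 2 * y * (pi / (real n + 1) + M' / (real n + 1)\<^sup>2)" for n
  proof -
    have bn: "b n > 0" using \<open>a > 0\<close> \<open>y > 0\<close> by (simp add: b_def)
    have nz: "cmod (Complex t (b n) - w) * cmod (Complex t (b n) - w') \<ge> (x - t)\<^sup>2 + (real n + 1)\<^sup>2" for t
    proof -
      have 1: "cmod (Complex t (b n) - w) = sqrt ((x - t)\<^sup>2 + (real n + 1)\<^sup>2)"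
        by (simp add: w_def b_def cmod_def power2_commute)
      have 2: "cmod (Complex t (b n) - w') \<ge> sqrt ((x - t)\<^sup>2 + (real n + 1)\<^sup>2)"
        using \<open>y > 0\<close> by (auto simp: w'_def b_def cmod_def power2_commute[of x] intro!: power_mono)
      have "(x - t)\<^sup>2 + (real n + 1)\<^sup>2 = sqrt ((x - t)\<^sup>2 + (real n + 1)\<^sup>2) * sqrt ((x - t)\<^sup>2 + (real n + 1)\<^sup>2)"
        by (simp flip: power2_eq_square)
      also have "\<dots> \<le> cmod (Complex t (b n) - w) * cmod (Complex t (b n) - w')"
        using 2 unfolding 1 by (intro mult_left_mono) auto
      finally show ?thesis .
    qed
    have pos: "(x - t)\<^sup>2 + (real n + 1)\<^sup>2 > 0" for t
      by (intro add_nonneg_pos) auto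
    have "ennreal (cmod (integral {- R n..R n} (\<lambda>t. h (Complex t (b n)))))
      \<le> (\<integral>\<^sup>+t. indicator {- R n..R n} t * (ennreal (2 * y) * (ennreal (1 / ((x - t)\<^sup>2 + (real n + 1)\<^sup>2)) + ennreal (1 / (real n + 1)\<^sup>2) * ennreal ((cmod (f (Complex t (b n))))\<^sup>2))) \<partial>lborel)"
    proof (rule norm_integral_le_nn_integral)
      show "continuous_on {- R n..R n} (\<lambda>t. h (Complex t (b n)))"
        using \<open>a > 0\<close> \<open>y > 0\<close>
        by (intro continuous_on_horizontal[OF h]) (auto simp: S_def w_def b_def)
      fix t
      let ?q = "(x - t)\<^sup>2 + (real n + 1)\<^sup>2"
      have "cmod (h (Complex t (b n))) = cmod (f (Complex t (b n))) * (2 * y / (cmod (Complex t (b n) - w) * cmod (Complex t (b n) - w')))"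
        by (rule gk)
      also have "\<dots> \<le> (1 + (cmod (f (Complex t (b n))))\<^sup>2) * (2 * y / ?q)"
      proof (intro mult_mono le_1_plus_square divide_left_mono nz mult_pos_pos[OF _ pos])
        show "0 < cmod (Complex t (b n) - w) * cmod (Complex t (b n) - w')"
          using pos[of t] nz[of t] by linarith
      qed (use \<open>y > 0\<close> pos[of t] in auto)
      also have "\<dots> = 2 * y * (1 / ?q + (1 / ?q) * (cmod (f (Complex t (b n))))\<^sup>2)"
        using pos[of t] by (simp add: field_simps)
      also have "\<dots> \<le> 2 * y * (1 / ?q + (1 / (real n + 1)\<^sup>2) * (cmod (f (Complex t (b n))))\<^sup>2)"
        using \<open>y > 0\<close> pos[of t] by (intro mult_left_mono add_left_mono mult_right_mono divide_left_mono mult_pos_pos) auto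
      finally show "ennreal (cmod (h (Complex t (b n))))
        \<le> ennreal (2 * y) * (ennreal (1 / ?q) + ennreal (1 / (real n + 1)\<^sup>2) * ennreal ((cmod (f (Complex t (b n))))\<^sup>2))"
        using \<open>y > 0\<close> pos[of t] by (simp flip: ennreal_mult ennreal_plus)
    qed
    also have "\<dots> \<le> (\<integral>\<^sup>+t. (ennreal (2 * y) * (ennreal (1 / ((x - t)\<^sup>2 + (real n + 1)\<^sup>2)) + ennreal (1 / (real n + 1)\<^sup>2) * ennreal ((cmod (f (Complex t (b n))))\<^sup>2))) \<partial>lborel)"
      by (intro nn_integral_mono) (auto simp: indicator_def)
    also have "\<dots> = ennreal (2 * y) * (ennreal (pi / (real n + 1)) + ennreal (1 / (real n + 1)\<^sup>2) * sqnorm (\<lambda>t. f (Complex t (b n))))"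
      unfolding sqnorm_def
      by (subst nn_integral_cmult, simp, subst nn_integral_add, simp, simp, subst nn_integral_cmult)
        (use nn_integral_inverse_quadratic[of "real n + 1" x] in auto)
    also have "\<dots> \<le> ennreal (2 * y) * (ennreal (pi / (real n + 1)) + ennreal (1 / (real n + 1)\<^sup>2) * ennreal M')"
      using M'(2)[OF bn] by (intro mult_left_mono add_mono) auto
    also have "\<dots> = ennreal (2 * y * (pi / (real n + 1) + M' / (real n + 1)\<^sup>2))"
      using \<open>y > 0\<close> M'(1)[OF bn] by (simp flip: ennreal_mult ennreal_plus)
    finally show ?thesis
      using \<open>y > 0\<close> M'(1)[OF bn] by (subst (asm) ennreal_le_iff) auto
  qed
  have main: "norm (integral {- R n..R n} (\<lambda>t. h (Complex t a)) - 2 * pi * \<i> * f w)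
      \<le> 2 * (2 * y / (R n - \<bar>x\<bar>)\<^sup>2 * (y + real n + 2)) + 2 * y * (pi / (real n + 1) + M' / (real n + 1)\<^sup>2)" for n
  proof -
    have "rect_integral h (- R n) (R n) a (b n) = 2 * pi * \<i> * g w"
      unfolding h_def[abs_def] using Rgt[of n] \<open>a > 0\<close> \<open>y > 0\<close>
      by (intro rect_integral_Cauchy[OF _ _ S g]) (auto simp: b_def w_def S_def in_cbox_complex_iff)
    moreover have "g w = f w"
      using \<open>y > 0\<close> by (simp add: g_def w_def w'_def complex_eq_iff)
    ultimately have eq: "integral {- R n..R n} (\<lambda>t. h (Complex t a)) - 2 * pi * \<i> * f w =
      (integral {- R n..R n} (\<lambda>t. h (Complex t (b n))) +
       \<i> * integral {a..b n} (\<lambda>\<eta>. h (Complex (- R n) \<eta>))) -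
       \<i> * integral {a..b n} (\<lambda>\<eta>. h (Complex (R n) \<eta>))"
      unfolding rect_integral_def by (simp add: algebra_simps)
    have "norm (integral {- R n..R n} (\<lambda>t. h (Complex t a)) - 2 * pi * \<i> * f w) \<le> (cmod (integral {- R n..R n} (\<lambda>t. h (Complex t (b n)))) +
      cmod (\<i> * integral {a..b n} (\<lambda>\<eta>. h (Complex (- R n) \<eta>)))) +
      cmod (\<i> * integral {a..b n} (\<lambda>\<eta>. h (Complex (R n) \<eta>)))"
      unfolding eq by (rule order.trans[OF norm_triangle_ineq4 add_right_mono[OF norm_triangle_ineq]])
    also have "\<dots> \<le> (2 * y * (pi / (real n + 1) + M' / (real n + 1)\<^sup>2) + 2 * y / (R n - \<bar>x\<bar>)\<^sup>2 * (y + real n + 2)) + 2 * y / (R n - \<bar>x\<bar>)\<^sup>2 * (y + real n + 2)"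
      unfolding norm_mult norm_ii mult_1 using Rgt(2)[of n]
      by (intro add_mono top side) simp_all
    finally show ?thesis by (simp add: algebra_simps)
  qed
  have lim1: "(\<lambda>n. 2 * y / (R n - \<bar>x\<bar>)\<^sup>2 * (y + real n + 2)) \<longlonglongrightarrow> 0"
  proof (rule Lim_null_comparison)
    show "\<forall>\<^sub>F n in sequentially. norm (2 * y / (R n - \<bar>x\<bar>)\<^sup>2 * (y + real n + 2)) \<le> 2 * y * (y + 2) * inverse (real (Suc n))"
    proof (intro always_eventually allI)
      fix n
      have 1: "real n + 1 \<le> R n - \<bar>x\<bar>"
        using R(1)[of n] le_1_plus_square[of "real n"] by linarith
      have "(real n + 1)\<^sup>2 \<le> (R n - \<bar>x\<bar>)\<^sup>2"
        using 1 by (intro power_mono) auto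
      then have "norm (2 * y / (R n - \<bar>x\<bar>)\<^sup>2 * (y + real n + 2)) \<le> 2 * y / (real n + 1)\<^sup>2 * (y + real n + 2)"
        using \<open>y > 0\<close> 1 by (auto simp: abs_mult intro!: mult_right_mono divide_left_mono mult_pos_pos)
      also have "\<dots> \<le> 2 * y / (real n + 1)\<^sup>2 * ((y + 2) * (real n + 1))"
        using \<open>y > 0\<close> by (intro mult_left_mono) (auto simp: algebra_simps)
      also have "\<dots> = 2 * y * (y + 2) * inverse (real (Suc n))"
      proof -
        have "2 * y / k\<^sup>2 * ((y + 2) * k) = 2 * y * (y + 2) * inverse k" if "k > 0" for k :: real
          using that by (simp add: power2_eq_square divide_simps)
        from this[of "real n + 1"] show ?thesis by (simp add: add.commute)
      qed
      finally show "norm (2 * y / (R n - \<bar>x\<bar>)\<^sup>2 * (y + real n + 2)) \<le> 2 * y * (y + 2) * inverse (real (Suc n))" .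
    qed
    show "(\<lambda>n. 2 * y * (y + 2) * inverse (real (Suc n))) \<longlonglongrightarrow> 0"
      by (intro tendsto_mult_right_zero LIMSEQ_inverse_real_of_nat)
  qed
  have lim2: "(\<lambda>n. 2 * y * (pi / (real n + 1) + M' / (real n + 1)\<^sup>2)) \<longlonglongrightarrow> 0"
    by real_asymp
  have "(\<lambda>n. 2 * (2 * y / (R n - \<bar>x\<bar>)\<^sup>2 * (y + real n + 2)) + 2 * y * (pi / (real n + 1) + M' / (real n + 1)\<^sup>2)) \<longlonglongrightarrow> 0"
    using tendsto_add[OF tendsto_mult_right_zero[OF lim1, of 2] lim2] by simp
  then have "(\<lambda>n. integral {- R n..R n} (\<lambda>t. h (Complex t a)) - 2 * pi * \<i> * f w) \<longlonglongrightarrow> 0"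
    by (rule Lim_null_comparison[rotated]) (use main in auto)
  then have l1: "(\<lambda>n. integral {- R n..R n} (\<lambda>t. h (Complex t a))) \<longlonglongrightarrow> 2 * pi * \<i> * f w"
    by (simp add: LIM_zero_iff)
  have "(\<lambda>n. integral {- R n..R n} (\<lambda>t. h (Complex t a))) \<longlonglongrightarrow>
      (LINT t|lborel. h (Complex t a))"
  proof (rule integral_symmetric_tendsto[OF _ _ Rgt(1)])
    show "integrable lborel (\<lambda>t. h (Complex t a))"
      unfolding bottom using int by (rule integrable_mult_right)
    show "continuous_on UNIV (\<lambda>t. h (Complex t a))"
      using \<open>a > 0\<close> \<open>y > 0\<close>
      by (intro continuous_on_horizontal[OF h]) (auto simp: S_def w_def)
  qed
  from LIMSEQ_unique[OF l1 this]
  have "f w = (LINT t|lborel. poisson y (x - t) *\<^sub>R f (Complex t a))"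
    unfolding bottom integral_mult_right_zero by simp
  then show "f (Complex x (a + y)) = (LINT t|lborel. poisson y (x - t) *\<^sub>R f (Complex t a))"
    by (simp add: w_def)
qed

lemma hardy2_poisson_nn_integral:
  assumes f: "hardy2 M f" and "a > 0" "y > 0"
  shows "ennreal (cmod (f (Complex x (a + y)))) \<le>
    (\<integral>\<^sup>+t. ennreal (poisson y (x - t) * cmod (f (Complex t a))) \<partial>lborel)"
proof -
  have "ennreal (cmod (f (Complex x (a + y)))) \<le>
      (\<integral>\<^sup>+t. ennreal (norm (poisson y (x - t) *\<^sub>R f (Complex t a))) \<partial>lborel)"
    unfolding hardy2_poisson(1)[OF assms]
    by (rule integral_norm_bound_ennreal[OF hardy2_poisson(2)[OF assms]])
  then show ?thesis
    using \<open>y > 0\<close> by (simp add: poisson_nonneg)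
qed

lemma poisson_average_square:
  assumes [measurable]: "g \<in> borel_measurable borel" and "\<And>t. g t \<ge> 0" "y > 0"
  shows "(\<integral>\<^sup>+t. ennreal (poisson y (x - t) * g t) \<partial>lborel)\<^sup>2 \<le>
    (\<integral>\<^sup>+t. ennreal (poisson y (x - t) * (g t)\<^sup>2) \<partial>lborel)"
  using assms nn_integral_poisson[OF assms(3), of x]
  by (intro nn_integral_average_square) (auto simp: poisson_nonneg)

lemma hardy2_poisson_square:
  assumes f: "hardy2 M f" and "a > 0" "y > 0"
  shows "ennreal ((cmod (f (Complex x (a + y))))\<^sup>2) \<le>
    (\<integral>\<^sup>+t. ennreal (poisson y (x - t) * (cmod (f (Complex t a)))\<^sup>2) \<partial>lborel)"
proof -
  note [measurable] = hardy2_measurable[OF f]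
  have "ennreal ((cmod (f (Complex x (a + y))))\<^sup>2) = (ennreal (cmod (f (Complex x (a + y)))))\<^sup>2"
    by (simp add: ennreal_power)
  also have "\<dots> \<le> (\<integral>\<^sup>+t. ennreal (poisson y (x - t) * cmod (f (Complex t a))) \<partial>lborel)\<^sup>2"
    by (intro power_mono hardy2_poisson_nn_integral[OF assms]) auto
  also have "\<dots> \<le> (\<integral>\<^sup>+t. ennreal (poisson y (x - t) * (cmod (f (Complex t a)))\<^sup>2) \<partial>lborel)"
    using \<open>y > 0\<close> by (intro poisson_average_square) auto
  finally show ?thesis .
qed

lemma nn_integral_poisson_smoothing:
  assumes [measurable]: "g \<in> borel_measurable borel" and "\<And>t. g t \<ge> 0" "y > 0"
  shows "(\<integral>\<^sup>+x. (\<integral>\<^sup>+t. ennreal (poisson y (x - t) * g t) \<partial>lborel) \<partial>lborel) = (\<integral>\<^sup>+t. ennreal (g t) \<partial>lborel)"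
proof -
  have "(\<integral>\<^sup>+x. (\<integral>\<^sup>+t. ennreal (poisson y (x - t) * g t) \<partial>lborel) \<partial>lborel) =
      (\<integral>\<^sup>+t. (\<integral>\<^sup>+x. ennreal (poisson y (x - t) * g t) \<partial>lborel) \<partial>lborel)"
    by (rule lborel_pair.Fubini') measurable
  also have "\<dots> = (\<integral>\<^sup>+t. ennreal (g t) \<partial>lborel)"
  proof (intro nn_integral_cong)
    fix t
    have sym: "poisson y (x - t) = poisson y (t - x)" for x
      by (simp add: poisson_def power2_commute)
    have "(\<integral>\<^sup>+x. ennreal (poisson y (x - t) * g t) \<partial>lborel) = (\<integral>\<^sup>+x. ennreal (g t) * ennreal (poisson y (t - x)) \<partial>lborel)"
      using assms by (intro nn_integral_cong) (simp add: sym poisson_nonneg mult.commute flip: ennreal_mult)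
    also have "\<dots> = ennreal (g t)"
      by (subst nn_integral_cmult) (use nn_integral_poisson[OF \<open>y > 0\<close>] in auto)
    finally show "(\<integral>\<^sup>+x. ennreal (poisson y (x - t) * g t) \<partial>lborel) = ennreal (g t)" .
  qed
  finally show ?thesis .
qed

lemma hardy2_sqnorm_antimono:
  assumes f: "hardy2 M f" and "0 < a" "a \<le> b"
  shows "sqnorm (\<lambda>x. f (Complex x b)) \<le> sqnorm (\<lambda>x. f (Complex x a))"
proof (cases "a = b")
  case False
  note [measurable] = hardy2_measurable[OF f]
  define y where "y = b - a"
  have y: "y > 0" "b = a + y" using assms False by (auto simp: y_def)
  have "sqnorm (\<lambda>x. f (Complex x b)) \<le>
      (\<integral>\<^sup>+x. (\<integral>\<^sup>+t. ennreal (poisson y (x - t) * (cmod (f (Complex t a)))\<^sup>2) \<partial>lborel) \<partial>lborel)"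
    unfolding sqnorm_def y(2) by (intro nn_integral_mono hardy2_poisson_square[OF f] assms y)
  also have "\<dots> = sqnorm (\<lambda>x. f (Complex x a))"
    unfolding sqnorm_def using y(1) by (intro nn_integral_poisson_smoothing) auto
  finally show ?thesis .
qed simp

lemma hardy2_mono: "hardy2 M f \<Longrightarrow> M \<le> N \<Longrightarrow> hardy2 N f"
  unfolding hardy2_def by (meson ennreal_leI order.trans)

text \<open>
  Norms on horizontal lines decrease with the height, so bounds at arbitrarily small heights suffice.
\<close>

lemma hardy2_improve:
  assumes f: "hardy2 M f" and "\<And>\<delta>. \<delta> > 0 \<Longrightarrow> \<exists>y>0. y < \<delta> \<and> sqnorm (\<lambda>x. f (Complex x y)) \<le> ennreal e"
  shows "hardy2 e f"
  unfolding hardy2_def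
proof (intro conjI allI impI hardy2_holomorphic[OF f] hardy2_measurable[OF f])
  fix y :: real assume "y > 0"
  then obtain y' where "y' > 0" "y' < y" "sqnorm (\<lambda>x. f (Complex x y')) \<le> ennreal e"
    using assms(2) by blast
  then show "sqnorm (\<lambda>x. f (Complex x y)) \<le> ennreal e"
    using hardy2_sqnorm_antimono[OF f, of y' y] by simp
qed

lemma norm_add_square_le: "(norm (a + b :: 'a :: real_normed_vector))\<^sup>2 \<le> 2 * (norm a)\<^sup>2 + 2 * (norm b)\<^sup>2"
proof -
  have "(norm (a + b))\<^sup>2 \<le> (norm a + norm b)\<^sup>2"
    by (intro power_mono norm_triangle_ineq) auto
  also have "\<dots> \<le> 2 * (norm a)\<^sup>2 + 2 * (norm b)\<^sup>2"
    using sum_squares_bound[of "norm a" "norm b"] by (simp add: power2_sum)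
  finally show ?thesis .
qed

lemma sqnorm_add_le:
  assumes [measurable]: "f \<in> borel_measurable borel" "g \<in> borel_measurable borel"
  shows "sqnorm (\<lambda>x. f x + g x) \<le> 2 * sqnorm f + 2 * sqnorm g"
proof -
  have "sqnorm (\<lambda>x. f x + g x) \<le> (\<integral>\<^sup>+x. (2 * ennreal ((cmod (f x))\<^sup>2) + 2 * ennreal ((cmod (g x))\<^sup>2)) \<partial>lborel)"
    unfolding sqnorm_def
  proof (intro nn_integral_mono)
    fix x
    show "ennreal ((cmod (f x + g x))\<^sup>2) \<le> 2 * ennreal ((cmod (f x))\<^sup>2) + 2 * ennreal ((cmod (g x))\<^sup>2)"
      using ennreal_leI[OF norm_add_square_le[of "f x" "g x"]] by (simp add: ennreal_mult)
  qed
  also have "\<dots> = 2 * sqnorm f + 2 * sqnorm g"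
    unfolding sqnorm_def by (simp add: nn_integral_add nn_integral_cmult)
  finally show ?thesis .
qed

lemma sqnorm_uminus [simp]: "sqnorm (\<lambda>x. - f x) = sqnorm f"
  by (simp add: sqnorm_def)

lemma hardy2_add:
  assumes "hardy2 M f" "hardy2 N g" "M \<ge> 0" "N \<ge> 0"
  shows "hardy2 (2 * M + 2 * N) (\<lambda>z. f z + g z)"
  unfolding hardy2_def
proof (intro conjI allI impI)
  note [measurable] = hardy2_measurable[OF assms(1)] hardy2_measurable[OF assms(2)]
  show "(\<lambda>z. f z + g z) \<in> borel_measurable borel"
    by measurable
  fix y :: real assume y: "y > 0"
  have "sqnorm (\<lambda>x. f (Complex x y) + g (Complex x y)) \<le> 2 * sqnorm (\<lambda>x. f (Complex x y)) + 2 * sqnorm (\<lambda>x. g (Complex x y))"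
    by (rule sqnorm_add_le) auto
  also have "\<dots> \<le> 2 * ennreal M + 2 * ennreal N"
    by (intro add_mono mult_left_mono hardy2_sqnorm[OF assms(1) y] hardy2_sqnorm[OF assms(2) y]) auto
  also have "\<dots> = ennreal (2 * M + 2 * N)"
    using assms by (simp add: ennreal_mult)
  finally show "sqnorm (\<lambda>x. f (Complex x y) + g (Complex x y)) \<le> ennreal (2 * M + 2 * N)" .
qed (intro holomorphic_intros assms(1,2)[THEN hardy2_holomorphic])

lemma hardy2_uminus: "hardy2 M f \<Longrightarrow> hardy2 M (\<lambda>z. - f z)"
  unfolding hardy2_def by (auto intro: holomorphic_intros)

lemma hardy2_diff:
  assumes "hardy2 M f" "hardy2 N g" "M \<ge> 0" "N \<ge> 0"
  shows "hardy2 (2 * M + 2 * N) (\<lambda>z. f z - g z)"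
  using hardy2_add[OF assms(1) hardy2_uminus[OF assms(2)] assms(3,4)] by simp

lemma sqnorm_translate:
  assumes [measurable]: "g \<in> borel_measurable borel"
  shows "sqnorm (\<lambda>x. g (x + c)) = sqnorm g"
  unfolding sqnorm_def using nn_integral_translate[of "\<lambda>x. ennreal ((cmod (g x))\<^sup>2)" c]
  by (simp add: add.commute)

lemma Complex_plus: "Complex x y + c = Complex (x + Re c) (y + Im c)"
  by (simp add: complex_eq_iff)

lemma hardy2_translate:
  assumes f: "hardy2 M f" and c: "Im c \<ge> 0"
  shows "hardy2 M (\<lambda>z. f (z + c))"
  unfolding hardy2_def
proof (intro conjI allI impI)
  note [measurable] = hardy2_measurable[OF f]
  show "(\<lambda>z. f (z + c)) \<in> borel_measurable borel"
    by measurable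
  show "(\<lambda>z. f (z + c)) holomorphic_on upper_half_plane"
    by (rule holomorphic_on_compose_gen[of "\<lambda>z. z + c" _ f upper_half_plane, unfolded o_def])
      (use hardy2_holomorphic[OF f] c in \<open>auto intro!: holomorphic_intros\<close>)
  fix y :: real assume y: "y > 0"
  show "sqnorm (\<lambda>x. f (Complex x y + c)) \<le> ennreal M"
    unfolding Complex_plus
    using hardy2_sqnorm[OF f, of "y + Im c"] c y sqnorm_translate[of "\<lambda>x. f (Complex x (y + Im c))" "Re c"]
    by simp
qed

lemma measurable_cnj [measurable]: "cnj \<in> borel_measurable borel"
  by (intro borel_measurable_continuous_onI continuous_intros)

section \<open>Continuity of translations\<close>

lemma mult_le_sum_squares:
  fixes a b :: real
  assumes "a \<ge> 0" "b \<ge> 0"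
  shows "a * b \<le> a\<^sup>2 + b\<^sup>2"
  using sum_squares_bound[of a b] mult_nonneg_nonneg[OF assms] by linarith

lemma integrable_mult_square:
  fixes f g :: "'a \<Rightarrow> complex"
  assumes "f \<in> borel_measurable M" "g \<in> borel_measurable M"
    "integrable M (\<lambda>x. (cmod (f x))\<^sup>2)" "integrable M (\<lambda>x. (cmod (g x))\<^sup>2)"
  shows "integrable M (\<lambda>x. f x * g x)"
proof (rule Bochner_Integration.integrable_bound)
  show "integrable M (\<lambda>x. (cmod (f x))\<^sup>2 + (cmod (g x))\<^sup>2)"
    using assms by auto
  have "norm (f x * g x) \<le> (cmod (f x))\<^sup>2 + (cmod (g x))\<^sup>2" for x
    unfolding norm_mult by (intro mult_le_sum_squares) auto
  then show "AE x in M. norm (f x * g x) \<le> norm ((cmod (f x))\<^sup>2 + (cmod (g x))\<^sup>2)"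
    by simp
qed (use assms in auto)

lemma hardy2_integrable:
  assumes f: "hardy2 M f" and "y > 0"
  shows "integrable lborel (\<lambda>x. (cmod (f (Complex x y)))\<^sup>2)"
    and "sqnorm (\<lambda>x. f (Complex x y)) = ennreal (LINT x|lborel. (cmod (f (Complex x y)))\<^sup>2)"
proof -
  note [measurable] = hardy2_measurable[OF f]
  show 1: "integrable lborel (\<lambda>x. (cmod (f (Complex x y)))\<^sup>2)"
    using hardy2_sqnorm[OF assms] by (intro sqnorm_integrable) (auto intro: le_less_trans)
  show "sqnorm (\<lambda>x. f (Complex x y)) = ennreal (LINT x|lborel. (cmod (f (Complex x y)))\<^sup>2)"
    unfolding sqnorm_def by (rule nn_integral_eq_integral[OF 1]) simp
qed

lemma holomorphic_on_cnj_cnj: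
  assumes "f holomorphic_on S" "open A" "\<And>z. z \<in> A \<Longrightarrow> cnj z \<in> S"
  shows "(\<lambda>z. cnj (f (cnj z))) holomorphic_on A"
proof -
  have "f holomorphic_on cnj ` A"
    using assms by (auto intro: holomorphic_on_subset)
  then show ?thesis
    using holomorphic_on_compose_cnj_cnj[of f A] assms(2) by (simp add: o_def)
qed

text \<open>
  With \<open>c = (a + b) / 2\<close>, the function \<open>f(z + \<i> c) cnj (f (cnj z + \<i> c))\<close> is holomorphic in the strip
  \<open>|Im z| < c\<close>. At height \<open>(a - b) / 2\<close> its integral is the inner product of \<open>f\<close> on the lines at heights
  \<open>a\<close> and \<open>b\<close>, at height 0 it is \<open>m c\<close>, and the two agree by a contour shift.
\<close>

lemma hardy2_parallelogram:
  assumes f: "hardy2 M f" and ab: "0 < b" "b < a"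
  defines "m \<equiv> (\<lambda>y. LINT x|lborel. (cmod (f (Complex x y)))\<^sup>2)"
  shows "(LINT x|lborel. (cmod (f (Complex x a) - f (Complex x b)))\<^sup>2) = m a + m b - 2 * m ((a + b) / 2)"
proof -
  note [measurable] = hardy2_measurable[OF f]
  define c d where "c = (a + b) / 2" and "d = (a - b) / 2"
  have cd: "c > 0" "d > 0" "d < c" "c + d = a" "c - d = b"
    using ab by (auto simp: c_def d_def field_simps)
  define f1 where "f1 z = f (z + \<i> * of_real c)" for z
  define h where "h z = f1 z * cnj (f1 (cnj z))" for z
  define S where "S = {z. - c < Im z} \<inter> {z. Im z < c}"
  have S: "convex S" "open S"
    by (auto simp: S_def open_halfspace_Im_gt convex_halfspace_Im_gt open_halfspace_Im_lt convex_halfspace_Im_lt intro!: convex_Int open_Int)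
  have f1: "f1 holomorphic_on S"
    unfolding f1_def
    by (rule holomorphic_on_compose_gen[of "\<lambda>z. z + \<i> * of_real c" _ f upper_half_plane, unfolded o_def])
      (use hardy2_holomorphic[OF f] in \<open>auto intro!: holomorphic_intros simp: S_def\<close>)
  have h: "h holomorphic_on S"
    unfolding h_def by (intro holomorphic_intros f1 holomorphic_on_cnj_cnj[OF f1 S(2)]) (auto simp: S_def)
  have [measurable]: "h \<in> borel_measurable borel"
    unfolding h_def f1_def by measurable
  have heq: "h (Complex x \<eta>) = f (Complex x (c + \<eta>)) * cnj (f (Complex x (c - \<eta>)))" for x \<eta>
    by (simp add: h_def f1_def Complex_plus add.commute complex_cnj)
  have int: "integrable lborel (\<lambda>x. h (Complex x \<eta>))" if "-c < \<eta>" "\<eta> < c" for \<eta>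
    unfolding heq using that hardy2_integrable(1)[OF f]
    by (intro integrable_mult_square) auto
  have "(LINT x|lborel. h (Complex x 0)) = (LINT x|lborel. h (Complex x d))"
  proof (rule horizontal_integral_shift[OF h S(1)])
    show "(\<integral>\<^sup>+y. indicator {0..d} y * (\<integral>\<^sup>+x. cmod (h (Complex x y)) \<partial>lborel) \<partial>lborel) < top"
    proof -
      have "(\<integral>\<^sup>+y. indicator {0..d} y * (\<integral>\<^sup>+x. cmod (h (Complex x y)) \<partial>lborel) \<partial>lborel)
         \<le> (\<integral>\<^sup>+y. (2 * ennreal M) * indicator {0..d} y \<partial>lborel)"
      proof (intro nn_integral_mono)
        fix y
        have "(\<integral>\<^sup>+x. cmod (h (Complex x y)) \<partial>lborel) \<le> 2 * ennreal M" if "y \<in> {0..d}"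
        proof -
          have "(\<integral>\<^sup>+x. cmod (h (Complex x y)) \<partial>lborel) \<le>
            (\<integral>\<^sup>+x. ennreal ((cmod (f (Complex x (c + y))))\<^sup>2) + ennreal ((cmod (f (Complex x (c - y))))\<^sup>2) \<partial>lborel)"
          proof (intro nn_integral_mono)
            fix x
            have "cmod (h (Complex x y)) \<le> (cmod (f (Complex x (c + y))))\<^sup>2 + (cmod (f (Complex x (c - y))))\<^sup>2"
              unfolding heq norm_mult complex_mod_cnj by (intro mult_le_sum_squares) auto
            then show "ennreal (cmod (h (Complex x y))) \<le> ennreal ((cmod (f (Complex x (c + y))))\<^sup>2) + ennreal ((cmod (f (Complex x (c - y))))\<^sup>2)"
              by (simp flip: ennreal_plus)
          qed
          also have "\<dots> = sqnorm (\<lambda>x. f (Complex x (c + y))) + sqnorm (\<lambda>x. f (Complex x (c - y)))"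
            unfolding sqnorm_def by (rule nn_integral_add) auto
          also have "\<dots> \<le> ennreal M + ennreal M"
            using that cd by (intro add_mono hardy2_sqnorm[OF f]) auto
          finally show ?thesis by (simp add: mult_2)
        qed
        then show "indicator {0..d} y * (\<integral>\<^sup>+x. cmod (h (Complex x y)) \<partial>lborel) \<le> (2 * ennreal M) * indicator {0..d} y"
          by (auto simp: indicator_def)
      qed
      also have "\<dots> < top"
        by (subst nn_integral_cmult_indicator) (auto simp: ennreal_mult_less_top emeasure_lborel_Icc_eq)
      finally show ?thesis .
    qed
  qed (use cd int in \<open>auto simp: S_def\<close>)
  moreover have "(LINT x|lborel. h (Complex x 0)) = of_real (m c)"
  proof -
    have "h (Complex x 0) = of_real ((cmod (f (Complex x c)))\<^sup>2)" for x
      unfolding heq complex_norm_square by simp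
    then show ?thesis
      by (simp only: m_def integral_complex_of_real)
  qed
  moreover have "h (Complex x d) = f (Complex x a) * cnj (f (Complex x b))" for x
    using cd by (simp add: heq)
  ultimately have key: "(LINT x|lborel. f (Complex x a) * cnj (f (Complex x b))) = of_real (m c)"
    by simp
  have iab: "integrable lborel (\<lambda>x. f (Complex x a) * cnj (f (Complex x b)))"
    using hardy2_integrable(1)[OF f] ab by (intro integrable_mult_square) auto
  have "(cmod (f (Complex x a) - f (Complex x b)))\<^sup>2 = (cmod (f (Complex x a)))\<^sup>2 + (cmod (f (Complex x b)))\<^sup>2
      - 2 * Re (f (Complex x a) * cnj (f (Complex x b)))" for x
    by (simp add: cmod_power2) (simp add: power2_eq_square algebra_simps)
  then have "(LINT x|lborel. (cmod (f (Complex x a) - f (Complex x b)))\<^sup>2) =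
      (LINT x|lborel. (cmod (f (Complex x a)))\<^sup>2 + (cmod (f (Complex x b)))\<^sup>2
      - 2 * Re (f (Complex x a) * cnj (f (Complex x b))))"
    by simp
  also have "\<dots> = m a + m b - 2 * Re (LINT x|lborel. f (Complex x a) * cnj (f (Complex x b)))"
    using hardy2_integrable(1)[OF f] ab iab
    by (subst Bochner_Integration.integral_diff) (auto simp: m_def simp del: times_complex.sel)
  finally show ?thesis
    unfolding key c_def by simp
qed

text \<open>
  As the height decreases to 0, the squared norm \<open>m\<close> increases to a finite limit; hence
  \<open>m a + m b - 2 m ((a + b) / 2)\<close> becomes small.
\<close>

lemma hardy2_vertical_continuity:
  assumes f: "hardy2 M f" and "e > 0"
  shows "\<exists>\<delta>>0. \<forall>a b. 0 < a \<and> a < \<delta> \<and> 0 < b \<and> b < \<delta> \<longrightarrow>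
    sqnorm (\<lambda>x. f (Complex x a) - f (Complex x b)) \<le> ennreal e"
proof -
  note [measurable] = hardy2_measurable[OF f]
  define m where "m = (\<lambda>y. LINT x|lborel. (cmod (f (Complex x y)))\<^sup>2)"
  have m: "sqnorm (\<lambda>x. f (Complex x y)) = ennreal (m y)" "m y \<ge> 0" if "y > 0" for y
    using hardy2_integrable(2)[OF f that] by (auto simp: m_def)
  have "m y \<le> max M 0" if "y > 0" for y
    using hardy2_sqnorm[OF f that] m[OF that] by (auto simp: ennreal_le_iff2)
  then have bdd: "bdd_above (m ` {0<..})"
    by (intro bdd_aboveI2[where M = "max M 0"]) auto
  have anti: "m b \<le> m a" if "0 < a" "a \<le> b" for a b
    using hardy2_sqnorm_antimono[OF f that] m[of a] m[of b] that by simp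
  define L where "L = (SUP y\<in>{0<..}. m y)"
  have "L - e / 2 < L" using \<open>e > 0\<close> by simp
  then obtain \<delta> where \<delta>: "\<delta> > 0" "L - e / 2 < m \<delta>"
    unfolding L_def by (subst (asm) less_cSUP_iff[OF _ bdd]) auto
  have L: "m y \<le> L" if "y > 0" for y
    unfolding L_def using that bdd by (intro cSUP_upper) auto
  have main: "sqnorm (\<lambda>x. f (Complex x a) - f (Complex x b)) \<le> ennreal e"
    if "0 < b" "b < a" "a < \<delta>" for a b
  proof -
    have "integrable lborel (\<lambda>x. (cmod (f (Complex x a) - f (Complex x b)))\<^sup>2)"
    proof (rule sqnorm_integrable)
      have "sqnorm (\<lambda>x. f (Complex x a) + (- f (Complex x b))) \<le>
          2 * sqnorm (\<lambda>x. f (Complex x a)) + 2 * sqnorm (\<lambda>x. - f (Complex x b))"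
        by (rule sqnorm_add_le) auto
      also have "\<dots> < top"
        using that m[of a] m[of b] by (simp add: ennreal_mult_less_top)
      finally show "sqnorm (\<lambda>x. f (Complex x a) - f (Complex x b)) < top"
        by simp
    qed simp
    then have "sqnorm (\<lambda>x. f (Complex x a) - f (Complex x b)) = ennreal (m a + m b - 2 * m ((a + b) / 2))"
      unfolding sqnorm_def m_def hardy2_parallelogram[OF f that(1,2), symmetric]
      by (rule nn_integral_eq_integral) simp
    also have "m \<delta> \<le> m ((a + b) / 2)"
      using that by (intro anti) auto
    then have "m a + m b - 2 * m ((a + b) / 2) \<le> e"
      using L[of a] L[of b] \<delta> that by auto
    then have "ennreal (m a + m b - 2 * m ((a + b) / 2)) \<le> ennreal e"
      by (rule ennreal_leI)
    finally show ?thesis .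
  qed
  have comm: "sqnorm (\<lambda>x. f (Complex x a) - f (Complex x b)) = sqnorm (\<lambda>x. f (Complex x b) - f (Complex x a))" for a b
    unfolding sqnorm_def by (simp add: norm_minus_commute)
  have "sqnorm (\<lambda>x. f (Complex x a) - f (Complex x b)) \<le> ennreal e"
    if "0 < b" "b < \<delta>" "0 < a" "a < \<delta>" for a b
    using main[of b a] main[of a b] comm[of a b] that
    by (cases "a < b"; cases "a = b") (auto simp: sqnorm_def)
  with \<delta>(1) show ?thesis by blast
qed

lemma hardy2_vertical_translate:
  assumes f: "hardy2 M f" and "e > 0"
  shows "\<exists>\<delta>>0. \<forall>\<tau>. 0 < \<tau> \<and> \<tau> < \<delta> \<longrightarrow> hardy2 e (\<lambda>z. f (z + \<i> * of_real \<tau>) - f z)"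
proof -
  obtain \<delta> where \<delta>: "\<delta> > 0"
    "\<And>a b. 0 < a \<Longrightarrow> a < \<delta> \<Longrightarrow> 0 < b \<Longrightarrow> b < \<delta> \<Longrightarrow> sqnorm (\<lambda>x. f (Complex x a) - f (Complex x b)) \<le> ennreal e"
    using hardy2_vertical_continuity[OF assms] by blast
  have "hardy2 e (\<lambda>z. f (z + \<i> * of_real \<tau>) - f z)" if \<tau>: "0 < \<tau>" "\<tau> < \<delta>" for \<tau>
  proof (rule hardy2_improve)
    have M: "hardy2 (max M 0) f"
      using hardy2_mono[OF f] by simp
    show "hardy2 (2 * max M 0 + 2 * max M 0) (\<lambda>z. f (z + \<i> * of_real \<tau>) - f z)"
      using \<tau> by (intro hardy2_diff hardy2_translate M) auto
    fix \<delta>' :: real assume "\<delta>' > 0"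
    then show "\<exists>y>0. y < \<delta>' \<and> sqnorm (\<lambda>x. f (Complex x y + \<i> * of_real \<tau>) - f (Complex x y)) \<le> ennreal e"
    proof -
      define y where "y = min (\<delta>' / 2) ((\<delta> - \<tau>) / 2)"
      have "0 < y"
        unfolding y_def using \<tau> \<open>\<delta>' > 0\<close> by simp
      with y_def have y: "y \<le> \<delta>' / 2" "y \<le> (\<delta> - \<tau>) / 2" "0 < y"
        by linarith+
      have "sqnorm (\<lambda>x. f (Complex x (y + \<tau>)) - f (Complex x y)) \<le> ennreal e"
      proof (rule \<delta>(2))
        show "y + \<tau> < \<delta>" "y < \<delta>" "0 < y + \<tau>" "0 < y"
          using y \<tau> by (simp_all add: field_simps)
      qed
      then show ?thesis
        using y \<open>\<delta>' > 0\<close> by (intro exI[of _ y]) (auto simp: Complex_plus)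
    qed
  qed
  with \<delta>(1) show ?thesis by blast
qed

lemma poisson_translate_diff:
  assumes "y > 0" "\<bar>\<tau>\<bar> \<le> y"
  shows "\<bar>poisson y (x + \<tau>) - poisson y x\<bar> \<le> 4 * \<bar>\<tau>\<bar> / y * poisson y x"
proof -
  define u where "u = x + \<tau>"
  have q: "u\<^sup>2 + y\<^sup>2 > 0" "x\<^sup>2 + y\<^sup>2 > 0"
    using assms(1) by (auto intro: add_nonneg_pos)
  have "poisson y (x + \<tau>) - poisson y x = poisson y x * ((x\<^sup>2 - u\<^sup>2) / (u\<^sup>2 + y\<^sup>2))"
    using q by (simp add: poisson_def u_def[symmetric] divide_simps) (simp add: algebra_simps)
  moreover have "\<bar>x\<^sup>2 - u\<^sup>2\<bar> \<le> 4 * \<bar>\<tau>\<bar> / y * (u\<^sup>2 + y\<^sup>2)"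
  proof -
    have "x\<^sup>2 - u\<^sup>2 = - \<tau> * (2 * u - \<tau>)"
      by (simp add: u_def power2_eq_square algebra_simps)
    then have "\<bar>x\<^sup>2 - u\<^sup>2\<bar> = \<bar>\<tau>\<bar> * \<bar>2 * u - \<tau>\<bar>"
      by (simp add: abs_mult)
    also have "\<dots> \<le> \<bar>\<tau>\<bar> * (4 / y * (u\<^sup>2 + y\<^sup>2))"
    proof (intro mult_left_mono)
      have "2 * \<bar>u\<bar> * y \<le> u\<^sup>2 + y\<^sup>2"
        using sum_squares_bound[of "\<bar>u\<bar>" y] by simp
      moreover have "\<bar>2 * u - \<tau>\<bar> * y \<le> 2 * \<bar>u\<bar> * y + y\<^sup>2"
      proof -
        have "\<bar>2 * u - \<tau>\<bar> * y \<le> (2 * \<bar>u\<bar> + y) * y"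
          using assms by (intro mult_right_mono) auto
        also have "\<dots> = 2 * \<bar>u\<bar> * y + y\<^sup>2"
          by (simp add: algebra_simps power2_eq_square)
        finally show ?thesis .
      qed
      ultimately have "\<bar>2 * u - \<tau>\<bar> * y \<le> (u\<^sup>2 + y\<^sup>2) + y\<^sup>2"
        by (meson add_right_mono order.trans)
      also have "\<dots> \<le> 4 * (u\<^sup>2 + y\<^sup>2)"
        by simp
      finally have "\<bar>2 * u - \<tau>\<bar> * y \<le> 4 * (u\<^sup>2 + y\<^sup>2)" .
      then show "\<bar>2 * u - \<tau>\<bar> \<le> 4 / y * (u\<^sup>2 + y\<^sup>2)"
        using assms(1) by (simp add: field_simps)
    qed simp
    finally show ?thesis by (simp add: field_simps)
  qed
  then have "\<bar>(x\<^sup>2 - u\<^sup>2) / (u\<^sup>2 + y\<^sup>2)\<bar> \<le> 4 * \<bar>\<tau>\<bar> / y"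
    using q by (simp add: abs_divide pos_divide_le_eq)
  then have "\<bar>(x\<^sup>2 - u\<^sup>2) / (u\<^sup>2 + y\<^sup>2)\<bar> * poisson y x \<le> 4 * \<bar>\<tau>\<bar> / y * poisson y x"
    using assms(1) by (intro mult_right_mono poisson_nonneg) auto
  moreover have "\<bar>poisson y x * D\<bar> = \<bar>D\<bar> * poisson y x" for D
    using poisson_nonneg[of y x] assms(1) by (simp add: abs_mult)
  ultimately show ?thesis
    by simp
qed

text \<open>
  Above height \<open>\<eta>\<close> the function is a Poisson average with parameter \<open>\<eta>\<close>, and translating that kernel
  by \<open>\<tau>\<close> changes it by at most the fraction \<open>4 |\<tau>| / \<eta>\<close> of itself.
\<close>

lemma hardy2_horizontal_translate_above:
  assumes f: "hardy2 M f" and "M \<ge> 0" "\<eta> > 0" "\<bar>\<tau>\<bar> \<le> \<eta>"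
  shows "hardy2 (16 * \<tau>\<^sup>2 / \<eta>\<^sup>2 * M) (\<lambda>z. f (z + of_real \<tau> + \<i> * of_real \<eta>) - f (z + \<i> * of_real \<eta>))"
  unfolding hardy2_def
proof (intro conjI allI impI)
  note [measurable] = hardy2_measurable[OF f]
  have "hardy2 (2 * M + 2 * M) (\<lambda>z. f (z + (of_real \<tau> + \<i> * of_real \<eta>)) - f (z + \<i> * of_real \<eta>))"
    using assms by (intro hardy2_diff hardy2_translate) auto
  then show "(\<lambda>z. f (z + of_real \<tau> + \<i> * of_real \<eta>) - f (z + \<i> * of_real \<eta>)) holomorphic_on upper_half_plane"
    unfolding add.assoc by (rule hardy2_holomorphic)
  show "(\<lambda>z. f (z + of_real \<tau> + \<i> * of_real \<eta>) - f (z + \<i> * of_real \<eta>)) \<in> borel_measurable borel"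
    by measurable
  fix y :: real assume y: "y > 0"
  let ?C = "4 * \<bar>\<tau>\<bar> / \<eta>"
  have C: "?C \<ge> 0" using assms by auto
  have pt: "ennreal ((cmod (f (Complex (x + \<tau>) (y + \<eta>)) - f (Complex x (y + \<eta>))))\<^sup>2)
      \<le> ennreal (?C\<^sup>2) * (\<integral>\<^sup>+t. ennreal (poisson \<eta> (x - t) * (cmod (f (Complex t y)))\<^sup>2) \<partial>lborel)" for x
  proof -
    note P = hardy2_poisson[OF f y \<open>\<eta> > 0\<close>]
    let ?k = "\<lambda>t. (poisson \<eta> (x + \<tau> - t) - poisson \<eta> (x - t)) *\<^sub>R f (Complex t y)"
    have "f (Complex (x + \<tau>) (y + \<eta>)) - f (Complex x (y + \<eta>)) = (LINT t|lborel. ?k t)"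
      unfolding P(1) using P(2) by (simp add: scaleR_left_diff_distrib)
    moreover have "integrable lborel ?k"
      unfolding scaleR_left_diff_distrib using P(2) by auto
    ultimately have "ennreal (cmod (f (Complex (x + \<tau>) (y + \<eta>)) - f (Complex x (y + \<eta>)))) \<le>
        (\<integral>\<^sup>+t. ennreal (norm (?k t)) \<partial>lborel)"
      by (simp only: integral_norm_bound_ennreal)
    also have "\<dots> \<le> (\<integral>\<^sup>+t. ennreal ?C * ennreal (poisson \<eta> (x - t) * cmod (f (Complex t y))) \<partial>lborel)"
    proof (intro nn_integral_mono)
      fix t
      have "norm (?k t) \<le> (?C * poisson \<eta> (x - t)) * cmod (f (Complex t y))"
        unfolding norm_scaleR
        using poisson_translate_diff[OF \<open>\<eta> > 0\<close> assms(4), of "x - t"]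
        by (intro mult_right_mono) (auto simp: algebra_simps)
      then show "ennreal (norm (?k t)) \<le> ennreal ?C * ennreal (poisson \<eta> (x - t) * cmod (f (Complex t y)))"
        using C \<open>\<eta> > 0\<close> by (simp flip: ennreal_mult add: poisson_nonneg mult.assoc)
    qed
    also have "\<dots> = ennreal ?C * (\<integral>\<^sup>+t. ennreal (poisson \<eta> (x - t) * cmod (f (Complex t y))) \<partial>lborel)"
      by (rule nn_integral_cmult) auto
    finally have "(ennreal (cmod (f (Complex (x + \<tau>) (y + \<eta>)) - f (Complex x (y + \<eta>)))))\<^sup>2 \<le>
        (ennreal ?C * (\<integral>\<^sup>+t. ennreal (poisson \<eta> (x - t) * cmod (f (Complex t y))) \<partial>lborel))\<^sup>2"
      by (rule power_mono) simp
    also have "\<dots> \<le> ennreal (?C\<^sup>2) * (\<integral>\<^sup>+t. ennreal (poisson \<eta> (x - t) * (cmod (f (Complex t y)))\<^sup>2) \<partial>lborel)"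
      unfolding power_mult_distrib ennreal_power[OF C]
      using \<open>\<eta> > 0\<close> by (intro mult_left_mono poisson_average_square) auto
    finally show ?thesis
      by (simp add: ennreal_power)
  qed
  have "sqnorm (\<lambda>x. f (Complex (x + \<tau>) (y + \<eta>)) - f (Complex x (y + \<eta>))) \<le>
      (\<integral>\<^sup>+x. ennreal (?C\<^sup>2) * (\<integral>\<^sup>+t. ennreal (poisson \<eta> (x - t) * (cmod (f (Complex t y)))\<^sup>2) \<partial>lborel) \<partial>lborel)"
    unfolding sqnorm_def by (intro nn_integral_mono pt)
  also have "\<dots> = ennreal (?C\<^sup>2) * sqnorm (\<lambda>x. f (Complex x y))"
    unfolding sqnorm_def using \<open>\<eta> > 0\<close>
    by (subst nn_integral_cmult) (auto intro!: arg_cong2[of _ _ _ _ "(*)"] nn_integral_poisson_smoothing)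
  also have "\<dots> \<le> ennreal (?C\<^sup>2) * ennreal M"
    by (intro mult_left_mono hardy2_sqnorm[OF f y]) auto
  also have "\<dots> = ennreal (16 * \<tau>\<^sup>2 / \<eta>\<^sup>2 * M)"
    using \<open>M \<ge> 0\<close> by (simp flip: ennreal_mult add: power_divide power_mult_distrib)
  finally show "sqnorm (\<lambda>x. f (Complex x y + of_real \<tau> + \<i> * of_real \<eta>) - f (Complex x y + \<i> * of_real \<eta>))
      \<le> ennreal (16 * \<tau>\<^sup>2 / \<eta>\<^sup>2 * M)"
    by (simp add: Complex_plus)
qed

text \<open>
  Lift both functions to height \<open>\<eta>\<close>, where horizontal translation is under control; the lift itself is
  a small vertical translation.
\<close>

lemma hardy2_horizontal_translate:
  assumes f: "hardy2 M f" and "e > 0"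
  shows "\<exists>\<delta>>0. \<forall>\<tau>. \<bar>\<tau>\<bar> < \<delta> \<longrightarrow> hardy2 e (\<lambda>z. f (z + of_real \<tau>) - f z)"
proof -
  define M' where "M' = max M 1"
  have M': "M' > 0" "hardy2 M' f"
    using hardy2_mono[OF f] by (auto simp: M'_def)
  \<comment> \<open>Combining three differences costs \<open>2 * (2 * e' + 2 * e') + 2 * e' = 10 * e'\<close>.\<close>
  define e' where "e' = e / 10"
  have e': "e' > 0" using \<open>e > 0\<close> by (simp add: e'_def)
  obtain \<delta> where \<delta>: "\<delta> > 0" "\<And>\<tau>. 0 < \<tau> \<Longrightarrow> \<tau> < \<delta> \<Longrightarrow> hardy2 e' (\<lambda>z. f (z + \<i> * of_real \<tau>) - f z)"
    using hardy2_vertical_translate[OF f e'] by blast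
  define \<eta> where "\<eta> = \<delta> / 2"
  have \<eta>: "\<eta> > 0" "\<eta> < \<delta>" using \<delta> by (auto simp: \<eta>_def)
  note V = \<delta>(2)[OF \<eta>]
  define \<delta>' where "\<delta>' = min \<eta> (\<eta> * sqrt (e' / (16 * M')))"
  have \<delta>': "\<delta>' > 0" using \<eta> e' M' by (simp add: \<delta>'_def)
  have "hardy2 e (\<lambda>z. f (z + of_real \<tau>) - f z)" if \<tau>: "\<bar>\<tau>\<bar> < \<delta>'" for \<tau>
  proof -
    have "\<bar>\<tau>\<bar> \<le> \<eta> * sqrt (e' / (16 * M'))"
      using \<tau> by (simp add: \<delta>'_def)
    then have "\<tau>\<^sup>2 \<le> (\<eta> * sqrt (e' / (16 * M')))\<^sup>2"
      using abs_le_square_iff[of \<tau> "\<eta> * sqrt (e' / (16 * M'))"] \<eta> e' M' by auto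
    also have "\<dots> = \<eta>\<^sup>2 * (e' / (16 * M'))"
      using e' M' by (simp add: power_mult_distrib)
    finally have "16 * \<tau>\<^sup>2 / \<eta>\<^sup>2 * M' \<le> e'"
      using \<eta> M' by (simp add: field_simps)
    moreover have "hardy2 (16 * \<tau>\<^sup>2 / \<eta>\<^sup>2 * M') (\<lambda>z. f (z + of_real \<tau> + \<i> * of_real \<eta>) - f (z + \<i> * of_real \<eta>))"
      using \<tau> \<eta> M' by (intro hardy2_horizontal_translate_above) (auto simp: \<delta>'_def)
    ultimately have A: "hardy2 e' (\<lambda>z. f (z + of_real \<tau> + \<i> * of_real \<eta>) - f (z + \<i> * of_real \<eta>))"
      by (rule hardy2_mono[rotated])
    have B: "hardy2 e' (\<lambda>z. f (z + of_real \<tau> + \<i> * of_real \<eta>) - f (z + of_real \<tau>))"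
      using hardy2_translate[OF V, of "of_real \<tau>"] by simp
    have "hardy2 (2 * (2 * e' + 2 * e') + 2 * e') (\<lambda>z. (f (z + of_real \<tau> + \<i> * of_real \<eta>) - f (z + \<i> * of_real \<eta>)
         - (f (z + of_real \<tau> + \<i> * of_real \<eta>) - f (z + of_real \<tau>))) + (f (z + \<i> * of_real \<eta>) - f z))"
      using e' by (intro hardy2_add hardy2_diff A B V) auto
    then show ?thesis
      by (simp add: e'_def)
  qed
  with \<delta>' show ?thesis by blast
qed

section \<open>Non-tangential limits in the upper half-plane\<close>

lemma nn_integral_limit_le:
  assumes "\<And>n. u n \<in> borel_measurable M" "AE x in M. (\<lambda>n. u n x) \<longlonglongrightarrow> v x"
    "\<forall>\<^sub>F n in sequentially. (\<integral>\<^sup>+x. u n x \<partial>M) \<le> (c::ennreal)"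
  shows "(\<integral>\<^sup>+x. v x \<partial>M) \<le> c"
proof -
  have "(\<integral>\<^sup>+x. v x \<partial>M) = (\<integral>\<^sup>+x. liminf (\<lambda>n. u n x) \<partial>M)"
    by (rule nn_integral_cong_AE) (use assms(2) in \<open>auto elim!: eventually_mono dest!: lim_imp_Liminf[rotated]\<close>)
  also have "\<dots> \<le> liminf (\<lambda>n. \<integral>\<^sup>+x. u n x \<partial>M)"
    by (rule nn_integral_liminf[OF assms(1)])
  also have "\<dots> \<le> c"
    by (rule order.trans[OF Liminf_le_Limsup Limsup_bounded[OF assms(3)]]) simp
  finally show ?thesis .
qed

text \<open>
  The Hardy-Littlewood maximal theorem: Vitali's lemma selects disjoint intervals with large mean
  whose five-fold enlargements still cover the exceptional set. The Borel set \<open>U\<close> is the union of these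
  enlargements.
\<close>

lemma maximal_function_weak_type:
  fixes g :: "real \<Rightarrow> ennreal"
  assumes [measurable]: "g \<in> borel_measurable borel" and fin: "(\<integral>\<^sup>+t. g t \<partial>lborel) < top" and "\<mu> > 0"
  shows "\<exists>U\<in>sets borel. {x. \<exists>r>0. ennreal (\<mu> * r) < (\<integral>\<^sup>+t. g t * indicator (cball x r) t \<partial>lborel)} \<subseteq> U \<and>
    emeasure lborel U \<le> ennreal (10 / \<mu>) * (\<integral>\<^sup>+t. g t \<partial>lborel)"
proof -
  let ?G = "\<integral>\<^sup>+t. g t \<partial>lborel"
  let ?E = "{x. \<exists>r>0. ennreal (\<mu> * r) < (\<integral>\<^sup>+t. g t * indicator (cball x r) t \<partial>lborel)}"
  define D where "D = density lborel g"
  have D: "emeasure D A = (\<integral>\<^sup>+t. g t * indicator A t \<partial>lborel)" if "A \<in> sets borel" for A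
    unfolding D_def using that by (intro emeasure_density) auto
  have [simp]: "sets D = sets borel"
    by (simp add: D_def)
  define K where "K = {i. snd i > 0 \<and> ennreal (\<mu> * snd i) < emeasure D (cball (fst i) (snd i))}"
  have DG: "emeasure D A \<le> ?G" if "A \<in> sets borel" for A
    unfolding D[OF that] by (intro nn_integral_mono) (auto simp: indicator_def)
  have r: "0 < snd i \<and> snd i \<le> enn2real ?G / \<mu>" if "i \<in> K" for i
  proof -
    have "ennreal (\<mu> * snd i) \<le> ?G"
      using that DG[of "cball (fst i) (snd i)"] by (auto simp: K_def intro: order.trans less_imp_le)
    also have "?G = ennreal (enn2real ?G)"
      using fin by simp
    finally have "\<mu> * snd i \<le> enn2real ?G"
      by (subst (asm) ennreal_le_iff) auto
    then show ?thesis
      using \<open>\<mu> > 0\<close> that by (auto simp: K_def field_simps)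
  qed
  have sub: "?E \<subseteq> (\<Union>i\<in>K. cball (fst i) (snd i))"
    by (force simp: K_def D)
  obtain C where C: "countable C" "C \<subseteq> K"
    "pairwise (\<lambda>i j. disjnt (cball (fst i) (snd i)) (cball (fst j) (snd j))) C"
    "?E \<subseteq> (\<Union>i\<in>C. cball (fst i) (5 * snd i))"
    by (rule Vitali_covering_lemma_cballs[OF sub r]) (assumption, rule that)
  let ?I = "to_nat_on C ` C"
  define e where "e = inv_into C (to_nat_on C)"
  have inj: "inj_on (to_nat_on C) C"
    using C(1) by (rule inj_on_to_nat_on)
  have e: "e n \<in> C" if "n \<in> ?I" for n
    using that by (auto simp: e_def inv_into_f_f[OF inj])
  have e': "e (to_nat_on C i) = i" if "i \<in> C" for i
    using that by (simp add: e_def inv_into_f_f[OF inj])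
  define A where "A n = (if n \<in> ?I then cball (fst (e n)) (5 * snd (e n)) else {})" for n
  define B where "B n = (if n \<in> ?I then cball (fst (e n)) (snd (e n)) else {})" for n
  have [simp]: "B n \<in> sets borel" for n
    by (auto simp: B_def)
  then have [simp]: "(\<Union>n. B n) \<in> sets borel"
    by blast
  have "disjoint_family B"
    unfolding disjoint_family_on_def
  proof (intro ballI impI)
    fix m n :: nat assume "m \<noteq> n"
    show "B m \<inter> B n = {}"
    proof (cases "m \<in> ?I \<and> n \<in> ?I")
      case True
      then have "e m \<noteq> e n"
        using \<open>m \<noteq> n\<close> by (auto simp: e')
      then show ?thesis
        using True C(3) e by (auto simp: B_def pairwise_def disjnt_def)
    qed (auto simp: B_def)
  qed
  have "?E \<subseteq> (\<Union>n. A n)"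
  proof -
    have "(\<Union>i\<in>C. cball (fst i) (5 * snd i)) \<subseteq> (\<Union>n. A n)"
    proof (rule UN_least)
      fix i assume "i \<in> C"
      then have "A (to_nat_on C i) = cball (fst i) (5 * snd i)"
        by (simp add: A_def e')
      then show "cball (fst i) (5 * snd i) \<subseteq> (\<Union>n. A n)" by blast
    qed
    with C(4) show ?thesis by blast
  qed
  moreover have "(\<Union>n. A n) \<in> sets borel"
  proof -
    have "A n \<in> sets borel" for n
      by (auto simp: A_def)
    then show ?thesis by blast
  qed
  moreover have "emeasure lborel (\<Union>n. A n) \<le> ennreal (10 / \<mu>) * ?G"
  proof -
    have "emeasure lborel (\<Union>n. A n) \<le> (\<Sum>n. emeasure lborel (A n))"
      by (rule emeasure_subadditive_countably) (auto simp: A_def)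
    also have "\<dots> \<le> (\<Sum>n. ennreal (10 / \<mu>) * emeasure D (B n))"
    proof (intro suminf_le summableI)
      fix n
      show "emeasure lborel (A n) \<le> ennreal (10 / \<mu>) * emeasure D (B n)"
      proof (cases "n \<in> ?I")
        case True
        define r where "r = snd (e n)"
        have "e n \<in> K" using e[OF True] C(2) by blast
        then have r: "r > 0" "ennreal (\<mu> * r) < emeasure D (B n)"
          using True by (auto simp: K_def r_def B_def)
        have "emeasure lborel (A n) = ennreal (10 * r)"
          using True r by (simp add: A_def cball_eq_atLeastAtMost r_def[symmetric])
        also have "\<dots> = ennreal (10 / \<mu>) * ennreal (\<mu> * r)"
          using r \<open>\<mu> > 0\<close> by (simp flip: ennreal_mult)
        also have "\<dots> \<le> ennreal (10 / \<mu>) * emeasure D (B n)"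
          using r by (intro mult_left_mono) auto
        finally show ?thesis .
      qed (simp add: A_def)
    qed
    also have "\<dots> = ennreal (10 / \<mu>) * emeasure D (\<Union>n. B n)"
      unfolding ennreal_suminf_cmult
      by (subst suminf_emeasure) (use \<open>disjoint_family B\<close> in auto)
    also have "\<dots> \<le> ennreal (10 / \<mu>) * ?G"
      by (intro mult_left_mono DG) auto
    finally show ?thesis .
  qed
  ultimately show ?thesis by blast
qed

lemma ennreal_le_suminf: "f k \<le> (suminf f :: ennreal)"
  using sum_le_suminf[of f "{k}"] by simp

text \<open>
  Doubling the distance from the centre divides the kernel by 4, up to a constant.
\<close>

lemma poisson_le_dyadic:
  assumes "y > 0"
  shows "ennreal (poisson y (x - t)) \<le> (\<Sum>k. ennreal (4 / (pi * y) * (1/4) ^ k) * indicator (cball x (2 ^ k * y)) t)"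
proof -
  have "\<exists>k. \<bar>x - t\<bar> \<le> 2 ^ k * y \<and> poisson y (x - t) \<le> 4 / (pi * y) * (1/4) ^ k"
  proof (cases "\<bar>x - t\<bar> \<le> y")
    case True
    have "poisson y (x - t) \<le> y / (pi * y\<^sup>2)"
      unfolding poisson_def using assms by (intro divide_left_mono mult_left_mono) (auto intro!: mult_pos_pos add_nonneg_pos)
    also have "\<dots> \<le> 4 / (pi * y)"
      using assms by (simp add: power2_eq_square field_simps)
    finally show ?thesis
      using True by (intro exI[of _ 0]) auto
  next
    case False
    define k where "k = (LEAST k. \<bar>x - t\<bar> \<le> 2 ^ k * y)"
    obtain m :: nat where "\<bar>x - t\<bar> / y < 2 ^ m"
      using real_arch_pow[of 2 "\<bar>x - t\<bar> / y"] by auto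
    then have "\<bar>x - t\<bar> \<le> 2 ^ m * y"
      using assms by (simp add: field_simps)
    then have k: "\<bar>x - t\<bar> \<le> 2 ^ k * y"
      unfolding k_def by (rule LeastI)
    have "k \<noteq> 0" using k False by (cases k) auto
    then obtain j where j: "k = Suc j" by (cases k) auto
    have "2 ^ j * y < \<bar>x - t\<bar>"
      using not_less_Least[of j "\<lambda>k. \<bar>x - t\<bar> \<le> 2 ^ k * y"] j by (auto simp: k_def)
    then have "(2 ^ j * y)\<^sup>2 \<le> \<bar>x - t\<bar>\<^sup>2"
      using assms by (intro power_mono) auto
    moreover have "(2 ^ j * y)\<^sup>2 = 4 ^ j * y\<^sup>2"
    proof -
      have "((2::real) ^ j)\<^sup>2 = (2\<^sup>2) ^ j"
        by (simp only: power_mult[symmetric] mult.commute)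
      then show ?thesis by (simp add: power_mult_distrib)
    qed
    ultimately have "4 ^ j * y\<^sup>2 \<le> (x - t)\<^sup>2 + y\<^sup>2"
      by (simp add: add_increasing2)
    then have "poisson y (x - t) \<le> y / (pi * (4 ^ j * y\<^sup>2))"
      unfolding poisson_def using assms
      by (intro divide_left_mono mult_left_mono) (auto intro!: mult_pos_pos add_nonneg_pos)
    also have "\<dots> = 4 / (pi * y) * (1/4) ^ k"
      using assms by (simp add: j power2_eq_square power_divide)
    finally show ?thesis using k by blast
  qed
  then obtain k where k: "\<bar>x - t\<bar> \<le> 2 ^ k * y" "poisson y (x - t) \<le> 4 / (pi * y) * (1/4) ^ k"
    by blast
  let ?s = "\<lambda>k. ennreal (4 / (pi * y) * (1/4) ^ k) * indicator (cball x (2 ^ k * y)) t"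
  have "ennreal (poisson y (x - t)) \<le> ?s k"
    using k by (auto simp: indicator_def dist_real_def intro: ennreal_leI)
  also have "\<dots> \<le> suminf ?s"
    by (rule ennreal_le_suminf)
  finally show ?thesis .
qed

lemma poisson_shift_le:
  assumes "y > 0" "\<bar>x - x0\<bar> \<le> \<alpha> * y"
  shows "poisson y (x - t) \<le> (2 + 2 * \<alpha>\<^sup>2) * poisson y (x0 - t)"
proof -
  have "(x - x0)\<^sup>2 \<le> (\<alpha> * y)\<^sup>2"
    using assms by (metis abs_ge_zero power2_abs power_mono)
  have "(x0 - t)\<^sup>2 \<le> 2 * (x - t)\<^sup>2 + 2 * (x - x0)\<^sup>2"
    using norm_add_square_le[of "x - t" "x0 - x"] by (simp add: power2_commute)
  also have "\<dots> \<le> 2 * (x - t)\<^sup>2 + 2 * (\<alpha> * y)\<^sup>2"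
    using \<open>(x - x0)\<^sup>2 \<le> (\<alpha> * y)\<^sup>2\<close> by simp
  finally have "(x0 - t)\<^sup>2 + y\<^sup>2 \<le> 2 * (x - t)\<^sup>2 + 2 * (\<alpha> * y)\<^sup>2 + y\<^sup>2"
    by simp
  also have "\<dots> \<le> (2 + 2 * \<alpha>\<^sup>2) * ((x - t)\<^sup>2 + y\<^sup>2)"
    by (simp add: algebra_simps power_mult_distrib)
  finally have *: "(x0 - t)\<^sup>2 + y\<^sup>2 \<le> (2 + 2 * \<alpha>\<^sup>2) * ((x - t)\<^sup>2 + y\<^sup>2)" .
  have pos: "(x - t)\<^sup>2 + y\<^sup>2 > 0" "(x0 - t)\<^sup>2 + y\<^sup>2 > 0"
    using assms(1) by (auto intro: add_nonneg_pos)
  have "1 / ((x - t)\<^sup>2 + y\<^sup>2) \<le> (2 + 2 * \<alpha>\<^sup>2) / ((x0 - t)\<^sup>2 + y\<^sup>2)"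
    using * pos by (simp add: field_simps)
  then have "y / pi * (1 / ((x - t)\<^sup>2 + y\<^sup>2)) \<le> y / pi * ((2 + 2 * \<alpha>\<^sup>2) / ((x0 - t)\<^sup>2 + y\<^sup>2))"
    using assms(1) by (intro mult_left_mono) auto
  then show ?thesis
    by (simp add: poisson_def mult.commute)
qed

text \<open>
  In the dyadic bound the \<open>k\<close>-th ball contributes at most a multiple of \<open>4\<^bsup>-k\<^esup> * 2\<^sup>k\<close>, and these
  numbers have a finite sum.
\<close>

lemma poisson_le_maximal_function:
  fixes g :: "real \<Rightarrow> real"
  assumes [measurable]: "g \<in> borel_measurable borel" and g: "\<And>t. g t \<ge> 0"
    and "y > 0" "\<mu> \<ge> 0" and x: "\<bar>x - x0\<bar> \<le> \<alpha> * y"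
    and avg: "\<And>r. r > 0 \<Longrightarrow> (\<integral>\<^sup>+t. ennreal (g t) * indicator (cball x0 r) t \<partial>lborel) \<le> ennreal (\<mu> * r)"
  shows "(\<integral>\<^sup>+t. ennreal (poisson y (x - t) * g t) \<partial>lborel) \<le> ennreal ((2 + 2 * \<alpha>\<^sup>2) * (3 * \<mu>))"
proof -
  have A: "2 + 2 * \<alpha>\<^sup>2 \<ge> 0" by simp
  have [measurable]: "cball x0 r \<in> sets borel" for r by simp
  have "(\<integral>\<^sup>+t. ennreal (poisson y (x - t) * g t) \<partial>lborel) \<le>
      (\<integral>\<^sup>+t. ennreal (2 + 2 * \<alpha>\<^sup>2) * (\<Sum>k. ennreal (4 / (pi * y) * (1/4) ^ k) * (ennreal (g t) * indicator (cball x0 (2 ^ k * y)) t)) \<partial>lborel)"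
  proof (intro nn_integral_mono)
    fix t
    have "ennreal (poisson y (x - t) * g t) \<le> ennreal ((2 + 2 * \<alpha>\<^sup>2) * poisson y (x0 - t) * g t)"
      using g poisson_shift_le[OF \<open>y > 0\<close> x] by (intro ennreal_leI mult_right_mono)
    also have "\<dots> = ennreal (2 + 2 * \<alpha>\<^sup>2) * (ennreal (poisson y (x0 - t)) * ennreal (g t))"
      using g \<open>y > 0\<close> A by (simp add: ennreal_mult poisson_nonneg mult.assoc)
    also have "\<dots> \<le> ennreal (2 + 2 * \<alpha>\<^sup>2) * ((\<Sum>k. ennreal (4 / (pi * y) * (1/4) ^ k) * indicator (cball x0 (2 ^ k * y)) t) * ennreal (g t))"
      by (intro mult_left_mono mult_right_mono poisson_le_dyadic \<open>y > 0\<close>) auto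
    also have "\<dots> = ennreal (2 + 2 * \<alpha>\<^sup>2) * (\<Sum>k. ennreal (4 / (pi * y) * (1/4) ^ k) * (ennreal (g t) * indicator (cball x0 (2 ^ k * y)) t))"
      by (subst ennreal_suminf_multc[symmetric]) (simp add: mult_ac)
    finally show "ennreal (poisson y (x - t) * g t) \<le> ennreal (2 + 2 * \<alpha>\<^sup>2) * (\<Sum>k. ennreal (4 / (pi * y) * (1/4) ^ k) * (ennreal (g t) * indicator (cball x0 (2 ^ k * y)) t))" .
  qed
  also have "\<dots> = ennreal (2 + 2 * \<alpha>\<^sup>2) * (\<integral>\<^sup>+t. (\<Sum>k. ennreal (4 / (pi * y) * (1/4) ^ k) * (ennreal (g t) * indicator (cball x0 (2 ^ k * y)) t)) \<partial>lborel)"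
    by (rule nn_integral_cmult) measurable
  also have "(\<integral>\<^sup>+t. (\<Sum>k. ennreal (4 / (pi * y) * (1/4) ^ k) * (ennreal (g t) * indicator (cball x0 (2 ^ k * y)) t)) \<partial>lborel)
      = (\<Sum>k. \<integral>\<^sup>+t. ennreal (4 / (pi * y) * (1/4) ^ k) * (ennreal (g t) * indicator (cball x0 (2 ^ k * y)) t) \<partial>lborel)"
    by (rule nn_integral_suminf) measurable
  also have "\<dots> = (\<Sum>k. ennreal (4 / (pi * y) * (1/4) ^ k) * (\<integral>\<^sup>+t. ennreal (g t) * indicator (cball x0 (2 ^ k * y)) t \<partial>lborel))"
    by (intro suminf_cong nn_integral_cmult) measurable
  also have "ennreal (2 + 2 * \<alpha>\<^sup>2) * (\<Sum>k. ennreal (4 / (pi * y) * (1/4) ^ k) * (\<integral>\<^sup>+t. ennreal (g t) * indicator (cball x0 (2 ^ k * y)) t \<partial>lborel))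
      \<le> ennreal (2 + 2 * \<alpha>\<^sup>2) * (\<Sum>k. ennreal (4 * \<mu> / pi * (1/2) ^ k))"
  proof (intro mult_left_mono suminf_le summableI)
    fix k
    have "ennreal (4 / (pi * y) * (1/4) ^ k) * (\<integral>\<^sup>+t. ennreal (g t) * indicator (cball x0 (2 ^ k * y)) t \<partial>lborel)
        \<le> ennreal (4 / (pi * y) * (1/4) ^ k) * ennreal (\<mu> * (2 ^ k * y))"
      using \<open>y > 0\<close> by (intro mult_left_mono avg) auto
    also have "\<dots> = ennreal (4 / (pi * y) * (1/4) ^ k * (\<mu> * (2 ^ k * y)))"
      using \<open>y > 0\<close> \<open>\<mu> \<ge> 0\<close> by (simp flip: ennreal_mult)
    also have "4 / (pi * y) * (1/4) ^ k * (\<mu> * (2 ^ k * y)) = 4 * \<mu> / pi * ((1/4) ^ k * 2 ^ k)"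
      using \<open>y > 0\<close> by (simp add: field_simps)
    also have "(1/4::real) ^ k * 2 ^ k = (1/2) ^ k"
      by (simp flip: power_mult_distrib)
    finally show "ennreal (4 / (pi * y) * (1/4) ^ k) * (\<integral>\<^sup>+t. ennreal (g t) * indicator (cball x0 (2 ^ k * y)) t \<partial>lborel)
        \<le> ennreal (4 * \<mu> / pi * (1/2) ^ k)" .
  qed simp
  also have "(\<Sum>k. ennreal (4 * \<mu> / pi * (1/2) ^ k)) = ennreal (4 * \<mu> / pi * 2)"
    using \<open>\<mu> \<ge> 0\<close> geometric_sums[of "1/2::real"] by (intro suminf_ennreal_eq sums_mult) auto
  also have "ennreal (2 + 2 * \<alpha>\<^sup>2) * ennreal (4 * \<mu> / pi * 2) \<le> ennreal (2 + 2 * \<alpha>\<^sup>2) * ennreal (3 * \<mu>)"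
  proof (intro mult_left_mono ennreal_leI)
    have "8 * \<mu> \<le> (3 * \<mu>) * pi"
      using mult_left_mono[of "8/3" pi "3 * \<mu>"] pi_gt3 \<open>\<mu> \<ge> 0\<close> by simp
    then show "4 * \<mu> / pi * 2 \<le> 3 * \<mu>"
      by (simp add: pos_divide_le_eq)
  qed simp
  also have "\<dots> = ennreal ((2 + 2 * \<alpha>\<^sup>2) * (3 * \<mu>))"
    using \<open>\<mu> \<ge> 0\<close> by (simp add: ennreal_mult)
  finally show ?thesis .
qed

definition stolz :: "real \<Rightarrow> real \<Rightarrow> complex set" where
  "stolz \<alpha> x = {z. 0 < Im z \<and> \<bar>Re z - x\<bar> < \<alpha> * Im z}"

text \<open>
  In a cone, \<open>|f|\<^sup>2\<close> is bounded by Poisson averages of its values on a line just above the real axis,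
  hence by the maximal function of these values. The sets \<open>En n\<close> use the line at height \<open>1 / (n + 1)\<close>
  and cones with vertices on it; they increase to \<open>E\<close>.
\<close>

lemma hardy2_nontangential_weak_type:
  fixes \<alpha> \<kappa> M :: real
  assumes f: "hardy2 M f" and "M \<ge> 0" "\<kappa> > 0"
  defines "E \<equiv> {x. \<exists>z\<in>stolz \<alpha> x. \<kappa> < (cmod (f z))\<^sup>2}"
  shows "open E" and "emeasure lborel E \<le> ennreal (30 * (2 + 2 * \<alpha>\<^sup>2) / \<kappa> * M)"
proof -
  note [measurable] = hardy2_measurable[OF f]
  define a where "a n = 1 / (real n + 1)" for n
  have a: "a n > 0" for n by (simp add: a_def)
  define En where "En n = {x. \<exists>z. a n < Im z \<and> \<bar>Re z - x\<bar> < \<alpha> * (Im z - a n) \<and> \<kappa> < (cmod (f z))\<^sup>2}" for n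
  have iv: "\<bar>u - x\<bar> < c \<longleftrightarrow> x \<in> {u - c<..<u + c}" for u x c :: real
    by auto
  have "E = (\<Union>z\<in>{z. 0 < Im z \<and> \<kappa> < (cmod (f z))\<^sup>2}. {Re z - \<alpha> * Im z <..< Re z + \<alpha> * Im z})"
    unfolding E_def stolz_def iv by blast
  then show "open E" by auto
  have "En n = (\<Union>z\<in>{z. a n < Im z \<and> \<kappa> < (cmod (f z))\<^sup>2}. {Re z - \<alpha> * (Im z - a n) <..< Re z + \<alpha> * (Im z - a n)})" for n
    unfolding En_def iv by blast
  then have "open (En n)" for n by auto
  then have [measurable]: "En n \<in> sets borel" for n by auto
  define C where "C = 2 + 2 * \<alpha>\<^sup>2"
  have C: "C > 0" by (auto simp: C_def intro: add_pos_nonneg)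
  define \<mu> where "\<mu> = \<kappa> / (3 * C)"
  have \<mu>: "\<mu> > 0" "C * (3 * \<mu>) = \<kappa>" using C \<open>\<kappa> > 0\<close> by (auto simp: \<mu>_def)
  have bound: "emeasure lborel (En n) \<le> ennreal (10 / \<mu> * M)" for n
  proof -
    let ?g = "\<lambda>t. ennreal ((cmod (f (Complex t (a n))))\<^sup>2)"
    have le: "(\<integral>\<^sup>+t. ?g t \<partial>lborel) \<le> ennreal M"
      using hardy2_sqnorm[OF f a] by (simp add: sqnorm_def)
    then have "(\<integral>\<^sup>+t. ?g t \<partial>lborel) < top"
      by (rule le_less_trans) simp
    then obtain U where U: "U \<in> sets borel"
      "{x. \<exists>r>0. ennreal (\<mu> * r) < (\<integral>\<^sup>+t. ?g t * indicator (cball x r) t \<partial>lborel)} \<subseteq> U"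
      "emeasure lborel U \<le> ennreal (10 / \<mu>) * (\<integral>\<^sup>+t. ?g t \<partial>lborel)"
      using maximal_function_weak_type[of ?g \<mu>] \<mu>(1) by auto
    have "En n \<subseteq> {x. \<exists>r>0. ennreal (\<mu> * r) < (\<integral>\<^sup>+t. ?g t * indicator (cball x r) t \<partial>lborel)}"
    proof (rule subsetI, rule ccontr)
      fix x0 assume "x0 \<in> En n"
      then obtain z where z: "a n < Im z" "\<bar>Re z - x0\<bar> < \<alpha> * (Im z - a n)" "\<kappa> < (cmod (f z))\<^sup>2"
        by (auto simp: En_def)
      assume "x0 \<notin> {x. \<exists>r>0. ennreal (\<mu> * r) < (\<integral>\<^sup>+t. ?g t * indicator (cball x r) t \<partial>lborel)}"
      then have avg: "(\<integral>\<^sup>+t. ?g t * indicator (cball x0 r) t \<partial>lborel) \<le> ennreal (\<mu> * r)" if "r > 0" for r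
        using that by (intro leI) blast
      have "ennreal ((cmod (f (Complex (Re z) (a n + (Im z - a n)))))\<^sup>2) \<le>
          (\<integral>\<^sup>+t. ennreal (poisson (Im z - a n) (Re z - t) * (cmod (f (Complex t (a n))))\<^sup>2) \<partial>lborel)"
        using z by (intro hardy2_poisson_square[OF f a]) auto
      also have "\<dots> \<le> ennreal ((2 + 2 * \<alpha>\<^sup>2) * (3 * \<mu>))"
        using poisson_le_maximal_function[of "\<lambda>t. (cmod (f (Complex t (a n))))\<^sup>2" "Im z - a n" \<mu> "Re z" x0 \<alpha>] z \<mu>(1) avg
        by auto
      also have "\<dots> = ennreal \<kappa>"
        using \<mu>(2) by (simp add: C_def)
      finally have "(cmod (f z))\<^sup>2 \<le> \<kappa>"
        using \<open>\<kappa> > 0\<close> by (simp add: complex_eq_iff[of z] ennreal_le_iff)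
      with z(3) show False by simp
    qed
    then have "En n \<subseteq> U" using U(2) by blast
    then have "emeasure lborel (En n) \<le> emeasure lborel U"
      using U(1) by (intro emeasure_mono) auto
    also have "\<dots> \<le> ennreal (10 / \<mu>) * ennreal M"
      using le by (intro order.trans[OF U(3)] mult_left_mono) auto
    also have "\<dots> = ennreal (10 / \<mu> * M)"
      using \<mu>(1) \<open>M \<ge> 0\<close> by (simp flip: ennreal_mult)
    finally show ?thesis .
  qed
  have inc: "incseq En"
  proof (rule incseq_SucI, rule subsetI)
    fix n x assume "x \<in> En n"
    then obtain z where z: "a n < Im z" "\<bar>Re z - x\<bar> < \<alpha> * (Im z - a n)" "\<kappa> < (cmod (f z))\<^sup>2"
      by (auto simp: En_def)
    have le: "a (Suc n) \<le> a n" by (simp add: a_def field_simps)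
    have "0 < \<alpha> * (Im z - a n)" using z(2) abs_ge_zero[of "Re z - x"] by linarith
    then have "\<alpha> > 0" using z(1) by (simp add: zero_less_mult_iff)
    then have "\<alpha> * (Im z - a n) \<le> \<alpha> * (Im z - a (Suc n))"
      using le by (intro mult_left_mono) auto
    then show "x \<in> En (Suc n)"
      using z le by (auto simp: En_def intro!: exI[of _ z])
  qed
  have "E = (\<Union>n. En n)"
  proof (intro equalityI subsetI)
    fix x assume "x \<in> E"
    then obtain z where z: "0 < Im z" "\<bar>Re z - x\<bar> < \<alpha> * Im z" "\<kappa> < (cmod (f z))\<^sup>2"
      by (auto simp: E_def stolz_def)
    have lim: "a \<longlonglongrightarrow> 0"
      unfolding a_def by real_asymp
    have "(\<lambda>n. \<alpha> * (Im z - a n)) \<longlonglongrightarrow> \<alpha> * (Im z - 0)"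
      by (intro tendsto_intros lim)
    then have "\<forall>\<^sub>F n in sequentially. \<bar>Re z - x\<bar> < \<alpha> * (Im z - a n)"
      by (rule order_tendstoD) (use z in simp)
    moreover have "\<forall>\<^sub>F n in sequentially. a n < Im z"
      by (rule order_tendstoD[OF lim]) (use z in simp)
    ultimately have "\<forall>\<^sub>F n in sequentially. x \<in> En n"
      by eventually_elim (use z(3) in \<open>auto simp: En_def\<close>)
    then show "x \<in> (\<Union>n. En n)"
      using eventually_happens'[OF sequentially_bot] by blast
  next
    fix x assume "x \<in> (\<Union>n. En n)"
    then obtain n z where z: "a n < Im z" "\<bar>Re z - x\<bar> < \<alpha> * (Im z - a n)" "\<kappa> < (cmod (f z))\<^sup>2"
      by (auto simp: En_def)
    have "0 < \<alpha> * (Im z - a n)" using z(2) abs_ge_zero[of "Re z - x"] by linarith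
    then have "\<alpha> > 0" using z(1) by (simp add: zero_less_mult_iff)
    then have "\<alpha> * (Im z - a n) \<le> \<alpha> * Im z"
      using a[of n] by (intro mult_left_mono) auto
    then have "z \<in> stolz \<alpha> x"
      unfolding stolz_def using z(1,2) a[of n] by (intro CollectI conjI) linarith+
    then show "x \<in> E"
      using z(3) by (auto simp: E_def)
  qed
  then have "emeasure lborel E = (SUP n. emeasure lborel (En n))"
    using SUP_emeasure_incseq[OF _ inc, of lborel] by (simp add: image_subset_iff)
  also have "\<dots> \<le> ennreal (10 / \<mu> * M)"
    by (intro SUP_least bound)
  also have "10 / \<mu> * M = 30 * (2 + 2 * \<alpha>\<^sup>2) / \<kappa> * M"
    using C by (simp add: \<mu>_def C_def)
  finally show "emeasure lborel E \<le> ennreal (30 * (2 + 2 * \<alpha>\<^sup>2) / \<kappa> * M)" .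
qed

text \<open>
  A limit along a fixed sequence of heights is a measurable function of \<open>x\<close>; almost everywhere it turns
  out to be the non-tangential limit.
\<close>

definition boundary_value :: "(complex \<Rightarrow> complex) \<Rightarrow> real \<Rightarrow> complex" where
  "boundary_value f x = lim (\<lambda>n. f (Complex x (1 / (real n + 1))))"

lemma boundary_value_measurable:
  assumes "hardy2 M f"
  shows "boundary_value f \<in> borel_measurable borel"
proof -
  note [measurable] = hardy2_measurable[OF assms]
  show ?thesis
    unfolding boundary_value_def by (rule borel_measurable_lim_metric) measurable
qed

lemma stolz_mono: "\<alpha> \<le> \<beta> \<Longrightarrow> stolz \<alpha> x \<subseteq> stolz \<beta> x"
proof
  fix z assume "\<alpha> \<le> \<beta>" "z \<in> stolz \<alpha> x"
  moreover from this have "\<alpha> * Im z \<le> \<beta> * Im z"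
    by (intro mult_right_mono) (auto simp: stolz_def)
  ultimately show "z \<in> stolz \<beta> x"
    unfolding stolz_def mem_Collect_eq by linarith
qed

lemma filterlim_vertical_stolz:
  assumes "\<alpha> > 0"
  shows "filterlim (\<lambda>y. Complex x y) (at (of_real x) within stolz \<alpha> x) (at_right 0)"
  unfolding filterlim_at
proof
  show "\<forall>\<^sub>F y in at_right 0. Complex x y \<in> stolz \<alpha> x \<and> Complex x y \<noteq> of_real x"
    using eventually_at_right_less[of "0::real"]
    by eventually_elim (use assms in \<open>auto simp: stolz_def complex_eq_iff\<close>)
  have "((\<lambda>y. of_real x + \<i> * of_real y) \<longlongrightarrow> of_real x + \<i> * of_real 0) (at_right (0::real))"
    by (intro tendsto_intros)
  then show "((\<lambda>y. Complex x y) \<longlongrightarrow> complex_of_real x) (at_right 0)"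
    by (simp add: Complex_eq)
qed

lemma stolz_not_trivial:
  assumes "\<alpha> > 0"
  shows "at (complex_of_real x) within stolz \<alpha> x \<noteq> bot"
  using filterlim_vertical_stolz[OF assms, of x]
  by (auto simp: filterlim_def filtermap_bot_iff bot_unique trivial_limit_at_right_real)

text \<open>
  The functions \<open>f(z + \<i> \<tau>)\<close> are continuous at the real axis, and \<open>f(z + \<i> \<tau>) - f(z)\<close> has a small bound
  for small \<open>\<tau>\<close>, so by the weak type estimate it is small in the cones over most points. Off a null set,
  \<open>f\<close> therefore satisfies the Cauchy criterion in every cone.
\<close>

theorem hardy2_nontangential_limit:
  assumes f: "hardy2 M f"
  shows "AE x in lborel. \<forall>\<alpha>>0. (f \<longlongrightarrow> boundary_value f x) (at (of_real x) within stolz \<alpha> x)"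
proof -
  have ex: "\<exists>\<tau>>0. hardy2 (1 / (real m + 1)) (\<lambda>z. f (z + \<i> * of_real \<tau>) - f z)" for m :: nat
  proof -
    obtain \<delta> where "\<delta> > 0" "\<forall>\<tau>. 0 < \<tau> \<and> \<tau> < \<delta> \<longrightarrow> hardy2 (1 / (real m + 1)) (\<lambda>z. f (z + \<i> * of_real \<tau>) - f z)"
      using hardy2_vertical_translate[OF f, of "1 / (real m + 1)"] by auto
    then show ?thesis by (meson field_lbound_gt_zero)
  qed
  then obtain \<tau> where \<tau>: "\<And>m. \<tau> m > 0"
    "\<And>m. hardy2 (1 / (real m + 1)) (\<lambda>z. f (z + \<i> * of_real (\<tau> m)) - f z)"
    by metis
  define E where "E \<alpha> k m = {x. \<exists>z\<in>stolz \<alpha> x. 1 / (real k + 1)\<^sup>2 < (cmod (f (z + \<i> * of_real (\<tau> m)) - f z))\<^sup>2}"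
    for \<alpha> :: real and k m :: nat
  define N where "N \<alpha> = (\<Union>k. \<Inter>m. E \<alpha> k m)" for \<alpha>
  have E [measurable]: "E \<alpha> k m \<in> sets borel"
    and Eb: "emeasure lborel (E \<alpha> k m) \<le> ennreal (30 * (2 + 2 * \<alpha>\<^sup>2) / (1 / (real k + 1)\<^sup>2) * (1 / (real m + 1)))"
    for \<alpha> k m
    unfolding E_def
    using hardy2_nontangential_weak_type[OF \<tau>(2)[of m], of "1 / (real k + 1)\<^sup>2" \<alpha>] by auto
  have "emeasure lborel (\<Inter>m. E \<alpha> k m) = 0" for \<alpha> k
  proof -
    define c where "c = 30 * (2 + 2 * \<alpha>\<^sup>2) / (1 / (real k + 1)\<^sup>2)"
    have "emeasure lborel (\<Inter>m. E \<alpha> k m) \<le> ennreal (c * (1 / (real m + 1)))" for m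
      using E by (intro order.trans[OF emeasure_mono Eb[of \<alpha> k m, folded c_def]]) auto
    moreover have "(\<lambda>m. ennreal (c * (1 / (real m + 1)))) \<longlonglongrightarrow> ennreal 0"
      by (intro tendsto_ennrealI) real_asymp
    ultimately have "emeasure lborel (\<Inter>m. E \<alpha> k m) \<le> ennreal 0"
      by (intro LIMSEQ_le_const) auto
    then show ?thesis by simp
  qed
  then have Ek: "(\<Inter>m. E \<alpha> k m) \<in> null_sets lborel" for \<alpha> k
    by (auto simp: null_sets_def)
  have "N \<alpha> \<in> null_sets lborel" for \<alpha>
    unfolding N_def by (rule null_sets_UN) (rule Ek)
  then have "(\<Union>j::nat. N (real j + 1)) \<in> null_sets lborel"
    by (intro null_sets_UN)
  then have "AE x in lborel. x \<notin> (\<Union>j::nat. N (real j + 1))"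
    by (rule AE_not_in)
  then show ?thesis
  proof eventually_elim
    case (elim x)
    have conv: "\<exists>l. (f \<longlongrightarrow> l) (at (of_real x) within stolz (real j + 1) x)" for j :: nat
    proof -
      let ?F = "at (complex_of_real x) within stolz (real j + 1) x"
      have "x \<notin> N (real j + 1)" using elim by blast
      have "cauchy_filter (filtermap f ?F)"
        unfolding cauchy_filter_metric_filtermap
      proof (intro allI impI)
        fix e :: real assume "e > 0"
        obtain k :: nat where k: "real k > 4 / e"
          using reals_Archimedean2 by blast
        have k': "4 / (real k + 1) < e"
        proof -
          have "4 < e * real k" using k \<open>e > 0\<close> by (simp add: field_simps)
          then have "4 < e * (real k + 1)" using \<open>e > 0\<close> by (simp add: algebra_simps)
          then show ?thesis by (simp add: field_simps)
        qed
        from \<open>x \<notin> N (real j + 1)\<close> obtain m where "x \<notin> E (real j + 1) k m"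
          by (auto simp: N_def)
        then have m: "cmod (f (z + \<i> * of_real (\<tau> m)) - f z) \<le> 1 / (real k + 1)" if "z \<in> stolz (real j + 1) x" for z
        proof -
          have "(cmod (f (z + \<i> * of_real (\<tau> m)) - f z))\<^sup>2 \<le> (1 / (real k + 1))\<^sup>2"
            using \<open>x \<notin> E (real j + 1) k m\<close> that by (auto simp: E_def power_divide not_less)
          then show ?thesis by (rule power2_le_imp_le) simp
        qed
        define c where "c = f (of_real x + \<i> * of_real (\<tau> m))"
        have "isCont f (of_real x + \<i> * of_real (\<tau> m))"
          using holomorphic_on_imp_continuous_on[OF hardy2_holomorphic[OF f]] \<tau>(1)[of m]
          by (auto simp: continuous_on_eq_continuous_at open_upper_half_plane)
        then have "isCont (\<lambda>z. f (z + \<i> * of_real (\<tau> m))) (of_real x)"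
          by (intro isCont_o2[where g = f and f = "\<lambda>z. z + \<i> * of_real (\<tau> m)"] continuous_intros)
        then have "((\<lambda>z. f (z + \<i> * of_real (\<tau> m))) \<longlongrightarrow> c) ?F"
          unfolding c_def isCont_def by (rule tendsto_within_subset) auto
        then have ev: "\<forall>\<^sub>F z in ?F. dist (f (z + \<i> * of_real (\<tau> m))) c < 1 / (real k + 1)"
          by (rule tendstoD) simp
        have ev2: "\<forall>\<^sub>F z in ?F. z \<in> stolz (real j + 1) x"
          by (auto simp: eventually_at_filter)
        have "\<forall>\<^sub>F z in ?F. dist (f z) c < 2 / (real k + 1)"
          using ev ev2
        proof eventually_elim
          case (elim z)
          have "dist (f z) c \<le> dist (f (z + \<i> * of_real (\<tau> m))) (f z) + dist (f (z + \<i> * of_real (\<tau> m))) c"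
            by (metis dist_commute dist_triangle3)
          also have "\<dots> < 1 / (real k + 1) + 1 / (real k + 1)"
            using elim m[of z] by (intro add_le_less_mono) (auto simp: dist_norm)
          finally show ?case by simp
        qed
        then show "\<exists>P. eventually P ?F \<and> (\<forall>z w. P z \<and> P w \<longrightarrow> dist (f z) (f w) < e)"
        proof (intro exI conjI allI impI)
          fix z w assume "dist (f z) c < 2 / (real k + 1) \<and> dist (f w) c < 2 / (real k + 1)"
          then have "dist (f z) (f w) < 2 / (real k + 1) + 2 / (real k + 1)"
            using dist_triangle2[of "f z" "f w" c] by linarith
          then show "dist (f z) (f w) < e" using k' by simp
        qed
      qed
      moreover have "filtermap f ?F \<noteq> bot"
        using stolz_not_trivial[of "real j + 1" x] by (simp add: filtermap_bot_iff)
      ultimately obtain l where "filtermap f ?F \<le> nhds l"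
        using cauchy_filter_complete_converges[OF _ complete_UNIV, of "filtermap f ?F"] by auto
      then show ?thesis by (auto simp: filterlim_def)
    qed
    obtain l where l: "(f \<longlongrightarrow> l) (at (of_real x) within stolz 1 x)"
      using conv[of 0] by auto
    have "\<forall>\<alpha>>0. (f \<longlongrightarrow> l) (at (of_real x) within stolz \<alpha> x)"
    proof (intro allI impI)
      fix \<alpha> :: real assume "\<alpha> > 0"
      obtain j :: nat where j: "\<alpha> \<le> real j" using real_arch_simple by blast
      obtain l' where l': "(f \<longlongrightarrow> l') (at (of_real x) within stolz (real j + 1) x)"
        using conv by blast
      then have "(f \<longlongrightarrow> l') (at (of_real x) within stolz 1 x)"
        by (rule tendsto_within_subset) (intro stolz_mono, simp)
      then have "l' = l"
        using l stolz_not_trivial[of 1 x] by (intro tendsto_unique) auto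
      with l' show "(f \<longlongrightarrow> l) (at (of_real x) within stolz \<alpha> x)"
        using tendsto_within_subset[OF _ stolz_mono[of \<alpha> "real j + 1" x]] j by auto
    qed
    moreover have "boundary_value f x = l"
    proof -
      have "filterlim (\<lambda>n. 1 / (real n + 1)) (at_right 0) sequentially"
        by real_asymp
      from filterlim_compose[OF filterlim_compose[OF l filterlim_vertical_stolz] this]
      show ?thesis
        unfolding boundary_value_def by (intro limI) simp
    qed
    ultimately show ?case by simp
  qed
qed

lemma hardy2_vertical_limit:
  assumes f: "hardy2 M f"
  shows "AE x in lborel. ((\<lambda>y. f (Complex x y)) \<longlongrightarrow> boundary_value f x) (at_right 0)"
  using hardy2_nontangential_limit[OF f]
proof eventually_elim
  case (elim x)
  then have "(f \<longlongrightarrow> boundary_value f x) (at (of_real x) within stolz 1 x)" by simp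
  from filterlim_compose[OF this filterlim_vertical_stolz] show ?case by simp
qed

lemma hardy2_limit_le:
  assumes f: "hardy2 M f" and [measurable]: "g \<in> borel_measurable borel"
    and "\<delta> > 0" "\<And>b. 0 < b \<Longrightarrow> b < \<delta> \<Longrightarrow> sqnorm (\<lambda>x. g x - f (Complex x b)) \<le> c"
  shows "sqnorm (\<lambda>x. g x - boundary_value f x) \<le> c"
  unfolding sqnorm_def
proof (rule nn_integral_limit_le)
  note [measurable] = hardy2_measurable[OF f]
  let ?a = "\<lambda>n. 1 / (real n + 1)"
  show "(\<lambda>x. ennreal ((cmod (g x - f (Complex x (?a n))))\<^sup>2)) \<in> borel_measurable lborel" for n
    by measurable
  have a: "filterlim ?a (at_right 0) sequentially"
    by real_asymp
  show "AE x in lborel. (\<lambda>n. ennreal ((cmod (g x - f (Complex x (?a n))))\<^sup>2)) \<longlonglongrightarrow> ennreal ((cmod (g x - boundary_value f x))\<^sup>2)"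
    using hardy2_vertical_limit[OF f]
  proof eventually_elim
    case (elim x)
    show ?case
      by (intro tendsto_intros filterlim_compose[OF elim a])
  qed
  have "\<forall>\<^sub>F n in sequentially. 0 < ?a n \<and> ?a n < \<delta>"
  proof -
    have "\<forall>\<^sub>F y in at_right 0. 0 < y \<and> y < \<delta>"
      using eventually_at_right_real[OF \<open>\<delta> > 0\<close>] by (simp add: greaterThanLessThan_def) 
    then show ?thesis
      by (rule eventually_compose_filterlim[OF _ a])
  qed
  then show "\<forall>\<^sub>F n in sequentially. (\<integral>\<^sup>+x. ennreal ((cmod (g x - f (Complex x (?a n))))\<^sup>2) \<partial>lborel) \<le> c"
    by eventually_elim (use assms(4) in \<open>auto simp: sqnorm_def\<close>)
qed

lemma hardy2_boundary_convergence:
  assumes f: "hardy2 M f" and "e > 0"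
  shows "\<exists>\<delta>>0. \<forall>\<tau>. 0 < \<tau> \<and> \<tau> < \<delta> \<longrightarrow> sqnorm (\<lambda>x. f (Complex x \<tau>) - boundary_value f x) \<le> ennreal e"
proof -
  note [measurable] = hardy2_measurable[OF f]
  obtain \<delta> where \<delta>: "\<delta> > 0"
    "\<And>a b. 0 < a \<Longrightarrow> a < \<delta> \<Longrightarrow> 0 < b \<Longrightarrow> b < \<delta> \<Longrightarrow> sqnorm (\<lambda>x. f (Complex x a) - f (Complex x b)) \<le> ennreal e"
    using hardy2_vertical_continuity[OF assms] by blast
  have "sqnorm (\<lambda>x. f (Complex x \<tau>) - boundary_value f x) \<le> ennreal e" if "0 < \<tau>" "\<tau> < \<delta>" for \<tau>
    using that \<delta> by (intro hardy2_limit_le[OF f, of _ \<delta>]) auto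
  with \<delta>(1) show ?thesis by blast
qed

lemma hardy2_boundary_sqnorm:
  assumes f: "hardy2 M f"
  shows "sqnorm (boundary_value f) \<le> ennreal M"
proof -
  have "sqnorm (\<lambda>x. 0 - boundary_value f x) \<le> ennreal M"
    by (rule hardy2_limit_le[OF f, of _ 1]) (use hardy2_sqnorm[OF f] in auto)
  then show ?thesis by simp
qed

section \<open>Restriction to perpendicular lines\<close>

text \<open>
  An inequality of Fejer-Riesz type. For \<open>x0 = 0\<close> the function \<open>h(z) = f(z) cnj (f (- cnj z))\<close> is
  holomorphic and equals \<open>|f|\<^sup>2\<close> on the imaginary axis. Cauchy's theorem on a rectangle with one side on
  that axis compares the integral there with the two horizontal sides, where \<open>|h|\<close> has integral at most
  \<open>2 M\<close>, and a vertical side that may be moved far out.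
\<close>

theorem hardy2_transversal:
  assumes f: "hardy2 M f" and "M \<ge> 0"
  shows "(\<integral>\<^sup>+y. indicator {0<..} y * ennreal ((cmod (f (Complex x0 y)))\<^sup>2) \<partial>lborel) \<le> ennreal (4 * M)"
proof -
  note [measurable] = hardy2_measurable[OF f]
  define f1 where "f1 z = f (z + of_real x0)" for z
  have f1: "hardy2 M f1"
    unfolding f1_def by (rule hardy2_translate[OF f]) simp
  note [measurable] = hardy2_measurable[OF f1]
  define h where "h z = f1 z * cnj (f1 (- cnj z))" for z
  have neg: "(\<lambda>w. f1 (- w)) holomorphic_on {z. Im z < 0}"
    by (rule holomorphic_on_compose_gen[of uminus _ f1 upper_half_plane, unfolded o_def])
      (use hardy2_holomorphic[OF f1] in \<open>auto intro!: holomorphic_intros\<close>)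
  have h: "h holomorphic_on upper_half_plane"
    unfolding h_def
    by (intro holomorphic_intros hardy2_holomorphic[OF f1] holomorphic_on_cnj_cnj[OF neg])
      (auto simp: open_halfspace_Im_gt)
  have [measurable]: "h \<in> borel_measurable borel"
    unfolding h_def by measurable
  have heq: "h (Complex x y) = f1 (Complex x y) * cnj (f1 (Complex (- x) y))" for x y
  proof -
    have "- cnj (Complex x y) = Complex (- x) y"
      by (simp add: complex_eq_iff)
    then show ?thesis by (simp add: h_def)
  qed
  have hb: "(\<integral>\<^sup>+x. cmod (h (Complex x y)) \<partial>lborel) \<le> ennreal (2 * M)" if "y > 0" for y
  proof -
    have "(\<integral>\<^sup>+x. cmod (h (Complex x y)) \<partial>lborel) \<le>
        (\<integral>\<^sup>+x. ennreal ((cmod (f1 (Complex x y)))\<^sup>2) + ennreal ((cmod (f1 (Complex (- x) y)))\<^sup>2) \<partial>lborel)"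
    proof (intro nn_integral_mono)
      fix x
      have "cmod (h (Complex x y)) \<le> (cmod (f1 (Complex x y)))\<^sup>2 + (cmod (f1 (Complex (- x) y)))\<^sup>2"
        unfolding heq norm_mult complex_mod_cnj by (intro mult_le_sum_squares) auto
      then show "ennreal (cmod (h (Complex x y))) \<le> ennreal ((cmod (f1 (Complex x y)))\<^sup>2) + ennreal ((cmod (f1 (Complex (- x) y)))\<^sup>2)"
        by (simp flip: ennreal_plus)
    qed
    also have "\<dots> = sqnorm (\<lambda>x. f1 (Complex x y)) + sqnorm (\<lambda>x. f1 (Complex x y))"
      unfolding sqnorm_def using nn_integral_reflect[of "\<lambda>x. ennreal ((cmod (f1 (Complex x y)))\<^sup>2)"]
      by (subst nn_integral_add) auto
    also have "\<dots> \<le> ennreal M + ennreal M"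
      by (intro add_mono hardy2_sqnorm[OF f1 that])
    finally show ?thesis
      using \<open>M \<ge> 0\<close> by (simp flip: ennreal_plus)
  qed
  have main: "(\<integral>\<^sup>+y. indicator {a..b} y * ennreal ((cmod (f (Complex x0 y)))\<^sup>2) \<partial>lborel) \<le> ennreal (4 * M)"
    if "0 < a" "a < b" for a b
  proof (rule ennreal_le_epsilon)
    fix e :: real assume "e > 0"
    define V where "V x = (\<integral>\<^sup>+y. indicator {a..b} y * ennreal (cmod (h (Complex x y))) \<partial>lborel)" for x
    have [measurable]: "V \<in> borel_measurable borel"
      unfolding V_def by measurable
    have "(\<integral>\<^sup>+x. V x \<partial>lborel) =
        (\<integral>\<^sup>+y. \<integral>\<^sup>+x. indicator {a..b} y * ennreal (cmod (h (Complex x y))) \<partial>lborel \<partial>lborel)"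
      unfolding V_def by (rule lborel_pair.Fubini'[symmetric]) measurable
    also have "\<dots> = (\<integral>\<^sup>+y. indicator {a..b} y * (\<integral>\<^sup>+x. cmod (h (Complex x y)) \<partial>lborel) \<partial>lborel)"
      by (intro nn_integral_cong nn_integral_cmult) measurable
    also have "\<dots> \<le> (\<integral>\<^sup>+y. ennreal (2 * M) * indicator {a..b} y \<partial>lborel)"
      using hb \<open>0 < a\<close> by (intro nn_integral_mono) (auto simp: indicator_def)
    also have "\<dots> < top"
      by (subst nn_integral_cmult_indicator) (auto simp: ennreal_mult_less_top emeasure_lborel_Icc_eq)
    finally obtain X where X: "X > 0" "V X < ennreal e"
      using exists_small_value[of V "ennreal e" 0] \<open>e > 0\<close> by auto
    have "rect_integral h 0 X a b = 0"
      using that by (intro rect_integral_zero[OF \<open>X > 0\<close> \<open>a < b\<close> convex_upper_half_plane h])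
        (auto simp: in_cbox_complex_iff)
    then have "\<i> * integral {a..b} (\<lambda>y. h (Complex 0 y)) = integral {0..X} (\<lambda>x. h (Complex x a))
        + \<i> * integral {a..b} (\<lambda>y. h (Complex X y)) - integral {0..X} (\<lambda>x. h (Complex x b))"
      by (simp add: rect_integral_def algebra_simps)
    then have "cmod (integral {a..b} (\<lambda>y. h (Complex 0 y))) = cmod (integral {0..X} (\<lambda>x. h (Complex x a))
        + \<i> * integral {a..b} (\<lambda>y. h (Complex X y)) - integral {0..X} (\<lambda>x. h (Complex x b)))"
      by (metis norm_ii norm_mult mult_1)
    also have "\<dots> \<le> cmod (integral {0..X} (\<lambda>x. h (Complex x a)))
        + cmod (\<i> * integral {a..b} (\<lambda>y. h (Complex X y))) + cmod (integral {0..X} (\<lambda>x. h (Complex x b)))"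
      by (rule order.trans[OF norm_triangle_ineq4 add_right_mono[OF norm_triangle_ineq]])
    finally have le: "cmod (integral {a..b} (\<lambda>y. h (Complex 0 y))) \<le> cmod (integral {0..X} (\<lambda>x. h (Complex x a)))
        + cmod (integral {a..b} (\<lambda>y. h (Complex X y))) + cmod (integral {0..X} (\<lambda>x. h (Complex x b)))"
      by (simp add: norm_mult)
    have hor: "ennreal (cmod (integral {0..X} (\<lambda>x. h (Complex x y)))) \<le> ennreal (2 * M)" if "y > 0" for y
    proof -
      have "ennreal (cmod (integral {0..X} (\<lambda>x. h (Complex x y)))) \<le> (\<integral>\<^sup>+x. indicator {0..X} x * ennreal (cmod (h (Complex x y))) \<partial>lborel)"
        using that by (intro norm_integral_le_nn_integral continuous_on_horizontal[OF h]) auto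
      also have "\<dots> \<le> (\<integral>\<^sup>+x. cmod (h (Complex x y)) \<partial>lborel)"
        by (intro nn_integral_mono) (auto simp: indicator_def)
      finally show ?thesis using hb[OF that] by (rule order.trans)
    qed
    have ver: "ennreal (cmod (integral {a..b} (\<lambda>y. h (Complex X y)))) \<le> ennreal e"
      using norm_integral_le_nn_integral[of a b "\<lambda>y. h (Complex X y)" "\<lambda>y. ennreal (cmod (h (Complex X y)))"] X(2) that
        continuous_on_vertical[OF h, of "{a..b}" X]
      by (auto simp: V_def)
    have le2: "cmod (integral {a..b} (\<lambda>y. h (Complex 0 y))) \<le> 4 * M + e"
      using le hor[of a] hor[of b] ver that \<open>M \<ge> 0\<close> \<open>e > 0\<close> by simp
    have h0: "h (Complex 0 y) = of_real ((cmod (f (Complex x0 y)))\<^sup>2)" for y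
      unfolding complex_norm_square by (simp add: heq f1_def Complex_plus)
    have cont: "continuous_on {a..b} (\<lambda>y. h (Complex 0 y))"
      using that by (intro continuous_on_vertical[OF h]) auto
    note I = continuous_integral_lborel[OF cont]
    have I1: "integrable lborel (\<lambda>y. complex_of_real (indicator {a..b} y * (cmod (f (Complex x0 y)))\<^sup>2))"
      using I(1) by (simp add: h0 scaleR_conv_of_real)
    then have I2: "integrable lborel (\<lambda>y. indicator {a..b} y * (cmod (f (Complex x0 y)))\<^sup>2)"
      using integrable_Re by fastforce
    have "integral {a..b} (\<lambda>y. h (Complex 0 y)) = of_real (LINT y|lborel. indicator {a..b} y * (cmod (f (Complex x0 y)))\<^sup>2)"
      unfolding I(2) integral_complex_of_real[symmetric] by (simp add: h0 scaleR_conv_of_real)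
    then have "(LINT y|lborel. indicator {a..b} y * (cmod (f (Complex x0 y)))\<^sup>2) \<le> 4 * M + e"
      using le2 by (simp add: abs_le_iff)
    moreover have "(\<integral>\<^sup>+y. ennreal (indicator {a..b} y * (cmod (f (Complex x0 y)))\<^sup>2) \<partial>lborel)
       = ennreal (LINT y|lborel. indicator {a..b} y * (cmod (f (Complex x0 y)))\<^sup>2)"
      by (rule nn_integral_eq_integral[OF I2]) simp
    moreover have "(\<integral>\<^sup>+y. indicator {a..b} y * ennreal ((cmod (f (Complex x0 y)))\<^sup>2) \<partial>lborel) =
        (\<integral>\<^sup>+y. ennreal (indicator {a..b} y * (cmod (f (Complex x0 y)))\<^sup>2) \<partial>lborel)"
      by (intro nn_integral_cong) (auto simp: indicator_def)
    ultimately show "(\<integral>\<^sup>+y. indicator {a..b} y * ennreal ((cmod (f (Complex x0 y)))\<^sup>2) \<partial>lborel) \<le> ennreal (4 * M) + ennreal e"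
      using \<open>M \<ge> 0\<close> \<open>e > 0\<close> by (simp flip: ennreal_plus add: ennreal_leI)
  qed
  show ?thesis
  proof (rule nn_integral_limit_le)
    let ?I = "\<lambda>n. {1 / (real n + 2)..real n + 2}"
    show "(\<lambda>y. indicator (?I n) y * ennreal ((cmod (f (Complex x0 y)))\<^sup>2)) \<in> borel_measurable lborel" for n
      by measurable
    show "\<forall>\<^sub>F n in sequentially. (\<integral>\<^sup>+y. indicator (?I n) y * ennreal ((cmod (f (Complex x0 y)))\<^sup>2) \<partial>lborel) \<le> ennreal (4 * M)"
    proof (intro always_eventually allI main)
      fix n :: nat
      have "1 / (real n + 2) \<le> 1" by simp
      then show "1 / (real n + 2) < real n + 2" by linarith
    qed simp
    show "AE y in lborel. (\<lambda>n. indicator (?I n) y * ennreal ((cmod (f (Complex x0 y)))\<^sup>2)) \<longlonglongrightarrow> indicator {0<..} y * ennreal ((cmod (f (Complex x0 y)))\<^sup>2)"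
    proof (rule AE_I2, rule tendsto_eventually)
      fix y :: real
      show "\<forall>\<^sub>F n in sequentially. indicator (?I n) y * ennreal ((cmod (f (Complex x0 y)))\<^sup>2) = indicator {0<..} y * ennreal ((cmod (f (Complex x0 y)))\<^sup>2)"
      proof (cases "y > 0")
        case True
        have "\<forall>\<^sub>F n in sequentially. 1 / (real n + 2) < y"
          by (rule order_tendstoD[OF _ True]) real_asymp
        moreover have "\<forall>\<^sub>F n in sequentially. y \<le> real n"
          using eventually_ge_at_top[of "nat \<lceil>y\<rceil>"] by eventually_elim linarith
        ultimately show ?thesis
          by eventually_elim (use True in \<open>auto simp: indicator_def\<close>)
      next
        case False
        have "y \<notin> ?I n" for n
        proof -
          have "0 < 1 / (real n + 2)" by simp
          then show ?thesis using False unfolding atLeastAtMost_iff by linarith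
        qed
        then show ?thesis
          using False by (intro always_eventually allI) simp
      qed
    qed
  qed
qed

section \<open>Cauchy transforms of segments\<close>

text \<open>
  Without the factor \<open>1 / (2 \<pi> \<i>)\<close>, and extended by 0 to a function on the plane.
\<close>

definition cauchy_transform :: "real \<Rightarrow> real \<Rightarrow> (real \<Rightarrow> complex) \<Rightarrow> complex \<Rightarrow> complex" where
  "cauchy_transform a b \<phi> z =
     (if Im z > 0 then integral {a..b} (\<lambda>t. \<phi> t / (of_real t - z)) else 0)"

lemma cauchy_transform_holomorphic:
  assumes "continuous_on {a..b} \<phi>"
  shows "cauchy_transform a b \<phi> holomorphic_on upper_half_plane"
proof -
  have nz: "complex_of_real t - z \<noteq> 0" if "Im z > 0" for t z
    using that by (auto simp: complex_eq_iff)
  have "(\<lambda>z. integral (cbox a b) (\<lambda>t. \<phi> t / (of_real t - z))) holomorphic_on upper_half_plane"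
  proof (rule leibniz_rule_holomorphic[where fx = "\<lambda>z t. \<phi> t / (of_real t - z)\<^sup>2"])
    fix z t assume "z \<in> upper_half_plane" "t \<in> cbox a b"
    then have "of_real t - z \<noteq> 0" by (auto simp: complex_eq_iff)
    then show "((\<lambda>z. \<phi> t / (of_real t - z)) has_field_derivative \<phi> t / (of_real t - z)\<^sup>2) (at z within upper_half_plane)"
      by (auto intro!: derivative_eq_intros simp: power2_eq_square)
  next
    fix z assume z: "z \<in> upper_half_plane"
    have "continuous_on {a..b} (\<lambda>t. \<phi> t / (of_real t - z))"
      using z by (intro continuous_intros assms) (auto simp: complex_eq_iff)
    then show "(\<lambda>t. \<phi> t / (of_real t - z)) integrable_on cbox a b"
      by (simp add: integrable_continuous_real)
  next
    show "continuous_on (upper_half_plane \<times> cbox a b) (\<lambda>(z, t). \<phi> t / (of_real t - z)\<^sup>2)"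
      unfolding case_prod_unfold
      by (intro continuous_intros continuous_on_compose2[OF assms]) (auto simp: nz)
  qed (rule convex_upper_half_plane)
  then show ?thesis
    by (rule holomorphic_transform) (simp add: cauchy_transform_def)
qed

lemma holomorphic_extension_measurable:
  assumes "f holomorphic_on upper_half_plane" "\<And>z. Im z \<le> 0 \<Longrightarrow> f z = 0"
  shows "f \<in> borel_measurable borel"
proof -
  have "(\<lambda>z. indicator upper_half_plane z *\<^sub>R f z) \<in> borel_measurable borel"
    by (intro borel_measurable_continuous_on_indicator holomorphic_on_imp_continuous_on assms(1))
      (use open_upper_half_plane in auto)
  moreover have "(\<lambda>z. indicator upper_half_plane z *\<^sub>R f z) = f"
    using assms(2) by (auto simp: indicator_def)
  ultimately show ?thesis by simp
qed

lemma cauchy_transform_measurable: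
  "continuous_on {a..b} \<phi> \<Longrightarrow> cauchy_transform a b \<phi> \<in> borel_measurable borel"
  by (rule holomorphic_extension_measurable[OF cauchy_transform_holomorphic]) (auto simp: cauchy_transform_def)

definition cutoff :: "real \<Rightarrow> real \<Rightarrow> (real \<Rightarrow> complex) \<Rightarrow> real \<Rightarrow> complex" where
  "cutoff a b \<phi> t = indicator {a..b} t *\<^sub>R \<phi> t"

lemma cutoff_measurable: "continuous_on {a..b} \<phi> \<Longrightarrow> cutoff a b \<phi> \<in> borel_measurable borel"
  unfolding cutoff_def by (intro borel_measurable_continuous_on_indicator) auto

lemma cauchy_transform_lborel:
  assumes "continuous_on {a..b} \<phi>" "y > 0"
  shows "cauchy_transform a b \<phi> (Complex x y) = (LINT t|lborel. cutoff a b \<phi> t / (of_real t - Complex x y))"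
    and "integrable lborel (\<lambda>t. cutoff a b \<phi> t / (of_real t - Complex x y))"
proof -
  have c: "continuous_on {a..b} (\<lambda>t. \<phi> t / (of_real t - Complex x y))"
    using assms by (intro continuous_intros) (auto simp: complex_eq_iff)
  have e: "cutoff a b \<phi> t / w = indicator {a..b} t *\<^sub>R (\<phi> t / w)" for t w
    by (simp add: cutoff_def scaleR_conv_of_real)
  show "cauchy_transform a b \<phi> (Complex x y) = (LINT t|lborel. cutoff a b \<phi> t / (of_real t - Complex x y))"
    "integrable lborel (\<lambda>t. cutoff a b \<phi> t / (of_real t - Complex x y))"
    using continuous_integral_lborel[OF c] assms(2) unfolding e by (auto simp: cauchy_transform_def)
qed

lemma cmod_of_real_minus_Complex: "(cmod (of_real t - Complex x y))\<^sup>2 = (x - t)\<^sup>2 + y\<^sup>2"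
  by (simp add: cmod_power2 power2_commute)

lemma cauchy_transform_nn_bound:
  assumes "continuous_on {a..b} \<phi>" "y > 0"
  shows "ennreal (cmod (cauchy_transform a b \<phi> (Complex x y))) \<le>
    (\<integral>\<^sup>+t. ennreal (cmod (cutoff a b \<phi> t)) * ennreal (1 / cmod (of_real t - Complex x y)) \<partial>lborel)"
proof -
  have "ennreal (cmod (cauchy_transform a b \<phi> (Complex x y))) \<le>
    (\<integral>\<^sup>+t. ennreal (norm (cutoff a b \<phi> t / (of_real t - Complex x y))) \<partial>lborel)"
    unfolding cauchy_transform_lborel(1)[OF assms]
    by (rule integral_norm_bound_ennreal[OF cauchy_transform_lborel(2)[OF assms]])
  also have "\<dots> = (\<integral>\<^sup>+t. ennreal (cmod (cutoff a b \<phi> t)) * ennreal (1 / cmod (of_real t - Complex x y)) \<partial>lborel)"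
    by (intro nn_integral_cong) (simp flip: ennreal_mult add: norm_divide)
  finally show ?thesis .
qed

lemma cauchy_transform_pointwise:
  assumes "continuous_on {a..b} \<phi>" "sqnorm (cutoff a b \<phi>) \<le> ennreal M" "M \<ge> 0" "Im z > 0"
  shows "(cmod (cauchy_transform a b \<phi> z))\<^sup>2 \<le> M * pi / Im z"
proof -
  note [measurable] = cutoff_measurable[OF assms(1)]
  obtain x y where z: "z = Complex x y" "y > 0" using assms(4) by (cases z) auto
  have "ennreal ((cmod (cauchy_transform a b \<phi> z))\<^sup>2) = (ennreal (cmod (cauchy_transform a b \<phi> (Complex x y))))\<^sup>2"
    by (simp add: z ennreal_power)
  also have "\<dots> \<le> (\<integral>\<^sup>+t. ennreal (cmod (cutoff a b \<phi> t)) * ennreal (1 / cmod (of_real t - Complex x y)) \<partial>lborel)\<^sup>2"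
    by (intro power_mono cauchy_transform_nn_bound assms(1) z) auto
  also have "\<dots> \<le> (\<integral>\<^sup>+t. (ennreal (cmod (cutoff a b \<phi> t)))\<^sup>2 \<partial>lborel) * (\<integral>\<^sup>+t. (ennreal (1 / cmod (of_real t - Complex x y)))\<^sup>2 \<partial>lborel)"
    by (rule Cauchy_Schwarz_nn_integral) auto
  also have "\<dots> = sqnorm (cutoff a b \<phi>) * (\<integral>\<^sup>+t. ennreal (1 / ((x - t)\<^sup>2 + y\<^sup>2)) \<partial>lborel)"
    unfolding sqnorm_def by (simp add: ennreal_power power_divide cmod_of_real_minus_Complex)
  also have "\<dots> \<le> ennreal M * ennreal (pi / y)"
    unfolding nn_integral_inverse_quadratic[OF z(2)] by (intro mult_right_mono assms) auto
  also have "\<dots> = ennreal (M * pi / Im z)"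
    using assms z by (simp flip: ennreal_mult)
  finally show ?thesis
    using assms by (subst (asm) ennreal_le_iff) auto
qed

text \<open>
  The Cauchy-Schwarz inequality on the segment. The bound depends on the length of the segment, but it
  decays with the height, which is what the contour shift to infinity in the next lemma needs.
\<close>

lemma cauchy_transform_sqnorm_decay:
  assumes "continuous_on {a..b} \<phi>" "a \<le> b" "sqnorm (cutoff a b \<phi>) \<le> ennreal M" "M \<ge> 0" "y > 0"
  shows "sqnorm (\<lambda>x. cauchy_transform a b \<phi> (Complex x y)) \<le> ennreal ((b - a) * M * pi / y)"
proof -
  note [measurable] = cutoff_measurable[OF assms(1)] cauchy_transform_measurable[OF assms(1)]
  have pt: "ennreal ((cmod (cauchy_transform a b \<phi> (Complex x y)))\<^sup>2) \<le>
      ennreal (b - a) * (\<integral>\<^sup>+t. ennreal ((cmod (cutoff a b \<phi> t))\<^sup>2) * ennreal (1 / ((x - t)\<^sup>2 + y\<^sup>2)) \<partial>lborel)" for x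
  proof -
    have "ennreal ((cmod (cauchy_transform a b \<phi> (Complex x y)))\<^sup>2) = (ennreal (cmod (cauchy_transform a b \<phi> (Complex x y))))\<^sup>2"
      by (simp add: ennreal_power)
    also have "\<dots> \<le> (\<integral>\<^sup>+t. ennreal (cmod (cutoff a b \<phi> t)) * ennreal (1 / cmod (of_real t - Complex x y)) \<partial>lborel)\<^sup>2"
      by (intro power_mono cauchy_transform_nn_bound assms) auto
    also have "\<dots> = (\<integral>\<^sup>+t. indicator {a..b} t * (ennreal (cmod (cutoff a b \<phi> t)) * ennreal (1 / cmod (of_real t - Complex x y))) \<partial>lborel)\<^sup>2"
      by (intro arg_cong[of _ _ "\<lambda>x. x\<^sup>2"] nn_integral_cong) (auto simp: cutoff_def indicator_def)
    also have "\<dots> \<le> (\<integral>\<^sup>+t. (indicator {a..b} t)\<^sup>2 \<partial>lborel) * (\<integral>\<^sup>+t. (ennreal (cmod (cutoff a b \<phi> t)) * ennreal (1 / cmod (of_real t - Complex x y)))\<^sup>2 \<partial>lborel)"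
      by (rule Cauchy_Schwarz_nn_integral) auto
    also have "(\<integral>\<^sup>+t. (indicator {a..b} t)\<^sup>2 \<partial>lborel) = (\<integral>\<^sup>+t. indicator {a..b} t \<partial>lborel)"
      by (intro nn_integral_cong) (auto simp: indicator_def)
    also have "\<dots> = ennreal (b - a)"
      using assms by simp
    also have "(\<integral>\<^sup>+t. (ennreal (cmod (cutoff a b \<phi> t)) * ennreal (1 / cmod (of_real t - Complex x y)))\<^sup>2 \<partial>lborel)
       = (\<integral>\<^sup>+t. ennreal ((cmod (cutoff a b \<phi> t))\<^sup>2) * ennreal (1 / ((x - t)\<^sup>2 + y\<^sup>2)) \<partial>lborel)"
      by (simp add: power_mult_distrib ennreal_power power_divide cmod_of_real_minus_Complex)
    finally show ?thesis .
  qed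
  have "sqnorm (\<lambda>x. cauchy_transform a b \<phi> (Complex x y)) \<le>
      (\<integral>\<^sup>+x. ennreal (b - a) * (\<integral>\<^sup>+t. ennreal ((cmod (cutoff a b \<phi> t))\<^sup>2) * ennreal (1 / ((x - t)\<^sup>2 + y\<^sup>2)) \<partial>lborel) \<partial>lborel)"
    unfolding sqnorm_def by (intro nn_integral_mono pt)
  also have "\<dots> = ennreal (b - a) * (\<integral>\<^sup>+x. (\<integral>\<^sup>+t. ennreal ((cmod (cutoff a b \<phi> t))\<^sup>2) * ennreal (1 / ((x - t)\<^sup>2 + y\<^sup>2)) \<partial>lborel) \<partial>lborel)"
    by (rule nn_integral_cmult) measurable
  also have "(\<integral>\<^sup>+x. (\<integral>\<^sup>+t. ennreal ((cmod (cutoff a b \<phi> t))\<^sup>2) * ennreal (1 / ((x - t)\<^sup>2 + y\<^sup>2)) \<partial>lborel) \<partial>lborel)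
     = (\<integral>\<^sup>+t. (\<integral>\<^sup>+x. ennreal ((cmod (cutoff a b \<phi> t))\<^sup>2) * ennreal (1 / ((x - t)\<^sup>2 + y\<^sup>2)) \<partial>lborel) \<partial>lborel)"
    by (rule lborel_pair.Fubini') measurable
  also have "\<dots> = (\<integral>\<^sup>+t. ennreal ((cmod (cutoff a b \<phi> t))\<^sup>2) * ennreal (pi / y) \<partial>lborel)"
  proof (intro nn_integral_cong)
    fix t
    have "(\<integral>\<^sup>+x. ennreal ((cmod (cutoff a b \<phi> t))\<^sup>2) * ennreal (1 / ((x - t)\<^sup>2 + y\<^sup>2)) \<partial>lborel) =
        ennreal ((cmod (cutoff a b \<phi> t))\<^sup>2) * (\<integral>\<^sup>+x. ennreal (1 / ((t - x)\<^sup>2 + y\<^sup>2)) \<partial>lborel)"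
      by (subst nn_integral_cmult) (auto simp: power2_commute[of t])
    then show "(\<integral>\<^sup>+x. ennreal ((cmod (cutoff a b \<phi> t))\<^sup>2) * ennreal (1 / ((x - t)\<^sup>2 + y\<^sup>2)) \<partial>lborel) = ennreal ((cmod (cutoff a b \<phi> t))\<^sup>2) * ennreal (pi / y)"
      using nn_integral_inverse_quadratic[OF assms(5)] by simp
  qed
  also have "\<dots> = sqnorm (cutoff a b \<phi>) * ennreal (pi / y)"
    unfolding sqnorm_def by (rule nn_integral_multc) measurable
  also have "ennreal (b - a) * (sqnorm (cutoff a b \<phi>) * ennreal (pi / y)) \<le> ennreal (b - a) * (ennreal M * ennreal (pi / y))"
    by (intro mult_left_mono mult_right_mono assms) auto
  also have "\<dots> = ennreal ((b - a) * M * pi / y)"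
    using assms by (simp flip: ennreal_mult add: mult.assoc)
  finally show ?thesis .
qed

text \<open>
  The integral of the square over a horizontal line does not depend on the height and tends to 0 at
  large heights.
\<close>

lemma cauchy_transform_square_integral:
  assumes \<phi>: "continuous_on {a..b} \<phi>" and ab: "a \<le> b" and M: "sqnorm (cutoff a b \<phi>) \<le> ennreal M" "M \<ge> 0" and "y > 0"
  shows "(LINT x|lborel. (cauchy_transform a b \<phi> (Complex x y))\<^sup>2) = 0"
    and "integrable lborel (\<lambda>x. (cmod (cauchy_transform a b \<phi> (Complex x y)))\<^sup>2)"
    and "integrable lborel (\<lambda>x. (cauchy_transform a b \<phi> (Complex x y))\<^sup>2)"
proof -
  let ?f = "cauchy_transform a b \<phi>"
  define c where "c = (b - a) * M * pi"
  have c: "c \<ge> 0" using ab M by (simp add: c_def)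
  note [measurable] = cauchy_transform_measurable[OF \<phi>]
  have sq: "sqnorm (\<lambda>x. ?f (Complex x y)) \<le> ennreal (c / y)" if "y > 0" for y
    unfolding c_def by (rule cauchy_transform_sqnorm_decay[OF \<phi> ab M that])
  have int: "integrable lborel (\<lambda>x. (cmod (?f (Complex x y)))\<^sup>2)" if "y > 0" for y
    by (intro sqnorm_integrable le_less_trans[OF sq[OF that]]) auto
  have int2: "integrable lborel (\<lambda>x. (?f (Complex x y))\<^sup>2)" if "y > 0" for y
    unfolding power2_eq_square using int[OF that] by (intro integrable_mult_square) auto
  have bound: "cmod (LINT x|lborel. (?f (Complex x y))\<^sup>2) \<le> c / Y" if "Y > y" for Y
  proof -
    have "(LINT x|lborel. (?f (Complex x y))\<^sup>2) = (LINT x|lborel. (?f (Complex x Y))\<^sup>2)"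
    proof (rule horizontal_integral_shift[where S = upper_half_plane and h = "\<lambda>z. (?f z)\<^sup>2"])
      show "(\<lambda>z. (?f z)\<^sup>2) holomorphic_on upper_half_plane"
        by (intro holomorphic_intros cauchy_transform_holomorphic \<phi>)
      have "(\<integral>\<^sup>+\<eta>. indicator {y..Y} \<eta> * (\<integral>\<^sup>+x. cmod ((?f (Complex x \<eta>))\<^sup>2) \<partial>lborel) \<partial>lborel) \<le>
          (\<integral>\<^sup>+\<eta>. ennreal (c / y) * indicator {y..Y} \<eta> \<partial>lborel)"
      proof (intro nn_integral_mono)
        fix \<eta>
        have "sqnorm (\<lambda>x. ?f (Complex x \<eta>)) \<le> ennreal (c / y)" if "y \<le> \<eta>"
          using \<open>y > 0\<close> that c by (intro order.trans[OF sq] ennreal_leI divide_left_mono) auto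
        then show "indicator {y..Y} \<eta> * (\<integral>\<^sup>+x. cmod ((?f (Complex x \<eta>))\<^sup>2) \<partial>lborel) \<le> ennreal (c / y) * indicator {y..Y} \<eta>"
          by (auto simp: indicator_def sqnorm_def norm_power)
      qed
      also have "\<dots> < top"
        by (subst nn_integral_cmult_indicator) (auto simp: ennreal_mult_less_top emeasure_lborel_Icc_eq)
      finally show "(\<integral>\<^sup>+\<eta>. indicator {y..Y} \<eta> * (\<integral>\<^sup>+x. cmod ((?f (Complex x \<eta>))\<^sup>2) \<partial>lborel) \<partial>lborel) < top" .
    qed (use \<open>y > 0\<close> that int2 in \<open>auto simp: convex_upper_half_plane\<close>)
    then have "ennreal (cmod (LINT x|lborel. (?f (Complex x y))\<^sup>2)) = ennreal (cmod (LINT x|lborel. (?f (Complex x Y))\<^sup>2))"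
      by simp
    also have "\<dots> \<le> (\<integral>\<^sup>+x. norm ((?f (Complex x Y))\<^sup>2) \<partial>lborel)"
      using \<open>y > 0\<close> that by (intro integral_norm_bound_ennreal int2) auto
    also have "\<dots> \<le> ennreal (c / Y)"
      using sq[of Y] \<open>y > 0\<close> that by (simp add: sqnorm_def norm_power)
    finally show ?thesis
      using c \<open>y > 0\<close> that by (subst (asm) ennreal_le_iff) auto
  qed
  have "((\<lambda>Y. c / Y) \<longlongrightarrow> 0) at_top"
    by real_asymp
  then have "cmod (LINT x|lborel. (?f (Complex x y))\<^sup>2) \<le> 0"
    by (rule tendsto_lowerbound) (use bound in \<open>auto intro!: eventually_mono[OF eventually_gt_at_top[of y]]\<close>)
  then show "(LINT x|lborel. (?f (Complex x y))\<^sup>2) = 0" by simp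
  show "integrable lborel (\<lambda>x. (cmod (?f (Complex x y)))\<^sup>2)" "integrable lborel (\<lambda>x. (?f (Complex x y))\<^sup>2)"
    using int int2 \<open>y > 0\<close> by auto
qed

text \<open>
  The imaginary part of \<open>1 / (t - z)\<close> is \<open>\<pi>\<close> times the Poisson kernel.
\<close>

lemma cauchy_transform_Im:
  assumes \<phi>: "continuous_on {a..b} \<phi>" and real: "\<And>t. t \<in> {a..b} \<Longrightarrow> Im (\<phi> t) = 0" and "y > 0"
  shows "Im (cauchy_transform a b \<phi> (Complex x y)) = (LINT t|lborel. pi * (poisson y (x - t) * Re (cutoff a b \<phi> t)))"
    and "integrable lborel (\<lambda>t. pi * (poisson y (x - t) * Re (cutoff a b \<phi> t)))"
proof -
  have eq: "Im (cutoff a b \<phi> t / (of_real t - Complex x y)) = pi * (poisson y (x - t) * Re (cutoff a b \<phi> t))" for t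
  proof -
    have 0: "Im (cutoff a b \<phi> t) = 0" using real by (auto simp: cutoff_def indicator_def)
    have "(t - x)\<^sup>2 + y\<^sup>2 > 0" using \<open>y > 0\<close> by (auto intro: add_nonneg_pos)
    then show ?thesis
      by (simp add: Im_divide 0 poisson_def power2_commute[of x])
  qed
  note C = cauchy_transform_lborel[OF \<phi> \<open>y > 0\<close>, of x]
  show "Im (cauchy_transform a b \<phi> (Complex x y)) = (LINT t|lborel. pi * (poisson y (x - t) * Re (cutoff a b \<phi> t)))"
    unfolding C(1) integral_Im[OF C(2), symmetric] eq ..
  show "integrable lborel (\<lambda>t. pi * (poisson y (x - t) * Re (cutoff a b \<phi> t)))"
    using integrable_Im[OF C(2)] unfolding eq .
qed

text \<open>
  The square of the transform has integral 0, so its real and imaginary parts have the same norm, and for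
  real data the imaginary part is \<open>\<pi>\<close> times a Poisson average. Unlike the previous bound, this one does not
  involve the length of the segment.
\<close>

lemma cauchy_transform_real_sqnorm:
  assumes \<phi>: "continuous_on {a..b} \<phi>" and real: "\<And>t. t \<in> {a..b} \<Longrightarrow> Im (\<phi> t) = 0"
    and ab: "a \<le> b" and M: "sqnorm (cutoff a b \<phi>) \<le> ennreal M" "M \<ge> 0" and y: "y > 0"
  shows "sqnorm (\<lambda>x. cauchy_transform a b \<phi> (Complex x y)) \<le> ennreal (2 * pi\<^sup>2 * M)"
proof -
  let ?f = "cauchy_transform a b \<phi>"
  note [measurable] = cutoff_measurable[OF \<phi>] cauchy_transform_measurable[OF \<phi>]
  note I = cauchy_transform_square_integral[OF \<phi> ab M y]
  have pt: "ennreal ((Im (?f (Complex x y)))\<^sup>2) \<le> ennreal (pi\<^sup>2) * (\<integral>\<^sup>+t. ennreal (poisson y (x - t) * (cmod (cutoff a b \<phi> t))\<^sup>2) \<partial>lborel)" for x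
  proof -
    have "ennreal \<bar>Im (?f (Complex x y))\<bar> \<le> (\<integral>\<^sup>+t. ennreal (norm (pi * (poisson y (x - t) * Re (cutoff a b \<phi> t)))) \<partial>lborel)"
    proof -
      have "Im (?f (Complex x y)) = (LINT t|lborel. pi * (poisson y (x - t) * Re (cutoff a b \<phi> t)))"
        and i: "integrable lborel (\<lambda>t. pi * (poisson y (x - t) * Re (cutoff a b \<phi> t)))"
        using cauchy_transform_Im[OF \<phi> _ y, of x] real by auto
      then show ?thesis
        using integral_norm_bound_ennreal[OF i] by (simp only: real_norm_def)
    qed
    also have "\<dots> \<le> (\<integral>\<^sup>+t. ennreal pi * ennreal (poisson y (x - t) * cmod (cutoff a b \<phi> t)) \<partial>lborel)"
    proof (intro nn_integral_mono)
      fix t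
      have "norm (pi * (poisson y (x - t) * Re (cutoff a b \<phi> t))) \<le> pi * (poisson y (x - t) * cmod (cutoff a b \<phi> t))"
        using y by (auto simp: abs_mult poisson_nonneg abs_Re_le_cmod intro!: mult_left_mono)
      then show "ennreal (norm (pi * (poisson y (x - t) * Re (cutoff a b \<phi> t)))) \<le> ennreal pi * ennreal (poisson y (x - t) * cmod (cutoff a b \<phi> t))"
        using y by (simp flip: ennreal_mult add: poisson_nonneg)
    qed
    also have "\<dots> = ennreal pi * (\<integral>\<^sup>+t. ennreal (poisson y (x - t) * cmod (cutoff a b \<phi> t)) \<partial>lborel)"
      by (rule nn_integral_cmult) measurable
    finally have "(ennreal \<bar>Im (?f (Complex x y))\<bar>)\<^sup>2 \<le> (ennreal pi * (\<integral>\<^sup>+t. ennreal (poisson y (x - t) * cmod (cutoff a b \<phi> t)) \<partial>lborel))\<^sup>2"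
      by (rule power_mono) simp
    also have "\<dots> \<le> ennreal (pi\<^sup>2) * (\<integral>\<^sup>+t. ennreal (poisson y (x - t) * (cmod (cutoff a b \<phi> t))\<^sup>2) \<partial>lborel)"
      unfolding power_mult_distrib ennreal_power[OF pi_ge_zero]
      using y by (intro mult_left_mono poisson_average_square) auto
    finally show ?thesis by (simp add: ennreal_power)
  qed
  have ReIm: "Re ((?f z)\<^sup>2) = (cmod (?f z))\<^sup>2 - 2 * (Im (?f z))\<^sup>2" for z
    unfolding cmod_power2 by (simp add: power2_eq_square)
  have intIm: "integrable lborel (\<lambda>x. (Im (?f (Complex x y)))\<^sup>2)"
    by (rule Bochner_Integration.integrable_bound[OF I(2)]) (auto simp: cmod_power2)
  have "0 = Re (LINT x|lborel. (?f (Complex x y))\<^sup>2)"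
    using I(1) by simp
  also have "\<dots> = (LINT x|lborel. Re ((?f (Complex x y))\<^sup>2))"
    using integral_Re[OF I(3)] by simp
  also have "\<dots> = (LINT x|lborel. (cmod (?f (Complex x y)))\<^sup>2) - 2 * (LINT x|lborel. (Im (?f (Complex x y)))\<^sup>2)"
    unfolding ReIm using I(2) intIm by simp
  finally have eq: "(LINT x|lborel. (cmod (?f (Complex x y)))\<^sup>2) = 2 * (LINT x|lborel. (Im (?f (Complex x y)))\<^sup>2)"
    by simp
  have "sqnorm (\<lambda>x. ?f (Complex x y)) = ennreal (LINT x|lborel. (cmod (?f (Complex x y)))\<^sup>2)"
    unfolding sqnorm_def by (rule nn_integral_eq_integral[OF I(2)]) simp
  also have "\<dots> = 2 * ennreal (LINT x|lborel. (Im (?f (Complex x y)))\<^sup>2)"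
    unfolding eq by (simp add: ennreal_mult)
  also have "ennreal (LINT x|lborel. (Im (?f (Complex x y)))\<^sup>2) = (\<integral>\<^sup>+x. ennreal ((Im (?f (Complex x y)))\<^sup>2) \<partial>lborel)"
    by (rule nn_integral_eq_integral[OF intIm, symmetric]) simp
  also have "2 * \<dots> \<le> 2 * (\<integral>\<^sup>+x. ennreal (pi\<^sup>2) * (\<integral>\<^sup>+t. ennreal (poisson y (x - t) * (cmod (cutoff a b \<phi> t))\<^sup>2) \<partial>lborel) \<partial>lborel)"
    by (intro mult_left_mono nn_integral_mono pt) auto
  also have "\<dots> = 2 * (ennreal (pi\<^sup>2) * sqnorm (cutoff a b \<phi>))"
    unfolding sqnorm_def using y
    by (subst nn_integral_cmult) (auto intro!: arg_cong2[of _ _ _ _ "(*)"] nn_integral_poisson_smoothing)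
  also have "\<dots> \<le> 2 * (ennreal (pi\<^sup>2) * ennreal M)"
    by (intro mult_left_mono M) auto
  also have "\<dots> = ennreal (2 * pi\<^sup>2 * M)"
    using M by (simp add: ennreal_mult mult.assoc)
  finally show ?thesis .
qed

theorem cauchy_transform_hardy2:
  assumes \<phi>: "continuous_on {a..b} \<phi>" and ab: "a \<le> b" and M: "sqnorm (cutoff a b \<phi>) \<le> ennreal M" "M \<ge> 0"
  shows "hardy2 (8 * pi\<^sup>2 * M) (cauchy_transform a b \<phi>)"
  unfolding hardy2_def
proof (intro conjI allI impI cauchy_transform_holomorphic cauchy_transform_measurable \<phi>)
  fix y :: real assume y: "y > 0"
  define \<phi>1 \<phi>2 where "\<phi>1 t = complex_of_real (Re (\<phi> t))" and "\<phi>2 t = complex_of_real (Im (\<phi> t))" for t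
  have c: "continuous_on {a..b} \<phi>1" "continuous_on {a..b} \<phi>2"
    unfolding \<phi>1_def \<phi>2_def by (intro continuous_intros \<phi>)+
  have M12: "sqnorm (cutoff a b \<phi>1) \<le> ennreal M" "sqnorm (cutoff a b \<phi>2) \<le> ennreal M"
  proof -
    have "cmod (cutoff a b \<phi>1 t) \<le> cmod (cutoff a b \<phi> t)" "cmod (cutoff a b \<phi>2 t) \<le> cmod (cutoff a b \<phi> t)" for t
      using abs_Re_le_cmod[of "\<phi> t"] abs_Im_le_cmod[of "\<phi> t"]
      by (auto simp: cutoff_def \<phi>1_def \<phi>2_def indicator_def)
    then have "sqnorm (cutoff a b \<phi>1) \<le> sqnorm (cutoff a b \<phi>)" "sqnorm (cutoff a b \<phi>2) \<le> sqnorm (cutoff a b \<phi>)"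
      unfolding sqnorm_def by (auto intro!: nn_integral_mono ennreal_leI power_mono)
    with M(1) show "sqnorm (cutoff a b \<phi>1) \<le> ennreal M" "sqnorm (cutoff a b \<phi>2) \<le> ennreal M"
      by auto
  qed
  note [measurable] = cauchy_transform_measurable[OF c(1)] cauchy_transform_measurable[OF c(2)]
  have split: "cauchy_transform a b \<phi> (Complex x y) = cauchy_transform a b \<phi>1 (Complex x y) + \<i> * cauchy_transform a b \<phi>2 (Complex x y)" for x
  proof -
    have e: "\<phi> t = \<phi>1 t + \<i> * \<phi>2 t" for t
      by (simp add: \<phi>1_def \<phi>2_def complex_eq_iff)
    have "cutoff a b \<phi> t / (of_real t - Complex x y) = cutoff a b \<phi>1 t / (of_real t - Complex x y) + \<i> * (cutoff a b \<phi>2 t / (of_real t - Complex x y))" for t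
      unfolding cutoff_def by (subst e) (simp add: add_divide_distrib scaleR_add_right)
    then show ?thesis
      unfolding cauchy_transform_lborel(1)[OF \<phi> y] cauchy_transform_lborel(1)[OF c(1) y] cauchy_transform_lborel(1)[OF c(2) y]
      using cauchy_transform_lborel(2)[OF c(1) y, of x] cauchy_transform_lborel(2)[OF c(2) y, of x]
      by (simp del: times_divide_eq_right)
  qed
  have "sqnorm (\<lambda>x. cauchy_transform a b \<phi> (Complex x y)) \<le>
      2 * sqnorm (\<lambda>x. cauchy_transform a b \<phi>1 (Complex x y)) + 2 * sqnorm (\<lambda>x. \<i> * cauchy_transform a b \<phi>2 (Complex x y))"
    unfolding split by (rule sqnorm_add_le) measurable
  also have "sqnorm (\<lambda>x. \<i> * cauchy_transform a b \<phi>2 (Complex x y)) = sqnorm (\<lambda>x. cauchy_transform a b \<phi>2 (Complex x y))"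
    by (simp add: sqnorm_def norm_mult)
  also have "2 * sqnorm (\<lambda>x. cauchy_transform a b \<phi>1 (Complex x y)) + 2 * sqnorm (\<lambda>x. cauchy_transform a b \<phi>2 (Complex x y))
      \<le> 2 * ennreal (2 * pi\<^sup>2 * M) + 2 * ennreal (2 * pi\<^sup>2 * M)"
    using ab M(2) y M12
    by (intro add_mono mult_left_mono cauchy_transform_real_sqnorm c) (auto simp: \<phi>1_def \<phi>2_def)
  also have "\<dots> = ennreal (8 * pi\<^sup>2 * M)"
  proof -
    have "2 * ennreal r + 2 * ennreal r = ennreal (4 * r)" if "r \<ge> 0" for r
    proof -
      have "2 * ennreal r = ennreal (2 * r)" using that by (simp add: ennreal_mult)
      then show ?thesis using that by (simp flip: ennreal_plus)
    qed
    from this[of "2 * pi\<^sup>2 * M"] show ?thesis using M(2) by simp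
  qed
  finally show "sqnorm (\<lambda>x. cauchy_transform a b \<phi> (Complex x y)) \<le> ennreal (8 * pi\<^sup>2 * M)" .
qed

section \<open>Normal families\<close>

definition locally_uniform_limit :: "(nat \<Rightarrow> complex \<Rightarrow> complex) \<Rightarrow> (complex \<Rightarrow> complex) \<Rightarrow> bool" where
  "locally_uniform_limit F g \<longleftrightarrow> continuous_on upper_half_plane g \<and>
     (\<forall>K. compact K \<and> K \<subseteq> upper_half_plane \<longrightarrow> uniform_limit K F g sequentially)"

lemma locally_uniform_limit_subseq:
  assumes "locally_uniform_limit F g" "strict_mono r"
  shows "locally_uniform_limit (\<lambda>n. F (r n)) g"
  using assms filterlim_compose[OF _ filterlim_subseq[OF assms(2)], of F]
  by (auto simp: locally_uniform_limit_def)

text \<open>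
  When rectangles grow to the half-strip, the transforms of their sides vary together with the
  points of the half-plane that correspond to a fixed \<open>w\<close>.
\<close>

lemma locally_uniform_limit_moving_point:
  assumes F: "locally_uniform_limit F g" and \<zeta>: "\<zeta> \<longlonglongrightarrow> z" "Im z > 0"
  shows "(\<lambda>n. F n (\<zeta> n)) \<longlonglongrightarrow> g z"
proof -
  define K where "K = cball z (Im z / 2)"
  have K: "compact K" "K \<subseteq> upper_half_plane"
  proof -
    show "K \<subseteq> upper_half_plane"
    proof
      fix w assume "w \<in> K"
      then have "Im z - Im w \<le> Im z / 2"
        using abs_Im_le_cmod[of "z - w"] by (auto simp: K_def dist_norm)
      then show "w \<in> upper_half_plane" using \<zeta>(2) by simp
    qed
  qed (simp add: K_def)
  then have ul: "uniform_limit K F g sequentially"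
    using F by (auto simp: locally_uniform_limit_def)
  have inK: "\<forall>\<^sub>F n in sequentially. \<zeta> n \<in> K"
    using tendstoD[OF \<zeta>(1), of "Im z / 2"] \<zeta>(2)
    by (auto simp: K_def dist_commute elim!: eventually_mono)
  have "isCont g z"
    using F \<zeta>(2) by (auto simp: locally_uniform_limit_def continuous_on_eq_continuous_at open_upper_half_plane)
  then have g: "(\<lambda>n. g (\<zeta> n)) \<longlonglongrightarrow> g z"
    using \<zeta>(1) isCont_tendsto_compose by blast
  have "(\<lambda>n. F n (\<zeta> n) - g (\<zeta> n)) \<longlonglongrightarrow> 0"
  proof (rule tendstoI)
    fix e :: real assume "e > 0"
    have "\<forall>\<^sub>F n in sequentially. \<forall>x\<in>K. dist (F n x) (g x) < e"
      using ul \<open>e > 0\<close> by (auto simp: uniform_limit_iff)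
    with inK show "\<forall>\<^sub>F n in sequentially. dist (F n (\<zeta> n) - g (\<zeta> n)) 0 < e"
      by eventually_elim (auto simp: dist_norm)
  qed
  from tendsto_add[OF this g] show ?thesis by simp
qed

text \<open>
  Montel's theorem gives the limit, Fatou's lemma its bound.
\<close>

lemma hardy2_compactness:
  assumes F: "\<And>n. hardy2 N (F n)" and bound: "\<And>n z. Im z > 0 \<Longrightarrow> (cmod (F n z))\<^sup>2 \<le> C / Im z"
  shows "\<exists>g r. hardy2 N g \<and> strict_mono (r :: nat \<Rightarrow> nat) \<and> locally_uniform_limit (\<lambda>n. F (r n)) g"
proof -
  let ?S = upper_half_plane
  let ?H = "{h. h holomorphic_on ?S \<and> (\<forall>z\<in>?S. (cmod (h z))\<^sup>2 \<le> C / Im z)}"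
  have bd: "\<exists>B. \<forall>h\<in>?H. \<forall>z\<in>K. norm (h z) \<le> B" if K: "compact K" "K \<subseteq> ?S" for K
  proof (cases "K = {}")
    case False
    obtain w where w: "w \<in> K" "\<And>z. z \<in> K \<Longrightarrow> Im w \<le> Im z"
      using continuous_attains_inf[OF K(1) False continuous_on_Im[OF continuous_on_id]] by auto
    have "norm (h z) \<le> 1 + \<bar>C\<bar> / Im w" if "h \<in> ?H" "z \<in> K" for h z
    proof -
      have "0 < Im w" "Im w \<le> Im z" using w K that by auto
      have "norm (h z) \<le> 1 + (cmod (h z))\<^sup>2" by (rule le_1_plus_square)
      also have "\<dots> \<le> 1 + C / Im z" using that K by auto
      also have "C / Im z \<le> \<bar>C\<bar> / Im w"
        using \<open>0 < Im w\<close> \<open>Im w \<le> Im z\<close> by (intro frac_le) auto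
      finally show ?thesis by simp
    qed
    then show ?thesis by blast
  qed auto
  have rng: "range F \<subseteq> ?H"
    using F bound by (auto intro: hardy2_holomorphic)
  obtain g r where g: "g holomorphic_on ?S" "strict_mono (r :: nat \<Rightarrow> nat)"
    "\<And>x. x \<in> ?S \<Longrightarrow> ((\<lambda>n. F (r n) x) \<longlongrightarrow> g x) sequentially"
    "\<And>K. compact K \<Longrightarrow> K \<subseteq> ?S \<Longrightarrow> uniform_limit K (F \<circ> r) g sequentially"
    by (rule Montel[OF open_upper_half_plane _ bd rng]) (auto simp: that)
  define g' where "g' z = (if Im z > 0 then g z else 0)" for z
  have g': "g' holomorphic_on ?S"
    using g(1) by (rule holomorphic_transform) (simp add: g'_def)
  have "hardy2 N g'"
    unfolding hardy2_def
  proof (intro conjI allI impI g' holomorphic_extension_measurable)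
    fix y :: real assume y: "y > 0"
    note [measurable] = F[THEN hardy2_measurable]
    show "sqnorm (\<lambda>x. g' (Complex x y)) \<le> ennreal N"
      unfolding sqnorm_def
    proof (rule nn_integral_limit_le)
      show "AE x in lborel. (\<lambda>n. ennreal ((cmod (F (r n) (Complex x y)))\<^sup>2)) \<longlonglongrightarrow> ennreal ((cmod (g' (Complex x y)))\<^sup>2)"
        using y g(3) by (intro AE_I2 tendsto_intros) (auto simp: g'_def)
      show "\<forall>\<^sub>F n in sequentially. (\<integral>\<^sup>+x. ennreal ((cmod (F (r n) (Complex x y)))\<^sup>2) \<partial>lborel) \<le> ennreal N"
        using hardy2_sqnorm[OF F y] by (auto simp: sqnorm_def)
    qed measurable
  qed (simp add: g'_def)
  moreover have "locally_uniform_limit (\<lambda>n. F (r n)) g'"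
    unfolding locally_uniform_limit_def
  proof (intro conjI allI impI holomorphic_on_imp_continuous_on g')
    fix K assume K: "compact K \<and> K \<subseteq> ?S"
    then have "uniform_limit K (F \<circ> r) g sequentially" using g(4) by blast
    then show "uniform_limit K (\<lambda>n. F (r n)) g' sequentially"
      by (rule uniform_limit_cong'[THEN iffD1, rotated -1]) (use K in \<open>auto simp: g'_def\<close>)
  qed
  ultimately show ?thesis using g(2) by blast
qed

section \<open>Decomposition of functions on the half-strip\<close>

text \<open>
  Each side of the rectangle \<open>[-s, s] \<times> [t, R]\<close> lies on the boundary of a half-plane that contains the
  rectangle. A rigid motion takes this half-plane to the upper half-plane and the side, with its
  counterclockwise orientation, to a segment of the real axis run through from left to right.
\<close>

definition cauchy_left :: "real \<Rightarrow> real \<Rightarrow> real \<Rightarrow> (complex \<Rightarrow> complex) \<Rightarrow> complex \<Rightarrow> complex" where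
  "cauchy_left s t R \<phi> w = cauchy_transform (- R) (- t) (\<lambda>x. \<phi> (Complex (- s) (- x))) (\<i> * (w + of_real s))"

definition cauchy_bottom :: "real \<Rightarrow> real \<Rightarrow> (complex \<Rightarrow> complex) \<Rightarrow> complex \<Rightarrow> complex" where
  "cauchy_bottom s t \<phi> w = cauchy_transform (- s) s (\<lambda>x. \<phi> (Complex x t)) (w - \<i> * of_real t)"

definition cauchy_right :: "real \<Rightarrow> real \<Rightarrow> real \<Rightarrow> (complex \<Rightarrow> complex) \<Rightarrow> complex \<Rightarrow> complex" where
  "cauchy_right s t R \<phi> w = cauchy_transform t R (\<lambda>x. \<phi> (Complex s x)) (- \<i> * (w - of_real s))"

definition cauchy_top :: "real \<Rightarrow> real \<Rightarrow> (complex \<Rightarrow> complex) \<Rightarrow> complex \<Rightarrow> complex" where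
  "cauchy_top s R \<phi> w = cauchy_transform (- s) s (\<lambda>x. \<phi> (Complex (- x) R)) (\<i> * of_real R - w)"

definition cauchy_sides :: "real \<Rightarrow> real \<Rightarrow> real \<Rightarrow> (complex \<Rightarrow> complex) \<Rightarrow> complex \<Rightarrow> complex" where
  "cauchy_sides s t R \<phi> w = cauchy_left s t R \<phi> w + cauchy_bottom s t \<phi> w + cauchy_right s t R \<phi> w + cauchy_top s R \<phi> w"

lemma open_half_strip: "open (half_strip s t)" and convex_half_strip: "convex (half_strip s t)"
proof -
  have "half_strip s t = {w. Re w < s} \<inter> {w. Re w > - s} \<inter> {w. Im w > t}"
    by (auto simp: half_strip_def)
  then show "open (half_strip s t)" "convex (half_strip s t)"
    by (auto intro!: open_Int convex_Int simp: open_halfspace_Re_lt open_halfspace_Re_gt open_halfspace_Im_gt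
        convex_halfspace_Re_lt convex_halfspace_Re_gt convex_halfspace_Im_gt)
qed

lemma continuous_on_Complex [continuous_intros]:
  "continuous_on S f \<Longrightarrow> continuous_on S g \<Longrightarrow> continuous_on S (\<lambda>x. Complex (f x) (g x))"
  unfolding Complex_eq by (intro continuous_intros)

lemma continuous_on_sides:
  assumes \<phi>: "continuous_on (half_strip \<sigma> 0) \<phi>" and st: "0 < s" "s < \<sigma>" "0 < t"
  shows "continuous_on {- R..- t} (\<lambda>x. \<phi> (Complex (- s) (- x)))"
    and "continuous_on {- s..s} (\<lambda>x. \<phi> (Complex x t))"
    and "continuous_on {t..R} (\<lambda>x. \<phi> (Complex s x))"
    and "t < R \<Longrightarrow> continuous_on {- s..s} (\<lambda>x. \<phi> (Complex (- x) R))"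
  using st by (auto intro!: continuous_on_compose2[OF \<phi>] continuous_intros simp: half_strip_def)

text \<open>
  The rigid motions preserve \<open>d\<zeta> / (\<zeta> - w)\<close>, so the four transforms are the four parts of the
  contour integral in Cauchy's formula.
\<close>

lemma cauchy_formula_rectangle:
  assumes G: "G holomorphic_on half_strip \<sigma> 0" and st: "0 < s" "s < \<sigma>" "0 < t" "t < R"
    and w: "\<bar>Re w\<bar> < s" "t < Im w" "Im w < R"
  shows "2 * pi * \<i> * G w = cauchy_sides s t R G w"
proof -
  have 1: "cauchy_bottom s t G w = integral {- s..s} (\<lambda>x. G (Complex x t) / (Complex x t - w))"
    using w by (simp add: cauchy_bottom_def cauchy_transform_def Complex_eq algebra_simps)
  have e2: "\<i> * (u / (Complex s x - w)) = u / (of_real x - (- \<i> * (w - of_real s)))" for u x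
  proof -
    have "Complex s x - w = \<i> * (of_real x - (- \<i> * (w - of_real s)))"
      by (simp add: Complex_eq algebra_simps)
    then show ?thesis by simp
  qed
  have 2: "cauchy_right s t R G w = \<i> * integral {t..R} (\<lambda>x. G (Complex s x) / (Complex s x - w))"
    unfolding integral_mult_right[symmetric] e2 using w by (simp add: cauchy_right_def cauchy_transform_def)
  have e3: "- (u / (Complex (- x) R - w)) = u / (of_real x - (\<i> * of_real R - w))" for u x
  proof -
    have "Complex (- x) R - w = - (of_real x - (\<i> * of_real R - w))"
      by (simp add: Complex_eq algebra_simps)
    then show ?thesis by (metis minus_divide_right minus_minus)
  qed
  have "cauchy_top s R G w = integral {- s..- (- s)} (\<lambda>x. (\<lambda>x. - (G (Complex x R) / (Complex x R - w))) (- x))"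
    unfolding e3 using w by (simp add: cauchy_top_def cauchy_transform_def)
  also have "\<dots> = - integral {- s..s} (\<lambda>x. G (Complex x R) / (Complex x R - w))"
    by (subst Henstock_Kurzweil_Integration.integral_reflect_real) (simp add: integral_neg)
  finally have 3: "cauchy_top s R G w = - integral {- s..s} (\<lambda>x. G (Complex x R) / (Complex x R - w))" .
  have e4: "- (\<i> * (u / (Complex (- s) (- x) - w))) = u / (of_real x - \<i> * (w + of_real s))" for u x
  proof -
    have "Complex (- s) (- x) - w = - \<i> * (of_real x - \<i> * (w + of_real s))"
      by (simp add: Complex_eq algebra_simps)
    then show ?thesis by simp
  qed
  have "cauchy_left s t R G w = integral {- R..- t} (\<lambda>x. (\<lambda>x. - (\<i> * (G (Complex (- s) x) / (Complex (- s) x - w)))) (- x))"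
    unfolding e4 using w by (simp add: cauchy_left_def cauchy_transform_def)
  also have "\<dots> = - (\<i> * integral {t..R} (\<lambda>x. G (Complex (- s) x) / (Complex (- s) x - w)))"
    by (subst Henstock_Kurzweil_Integration.integral_reflect_real) (simp only: integral_neg integral_mult_right)
  finally have 4: "cauchy_left s t R G w = - (\<i> * integral {t..R} (\<lambda>x. G (Complex (- s) x) / (Complex (- s) x - w)))" .
  have "rect_integral (\<lambda>\<zeta>. G \<zeta> / (\<zeta> - w)) (- s) s t R = 2 * pi * \<i> * G w"
    using st w by (intro rect_integral_Cauchy[OF _ _ convex_half_strip open_half_strip G])
      (auto simp: in_cbox_complex_iff half_strip_def)
  then show ?thesis
    unfolding cauchy_sides_def rect_integral_def 1 2 3 4 by (simp add: algebra_simps)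
qed

definition side_bound :: "real \<Rightarrow> real \<Rightarrow> (complex \<Rightarrow> complex) \<Rightarrow> bool" where
  "side_bound \<sigma> M \<phi> \<longleftrightarrow> (\<forall>s t. 0 < s \<and> s < \<sigma> \<and> 0 < t \<longrightarrow>
     (\<integral>\<^sup>+v. indicator {t..} v * ennreal ((cmod (\<phi> (Complex (- s) v)))\<^sup>2) \<partial>lborel) \<le> ennreal M \<and>
     (\<integral>\<^sup>+u. indicator {- s..s} u * ennreal ((cmod (\<phi> (Complex u t)))\<^sup>2) \<partial>lborel) \<le> ennreal M \<and>
     (\<integral>\<^sup>+v. indicator {t..} v * ennreal ((cmod (\<phi> (Complex s v)))\<^sup>2) \<partial>lborel) \<le> ennreal M)"

lemma sqnorm_cutoff: "sqnorm (cutoff a b \<phi>) = (\<integral>\<^sup>+x. indicator {a..b} x * ennreal ((cmod (\<phi> x))\<^sup>2) \<partial>lborel)"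
  unfolding sqnorm_def by (intro nn_integral_cong) (auto simp: cutoff_def indicator_def)

lemma sqnorm_cutoff_reflect:
  assumes "continuous_on {a..b} \<phi>"
  shows "sqnorm (cutoff (- b) (- a) (\<lambda>x. \<phi> (- x))) = sqnorm (cutoff a b \<phi>)"
proof -
  note [measurable] = cutoff_measurable[OF assms]
  have "cutoff (- b) (- a) (\<lambda>x. \<phi> (- x)) = (\<lambda>x. cutoff a b \<phi> (- x))"
    by (rule ext) (auto simp: cutoff_def indicator_def)
  then show ?thesis
    unfolding sqnorm_def using nn_integral_reflect[of "\<lambda>x. ennreal ((cmod (cutoff a b \<phi> x))\<^sup>2)"] by simp
qed

lemma side_bound_sqnorm:
  assumes \<phi>: "continuous_on (half_strip \<sigma> 0) \<phi>" and b: "side_bound \<sigma> M \<phi>"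
    and st: "0 < s" "s < \<sigma>" "0 < t" "t < R"
  shows "sqnorm (cutoff (- R) (- t) (\<lambda>x. \<phi> (Complex (- s) (- x)))) \<le> ennreal M"
    and "sqnorm (cutoff (- s) s (\<lambda>x. \<phi> (Complex x t))) \<le> ennreal M"
    and "sqnorm (cutoff t R (\<lambda>x. \<phi> (Complex s x))) \<le> ennreal M"
    and "sqnorm (cutoff (- s) s (\<lambda>x. \<phi> (Complex (- x) R))) \<le> ennreal M"
proof -
  have v: "sqnorm (cutoff t R (\<lambda>x. \<phi> (Complex s' x))) \<le> (\<integral>\<^sup>+v. indicator {t..} v * ennreal ((cmod (\<phi> (Complex s' v)))\<^sup>2) \<partial>lborel)" for s'
    unfolding sqnorm_cutoff by (intro nn_integral_mono) (auto simp: indicator_def)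
  have h: "sqnorm (cutoff (- s) s (\<lambda>x. \<phi> (Complex x t'))) \<le> ennreal M" if "0 < t'" for t'
    unfolding sqnorm_cutoff using b st that by (auto simp: side_bound_def)
  show "sqnorm (cutoff t R (\<lambda>x. \<phi> (Complex s x))) \<le> ennreal M"
    using b st by (intro order.trans[OF v]) (auto simp: side_bound_def)
  have c: "continuous_on {t..R} (\<lambda>x. \<phi> (Complex (- s) x))" "continuous_on {- s..s} (\<lambda>x. \<phi> (Complex x R))"
    using st by (auto intro!: continuous_on_compose2[OF \<phi>] continuous_intros simp: half_strip_def)
  show "sqnorm (cutoff (- R) (- t) (\<lambda>x. \<phi> (Complex (- s) (- x)))) \<le> ennreal M"
    unfolding sqnorm_cutoff_reflect[OF c(1)] using b st by (intro order.trans[OF v]) (auto simp: side_bound_def)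
  show "sqnorm (cutoff (- s) s (\<lambda>x. \<phi> (Complex x t))) \<le> ennreal M"
    by (rule h) (use st in auto)
  show "sqnorm (cutoff (- s) s (\<lambda>x. \<phi> (Complex (- x) R))) \<le> ennreal M"
    using sqnorm_cutoff_reflect[OF c(2)] h[of R] st by simp
qed

definition inner_width :: "real \<Rightarrow> nat \<Rightarrow> real" where
  "inner_width \<sigma> n = \<sigma> * (real n + 1) / (real n + 2)"

definition inner_base :: "nat \<Rightarrow> real" where
  "inner_base n = 1 / (real n + 2)"

definition inner_height :: "nat \<Rightarrow> real" where
  "inner_height n = real n + 2"

lemma inner_rectangle:
  assumes "\<sigma> > 0"
  shows "0 < inner_width \<sigma> n" "inner_width \<sigma> n < \<sigma>" "0 < inner_base n" "inner_base n < inner_height n"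
proof -
  show "0 < inner_width \<sigma> n"
    unfolding inner_width_def using assms by (intro divide_pos_pos mult_pos_pos) auto
  show "inner_width \<sigma> n < \<sigma>" "0 < inner_base n"
    using assms by (auto simp: inner_width_def inner_base_def field_simps)
  have "inner_base n \<le> 1" by (simp add: inner_base_def)
  then show "inner_base n < inner_height n" by (simp add: inner_height_def)
qed

lemma inner_rectangle_limits:
  shows "\<sigma> > 0 \<Longrightarrow> inner_width \<sigma> \<longlonglongrightarrow> \<sigma>" "inner_base \<longlonglongrightarrow> 0" "filterlim inner_height at_top sequentially"
proof -
  show "inner_width \<sigma> \<longlonglongrightarrow> \<sigma>" if "\<sigma> > 0"
    unfolding inner_width_def using that by real_asymp
  show "inner_base \<longlonglongrightarrow> 0"
    unfolding inner_base_def by real_asymp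
  show "filterlim inner_height at_top sequentially"
    unfolding inner_height_def by real_asymp
qed

lemma eventually_in_inner_rectangle:
  assumes "w \<in> half_strip \<sigma> 0" "\<sigma> > 0"
  shows "\<forall>\<^sub>F n in sequentially. \<bar>Re w\<bar> < inner_width \<sigma> n \<and> inner_base n < Im w \<and> Im w < inner_height n"
proof -
  have "\<forall>\<^sub>F n in sequentially. \<bar>Re w\<bar> < inner_width \<sigma> n"
    by (rule order_tendstoD[OF inner_rectangle_limits(1)]) (use assms in \<open>auto simp: half_strip_def\<close>)
  moreover have "\<forall>\<^sub>F n in sequentially. inner_base n < Im w"
    by (rule order_tendstoD[OF inner_rectangle_limits(2)]) (use assms in \<open>auto simp: half_strip_def\<close>)
  moreover have "\<forall>\<^sub>F n in sequentially. Im w < inner_height n"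
    using inner_rectangle_limits(3) by (simp add: filterlim_at_top_dense)
  ultimately show ?thesis by eventually_elim simp
qed

text \<open>
  A sum of functions of three half-planes, to the right of \<open>Re w = -\<sigma>\<close>, above the real axis and to the
  left of \<open>Re w = \<sigma>\<close>, each of them mapped to the upper half-plane.
\<close>

definition strip_sum :: "real \<Rightarrow> (complex \<Rightarrow> complex) \<Rightarrow> (complex \<Rightarrow> complex) \<Rightarrow> (complex \<Rightarrow> complex) \<Rightarrow> complex \<Rightarrow> complex" where
  "strip_sum \<sigma> g1 g2 g3 w = g1 (\<i> * (w + of_real \<sigma>)) + g2 w + g3 (- \<i> * (w - of_real \<sigma>))"

lemma hardy2_cmult:
  assumes "hardy2 M f"
  shows "hardy2 ((cmod c)\<^sup>2 * M) (\<lambda>z. c * f z)"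
  unfolding hardy2_def
proof (intro conjI allI impI)
  note [measurable] = hardy2_measurable[OF assms]
  show "(\<lambda>z. c * f z) \<in> borel_measurable borel" by measurable
  fix y :: real assume y: "y > 0"
  have "sqnorm (\<lambda>x. c * f (Complex x y)) = ennreal ((cmod c)\<^sup>2) * sqnorm (\<lambda>x. f (Complex x y))"
    unfolding sqnorm_def by (subst nn_integral_cmult[symmetric]) (auto simp: norm_mult power_mult_distrib ennreal_mult)
  also have "\<dots> \<le> ennreal ((cmod c)\<^sup>2) * ennreal M"
    by (intro mult_left_mono hardy2_sqnorm[OF assms y]) auto
  also have "\<dots> = ennreal ((cmod c)\<^sup>2 * M)" by (simp add: ennreal_mult')
  finally show "sqnorm (\<lambda>x. c * f (Complex x y)) \<le> ennreal ((cmod c)\<^sup>2 * M)" .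
qed (intro holomorphic_intros hardy2_holomorphic[OF assms])

text \<open>
  The transforms of the left, bottom and right sides are bounded in \<open>H\<^sup>2\<close> independently of \<open>n\<close>, so
  suitable subsequences converge. The top side moves off to infinity, where the pointwise bound for its
  transform tends to 0.
\<close>

theorem sides_compactness:
  assumes \<phi>: "continuous_on (half_strip \<sigma> 0) \<phi>" and b: "side_bound \<sigma> M \<phi>" and "M \<ge> 0" "\<sigma> > 0"
  defines "s \<equiv> inner_width \<sigma>" and "t \<equiv> inner_base" and "R \<equiv> inner_height"
  shows "\<exists>g1 g2 g3 r. hardy2 (8 * pi\<^sup>2 * M) g1 \<and> hardy2 (8 * pi\<^sup>2 * M) g2 \<and> hardy2 (8 * pi\<^sup>2 * M) g3 \<and> strict_mono (r :: nat \<Rightarrow> nat) \<and>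
    (\<forall>w\<in>half_strip \<sigma> 0. (\<lambda>n. cauchy_sides (s (r n)) (t (r n)) (R (r n)) \<phi> w) \<longlonglongrightarrow> strip_sum \<sigma> g1 g2 g3 w)"
proof -
  have s: "0 < s n" "s n < \<sigma>" and t: "0 < t n" "t n < R n" for n
    using inner_rectangle[OF \<open>\<sigma> > 0\<close>] by (auto simp: s_def t_def R_def)
  note cont = continuous_on_sides[OF \<phi> s t(1)]
  note bnd = side_bound_sqnorm[OF \<phi> b s t]
  define F1 where "F1 n = cauchy_transform (- R n) (- t n) (\<lambda>x. \<phi> (Complex (- s n) (- x)))" for n
  define F2 where "F2 n = cauchy_transform (- s n) (s n) (\<lambda>x. \<phi> (Complex x (t n)))" for n
  define F3 where "F3 n = cauchy_transform (t n) (R n) (\<lambda>x. \<phi> (Complex (s n) x))" for n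
  have pos: "- R n \<le> - t n" "- s n \<le> s n" "t n \<le> R n" for n
    using s[of n] t[of n] by auto
  have h: "hardy2 (8 * pi\<^sup>2 * M) (F1 n)" "hardy2 (8 * pi\<^sup>2 * M) (F2 n)" "hardy2 (8 * pi\<^sup>2 * M) (F3 n)" for n
    unfolding F1_def F2_def F3_def by (intro cauchy_transform_hardy2 cont bnd pos \<open>M \<ge> 0\<close>)+
  have c: "(cmod (F1 n z))\<^sup>2 \<le> M * pi / Im z" "(cmod (F2 n z))\<^sup>2 \<le> M * pi / Im z" "(cmod (F3 n z))\<^sup>2 \<le> M * pi / Im z"
    if "Im z > 0" for n z
    unfolding F1_def F2_def F3_def by (intro cauchy_transform_pointwise cont bnd \<open>M \<ge> 0\<close> that)+
  obtain g1 r1 where g1: "hardy2 (8 * pi\<^sup>2 * M) g1" "strict_mono r1" "locally_uniform_limit (\<lambda>n. F1 (r1 n)) g1"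
    using hardy2_compactness[of _ F1, OF h(1) c(1)] by blast
  obtain g2 r2 where g2: "hardy2 (8 * pi\<^sup>2 * M) g2" "strict_mono r2" "locally_uniform_limit (\<lambda>n. F2 (r1 (r2 n))) g2"
    using hardy2_compactness[of _ "\<lambda>n. F2 (r1 n)", OF h(2) c(2)] by blast
  obtain g3 r3 where g3: "hardy2 (8 * pi\<^sup>2 * M) g3" "strict_mono r3" "locally_uniform_limit (\<lambda>n. F3 (r1 (r2 (r3 n)))) g3"
    using hardy2_compactness[of _ "\<lambda>n. F3 (r1 (r2 n))", OF h(3) c(3)] by blast
  define r where "r = (\<lambda>n. r1 (r2 (r3 n)))"
  have r: "strict_mono r"
    using g1(2) g2(2) g3(2) by (auto simp: r_def strict_mono_def)
  have lim: "locally_uniform_limit (\<lambda>n. F1 (r n)) g1" "locally_uniform_limit (\<lambda>n. F2 (r n)) g2" "locally_uniform_limit (\<lambda>n. F3 (r n)) g3"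
  proof -
    have "strict_mono (\<lambda>n. r2 (r3 n))" using g2(2) g3(2) by (auto simp: strict_mono_def)
    from locally_uniform_limit_subseq[OF g1(3) this] show "locally_uniform_limit (\<lambda>n. F1 (r n)) g1"
      by (simp add: r_def)
    from locally_uniform_limit_subseq[OF g2(3) g3(2)] show "locally_uniform_limit (\<lambda>n. F2 (r n)) g2"
      by (simp add: r_def)
  qed (use g3(3) in \<open>simp add: r_def\<close>)
  have r_top: "filterlim r sequentially sequentially" by (rule filterlim_subseq[OF r])
  have slim: "(\<lambda>n. s (r n)) \<longlonglongrightarrow> \<sigma>"
  proof -
    have "s \<longlonglongrightarrow> \<sigma>" unfolding s_def by (rule inner_rectangle_limits) fact
    then show ?thesis by (rule filterlim_compose[OF _ r_top])
  qed
  have tlim: "(\<lambda>n. t (r n)) \<longlonglongrightarrow> 0"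
  proof -
    have "t \<longlonglongrightarrow> 0" unfolding t_def by (rule inner_rectangle_limits)
    then show ?thesis by (rule filterlim_compose[OF _ r_top])
  qed
  have Rlim: "filterlim (\<lambda>n. R (r n)) at_top sequentially"
  proof -
    have "filterlim R at_top sequentially" unfolding R_def by (rule inner_rectangle_limits)
    then show ?thesis by (rule filterlim_compose[OF _ r_top])
  qed
  have "(\<lambda>n. cauchy_sides (s (r n)) (t (r n)) (R (r n)) \<phi> w) \<longlonglongrightarrow> strip_sum \<sigma> g1 g2 g3 w + 0"
    if w: "w \<in> half_strip \<sigma> 0" for w
    unfolding cauchy_sides_def strip_sum_def
  proof (intro tendsto_add)
    have w': "0 < Re w + \<sigma>" "Re w < \<sigma>" "0 < Im w" using w by (auto simp: half_strip_def)
    show "(\<lambda>n. cauchy_left (s (r n)) (t (r n)) (R (r n)) \<phi> w) \<longlonglongrightarrow> g1 (\<i> * (w + of_real \<sigma>))"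
    proof -
      have "(\<lambda>n. \<i> * (w + of_real (s (r n)))) \<longlonglongrightarrow> \<i> * (w + of_real \<sigma>)"
        by (intro tendsto_intros slim)
      from locally_uniform_limit_moving_point[OF lim(1) this] show ?thesis
        using w' by (simp add: cauchy_left_def F1_def)
    qed
    show "(\<lambda>n. cauchy_bottom (s (r n)) (t (r n)) \<phi> w) \<longlonglongrightarrow> g2 w"
    proof -
      have "(\<lambda>n. w - \<i> * of_real (t (r n))) \<longlonglongrightarrow> w - \<i> * of_real 0"
        by (intro tendsto_intros tlim)
      from locally_uniform_limit_moving_point[OF lim(2) this] show ?thesis
        using w' by (simp add: cauchy_bottom_def F2_def)
    qed
    show "(\<lambda>n. cauchy_right (s (r n)) (t (r n)) (R (r n)) \<phi> w) \<longlonglongrightarrow> g3 (- \<i> * (w - of_real \<sigma>))"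
    proof -
      have "(\<lambda>n. - \<i> * (w - of_real (s (r n)))) \<longlonglongrightarrow> - \<i> * (w - of_real \<sigma>)"
        by (intro tendsto_intros slim)
      from locally_uniform_limit_moving_point[OF lim(3) this] show ?thesis
        using w' by (simp add: cauchy_right_def F3_def)
    qed
    have ev: "\<forall>\<^sub>F n in sequentially. (cmod (cauchy_top (s (r n)) (R (r n)) \<phi> w))\<^sup>2 \<le> M * pi / (R (r n) - Im w)"
    proof -
      have "\<forall>\<^sub>F n in sequentially. R (r n) > Im w"
        using Rlim by (simp add: filterlim_at_top_dense)
      then show ?thesis
      proof eventually_elim
        case (elim n)
        have "continuous_on {- s (r n)..s (r n)} (\<lambda>x. \<phi> (Complex (- x) (R (r n))))"
          by (rule cont(4)) (rule t)
        from cauchy_transform_pointwise[OF this bnd(4) \<open>M \<ge> 0\<close>, of "\<i> * of_real (R (r n)) - w"]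
        show ?case using elim by (simp add: cauchy_top_def)
      qed
    qed
    have "filterlim (\<lambda>n. R (r n) - Im w) at_infinity sequentially"
      using filterlim_at_top_imp_at_infinity[OF filterlim_tendsto_add_at_top[OF tendsto_const[of "- Im w"] Rlim]] by simp
    then have "(\<lambda>n. M * pi / (R (r n) - Im w)) \<longlonglongrightarrow> 0"
      by (intro tendsto_divide_0[OF tendsto_const])
    then have "(\<lambda>n. (cmod (cauchy_top (s (r n)) (R (r n)) \<phi> w))\<^sup>2) \<longlonglongrightarrow> 0"
      by (rule Lim_null_comparison[rotated]) (use ev in simp)
    then have "(\<lambda>n. sqrt ((cmod (cauchy_top (s (r n)) (R (r n)) \<phi> w))\<^sup>2)) \<longlonglongrightarrow> sqrt 0"
      by (intro tendsto_intros)
    then show "(\<lambda>n. cauchy_top (s (r n)) (R (r n)) \<phi> w) \<longlonglongrightarrow> 0"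
      by (simp add: tendsto_norm_zero_iff)
  qed
  then have "\<forall>w\<in>half_strip \<sigma> 0. (\<lambda>n. cauchy_sides (s (r n)) (t (r n)) (R (r n)) \<phi> w) \<longlonglongrightarrow> strip_sum \<sigma> g1 g2 g3 w" by simp
  with g1(1) g2(1) g3(1) r show ?thesis by blast
qed

lemma strip_sum_cmult: "strip_sum \<sigma> (\<lambda>z. c * g1 z) (\<lambda>z. c * g2 z) (\<lambda>z. c * g3 z) w = c * strip_sum \<sigma> g1 g2 g3 w"
  by (simp add: strip_sum_def distrib_left)

theorem half_strip_decomposition:
  assumes G: "G holomorphic_on half_strip \<sigma> 0" and b: "side_bound \<sigma> M G" and "M \<ge> 0" "\<sigma> > 0"
  shows "\<exists>N\<ge>0. \<exists>g1 g2 g3. hardy2 N g1 \<and> hardy2 N g2 \<and> hardy2 N g3 \<and> (\<forall>w\<in>half_strip \<sigma> 0. G w = strip_sum \<sigma> g1 g2 g3 w)"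
proof -
  obtain g1 g2 g3 r where h: "hardy2 (8 * pi\<^sup>2 * M) g1" "hardy2 (8 * pi\<^sup>2 * M) g2" "hardy2 (8 * pi\<^sup>2 * M) g3" and r: "strict_mono (r :: nat \<Rightarrow> nat)"
    and lim: "\<And>w. w\<in>half_strip \<sigma> 0 \<Longrightarrow> (\<lambda>n. cauchy_sides (inner_width \<sigma> (r n)) (inner_base (r n)) (inner_height (r n)) G w) \<longlonglongrightarrow> strip_sum \<sigma> g1 g2 g3 w"
    using sides_compactness[OF holomorphic_on_imp_continuous_on[OF G] b assms(3,4)] by blast
  define c where "c = 1 / (2 * pi * \<i>)"
  have "G w = strip_sum \<sigma> (\<lambda>z. c * g1 z) (\<lambda>z. c * g2 z) (\<lambda>z. c * g3 z) w" if w: "w \<in> half_strip \<sigma> 0" for w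
  proof -
    have "\<forall>\<^sub>F n in sequentially. cauchy_sides (inner_width \<sigma> n) (inner_base n) (inner_height n) G w = 2 * pi * \<i> * G w"
      using eventually_in_inner_rectangle[OF w \<open>\<sigma> > 0\<close>]
      by eventually_elim (intro cauchy_formula_rectangle[OF G, symmetric] inner_rectangle[OF \<open>\<sigma> > 0\<close>]; simp)
    then have "\<forall>\<^sub>F n in sequentially. cauchy_sides (inner_width \<sigma> (r n)) (inner_base (r n)) (inner_height (r n)) G w = 2 * pi * \<i> * G w"
      by (rule eventually_compose_filterlim[OF _ filterlim_subseq[OF r]])
    from LIMSEQ_unique[OF lim[OF w] tendsto_eventually[OF this]] show ?thesis
      unfolding strip_sum_cmult by (simp add: c_def)
  qed
  moreover have "(cmod c)\<^sup>2 * (8 * pi\<^sup>2 * M) \<ge> 0" using \<open>M \<ge> 0\<close> by simp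
  ultimately show ?thesis
    using hardy2_cmult[OF h(1), of c] hardy2_cmult[OF h(2), of c] hardy2_cmult[OF h(3), of c] by blast
qed

section \<open>Harmonic majorant\<close>

text \<open>
  At an interior maximum point of \<open>|F|\<^sup>q - Re K\<close> with positive value, \<open>F\<close> is not 0, so near that point
  \<open>|F|\<^sup>q\<close> is the modulus of a holomorphic branch \<open>h\<close> of \<open>F\<^sup>q\<close>. For the unimodular \<open>c\<close> that makes \<open>c h\<close>
  positive at the point, \<open>Re (c h - K)\<close> is below \<open>|F|\<^sup>q - Re K\<close> and touches it there, so the maximum modulus
  principle for \<open>exp (c h - K)\<close> yields further maximum points on all sides.
\<close>

lemma powr_norm_le_Re_max_principle:
  fixes F K :: "complex \<Rightarrow> complex" and q :: real
  assumes D: "open D" "bounded D" and F: "F holomorphic_on D" and K: "K holomorphic_on D"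
    and Kpos: "\<And>z. z \<in> D \<Longrightarrow> 0 \<le> Re (K z)" and "q > 0"
    and bdry: "\<And>c e. c \<in> frontier D \<Longrightarrow> e > 0 \<Longrightarrow> \<exists>\<delta>>0. \<forall>z\<in>D. dist z c < \<delta> \<longrightarrow> cmod (F z) powr q - Re (K z) \<le> e"
    and w: "w \<in> D"
  shows "cmod (F w) powr q \<le> Re (K w)"
proof (rule ccontr)
  define u where "u z = cmod (F z) powr q - Re (K z)" for z
  assume "\<not> ?thesis"
  then have uw: "u w > 0" by (simp add: u_def)
  have cu: "continuous_on D u"
    unfolding u_def using \<open>q > 0\<close>
    by (intro continuous_intros continuous_on_powr' holomorphic_on_imp_continuous_on F K) auto
  define A where "A = {z\<in>D. u z \<ge> u w}"
  have "closed A"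
    unfolding closed_sequential_limits
  proof (intro allI impI, elim conjE)
    fix x l assume x: "\<forall>n. x n \<in> A" "x \<longlonglongrightarrow> l"
    have xD: "x n \<in> D" for n using x by (auto simp: A_def)
    have "l \<in> closure D"
      using x xD closure_sequential by blast
    moreover have "l \<notin> frontier D"
    proof
      assume "l \<in> frontier D"
      then obtain \<delta> where \<delta>: "\<delta> > 0" "\<And>z. z \<in> D \<Longrightarrow> dist z l < \<delta> \<Longrightarrow> u z \<le> u w / 2"
        using bdry[of l "u w / 2"] uw by (auto simp: u_def)
      have "\<forall>\<^sub>F n in sequentially. dist (x n) l < \<delta>"
        using x(2) \<delta>(1) by (rule tendstoD)
      then obtain n where "dist (x n) l < \<delta>"
        using eventually_happens'[OF sequentially_bot] by blast
      then have "u (x n) \<le> u w / 2" using \<delta>(2) xD by blast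
      moreover have "u w \<le> u (x n)" using x(1) by (simp add: A_def)
      ultimately show False using uw by linarith
    qed
    ultimately have "l \<in> D"
      using D(1) by (simp add: frontier_def interior_open)
    then have "(\<lambda>n. u (x n)) \<longlonglongrightarrow> u l"
      using continuous_on_tendsto_compose[OF cu x(2)] xD by simp
    then have "u w \<le> u l"
      by (rule LIMSEQ_le_const) (use x(1) in \<open>auto simp: A_def\<close>)
    with \<open>l \<in> D\<close> show "l \<in> A" by (simp add: A_def)
  qed
  moreover have "bounded A"
    using D(2) by (rule bounded_subset) (auto simp: A_def)
  ultimately have "compact A" by (simp add: compact_eq_bounded_closed)
  have "w \<in> A" using w by (simp add: A_def)
  have "continuous_on A u" using cu by (rule continuous_on_subset) (auto simp: A_def)
  then obtain z0 where z0: "z0 \<in> A" "\<And>z. z \<in> A \<Longrightarrow> u z \<le> u z0"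
    using continuous_attains_sup[OF \<open>compact A\<close>, of u] \<open>w \<in> A\<close> by blast
  have max: "u z \<le> u z0" if "z \<in> D" for z
    using z0(2)[of z] z0(1) that by (cases "z \<in> A") (auto simp: A_def)
  \<comment> \<open>The rightmost maximum point is impossible, as there are others to its right.\<close>
  define B where "B = {z\<in>A. u z0 \<le> u z}"
  have "compact B"
  proof -
    have "B = A \<inter> u -` {u z0..}" by (auto simp: B_def)
    moreover have "closed (A \<inter> u -` {u z0..})"
      using \<open>continuous_on A u\<close> \<open>closed A\<close> by (intro continuous_closed_preimage) auto
    ultimately show ?thesis
      using \<open>compact A\<close> by (metis Int_lower1 bounded_subset compact_eq_bounded_closed)
  qed
  moreover have "B \<noteq> {}" using z0(1) by (auto simp: B_def)
  ultimately obtain z1 where z1: "z1 \<in> B" "\<And>z. z \<in> B \<Longrightarrow> Re z \<le> Re z1"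
    using continuous_attains_sup[OF _ _ continuous_on_Re[OF continuous_on_id], of B] by blast
  have "z1 \<in> D" "u z0 \<le> u z1" "u w \<le> u z1"
    using z1(1) by (auto simp: B_def A_def)
  then have z1D: "z1 \<in> D" "u z1 = u z0" "u z1 > 0"
    using max[of z1] uw by linarith+
  have "F z1 \<noteq> 0"
  proof
    assume "F z1 = 0"
    then have "u z1 \<le> 0" using Kpos[OF z1D(1)] by (simp add: u_def)
    with z1D(3) show False by simp
  qed
  have "isCont F z1"
    using holomorphic_on_imp_continuous_on[OF F] D(1) z1D(1) by (simp add: continuous_on_eq_continuous_at)
  then obtain d where d: "d > 0" "\<And>z. dist z1 z < d \<Longrightarrow> F z \<noteq> 0"
    using continuous_at_avoid[of z1 F 0] \<open>F z1 \<noteq> 0\<close> by blast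
  obtain d' where d': "d' > 0" "ball z1 d' \<subseteq> D"
    using D(1) z1D(1) openE by blast
  define r where "r = min d d'"
  have r: "r > 0" "ball z1 r \<subseteq> D" "\<And>z. z \<in> ball z1 r \<Longrightarrow> F z \<noteq> 0"
    using d d' by (auto simp: r_def)
  have Fb: "F holomorphic_on ball z1 r" and Kb: "K holomorphic_on ball z1 r"
    using F K r(2) by (auto intro: holomorphic_on_subset)
  obtain g where g: "g holomorphic_on ball z1 r" "\<And>z. z \<in> ball z1 r \<Longrightarrow> F z = exp (g z)"
    using contractible_imp_holomorphic_log[OF Fb convex_imp_contractible[OF convex_ball] r(3)] by blast
  define h where "h z = exp (of_real q * g z)" for z
  have hF: "cmod (h z) = cmod (F z) powr q" if "z \<in> ball z1 r" for z
  proof -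
    have "cmod (h z) = exp (q * Re (g z))" by (simp add: h_def)
    also have "\<dots> = cmod (F z) powr q"
      using g(2)[OF that] by (simp add: powr_def)
    finally show ?thesis .
  qed
  define c where "c = cnj (h z1) / of_real (cmod (h z1))"
  have "h z1 \<noteq> 0" by (simp add: h_def)
  then have c: "cmod c = 1" "c * h z1 = of_real (cmod (h z1))"
    by (auto simp: c_def norm_divide complex_norm_square[symmetric] power2_eq_square mult.commute)
  define v where "v z = c * h z - K z" for z
  have vu: "Re (v z) \<le> u z" if "z \<in> ball z1 r" for z
  proof -
    have "Re (c * h z) \<le> cmod (c * h z)" by (rule complex_Re_le_cmod)
    also have "\<dots> = cmod (F z) powr q" using hF[OF that] c by (simp add: norm_mult)
    finally show ?thesis by (simp add: v_def u_def)
  qed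
  have v1: "Re (v z1) = u z1"
    using hF[of z1] r(1) by (simp add: v_def c u_def)
  have hol: "(\<lambda>z. exp (v z)) holomorphic_on ball z1 r"
    unfolding v_def h_def by (intro holomorphic_intros g Kb)
  have "(\<lambda>z. exp (v z)) constant_on ball z1 r"
  proof (rule maximum_modulus_principle[OF hol, of "ball z1 r" z1])
    fix z assume z: "z \<in> ball z1 r"
    have "Re (v z) \<le> u z0" using vu[OF z] max[of z] r(2) z by auto
    then show "cmod (exp (v z)) \<le> cmod (exp (v z1))"
      using v1 z1D(2) by simp
  qed (use r(1) in auto)
  then have const: "exp (v z) = exp (v z1)" if "z \<in> ball z1 r" for z
    using that r(1) by (auto simp: constant_on_def)
  define z2 where "z2 = z1 + of_real (r / 2)"
  have z2: "z2 \<in> ball z1 r" using r(1) by (simp add: z2_def dist_norm)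
  have "Re (v z2) = Re (v z1)"
    using const[OF z2] by (metis exp_inj_iff norm_exp_eq_Re)
  then have "u z0 \<le> u z2"
    using vu[OF z2] v1 z1D(2) by simp
  then have "z2 \<in> B"
    using z2 r(2) z0(1) by (auto simp: B_def A_def)
  then have "Re z2 \<le> Re z1" by (rule z1(2))
  then show False using r(1) by (simp add: z2_def)
qed

lemma integral_poisson_half:
  assumes "y > 0" "h > 0"
  shows "integral {x..x + h} (\<lambda>t. poisson y (x - t)) = arctan (h / y) / pi"
    and "integral {x - h..x} (\<lambda>t. poisson y (x - t)) = arctan (h / y) / pi"
proof -
  have d: "((\<lambda>t. arctan ((t - x) / y) / pi) has_vector_derivative poisson y (x - t)) (at t within S)" for t S
  proof -
    have pos: "(t - x)\<^sup>2 + y\<^sup>2 > 0" using assms by (auto intro: add_nonneg_pos)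
    have "1 + ((t - x) / y)\<^sup>2 = ((t - x)\<^sup>2 + y\<^sup>2) / y\<^sup>2"
      using assms by (simp add: power_divide field_simps)
    then have "(1 / y) * (1 / (1 + ((t - x) / y)\<^sup>2)) / pi = poisson y (x - t)"
      using assms pos by (simp add: poisson_def power2_commute[of x] power2_eq_square[of y])
    moreover have "((\<lambda>t. arctan ((t - x) / y) / pi) has_real_derivative (1 / y) * (1 / (1 + ((t - x) / y)\<^sup>2)) / pi) (at t within S)"
      using assms by (auto intro!: derivative_eq_intros simp: inverse_eq_divide)
    ultimately show ?thesis by (simp add: has_real_derivative_iff_has_vector_derivative)
  qed
  have "((\<lambda>t. poisson y (x - t)) has_integral (arctan ((x + h - x) / y) / pi - arctan ((x - x) / y) / pi)) {x..x + h}"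
    using assms by (intro fundamental_theorem_of_calculus d) auto
  then show "integral {x..x + h} (\<lambda>t. poisson y (x - t)) = arctan (h / y) / pi"
    by (simp add: integral_unique)
  have "((\<lambda>t. poisson y (x - t)) has_integral (arctan ((x - x) / y) / pi - arctan ((x - h - x) / y) / pi)) {x - h..x}"
    using assms by (intro fundamental_theorem_of_calculus d) auto
  then show "integral {x - h..x} (\<lambda>t. poisson y (x - t)) = arctan (h / y) / pi"
    by (simp add: integral_unique arctan_minus)
qed

lemma cauchy_transform_Im_nonneg:
  assumes \<phi>: "continuous_on {a..b} \<phi>" and nn: "\<And>t. t \<in> {a..b} \<Longrightarrow> 0 \<le> \<phi> t"
  shows "0 \<le> Im (cauchy_transform a b (\<lambda>t. complex_of_real (\<phi> t)) z)"
proof (cases "Im z > 0")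
  case True
  then obtain x y where z: "z = Complex x y" "y > 0" by (cases z) auto
  have "continuous_on {a..b} (\<lambda>t. complex_of_real (\<phi> t))" by (intro continuous_intros \<phi>)
  then have "Im (cauchy_transform a b (\<lambda>t. complex_of_real (\<phi> t)) (Complex x y)) =
      (LINT t|lborel. pi * (poisson y (x - t) * Re (cutoff a b (\<lambda>t. complex_of_real (\<phi> t)) t)))"
    by (rule cauchy_transform_Im(1)[OF _ _ z(2)]) simp
  moreover have "0 \<le> pi * (poisson y (x - t) * Re (cutoff a b (\<lambda>t. complex_of_real (\<phi> t)) t))" for t
    using nn[of t] z(2) by (cases "t \<in> {a..b}") (auto simp: cutoff_def poisson_nonneg)
  ultimately show ?thesis
    unfolding z(1) by (simp only: Bochner_Integration.integral_nonneg)
qed (simp add: cauchy_transform_def)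

text \<open>
  Even near an end of the segment, one of the two one-sided neighbourhoods of the foot of a point lies
  within the segment, and it carries almost one half of the mass of the Poisson kernel. Doubled data thus
  dominate \<open>\<phi>\<close> up to and including the end points.
\<close>

lemma cauchy_transform_Im_boundary:
  assumes ab: "a < b" and \<phi>: "continuous_on {a..b} \<phi>" and nn: "\<And>t. t \<in> {a..b} \<Longrightarrow> 0 \<le> \<phi> t"
    and c: "c \<in> {a..b}" and "e > 0"
  shows "\<exists>\<delta>>0. \<forall>x y. x \<in> {a..b} \<and> \<bar>x - c\<bar> < \<delta> \<and> 0 < y \<and> y < \<delta> \<longrightarrow>
    \<phi> c - e \<le> Im (cauchy_transform a b (\<lambda>t. complex_of_real (2 * \<phi> t)) (Complex x y)) / pi"
proof (cases "\<phi> c \<le> e")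
  case True
  have "continuous_on {a..b} (\<lambda>t. 2 * \<phi> t)" by (intro continuous_intros \<phi>)
  from cauchy_transform_Im_nonneg[OF this] nn have "0 \<le> Im (cauchy_transform a b (\<lambda>t. complex_of_real (2 * \<phi> t)) z)" for z
    by (simp del: of_real_mult)
  then show ?thesis
    using True by (intro exI[of _ 1]) (auto simp del: of_real_mult intro: order.trans[of _ 0])
next
  case False
  define L where "L = \<phi> c - e / 2"
  have L: "L > 0" "\<phi> c - e = L - e / 2" using False \<open>e > 0\<close> by (auto simp: L_def)
  obtain d where d: "d > 0" "\<And>t. t \<in> {a..b} \<Longrightarrow> dist t c < d \<Longrightarrow> dist (\<phi> t) (\<phi> c) < e / 2"
    using \<phi> c \<open>e > 0\<close> unfolding continuous_on_iff by (meson half_gt_zero)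
  define h where "h = min (d / 4) ((b - a) / 4)"
  have h: "h > 0" "h \<le> d / 4" "h \<le> (b - a) / 4"
    using d(1) ab unfolding h_def by (simp, intro min.cobounded1, intro min.cobounded2)
  have near: "L \<le> \<phi> t" if "t \<in> {a..b}" "\<bar>t - c\<bar> < d" for t
    using d(2)[OF that(1)] that(2) unfolding L_def dist_real_def by linarith
  have "((\<lambda>y. 2 * L * (arctan (h / y) / pi)) \<longlongrightarrow> L) (at_right 0)"
    using h(1) by real_asymp
  then have "\<forall>\<^sub>F y in at_right 0. L - e / 2 < 2 * L * (arctan (h / y) / pi)"
    by (rule order_tendstoD) (use \<open>e > 0\<close> in auto)
  then obtain \<eta> where \<eta>: "\<eta> > 0" "\<And>y. 0 < y \<Longrightarrow> y < \<eta> \<Longrightarrow> L - e / 2 < 2 * L * (arctan (h / y) / pi)"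
    unfolding eventually_at_right_field by blast
  define \<delta> where "\<delta> = min \<eta> h"
  have \<delta>: "\<delta> > 0" "\<delta> \<le> \<eta>" "\<delta> \<le> h" using \<eta> h by (auto simp: \<delta>_def)
  have main: "\<phi> c - e \<le> Im (cauchy_transform a b (\<lambda>t. complex_of_real (2 * \<phi> t)) (Complex x y)) / pi"
    if x: "x \<in> {a..b}" "\<bar>x - c\<bar> < \<delta>" and y: "0 < y" "y < \<delta>" for x y
  proof -
    obtain l u where lu: "{l..u} \<subseteq> {a..b}" "\<And>t. t \<in> {l..u} \<Longrightarrow> \<bar>t - c\<bar> < d"
      "integral {l..u} (\<lambda>t. poisson y (x - t)) = arctan (h / y) / pi"
    proof (cases "x + h \<le> b")
      case True
      show ?thesis
      proof (rule that[of x "x + h"])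
        show "{x..x + h} \<subseteq> {a..b}" using True x by auto
        show "\<bar>t - c\<bar> < d" if "t \<in> {x..x + h}" for t using that x(2) \<delta> h d(1) by auto
      qed (rule integral_poisson_half[OF y(1) h(1)])
    next
      case False
      show ?thesis
      proof (rule that[of "x - h" x])
        have "a \<le> x - h" using False h ab by argo
        then show "{x - h..x} \<subseteq> {a..b}" using x by auto
        show "\<bar>t - c\<bar> < d" if "t \<in> {x - h..x}" for t using that x(2) \<delta> h d(1) by auto
      qed (rule integral_poisson_half[OF y(1) h(1)])
    qed
    have c2: "continuous_on {a..b} (\<lambda>t. complex_of_real (2 * \<phi> t))" by (intro continuous_intros \<phi>)
    have Im0: "Im (complex_of_real (2 * \<phi> t)) = 0" for t by simp
    let ?I = "\<lambda>t. pi * (poisson y (x - t) * Re (cutoff a b (\<lambda>t. complex_of_real (2 * \<phi> t)) t))"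
    have CI: "Im (cauchy_transform a b (\<lambda>t. complex_of_real (2 * \<phi> t)) (Complex x y)) = (LINT t|lborel. ?I t)"
      "integrable lborel ?I"
      by (rule cauchy_transform_Im[OF c2 Im0 y(1)])+
    have cp: "continuous_on {l..u} (\<lambda>t. complex_of_real (poisson y (x - t)))"
      unfolding poisson_def using y by (intro continuous_intros) (auto simp: add_nonneg_eq_0_iff)
    have "integrable lborel (\<lambda>t. indicator {l..u} t *\<^sub>R complex_of_real (poisson y (x - t)))"
      by (rule continuous_integral_lborel(1)[OF cp])
    then have "integrable lborel (\<lambda>t. Re (indicator {l..u} t *\<^sub>R complex_of_real (poisson y (x - t))))"
      by (rule integrable_Re)
    then have pi1: "integrable lborel (\<lambda>t. indicator {l..u} t * poisson y (x - t))" by simp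
    have cp': "continuous_on {l..u} (\<lambda>t. poisson y (x - t))"
      unfolding poisson_def using y by (intro continuous_intros) (auto simp: add_nonneg_eq_0_iff)
    have pi2: "(LINT t|lborel. indicator {l..u} t * poisson y (x - t)) = arctan (h / y) / pi"
      using set_borel_integral_eq_integral(2)[of "{l..u}" "\<lambda>t. poisson y (x - t)"] pi1 lu(3)
      by (simp add: set_integrable_def set_lebesgue_integral_def)
    have "pi * (2 * L * (arctan (h / y) / pi)) = (LINT t|lborel. pi * (2 * L) * (indicator {l..u} t * poisson y (x - t)))"
      using pi2 by simp
    also have "\<dots> \<le> (LINT t|lborel. ?I t)"
    proof (intro integral_mono CI(2) integrable_mult_right pi1)
      fix t
      have p: "poisson y (x - t) \<ge> 0" using y by (simp add: poisson_nonneg)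
      show "pi * (2 * L) * (indicator {l..u} t * poisson y (x - t)) \<le> ?I t"
      proof (cases "t \<in> {l..u}")
        case True
        then have "t \<in> {a..b}" "L \<le> \<phi> t" using lu near by blast+
        then show ?thesis
          using True p mult_right_mono[of L "\<phi> t" "poisson y (x - t)"] by (simp add: cutoff_def mult_ac)
      next
        case False
        then show ?thesis
          using nn[of t] p by (auto simp: cutoff_def indicator_def)
      qed
    qed
    finally have "2 * L * (arctan (h / y) / pi) \<le> Im (cauchy_transform a b (\<lambda>t. complex_of_real (2 * \<phi> t)) (Complex x y)) / pi"
      unfolding CI(1) by (simp add: field_simps)
    moreover have "L - e / 2 < 2 * L * (arctan (h / y) / pi)"
      using y \<delta> by (intro \<eta>(2)) auto
    ultimately show ?thesis using L(2) by linarith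
  qed
  with \<delta>(1) show ?thesis by blast
qed

text \<open>
  All four Poisson integrals \<open>J1\<close> to \<open>J4\<close> are nonnegative, and near a boundary point, corners included,
  the one belonging to a side through that point is at least \<open>|F|\<^sup>q\<close> up to a small error. The maximum
  principle extends the comparison to the interior.
\<close>

lemma powr_norm_le_cauchy_sides:
  assumes F: "F holomorphic_on half_strip \<sigma> 0" and "q > 0" and st: "0 < s" "s < \<sigma>" "0 < t" "t < R"
    and w: "\<bar>Re w\<bar> < s" "t < Im w" "Im w < R"
  defines "\<phi> \<equiv> (\<lambda>z. complex_of_real (2 * cmod (F z) powr q))"
  shows "cmod (F w) powr q \<le>
    Im (cauchy_sides s t R \<phi> w) / pi"
proof -
  define \<psi> where "\<psi> z = cmod (F z) powr q" for z
  have c\<psi>: "continuous_on (half_strip \<sigma> 0) \<psi>"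
    unfolding \<psi>_def using \<open>q > 0\<close>
    by (intro continuous_intros continuous_on_powr' holomorphic_on_imp_continuous_on F) auto
  have \<psi>0: "\<psi> z \<ge> 0" for z by (simp add: \<psi>_def)
  have c\<phi>: "continuous_on (half_strip \<sigma> 0) \<phi>"
    unfolding \<phi>_def \<psi>_def[symmetric] by (intro continuous_intros c\<psi>)
  define D where "D = {z. - s < Re z \<and> Re z < s \<and> t < Im z \<and> Im z < R}"
  have D_eq: "D = {z. Re z > - s} \<inter> {z. Re z < s} \<inter> {z. Im z > t} \<inter> {z. Im z < R}"
    by (auto simp: D_def)
  have D: "open D" "bounded D"
  proof -
    show "open D"
      unfolding D_eq by (intro open_Int open_halfspace_Re_lt open_halfspace_Re_gt open_halfspace_Im_gt open_halfspace_Im_lt)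
    have "D \<subseteq> cbox (Complex (- s) t) (Complex s R)"
      by (auto simp: D_def in_cbox_complex_iff)
    then show "bounded D" using bounded_cbox bounded_subset by blast
  qed
  have Dsub: "D \<subseteq> half_strip \<sigma> 0" using st by (auto simp: D_def half_strip_def)
  note cs = continuous_on_sides[OF c\<phi> st(1-3)]
  have hol: "cauchy_left s t R \<phi> holomorphic_on D" "cauchy_bottom s t \<phi> holomorphic_on D"
    "cauchy_right s t R \<phi> holomorphic_on D" "cauchy_top s R \<phi> holomorphic_on D"
  proof -
    show "cauchy_left s t R \<phi> holomorphic_on D"
      unfolding cauchy_left_def
      by (rule holomorphic_on_compose_gen[OF _ cauchy_transform_holomorphic[OF cs(1)], unfolded o_def])
        (auto intro!: holomorphic_intros simp: D_def)
    show "cauchy_bottom s t \<phi> holomorphic_on D"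
      unfolding cauchy_bottom_def
      by (rule holomorphic_on_compose_gen[OF _ cauchy_transform_holomorphic[OF cs(2)], unfolded o_def])
        (auto intro!: holomorphic_intros simp: D_def)
    show "cauchy_right s t R \<phi> holomorphic_on D"
      unfolding cauchy_right_def
      by (rule holomorphic_on_compose_gen[OF _ cauchy_transform_holomorphic[OF cs(3)], unfolded o_def])
        (auto intro!: holomorphic_intros simp: D_def)
    show "cauchy_top s R \<phi> holomorphic_on D"
      unfolding cauchy_top_def
      by (rule holomorphic_on_compose_gen[OF _ cauchy_transform_holomorphic[OF cs(4)[OF st(4)]], unfolded o_def])
        (auto intro!: holomorphic_intros simp: D_def)
  qed
  define K where "K z = cauchy_sides s t R \<phi> z / (pi * \<i>)" for z
  have K: "K holomorphic_on D"
    unfolding K_def cauchy_sides_def by (intro holomorphic_intros hol) auto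
  define J1 J2 J3 J4 where "J1 z = Im (cauchy_left s t R \<phi> z) / pi" and "J2 z = Im (cauchy_bottom s t \<phi> z) / pi"
    and "J3 z = Im (cauchy_right s t R \<phi> z) / pi" and "J4 z = Im (cauchy_top s R \<phi> z) / pi" for z
  have ReK: "Re (K z) = J1 z + J2 z + J3 z + J4 z" for z
    by (simp add: K_def cauchy_sides_def J1_def J2_def J3_def J4_def Re_divide power2_eq_square add_divide_distrib)
  have cp: "continuous_on {- R..- t} (\<lambda>x. \<psi> (Complex (- s) (- x)))" "continuous_on {- s..s} (\<lambda>x. \<psi> (Complex x t))"
    "continuous_on {t..R} (\<lambda>x. \<psi> (Complex s x))" "continuous_on {- s..s} (\<lambda>x. \<psi> (Complex (- x) R))"
    using st by (auto intro!: continuous_on_compose2[OF c\<psi>] continuous_intros simp: half_strip_def)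
  have J: "0 \<le> J1 z" "0 \<le> J2 z" "0 \<le> J3 z" "0 \<le> J4 z" for z
    unfolding J1_def J2_def J3_def J4_def cauchy_left_def cauchy_bottom_def cauchy_right_def cauchy_top_def \<phi>_def \<psi>_def[symmetric]
    by (intro divide_nonneg_nonneg cauchy_transform_Im_nonneg continuous_intros cp; simp add: \<psi>0)+
  have near_side: "\<exists>\<delta>>0. \<forall>z\<in>D. dist z c < \<delta> \<longrightarrow> \<psi> z - (J1 z + J2 z + J3 z + J4 z) \<le> e"
    if c: "c \<in> half_strip \<sigma> 0" and "e > 0"
      and side: "\<exists>\<delta>>0. \<forall>z\<in>D. dist z c < \<delta> \<longrightarrow> \<psi> c - e / 2 \<le> J1 z + J2 z + J3 z + J4 z" for c e
  proof -
    have "isCont \<psi> c"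
      using c\<psi> c by (simp add: continuous_on_eq_continuous_at open_half_strip)
    then obtain d where d: "d > 0" "\<And>z. dist z c < d \<Longrightarrow> dist (\<psi> z) (\<psi> c) < e / 2"
      unfolding continuous_at_eps_delta using \<open>e > 0\<close> by (meson half_gt_zero)
    obtain \<delta> where \<delta>: "\<delta> > 0" "\<And>z. z \<in> D \<Longrightarrow> dist z c < \<delta> \<Longrightarrow> \<psi> c - e / 2 \<le> J1 z + J2 z + J3 z + J4 z"
      using side by blast
    have "\<psi> z - (J1 z + J2 z + J3 z + J4 z) \<le> e" if "z \<in> D" "dist z c < min d \<delta>" for z
    proof -
      have "\<psi> z - \<psi> c < e / 2"
        using d(2)[of z] that abs_ge_self[of "\<psi> z - \<psi> c"] unfolding dist_real_def
        by (meson le_less_trans min_less_iff_conj)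
      moreover have "\<psi> c - e / 2 \<le> J1 z + J2 z + J3 z + J4 z"
        using \<delta>(2)[of z] that by simp
      ultimately show ?thesis by argo
    qed
    moreover have "min d \<delta> > 0" using d(1) \<delta>(1) by simp
    ultimately show ?thesis by blast
  qed
  have "\<psi> w \<le> Re (K w)"
    unfolding \<psi>_def
  proof (rule powr_norm_le_Re_max_principle[OF D holomorphic_on_subset[OF F Dsub] K _ \<open>q > 0\<close>])
    show "w \<in> D" using w by (auto simp: D_def)
    show "0 \<le> Re (K z)" for z using J[of z] by (simp add: ReK)
    fix c e assume c: "c \<in> frontier D" and "(e::real) > 0"
    have "c \<in> closure D" "c \<notin> D"
      using c D(1) by (auto simp: frontier_def interior_open)
    have "closure D \<subseteq> cbox (Complex (- s) t) (Complex s R)"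
      by (rule closure_minimal) (auto simp: D_def in_cbox_complex_iff)
    with \<open>c \<in> closure D\<close> have cb: "- s \<le> Re c" "Re c \<le> s" "t \<le> Im c" "Im c \<le> R"
      by (auto simp: in_cbox_complex_iff)
    then have cs: "c \<in> half_strip \<sigma> 0" using st by (auto simp: half_strip_def)
    have re: "\<bar>Re z - Re c\<bar> \<le> dist z c" and im: "\<bar>Im z - Im c\<bar> \<le> dist z c" for z
      using abs_Re_le_cmod[of "z - c"] abs_Im_le_cmod[of "z - c"] by (auto simp: dist_norm)
    have seg: "\<exists>\<delta>>0. \<forall>z\<in>D. dist z c < \<delta> \<longrightarrow> \<psi> c - e / 2 \<le> J1 z + J2 z + J3 z + J4 z"
      if ab: "a < b" and cont: "continuous_on {a..b} (\<lambda>x. \<psi> (P x))" and x0: "x0 \<in> {a..b}" "P x0 = c"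
        and XY: "\<And>z. z \<in> D \<Longrightarrow> X z \<in> {a..b} \<and> 0 < Y z \<and> \<bar>X z - x0\<bar> \<le> dist z c \<and> Y z \<le> dist z c"
        and le: "\<And>z. Im (cauchy_transform a b (\<lambda>x. complex_of_real (2 * \<psi> (P x))) (Complex (X z) (Y z))) / pi \<le> J1 z + J2 z + J3 z + J4 z"
      for a b P x0 X Y
    proof -
      obtain \<delta> where \<delta>: "\<delta> > 0" "\<And>x y. x \<in> {a..b} \<Longrightarrow> \<bar>x - x0\<bar> < \<delta> \<Longrightarrow> 0 < y \<Longrightarrow> y < \<delta> \<Longrightarrow>
         \<psi> c - e / 2 \<le> Im (cauchy_transform a b (\<lambda>x. complex_of_real (2 * \<psi> (P x))) (Complex x y)) / pi"
        using cauchy_transform_Im_boundary[OF ab cont _ x0(1), of "e / 2"] \<psi>0 \<open>e > 0\<close> unfolding x0(2)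
        by (auto simp del: of_real_mult)
      have "\<psi> c - e / 2 \<le> J1 z + J2 z + J3 z + J4 z" if "z \<in> D" "dist z c < \<delta>" for z
        using XY[OF that(1)] that(2) by (intro order.trans[OF \<delta>(2) le]) auto
      with \<delta>(1) show ?thesis by blast
    qed
    consider (left) "Re c = - s" | (right) "Re c = s" | (bottom) "Im c = t" | (top) "Im c = R"
      using \<open>c \<notin> D\<close> cb by (force simp: D_def)
    then have "\<exists>\<delta>>0. \<forall>z\<in>D. dist z c < \<delta> \<longrightarrow> \<psi> c - e / 2 \<le> J1 z + J2 z + J3 z + J4 z"
    proof cases
      case left
      have eq: "\<i> * (z + of_real s) = Complex (- Im z) (Re z + s)" for z by (simp add: complex_eq_iff)
      have le: "Im (cauchy_transform (- R) (- t) (\<lambda>x. complex_of_real (2 * \<psi> (Complex (- s) (- x)))) (Complex (- Im z) (Re z + s))) / pi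
          \<le> J1 z + J2 z + J3 z + J4 z" for z
        using J[of z] unfolding J1_def cauchy_left_def eq \<phi>_def \<psi>_def[symmetric] by simp
      show ?thesis
        by (rule seg[OF _ cp(1) _ _ _ le, of "- Im c"]) (use left re im st cb in \<open>auto simp: D_def complex_eq_iff abs_le_iff\<close>)
    next
      case right
      have eq: "- \<i> * (z - of_real s) = Complex (Im z) (s - Re z)" for z by (simp add: complex_eq_iff)
      have le: "Im (cauchy_transform t R (\<lambda>x. complex_of_real (2 * \<psi> (Complex s x))) (Complex (Im z) (s - Re z))) / pi
          \<le> J1 z + J2 z + J3 z + J4 z" for z
        using J[of z] unfolding J3_def cauchy_right_def eq \<phi>_def \<psi>_def[symmetric] by simp
      show ?thesis
        by (rule seg[OF _ cp(3) _ _ _ le, of "Im c"]) (use right re im st cb in \<open>auto simp: D_def complex_eq_iff abs_le_iff\<close>)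
    next
      case bottom
      have eq: "z - \<i> * of_real t = Complex (Re z) (Im z - t)" for z by (simp add: complex_eq_iff)
      have le: "Im (cauchy_transform (- s) s (\<lambda>x. complex_of_real (2 * \<psi> (Complex x t))) (Complex (Re z) (Im z - t))) / pi
          \<le> J1 z + J2 z + J3 z + J4 z" for z
        using J[of z] unfolding J2_def cauchy_bottom_def eq \<phi>_def \<psi>_def[symmetric] by simp
      show ?thesis
        by (rule seg[OF _ cp(2) _ _ _ le, of "Re c"]) (use bottom re im st cb in \<open>auto simp: D_def complex_eq_iff abs_le_iff\<close>)
    next
      case top
      have eq: "\<i> * of_real R - z = Complex (- Re z) (R - Im z)" for z by (simp add: complex_eq_iff)
      have le: "Im (cauchy_transform (- s) s (\<lambda>x. complex_of_real (2 * \<psi> (Complex (- x) R))) (Complex (- Re z) (R - Im z))) / pi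
          \<le> J1 z + J2 z + J3 z + J4 z" for z
        using J[of z] unfolding J4_def cauchy_top_def eq \<phi>_def \<psi>_def[symmetric] by simp
      show ?thesis
        by (rule seg[OF _ cp(4) _ _ _ le, of "- Re c"]) (use top re im st cb in \<open>auto simp: D_def complex_eq_iff abs_le_iff\<close>)
    qed
    from near_side[OF cs \<open>e > 0\<close> this]
    show "\<exists>\<delta>>0. \<forall>z\<in>D. dist z c < \<delta> \<longrightarrow> cmod (F z) powr q - Re (K z) \<le> e"
      unfolding \<psi>_def ReK .
  qed
  also have "Re (K w) = Im (cauchy_sides s t R \<phi> w) / pi"
    by (simp add: cauchy_sides_def ReK J1_def J2_def J3_def J4_def add_divide_distrib)
  finally show ?thesis by (simp add: \<psi>_def)
qed

theorem half_strip_majorant: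
  assumes F: "F holomorphic_on half_strip \<sigma> 0" and b: "side_bound \<sigma> M (\<lambda>z. complex_of_real (2 * cmod (F z) powr q))"
    and "M \<ge> 0" "\<sigma> > 0" "q > 0"
  shows "\<exists>N\<ge>0. \<exists>g1 g2 g3. hardy2 N g1 \<and> hardy2 N g2 \<and> hardy2 N g3 \<and>
    (\<forall>w\<in>half_strip \<sigma> 0. cmod (F w) powr q \<le> Re (strip_sum \<sigma> g1 g2 g3 w))"
proof -
  define \<phi> where "\<phi> = (\<lambda>z. complex_of_real (2 * cmod (F z) powr q))"
  have c\<phi>: "continuous_on (half_strip \<sigma> 0) \<phi>"
    unfolding \<phi>_def using \<open>q > 0\<close>
    by (intro continuous_intros continuous_on_powr' holomorphic_on_imp_continuous_on F) auto
  obtain g1 g2 g3 r where h: "hardy2 (8 * pi\<^sup>2 * M) g1" "hardy2 (8 * pi\<^sup>2 * M) g2" "hardy2 (8 * pi\<^sup>2 * M) g3" and r: "strict_mono (r :: nat \<Rightarrow> nat)"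
    and lim: "\<And>w. w\<in>half_strip \<sigma> 0 \<Longrightarrow> (\<lambda>n. cauchy_sides (inner_width \<sigma> (r n)) (inner_base (r n)) (inner_height (r n)) \<phi> w) \<longlonglongrightarrow> strip_sum \<sigma> g1 g2 g3 w"
    using sides_compactness[OF c\<phi> b[folded \<phi>_def] assms(3,4)] by blast
  define c where "c = 1 / (pi * \<i>)"
  have Re_c: "Re (c * z) = Im z / pi" for z
    by (simp add: c_def Re_divide power2_eq_square)
  have "cmod (F w) powr q \<le> Re (strip_sum \<sigma> (\<lambda>z. c * g1 z) (\<lambda>z. c * g2 z) (\<lambda>z. c * g3 z) w)" if w: "w \<in> half_strip \<sigma> 0" for w
  proof -
    have "\<forall>\<^sub>F n in sequentially. cmod (F w) powr q \<le> Im (cauchy_sides (inner_width \<sigma> n) (inner_base n) (inner_height n) \<phi> w) / pi"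
      using eventually_in_inner_rectangle[OF w \<open>\<sigma> > 0\<close>] unfolding \<phi>_def
      by eventually_elim (intro powr_norm_le_cauchy_sides[OF F \<open>q > 0\<close>] inner_rectangle[OF \<open>\<sigma> > 0\<close>]; simp)
    then have ev: "\<forall>\<^sub>F n in sequentially. cmod (F w) powr q \<le> Im (cauchy_sides (inner_width \<sigma> (r n)) (inner_base (r n)) (inner_height (r n)) \<phi> w) / pi"
      by (rule eventually_compose_filterlim[OF _ filterlim_subseq[OF r]])
    have "(\<lambda>n. Im (cauchy_sides (inner_width \<sigma> (r n)) (inner_base (r n)) (inner_height (r n)) \<phi> w) / pi) \<longlonglongrightarrow> Im (strip_sum \<sigma> g1 g2 g3 w) / pi"
      by (intro tendsto_intros lim w) auto
    then show ?thesis
      unfolding strip_sum_cmult Re_c by (rule tendsto_lowerbound) (use ev in auto)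
  qed
  moreover have "(cmod c)\<^sup>2 * (8 * pi\<^sup>2 * M) \<ge> 0" using \<open>M \<ge> 0\<close> by simp
  ultimately show ?thesis
    using hardy2_cmult[OF h(1), of c] hardy2_cmult[OF h(2), of c] hardy2_cmult[OF h(3), of c] by blast
qed

section \<open>Square-mean convergence on the three boundary lines\<close>

lemma tendsto_at_right_0_ennrealI:
  fixes X :: "real \<Rightarrow> ennreal"
  assumes "\<And>e. e > 0 \<Longrightarrow> \<exists>\<delta>>0. \<forall>\<tau>. 0 < \<tau> \<and> \<tau> < \<delta> \<longrightarrow> X \<tau> \<le> ennreal e"
  shows "(X \<longlongrightarrow> 0) (at_right 0)"
proof (rule order_tendstoI)
  fix a :: ennreal assume "0 < a"
  then obtain e where e: "0 < e" "ennreal e < a"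
    by (metis dense ennreal_cases ennreal_less_zero_iff ennreal_0 less_top not_less_iff_gr_or_eq order_less_trans)
  obtain \<delta> where \<delta>: "\<delta> > 0" "\<And>\<tau>. 0 < \<tau> \<Longrightarrow> \<tau> < \<delta> \<Longrightarrow> X \<tau> \<le> ennreal e"
    using assms[OF e(1)] by blast
  show "\<forall>\<^sub>F \<tau> in at_right 0. X \<tau> < a"
    unfolding eventually_at_right_field using \<delta> e(2) le_less_trans by blast
qed simp

lemma tendsto_at_right_0_sequentiallyI:
  fixes X :: "real \<Rightarrow> 'a :: topological_space"
  assumes "\<And>\<tau>. (\<And>n. \<tau> n > 0) \<Longrightarrow> \<tau> \<longlonglongrightarrow> 0 \<Longrightarrow> (\<lambda>n. X (\<tau> n)) \<longlonglongrightarrow> l"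
  shows "(X \<longlongrightarrow> l) (at_right 0)"
  unfolding tendsto_at_iff_sequentially using assms by (auto simp: o_def)

text \<open>
  Split \<open>g n\<close> into \<open>min (g n) H\<close>, to which dominated convergence applies, and a rest of at most \<open>E n\<close>.
\<close>

lemma nn_integral_generalized_dominated:
  fixes g :: "nat \<Rightarrow> 'a \<Rightarrow> ennreal"
  assumes [measurable]: "\<And>n. g n \<in> borel_measurable M" "H \<in> borel_measurable M" "\<And>n. E n \<in> borel_measurable M"
    and lim: "AE x in M. (\<lambda>n. g n x) \<longlonglongrightarrow> 0"
    and bound: "\<forall>\<^sub>F n in sequentially. AE x in M. g n x \<le> H x + E n x"
    and H: "(\<integral>\<^sup>+x. H x \<partial>M) < top" and E: "(\<lambda>n. \<integral>\<^sup>+x. E n x \<partial>M) \<longlonglongrightarrow> 0"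
  shows "(\<lambda>n. \<integral>\<^sup>+x. g n x \<partial>M) \<longlonglongrightarrow> 0"
proof -
  have "(\<lambda>n. \<integral>\<^sup>+x. min (g n x) (H x) \<partial>M) \<longlonglongrightarrow> (\<integral>\<^sup>+x. 0 \<partial>M)"
  proof (rule nn_integral_dominated_convergence[where w = H])
    show "AE x in M. (\<lambda>n. min (g n x) (H x)) \<longlonglongrightarrow> 0"
      using lim
    proof eventually_elim
      case (elim x)
      show ?case
        by (rule tendsto_sandwich[OF _ _ tendsto_const elim]) auto
    qed
  qed (use H in auto)
  then have "(\<lambda>n. (\<integral>\<^sup>+x. min (g n x) (H x) \<partial>M) + (\<integral>\<^sup>+x. E n x \<partial>M)) \<longlonglongrightarrow> 0 + 0"
    using E by (intro tendsto_add) auto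
  then have lim2: "(\<lambda>n. (\<integral>\<^sup>+x. min (g n x) (H x) \<partial>M) + (\<integral>\<^sup>+x. E n x \<partial>M)) \<longlonglongrightarrow> 0"
    by simp
  show ?thesis
  proof (rule tendsto_sandwich[OF _ _ tendsto_const lim2])
    show "\<forall>\<^sub>F n in sequentially. (\<integral>\<^sup>+x. g n x \<partial>M) \<le> (\<integral>\<^sup>+x. min (g n x) (H x) \<partial>M) + (\<integral>\<^sup>+x. E n x \<partial>M)"
      using bound
    proof eventually_elim
      case (elim n)
      have "(\<integral>\<^sup>+x. g n x \<partial>M) \<le> (\<integral>\<^sup>+x. min (g n x) (H x) + E n x \<partial>M)"
      proof (rule nn_integral_mono_AE)
        show "AE x in M. g n x \<le> min (g n x) (H x) + E n x"
          using elim by eventually_elim (auto simp: min_def)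
      qed
      then show ?case by (simp add: nn_integral_add)
    qed
  qed simp
qed

definition restr :: "real set \<Rightarrow> (real \<Rightarrow> complex) \<Rightarrow> real \<Rightarrow> complex" where
  "restr S g x = indicator S x *\<^sub>R g x"

lemma restr_measurable [measurable]:
  assumes [measurable]: "S \<in> sets borel" "g \<in> borel_measurable borel"
  shows "restr S g \<in> borel_measurable borel"
  unfolding restr_def by measurable

lemma sqnorm_restr_le: "S \<subseteq> T \<Longrightarrow> sqnorm (restr S g) \<le> sqnorm (restr T g)"
  unfolding sqnorm_def restr_def by (intro nn_integral_mono) (auto simp: indicator_def)

lemma sqnorm_restr_le': "sqnorm (restr S g) \<le> sqnorm g"
  unfolding sqnorm_def restr_def by (intro nn_integral_mono) (auto simp: indicator_def)

lemma sqnorm_restr_vanishing: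
  assumes [measurable]: "S \<in> sets borel" "\<And>\<tau>. I \<tau> \<in> sets borel" "b \<in> borel_measurable borel"
    and fin: "sqnorm (restr S b) < top"
    and ev: "\<And>x. x \<in> S \<Longrightarrow> \<forall>\<^sub>F \<tau> in at_right 0. x \<in> I \<tau>"
  shows "((\<lambda>\<tau>. sqnorm (restr (S - I \<tau>) b)) \<longlongrightarrow> 0) (at_right (0::real))"
proof (rule tendsto_at_right_0_sequentiallyI)
  fix \<tau> :: "nat \<Rightarrow> real" assume \<tau>: "\<And>n. \<tau> n > 0" "\<tau> \<longlonglongrightarrow> 0"
  have f: "filterlim \<tau> (at_right 0) sequentially"
    using \<tau> by (auto simp: filterlim_at less_imp_neq[THEN not_sym] intro!: always_eventually)
  have "(\<lambda>n. sqnorm (restr (S - I (\<tau> n)) b)) \<longlonglongrightarrow> (\<integral>\<^sup>+x. 0 \<partial>(lborel :: real measure))"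
    unfolding sqnorm_def
  proof (rule nn_integral_dominated_convergence[where w = "\<lambda>x. ennreal ((cmod (restr S b x))\<^sup>2)"])
    show "AE x in lborel. (\<lambda>n. ennreal ((cmod (restr (S - I (\<tau> n)) b x))\<^sup>2)) \<longlonglongrightarrow> 0"
    proof (rule AE_I2, rule tendsto_eventually)
      fix x
      show "\<forall>\<^sub>F n in sequentially. ennreal ((cmod (restr (S - I (\<tau> n)) b x))\<^sup>2) = 0"
      proof (cases "x \<in> S")
        case True
        have "\<forall>\<^sub>F n in sequentially. x \<in> I (\<tau> n)"
          by (rule eventually_compose_filterlim[OF ev[OF True] f])
        then show ?thesis by eventually_elim (simp add: restr_def)
      qed (simp add: restr_def)
    qed
  qed (use fin in \<open>auto simp: sqnorm_def restr_def indicator_def\<close>)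
  then show "(\<lambda>n. sqnorm (restr (S - I (\<tau> n)) b)) \<longlonglongrightarrow> 0" by simp
qed

text \<open>
  The sums in question live on the smaller sets \<open>I \<tau>\<close>. Their deviation from the limit on \<open>S\<close> consists of
  the three errors and of the part of the limit outside \<open>I \<tau>\<close>, whose norm tends to 0 as \<open>I \<tau>\<close>
  exhausts \<open>S\<close>.
\<close>

lemma sqnorm_three_tendsto:
  fixes a1 a2 a3 :: "real \<Rightarrow> real \<Rightarrow> complex"
  assumes [measurable]: "S \<in> sets borel" "\<And>\<tau>. I \<tau> \<in> sets borel"
    "\<And>\<tau>. a1 \<tau> \<in> borel_measurable borel" "\<And>\<tau>. a2 \<tau> \<in> borel_measurable borel" "\<And>\<tau>. a3 \<tau> \<in> borel_measurable borel"
    "b1 \<in> borel_measurable borel" "b2 \<in> borel_measurable borel" "b3 \<in> borel_measurable borel"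
    and conv: "((\<lambda>\<tau>. sqnorm (restr S (\<lambda>x. a1 \<tau> x - b1 x))) \<longlongrightarrow> 0) (at_right 0)"
      "((\<lambda>\<tau>. sqnorm (restr S (\<lambda>x. a2 \<tau> x - b2 x))) \<longlongrightarrow> 0) (at_right 0)"
      "((\<lambda>\<tau>. sqnorm (restr S (\<lambda>x. a3 \<tau> x - b3 x))) \<longlongrightarrow> 0) (at_right 0)"
    and fin: "sqnorm (restr S b1) < top" "sqnorm (restr S b2) < top" "sqnorm (restr S b3) < top"
    and sub: "\<And>\<tau>. \<tau> > 0 \<Longrightarrow> I \<tau> \<subseteq> S" and ev: "\<And>x. x \<in> S \<Longrightarrow> \<forall>\<^sub>F \<tau> in at_right 0. x \<in> I \<tau>"
  shows "sqnorm (restr S (\<lambda>x. b1 x + b2 x + b3 x)) < top"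
    and "((\<lambda>\<tau>. sqnorm (\<lambda>x. restr (I \<tau>) (\<lambda>x. a1 \<tau> x + a2 \<tau> x + a3 \<tau> x) x - restr S (\<lambda>x. b1 x + b2 x + b3 x) x)) \<longlongrightarrow> 0) (at_right 0)"
proof -
  have three: "sqnorm (restr T (\<lambda>x. u1 x + u2 x + u3 x)) \<le> 2 * (2 * sqnorm (restr T u1) + 2 * sqnorm (restr T u2)) + 2 * sqnorm (restr T u3)"
    if [measurable]: "T \<in> sets borel" "u1 \<in> borel_measurable borel" "u2 \<in> borel_measurable borel" "u3 \<in> borel_measurable borel" for T u1 u2 u3
  proof -
    have "restr T (\<lambda>x. u1 x + u2 x + u3 x) = (\<lambda>x. (restr T u1 x + restr T u2 x) + restr T u3 x)"
      by (auto simp: restr_def scaleR_add_right)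
    then have "sqnorm (restr T (\<lambda>x. u1 x + u2 x + u3 x)) \<le> 2 * sqnorm (\<lambda>x. restr T u1 x + restr T u2 x) + 2 * sqnorm (restr T u3)"
      using sqnorm_add_le[of "\<lambda>x. restr T u1 x + restr T u2 x" "restr T u3"] by simp
    also have "\<dots> \<le> 2 * (2 * sqnorm (restr T u1) + 2 * sqnorm (restr T u2)) + 2 * sqnorm (restr T u3)"
      by (intro add_right_mono mult_left_mono sqnorm_add_le) auto
    finally show ?thesis .
  qed
  show fin3: "sqnorm (restr S (\<lambda>x. b1 x + b2 x + b3 x)) < top"
    by (rule le_less_trans[OF three]) (use fin in \<open>auto simp: ennreal_mult_less_top ennreal_add_eq_top less_top\<close>)
  let ?U = "\<lambda>\<tau>. 2 * (2 * (2 * sqnorm (restr S (\<lambda>x. a1 \<tau> x - b1 x)) + 2 * sqnorm (restr S (\<lambda>x. a2 \<tau> x - b2 x))) + 2 * sqnorm (restr S (\<lambda>x. a3 \<tau> x - b3 x)))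
      + 2 * sqnorm (restr (S - I \<tau>) (\<lambda>x. b1 x + b2 x + b3 x))"
  have "((\<lambda>\<tau>. sqnorm (restr (S - I \<tau>) (\<lambda>x. b1 x + b2 x + b3 x))) \<longlongrightarrow> 0) (at_right 0)"
    by (rule sqnorm_restr_vanishing[OF _ _ _ fin3 ev]) auto
  then have "(?U \<longlongrightarrow> 2 * (2 * (2 * 0 + 2 * 0) + 2 * 0) + 2 * 0) (at_right 0)"
    by (intro tendsto_add ennreal_tendsto_cmult conv) auto
  then have U: "(?U \<longlongrightarrow> 0) (at_right 0)" by simp
  show "((\<lambda>\<tau>. sqnorm (\<lambda>x. restr (I \<tau>) (\<lambda>x. a1 \<tau> x + a2 \<tau> x + a3 \<tau> x) x - restr S (\<lambda>x. b1 x + b2 x + b3 x) x)) \<longlongrightarrow> 0) (at_right 0)"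
  proof (rule tendsto_sandwich[OF _ _ tendsto_const U])
    show "\<forall>\<^sub>F \<tau> in at_right 0. sqnorm (\<lambda>x. restr (I \<tau>) (\<lambda>x. a1 \<tau> x + a2 \<tau> x + a3 \<tau> x) x - restr S (\<lambda>x. b1 x + b2 x + b3 x) x) \<le> ?U \<tau>"
      using eventually_at_right_less[of "0::real"]
    proof eventually_elim
      case (elim \<tau>)
      let ?d = "\<lambda>x. (a1 \<tau> x - b1 x) + (a2 \<tau> x - b2 x) + (a3 \<tau> x - b3 x)"
      let ?b = "\<lambda>x. b1 x + b2 x + b3 x"
      have "(\<lambda>x. restr (I \<tau>) (\<lambda>x. a1 \<tau> x + a2 \<tau> x + a3 \<tau> x) x - restr S ?b x) = (\<lambda>x. restr (I \<tau>) ?d x + - restr (S - I \<tau>) ?b x)"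
      proof
        fix x
        show "restr (I \<tau>) (\<lambda>x. a1 \<tau> x + a2 \<tau> x + a3 \<tau> x) x - restr S ?b x = restr (I \<tau>) ?d x + - restr (S - I \<tau>) ?b x"
          using sub[OF elim] by (cases "x \<in> I \<tau>"; cases "x \<in> S") (auto simp: restr_def)
      qed
      then have "sqnorm (\<lambda>x. restr (I \<tau>) (\<lambda>x. a1 \<tau> x + a2 \<tau> x + a3 \<tau> x) x - restr S ?b x) \<le> 2 * sqnorm (restr (I \<tau>) ?d) + 2 * sqnorm (\<lambda>x. - restr (S - I \<tau>) ?b x)"
        using sqnorm_add_le[of "restr (I \<tau>) ?d" "\<lambda>x. - restr (S - I \<tau>) ?b x"] by simp
      also have "\<dots> \<le> 2 * sqnorm (restr S ?d) + 2 * sqnorm (restr (S - I \<tau>) ?b)"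
        using sub[OF elim] by (simp add: sqnorm_restr_le mult_left_mono)
      also have "\<dots> \<le> ?U \<tau>"
        by (intro add_right_mono mult_left_mono three) auto
      finally show ?case .
    qed
  qed simp
qed

lemma hardy2_same_line:
  assumes f: "hardy2 M f"
  shows "((\<lambda>\<tau>. sqnorm (\<lambda>x. f (Complex x \<tau>) - boundary_value f x)) \<longlongrightarrow> 0) (at_right 0)"
  by (rule tendsto_at_right_0_ennrealI) (rule hardy2_boundary_convergence[OF f])

lemma sqnorm_restr_pos:
  assumes [measurable]: "g \<in> borel_measurable borel"
  shows "sqnorm (restr {0<..} g) = (\<integral>\<^sup>+y. indicator {0<..} y * ennreal ((cmod (g y))\<^sup>2) \<partial>lborel)"
  unfolding sqnorm_def restr_def by (intro nn_integral_cong) (auto simp: indicator_def)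

lemma hardy2_transversal_line:
  assumes f: "hardy2 M f" and c: "\<bar>c\<bar> = 1"
  shows "((\<lambda>\<tau>. sqnorm (restr {0<..} (\<lambda>y. f (Complex (x + c * \<tau>) y) - f (Complex x y)))) \<longlongrightarrow> 0) (at_right 0)"
    and "sqnorm (restr {0<..} (\<lambda>y. f (Complex x y))) < top"
proof -
  note [measurable] = hardy2_measurable[OF f]
  have "hardy2 (max M 0) f" using hardy2_mono[OF f] by simp
  from hardy2_transversal[OF this, of x] have "sqnorm (restr {0<..} (\<lambda>y. f (Complex x y))) \<le> ennreal (4 * max M 0)"
    by (simp add: sqnorm_restr_pos)
  then show "sqnorm (restr {0<..} (\<lambda>y. f (Complex x y))) < top"
    by (rule le_less_trans) simp
  show "((\<lambda>\<tau>. sqnorm (restr {0<..} (\<lambda>y. f (Complex (x + c * \<tau>) y) - f (Complex x y)))) \<longlongrightarrow> 0) (at_right 0)"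
  proof (rule tendsto_at_right_0_ennrealI)
    fix e :: real assume "e > 0"
    then obtain \<delta> where \<delta>: "\<delta> > 0" "\<And>\<tau>. \<bar>\<tau>\<bar> < \<delta> \<Longrightarrow> hardy2 (e / 4) (\<lambda>z. f (z + of_real \<tau>) - f z)"
      using hardy2_horizontal_translate[OF f, of "e / 4"] by auto
    have "sqnorm (restr {0<..} (\<lambda>y. f (Complex (x + c * \<tau>) y) - f (Complex x y))) \<le> ennreal e" if "0 < \<tau>" "\<tau> < \<delta>" for \<tau>
    proof -
      have "\<bar>c * \<tau>\<bar> < \<delta>" using c that by (simp add: abs_mult)
      from hardy2_transversal[OF \<delta>(2)[OF this], of x] show ?thesis
        using \<open>e > 0\<close> by (simp add: sqnorm_restr_pos Complex_plus)
    qed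
    then show "\<exists>\<delta>>0. \<forall>\<tau>. 0 < \<tau> \<and> \<tau> < \<delta> \<longrightarrow> sqnorm (restr {0<..} (\<lambda>y. f (Complex (x + c * \<tau>) y) - f (Complex x y))) \<le> ennreal e"
      using \<delta>(1) by blast
  qed
qed

lemma hardy2_parallel_line:
  assumes f: "hardy2 M f" and "h > 0"
  shows "((\<lambda>\<tau>. sqnorm (\<lambda>x. f (Complex x (h - \<tau>)) - f (Complex x h))) \<longlongrightarrow> 0) (at_right 0)"
    and "sqnorm (\<lambda>x. f (Complex x h)) < top"
proof -
  show "sqnorm (\<lambda>x. f (Complex x h)) < top"
    using hardy2_sqnorm[OF f \<open>h > 0\<close>] by (rule le_less_trans) simp
  show "((\<lambda>\<tau>. sqnorm (\<lambda>x. f (Complex x (h - \<tau>)) - f (Complex x h))) \<longlongrightarrow> 0) (at_right 0)"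
  proof (rule tendsto_at_right_0_ennrealI)
    fix e :: real assume "e > 0"
    then obtain \<delta> where \<delta>: "\<delta> > 0" "\<And>\<tau>. 0 < \<tau> \<Longrightarrow> \<tau> < \<delta> \<Longrightarrow> hardy2 e (\<lambda>z. f (z + \<i> * of_real \<tau>) - f z)"
      using hardy2_vertical_translate[OF f, of e] by auto
    have "sqnorm (\<lambda>x. f (Complex x (h - \<tau>)) - f (Complex x h)) \<le> ennreal e" if "0 < \<tau>" "\<tau> < min \<delta> h" for \<tau>
    proof -
      have "sqnorm (\<lambda>x. f (Complex x (h - \<tau>) + \<i> * of_real \<tau>) - f (Complex x (h - \<tau>))) \<le> ennreal e"
        using that by (intro hardy2_sqnorm[OF \<delta>(2)]) auto
      moreover have "cmod (f (Complex x h) - f (Complex x (h - \<tau>))) = cmod (f (Complex x (h - \<tau>)) - f (Complex x h))" for x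
        by (rule norm_minus_commute)
      ultimately show ?thesis by (simp add: sqnorm_def Complex_plus)
    qed
    then show "\<exists>\<delta>>0. \<forall>\<tau>. 0 < \<tau> \<and> \<tau> < \<delta> \<longrightarrow> sqnorm (\<lambda>x. f (Complex x (h - \<tau>)) - f (Complex x h)) \<le> ennreal e"
      using \<delta>(1) \<open>h > 0\<close> by (intro exI[of _ "min \<delta> h"]) auto
  qed
qed

lemma sqnorm_reflect:
  assumes [measurable]: "g \<in> borel_measurable borel"
  shows "sqnorm (\<lambda>x. g (- x)) = sqnorm g"
  unfolding sqnorm_def using nn_integral_reflect[of "\<lambda>x. ennreal ((cmod (g x))\<^sup>2)"] by simp

text \<open>
  Boundary values of \<open>strip_sum\<close> on the three lines, in terms of the free coordinate. On each line
  one summand is at the boundary of its half-plane and the other two are inside theirs.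
\<close>

definition strip_left :: "real \<Rightarrow> (complex \<Rightarrow> complex) \<Rightarrow> (complex \<Rightarrow> complex) \<Rightarrow> (complex \<Rightarrow> complex) \<Rightarrow> real \<Rightarrow> complex" where
  "strip_left \<sigma> g1 g2 g3 v = boundary_value g1 (- v) + g2 (Complex (- \<sigma>) v) + g3 (Complex v (2 * \<sigma>))"

definition strip_bottom :: "real \<Rightarrow> (complex \<Rightarrow> complex) \<Rightarrow> (complex \<Rightarrow> complex) \<Rightarrow> (complex \<Rightarrow> complex) \<Rightarrow> real \<Rightarrow> complex" where
  "strip_bottom \<sigma> g1 g2 g3 u = g1 (Complex 0 (\<sigma> + u)) + boundary_value g2 u + g3 (Complex 0 (\<sigma> - u))"

definition strip_right :: "real \<Rightarrow> (complex \<Rightarrow> complex) \<Rightarrow> (complex \<Rightarrow> complex) \<Rightarrow> (complex \<Rightarrow> complex) \<Rightarrow> real \<Rightarrow> complex" where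
  "strip_right \<sigma> g1 g2 g3 v = g1 (Complex (- v) (2 * \<sigma>)) + g2 (Complex \<sigma> v) + boundary_value g3 v"

context
  fixes \<sigma> N :: real and g1 g2 g3 :: "complex \<Rightarrow> complex"
  assumes \<sigma>: "\<sigma> > 0" and g: "hardy2 N g1" "hardy2 N g2" "hardy2 N g3"
begin

lemma strip_measurable:
  "strip_left \<sigma> g1 g2 g3 \<in> borel_measurable borel"
  "strip_bottom \<sigma> g1 g2 g3 \<in> borel_measurable borel"
  "strip_right \<sigma> g1 g2 g3 \<in> borel_measurable borel"
  "strip_sum \<sigma> g1 g2 g3 \<in> borel_measurable borel"
proof -
  note [measurable] = g[THEN hardy2_measurable] g[THEN boundary_value_measurable]
  show "strip_left \<sigma> g1 g2 g3 \<in> borel_measurable borel" "strip_bottom \<sigma> g1 g2 g3 \<in> borel_measurable borel"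
    "strip_right \<sigma> g1 g2 g3 \<in> borel_measurable borel" "strip_sum \<sigma> g1 g2 g3 \<in> borel_measurable borel"
    unfolding strip_left_def strip_bottom_def strip_right_def strip_sum_def by measurable
qed

text \<open>
  Along the left side, \<open>g1\<close> is evaluated on lines approaching the boundary of its half-plane, \<open>g2\<close> on
  lines perpendicular to the boundary of its own, and \<open>g3\<close> on lines approaching the parallel at
  distance \<open>2 \<sigma>\<close>.
\<close>

lemma strip_left_convergence:
  "sqnorm (restr {0<..} (strip_left \<sigma> g1 g2 g3)) < top"
  "((\<lambda>\<tau>. sqnorm (\<lambda>v. restr {\<tau><..} (\<lambda>v. strip_sum \<sigma> g1 g2 g3 (Complex (\<tau> - \<sigma>) v)) v - restr {0<..} (strip_left \<sigma> g1 g2 g3) v)) \<longlongrightarrow> 0) (at_right 0)"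
proof -
  note [measurable] = g[THEN hardy2_measurable] g[THEN boundary_value_measurable]
  have eq: "strip_sum \<sigma> g1 g2 g3 (Complex (\<tau> - \<sigma>) v) = g1 (Complex (- v) \<tau>) + g2 (Complex (\<tau> - \<sigma>) v) + g3 (Complex v (2 * \<sigma> - \<tau>))" for \<tau> v
  proof -
    have "\<i> * (Complex (\<tau> - \<sigma>) v + of_real \<sigma>) = Complex (- v) \<tau>" "- \<i> * (Complex (\<tau> - \<sigma>) v - of_real \<sigma>) = Complex v (2 * \<sigma> - \<tau>)"
      by (auto simp: complex_eq_iff)
    then show ?thesis by (simp add: strip_sum_def del: minus_mult_left)
  qed
  have r: "sqnorm (\<lambda>v. g1 (Complex (- v) \<tau>) - boundary_value g1 (- v)) = sqnorm (\<lambda>v. g1 (Complex v \<tau>) - boundary_value g1 v)" for \<tau>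
    using sqnorm_reflect[of "\<lambda>v. g1 (Complex v \<tau>) - boundary_value g1 v"] by simp
  have r': "sqnorm (\<lambda>v. boundary_value g1 (- v)) = sqnorm (boundary_value g1)"
    by (rule sqnorm_reflect) measurable
  have c1: "((\<lambda>\<tau>. sqnorm (restr {0<..} (\<lambda>v. g1 (Complex (- v) \<tau>) - boundary_value g1 (- v)))) \<longlongrightarrow> 0) (at_right 0)"
    by (rule tendsto_sandwich[OF _ _ tendsto_const hardy2_same_line[OF g(1)]])
      (auto simp: r[symmetric] intro!: always_eventually sqnorm_restr_le')
  have c2: "((\<lambda>\<tau>. sqnorm (restr {0<..} (\<lambda>v. g2 (Complex (\<tau> - \<sigma>) v) - g2 (Complex (- \<sigma>) v)))) \<longlongrightarrow> 0) (at_right 0)"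
    using hardy2_transversal_line(1)[OF g(2), of 1 "- \<sigma>"] by simp
  have c3: "((\<lambda>\<tau>. sqnorm (restr {0<..} (\<lambda>v. g3 (Complex v (2 * \<sigma> - \<tau>)) - g3 (Complex v (2 * \<sigma>))))) \<longlongrightarrow> 0) (at_right 0)"
    by (rule tendsto_sandwich[OF _ _ tendsto_const hardy2_parallel_line(1)[OF g(3), of "2 * \<sigma>"]])
      (use \<sigma> in \<open>auto intro!: always_eventually sqnorm_restr_le'\<close>)
  have f1: "sqnorm (restr {0<..} (\<lambda>v. boundary_value g1 (- v))) < top"
    by (rule le_less_trans[OF sqnorm_restr_le'], subst r', rule le_less_trans[OF hardy2_boundary_sqnorm[OF g(1)]]) simp
  have f2: "sqnorm (restr {0<..} (\<lambda>v. g2 (Complex (- \<sigma>) v))) < top"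
    using hardy2_transversal_line(2)[OF g(2), of 1] by simp
  have f3: "sqnorm (restr {0<..} (\<lambda>v. g3 (Complex v (2 * \<sigma>)))) < top"
    by (rule le_less_trans[OF sqnorm_restr_le' hardy2_parallel_line(2)[OF g(3)]]) (use \<sigma> in simp)
  have ev: "\<forall>\<^sub>F \<tau> in at_right 0. x \<in> {\<tau><..}" if "x \<in> {0<..}" for x :: real
    using that eventually_at_right_real[of 0 x] by (auto elim: eventually_mono)
  note T = sqnorm_three_tendsto[of "{0<..}" "\<lambda>\<tau>. {\<tau><..}" "\<lambda>\<tau> v. g1 (Complex (- v) \<tau>)" "\<lambda>\<tau> v. g2 (Complex (\<tau> - \<sigma>) v)" "\<lambda>\<tau> v. g3 (Complex v (2 * \<sigma> - \<tau>))",
      OF _ _ _ _ _ _ _ _ c1 c2 c3 f1 f2 f3 _ ev]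
  show "sqnorm (restr {0<..} (strip_left \<sigma> g1 g2 g3)) < top"
    unfolding strip_left_def[abs_def] by (rule T(1)) auto
  show "((\<lambda>\<tau>. sqnorm (\<lambda>v. restr {\<tau><..} (\<lambda>v. strip_sum \<sigma> g1 g2 g3 (Complex (\<tau> - \<sigma>) v)) v - restr {0<..} (strip_left \<sigma> g1 g2 g3) v)) \<longlongrightarrow> 0) (at_right 0)"
    unfolding strip_left_def[abs_def] eq by (rule T(2)) auto
qed

lemma strip_right_convergence:
  "sqnorm (restr {0<..} (strip_right \<sigma> g1 g2 g3)) < top"
  "((\<lambda>\<tau>. sqnorm (\<lambda>v. restr {\<tau><..} (\<lambda>v. strip_sum \<sigma> g1 g2 g3 (Complex (\<sigma> - \<tau>) v)) v - restr {0<..} (strip_right \<sigma> g1 g2 g3) v)) \<longlongrightarrow> 0) (at_right 0)"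
proof -
  note [measurable] = g[THEN hardy2_measurable] g[THEN boundary_value_measurable]
  have eq: "strip_sum \<sigma> g1 g2 g3 (Complex (\<sigma> - \<tau>) v) = g1 (Complex (- v) (2 * \<sigma> - \<tau>)) + g2 (Complex (\<sigma> - \<tau>) v) + g3 (Complex v \<tau>)" for \<tau> v
  proof -
    have "\<i> * (Complex (\<sigma> - \<tau>) v + of_real \<sigma>) = Complex (- v) (2 * \<sigma> - \<tau>)" "- \<i> * (Complex (\<sigma> - \<tau>) v - of_real \<sigma>) = Complex v \<tau>"
      by (auto simp: complex_eq_iff)
    then show ?thesis by (simp add: strip_sum_def del: minus_mult_left)
  qed
  have r: "sqnorm (\<lambda>v. g1 (Complex (- v) (2 * \<sigma> - \<tau>)) - g1 (Complex (- v) (2 * \<sigma>))) = sqnorm (\<lambda>v. g1 (Complex v (2 * \<sigma> - \<tau>)) - g1 (Complex v (2 * \<sigma>)))" for \<tau>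
    using sqnorm_reflect[of "\<lambda>v. g1 (Complex v (2 * \<sigma> - \<tau>)) - g1 (Complex v (2 * \<sigma>))"] by simp
  have r': "sqnorm (\<lambda>v. g1 (Complex (- v) (2 * \<sigma>))) = sqnorm (\<lambda>v. g1 (Complex v (2 * \<sigma>)))"
    using sqnorm_reflect[of "\<lambda>v. g1 (Complex v (2 * \<sigma>))"] by simp
  have c1: "((\<lambda>\<tau>. sqnorm (restr {0<..} (\<lambda>v. g1 (Complex (- v) (2 * \<sigma> - \<tau>)) - g1 (Complex (- v) (2 * \<sigma>))))) \<longlongrightarrow> 0) (at_right 0)"
    by (rule tendsto_sandwich[OF _ _ tendsto_const hardy2_parallel_line(1)[OF g(1), of "2 * \<sigma>"]])
      (use \<sigma> in \<open>auto simp: r[symmetric] intro!: always_eventually sqnorm_restr_le'\<close>)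
  have c2: "((\<lambda>\<tau>. sqnorm (restr {0<..} (\<lambda>v. g2 (Complex (\<sigma> - \<tau>) v) - g2 (Complex \<sigma> v)))) \<longlongrightarrow> 0) (at_right 0)"
    using hardy2_transversal_line(1)[OF g(2), of "- 1" \<sigma>] by simp
  have c3: "((\<lambda>\<tau>. sqnorm (restr {0<..} (\<lambda>v. g3 (Complex v \<tau>) - boundary_value g3 v))) \<longlongrightarrow> 0) (at_right 0)"
    by (rule tendsto_sandwich[OF _ _ tendsto_const hardy2_same_line[OF g(3)]])
      (auto intro!: always_eventually sqnorm_restr_le')
  have f1: "sqnorm (restr {0<..} (\<lambda>v. g1 (Complex (- v) (2 * \<sigma>)))) < top"
    by (rule le_less_trans[OF sqnorm_restr_le'], subst r', rule hardy2_parallel_line(2)[OF g(1)]) (use \<sigma> in simp)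
  have f2: "sqnorm (restr {0<..} (\<lambda>v. g2 (Complex \<sigma> v))) < top"
    using hardy2_transversal_line(2)[OF g(2), of 1] by simp
  have f3: "sqnorm (restr {0<..} (boundary_value g3)) < top"
    by (rule le_less_trans[OF sqnorm_restr_le'], rule le_less_trans[OF hardy2_boundary_sqnorm[OF g(3)]]) simp
  have ev: "\<forall>\<^sub>F \<tau> in at_right 0. x \<in> {\<tau><..}" if "x \<in> {0<..}" for x :: real
    using that eventually_at_right_real[of 0 x] by (auto elim: eventually_mono)
  note T = sqnorm_three_tendsto[of "{0<..}" "\<lambda>\<tau>. {\<tau><..}" "\<lambda>\<tau> v. g1 (Complex (- v) (2 * \<sigma> - \<tau>))" "\<lambda>\<tau> v. g2 (Complex (\<sigma> - \<tau>) v)" "\<lambda>\<tau> v. g3 (Complex v \<tau>)",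
      OF _ _ _ _ _ _ _ _ c1 c2 c3 f1 f2 f3 _ ev]
  show "sqnorm (restr {0<..} (strip_right \<sigma> g1 g2 g3)) < top"
    unfolding strip_right_def[abs_def] by (rule T(1)) auto
  show "((\<lambda>\<tau>. sqnorm (\<lambda>v. restr {\<tau><..} (\<lambda>v. strip_sum \<sigma> g1 g2 g3 (Complex (\<sigma> - \<tau>) v)) v - restr {0<..} (strip_right \<sigma> g1 g2 g3) v)) \<longlongrightarrow> 0) (at_right 0)"
    unfolding strip_right_def[abs_def] eq by (rule T(2)) auto
qed

text \<open>
  Now \<open>g1\<close> and \<open>g3\<close> are restricted to pieces of perpendicular lines and \<open>g2\<close> approaches its boundary.
\<close>

lemma strip_bottom_convergence:
  "sqnorm (restr {-\<sigma><..<\<sigma>} (strip_bottom \<sigma> g1 g2 g3)) < top"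
  "((\<lambda>\<tau>. sqnorm (\<lambda>u. restr {\<tau> - \<sigma>..\<sigma> - \<tau>} (\<lambda>u. strip_sum \<sigma> g1 g2 g3 (Complex u \<tau>)) u - restr {-\<sigma><..<\<sigma>} (strip_bottom \<sigma> g1 g2 g3) u)) \<longlongrightarrow> 0) (at_right 0)"
proof -
  note [measurable] = g[THEN hardy2_measurable] g[THEN boundary_value_measurable]
  have eq: "strip_sum \<sigma> g1 g2 g3 (Complex u \<tau>) = g1 (Complex (- \<tau>) (\<sigma> + u)) + g2 (Complex u \<tau>) + g3 (Complex \<tau> (\<sigma> - u))" for \<tau> u
  proof -
    have "\<i> * (Complex u \<tau> + of_real \<sigma>) = Complex (- \<tau>) (\<sigma> + u)" "- \<i> * (Complex u \<tau> - of_real \<sigma>) = Complex \<tau> (\<sigma> - u)"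
      by (auto simp: complex_eq_iff)
    then show ?thesis by (simp add: strip_sum_def del: minus_mult_left)
  qed
  have s1: "sqnorm (restr {-\<sigma><..<\<sigma>} (\<lambda>u. h (\<sigma> + u))) \<le> sqnorm (restr {0<..} h)"
    if [measurable]: "h \<in> borel_measurable borel" for h
  proof -
    have "sqnorm (restr {-\<sigma><..<\<sigma>} (\<lambda>u. h (\<sigma> + u))) \<le> sqnorm (\<lambda>u. restr {0<..} h (u + \<sigma>))"
      unfolding sqnorm_def restr_def by (intro nn_integral_mono) (auto simp: indicator_def add.commute)
    also have "\<dots> = sqnorm (restr {0<..} h)" by (rule sqnorm_translate) measurable
    finally show ?thesis .
  qed
  have s2: "sqnorm (restr {-\<sigma><..<\<sigma>} (\<lambda>u. h (\<sigma> - u))) \<le> sqnorm (restr {0<..} h)"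
    if [measurable]: "h \<in> borel_measurable borel" for h
  proof -
    have "restr {-\<sigma><..<\<sigma>} (\<lambda>u. h (\<sigma> - u)) = (\<lambda>u. restr {-\<sigma><..<\<sigma>} (\<lambda>u. h (\<sigma> + u)) (- u))"
      by (rule ext) (auto simp: restr_def indicator_def)
    then show ?thesis
      using sqnorm_reflect[of "restr {-\<sigma><..<\<sigma>} (\<lambda>u. h (\<sigma> + u))"] s1[OF that] by simp
  qed
  have c1: "((\<lambda>\<tau>. sqnorm (restr {-\<sigma><..<\<sigma>} (\<lambda>u. g1 (Complex (- \<tau>) (\<sigma> + u)) - g1 (Complex 0 (\<sigma> + u))))) \<longlongrightarrow> 0) (at_right 0)"
  proof (rule tendsto_sandwich[OF _ _ tendsto_const hardy2_transversal_line(1)[OF g(1), of "- 1" 0]])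
    show "\<forall>\<^sub>F \<tau> in at_right 0. sqnorm (restr {-\<sigma><..<\<sigma>} (\<lambda>u. g1 (Complex (- \<tau>) (\<sigma> + u)) - g1 (Complex 0 (\<sigma> + u))))
        \<le> sqnorm (restr {0<..} (\<lambda>y. g1 (Complex (0 + - 1 * \<tau>) y) - g1 (Complex 0 y)))"
      using s1[of "\<lambda>y. g1 (Complex (0 + - 1 * \<tau>) y) - g1 (Complex 0 y)" for \<tau>] by (auto intro!: always_eventually)
  qed auto
  have c3: "((\<lambda>\<tau>. sqnorm (restr {-\<sigma><..<\<sigma>} (\<lambda>u. g3 (Complex \<tau> (\<sigma> - u)) - g3 (Complex 0 (\<sigma> - u))))) \<longlongrightarrow> 0) (at_right 0)"
  proof (rule tendsto_sandwich[OF _ _ tendsto_const hardy2_transversal_line(1)[OF g(3), of 1 0]])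
    show "\<forall>\<^sub>F \<tau> in at_right 0. sqnorm (restr {-\<sigma><..<\<sigma>} (\<lambda>u. g3 (Complex \<tau> (\<sigma> - u)) - g3 (Complex 0 (\<sigma> - u))))
        \<le> sqnorm (restr {0<..} (\<lambda>y. g3 (Complex (0 + 1 * \<tau>) y) - g3 (Complex 0 y)))"
      using s2[of "\<lambda>y. g3 (Complex (0 + 1 * \<tau>) y) - g3 (Complex 0 y)" for \<tau>] by (auto intro!: always_eventually)
  qed auto
  have c2: "((\<lambda>\<tau>. sqnorm (restr {-\<sigma><..<\<sigma>} (\<lambda>u. g2 (Complex u \<tau>) - boundary_value g2 u))) \<longlongrightarrow> 0) (at_right 0)"
    by (rule tendsto_sandwich[OF _ _ tendsto_const hardy2_same_line[OF g(2)]])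
      (auto intro!: always_eventually sqnorm_restr_le')
  have f1: "sqnorm (restr {-\<sigma><..<\<sigma>} (\<lambda>u. g1 (Complex 0 (\<sigma> + u)))) < top"
    by (rule le_less_trans[OF s1 hardy2_transversal_line(2)[OF g(1), of 1]]) auto
  have f3: "sqnorm (restr {-\<sigma><..<\<sigma>} (\<lambda>u. g3 (Complex 0 (\<sigma> - u)))) < top"
    by (rule le_less_trans[OF s2 hardy2_transversal_line(2)[OF g(3), of 1]]) auto
  have f2: "sqnorm (restr {-\<sigma><..<\<sigma>} (boundary_value g2)) < top"
    by (rule le_less_trans[OF sqnorm_restr_le'], rule le_less_trans[OF hardy2_boundary_sqnorm[OF g(2)]]) simp
  have ev: "\<forall>\<^sub>F \<tau> in at_right 0. x \<in> {\<tau> - \<sigma>..\<sigma> - \<tau>}" if "x \<in> {-\<sigma><..<\<sigma>}" for x :: real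
  proof -
    have "0 < \<sigma> - \<bar>x\<bar>" using that by auto
    from eventually_at_right_real[OF this] show ?thesis by eventually_elim auto
  qed
  note T = sqnorm_three_tendsto[of "{-\<sigma><..<\<sigma>}" "\<lambda>\<tau>. {\<tau> - \<sigma>..\<sigma> - \<tau>}" "\<lambda>\<tau> u. g1 (Complex (- \<tau>) (\<sigma> + u))" "\<lambda>\<tau> u. g2 (Complex u \<tau>)" "\<lambda>\<tau> u. g3 (Complex \<tau> (\<sigma> - u))",
      OF _ _ _ _ _ _ _ _ c1 c2 c3 f1 f2 f3 _ ev]
  show "sqnorm (restr {-\<sigma><..<\<sigma>} (strip_bottom \<sigma> g1 g2 g3)) < top"
    unfolding strip_bottom_def[abs_def] by (rule T(1)) auto
  show "((\<lambda>\<tau>. sqnorm (\<lambda>u. restr {\<tau> - \<sigma>..\<sigma> - \<tau>} (\<lambda>u. strip_sum \<sigma> g1 g2 g3 (Complex u \<tau>)) u - restr {-\<sigma><..<\<sigma>} (strip_bottom \<sigma> g1 g2 g3) u)) \<longlongrightarrow> 0) (at_right 0)"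
    unfolding strip_bottom_def[abs_def] eq by (rule T(2)) auto
qed

end

section \<open>Non-tangential limits on the half-strip\<close>

abbreviation nt_filter :: "real \<Rightarrow> real \<Rightarrow> complex \<Rightarrow> complex filter" where
  "nt_filter \<sigma> \<alpha> \<zeta> \<equiv> at \<zeta> within cone \<sigma> \<alpha> \<zeta> \<inter> Omega_plus \<sigma>"

lemma mem_translate_image: "w \<in> (\<lambda>z. c + z) ` S \<longleftrightarrow> w - c \<in> (S :: complex set)"
proof
  assume "w - c \<in> S"
  then show "w \<in> (\<lambda>z. c + z) ` S" by (rule rev_image_eqI) simp
qed auto

lemma cone_left_iff:
  assumes "v > 0"
  shows "w \<in> cone \<sigma> \<alpha> (Complex (- \<sigma>) v) \<longleftrightarrow> 0 < Re w + \<sigma> \<and> \<bar>Im w - v\<bar> < \<alpha> * (Re w + \<sigma>)"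
  using assms by (simp add: cone_def mem_translate_image Gamma1_def)

lemma cone_bottom_iff:
  assumes "\<bar>u\<bar> \<le> \<sigma>"
  shows "w \<in> cone \<sigma> \<alpha> (Complex u 0) \<longleftrightarrow> 0 < Im w \<and> \<bar>Re w - u\<bar> < \<alpha> * Im w"
  using assms by (simp add: cone_def mem_translate_image Gamma1_def Gamma2_def)

lemma cone_right_iff:
  assumes "v > 0" "\<sigma> > 0"
  shows "w \<in> cone \<sigma> \<alpha> (Complex \<sigma> v) \<longleftrightarrow> Re w < \<sigma> \<and> \<bar>Im w - v\<bar> < \<alpha> * (\<sigma> - Re w)"
  using assms by (simp add: cone_def mem_translate_image Gamma1_def Gamma2_def right_diff_distrib)

lemma eventually_nt_filter: "\<forall>\<^sub>F w in nt_filter \<sigma> \<alpha> \<zeta>. w \<in> cone \<sigma> \<alpha> \<zeta> \<and> w \<in> half_strip \<sigma> 0 \<and> w \<noteq> \<zeta>"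
  by (auto simp: eventually_at_filter Omega_plus_def)

lemma normal_approach_left:
  assumes "v > 0" "\<sigma> > 0" "\<alpha> > 0"
  shows "filterlim (\<lambda>\<tau>. Complex (\<tau> - \<sigma>) v) (nt_filter \<sigma> \<alpha> (Complex (- \<sigma>) v)) (at_right 0)"
  unfolding filterlim_at
proof
  have "((\<lambda>\<tau>. Complex (\<tau> - \<sigma>) v) \<longlongrightarrow> Complex (0 - \<sigma>) v) (at_right 0)"
    by (intro tendsto_Complex tendsto_intros)
  then show "((\<lambda>\<tau>. Complex (\<tau> - \<sigma>) v) \<longlongrightarrow> Complex (- \<sigma>) v) (at_right 0)" by simp
  show "\<forall>\<^sub>F \<tau> in at_right 0. Complex (\<tau> - \<sigma>) v \<in> cone \<sigma> \<alpha> (Complex (- \<sigma>) v) \<inter> Omega_plus \<sigma> \<and> Complex (\<tau> - \<sigma>) v \<noteq> Complex (- \<sigma>) v"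
    using eventually_at_right_real[OF \<open>\<sigma> > 0\<close>]
    by eventually_elim (use assms in \<open>auto simp: cone_left_iff Omega_plus_def half_strip_def\<close>)
qed

lemma normal_approach_right:
  assumes "v > 0" "\<sigma> > 0" "\<alpha> > 0"
  shows "filterlim (\<lambda>\<tau>. Complex (\<sigma> - \<tau>) v) (nt_filter \<sigma> \<alpha> (Complex \<sigma> v)) (at_right 0)"
  unfolding filterlim_at
proof
  have "((\<lambda>\<tau>. Complex (\<sigma> - \<tau>) v) \<longlongrightarrow> Complex (\<sigma> - 0) v) (at_right 0)"
    by (intro tendsto_Complex tendsto_intros)
  then show "((\<lambda>\<tau>. Complex (\<sigma> - \<tau>) v) \<longlongrightarrow> Complex \<sigma> v) (at_right 0)" by simp
  show "\<forall>\<^sub>F \<tau> in at_right 0. Complex (\<sigma> - \<tau>) v \<in> cone \<sigma> \<alpha> (Complex \<sigma> v) \<inter> Omega_plus \<sigma> \<and> Complex (\<sigma> - \<tau>) v \<noteq> Complex \<sigma> v"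
    using eventually_at_right_real[OF \<open>\<sigma> > 0\<close>]
    by eventually_elim (use assms in \<open>auto simp: cone_right_iff Omega_plus_def half_strip_def\<close>)
qed

lemma normal_approach_bottom:
  assumes "\<bar>u\<bar> < \<sigma>" "\<alpha> > 0"
  shows "filterlim (\<lambda>\<tau>. Complex u \<tau>) (nt_filter \<sigma> \<alpha> (Complex u 0)) (at_right 0)"
  unfolding filterlim_at
proof
  show "((\<lambda>\<tau>. Complex u \<tau>) \<longlongrightarrow> Complex u 0) (at_right 0)"
    by (intro tendsto_Complex tendsto_intros)
  show "\<forall>\<^sub>F \<tau> in at_right 0. Complex u \<tau> \<in> cone \<sigma> \<alpha> (Complex u 0) \<inter> Omega_plus \<sigma> \<and> Complex u \<tau> \<noteq> Complex u 0"
    using eventually_at_right_less[of "0::real"]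
    by eventually_elim (use assms in \<open>auto simp: cone_bottom_iff Omega_plus_def half_strip_def\<close>)
qed

lemma hardy2_tendsto_compose:
  assumes f: "hardy2 M f" and h: "(h \<longlongrightarrow> c) F" and "Im c > 0"
  shows "((\<lambda>w. f (h w)) \<longlongrightarrow> f c) F"
proof -
  have "isCont f c"
    using holomorphic_on_imp_continuous_on[OF hardy2_holomorphic[OF f]] \<open>Im c > 0\<close>
    by (auto simp: continuous_on_eq_continuous_at open_upper_half_plane)
  then show ?thesis using h by (rule isCont_tendsto_compose)
qed

definition nt_limit_at :: "(complex \<Rightarrow> complex) \<Rightarrow> real \<Rightarrow> bool" where
  "nt_limit_at f x \<longleftrightarrow> (\<forall>\<alpha>>0. (f \<longlongrightarrow> boundary_value f x) (at (of_real x) within stolz \<alpha> x))"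

text \<open>
  The rotation takes the cone at the boundary point to a Stolz angle for \<open>g1\<close>, while the other two
  summands are continuous at that point.
\<close>

lemma strip_sum_limit_left:
  assumes g: "hardy2 N g2" "hardy2 N g3" and "v > 0" "\<sigma> > 0" "\<alpha> > 0" and nt: "nt_limit_at g1 (- v)"
  shows "(strip_sum \<sigma> g1 g2 g3 \<longlongrightarrow> strip_left \<sigma> g1 g2 g3 v) (nt_filter \<sigma> \<alpha> (Complex (- \<sigma>) v))"
  unfolding strip_sum_def[abs_def] strip_left_def
proof (intro tendsto_add)
  let ?F = "nt_filter \<sigma> \<alpha> (Complex (- \<sigma>) v)"
  have id: "((\<lambda>w. w) \<longlongrightarrow> Complex (- \<sigma>) v) ?F" by (rule tendsto_ident_at)
  have "filterlim (\<lambda>w. \<i> * (w + of_real \<sigma>)) (at (of_real (- v)) within stolz \<alpha> (- v)) ?F"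
    unfolding filterlim_at
  proof
    have "((\<lambda>w. \<i> * (w + of_real \<sigma>)) \<longlongrightarrow> \<i> * (Complex (- \<sigma>) v + of_real \<sigma>)) ?F"
      by (intro tendsto_intros id)
    moreover have "\<i> * (Complex (- \<sigma>) v + of_real \<sigma>) = of_real (- v)" by (simp add: complex_eq_iff)
    ultimately show "((\<lambda>w. \<i> * (w + of_real \<sigma>)) \<longlongrightarrow> complex_of_real (- v)) ?F" by simp
    show "\<forall>\<^sub>F w in ?F. \<i> * (w + of_real \<sigma>) \<in> stolz \<alpha> (- v) \<and> \<i> * (w + of_real \<sigma>) \<noteq> complex_of_real (- v)"
      using eventually_nt_filter
      by eventually_elim (use \<open>v > 0\<close> in \<open>auto simp: cone_left_iff stolz_def complex_eq_iff abs_minus_commute\<close>)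
  qed
  from filterlim_compose[OF nt[unfolded nt_limit_at_def, rule_format, OF \<open>\<alpha> > 0\<close>] this]
  show "((\<lambda>w. g1 (\<i> * (w + of_real \<sigma>))) \<longlongrightarrow> boundary_value g1 (- v)) ?F" .
  show "((\<lambda>w. g2 w) \<longlongrightarrow> g2 (Complex (- \<sigma>) v)) ?F"
    using \<open>v > 0\<close> by (intro hardy2_tendsto_compose[OF g(1) id]) auto
  have "((\<lambda>w. - \<i> * (w - of_real \<sigma>)) \<longlongrightarrow> - \<i> * (Complex (- \<sigma>) v - of_real \<sigma>)) ?F"
    by (intro tendsto_intros id)
  moreover have "- \<i> * (Complex (- \<sigma>) v - of_real \<sigma>) = Complex v (2 * \<sigma>)" by (simp add: complex_eq_iff)
  ultimately show "((\<lambda>w. g3 (- \<i> * (w - of_real \<sigma>))) \<longlongrightarrow> g3 (Complex v (2 * \<sigma>))) ?F"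
    using \<open>\<sigma> > 0\<close> by (intro hardy2_tendsto_compose[OF g(2)]) auto
qed

lemma strip_sum_limit_right:
  assumes g: "hardy2 N g1" "hardy2 N g2" and "v > 0" "\<sigma> > 0" "\<alpha> > 0" and nt: "nt_limit_at g3 v"
  shows "(strip_sum \<sigma> g1 g2 g3 \<longlongrightarrow> strip_right \<sigma> g1 g2 g3 v) (nt_filter \<sigma> \<alpha> (Complex \<sigma> v))"
  unfolding strip_sum_def[abs_def] strip_right_def
proof (intro tendsto_add)
  let ?F = "nt_filter \<sigma> \<alpha> (Complex \<sigma> v)"
  have id: "((\<lambda>w. w) \<longlongrightarrow> Complex \<sigma> v) ?F" by (rule tendsto_ident_at)
  have "filterlim (\<lambda>w. - \<i> * (w - of_real \<sigma>)) (at (of_real v) within stolz \<alpha> v) ?F"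
    unfolding filterlim_at
  proof
    have "((\<lambda>w. - \<i> * (w - of_real \<sigma>)) \<longlongrightarrow> - \<i> * (Complex \<sigma> v - of_real \<sigma>)) ?F"
      by (intro tendsto_intros id)
    moreover have "- \<i> * (Complex \<sigma> v - of_real \<sigma>) = of_real v" by (simp add: complex_eq_iff)
    ultimately show "((\<lambda>w. - \<i> * (w - of_real \<sigma>)) \<longlongrightarrow> complex_of_real v) ?F" by simp
    show "\<forall>\<^sub>F w in ?F. - \<i> * (w - of_real \<sigma>) \<in> stolz \<alpha> v \<and> - \<i> * (w - of_real \<sigma>) \<noteq> complex_of_real v"
      using eventually_nt_filter
      by eventually_elim (use \<open>v > 0\<close> \<open>\<sigma> > 0\<close> in \<open>auto simp: cone_right_iff stolz_def complex_eq_iff\<close>)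
  qed
  from filterlim_compose[OF nt[unfolded nt_limit_at_def, rule_format, OF \<open>\<alpha> > 0\<close>] this]
  show "((\<lambda>w. g3 (- \<i> * (w - of_real \<sigma>))) \<longlongrightarrow> boundary_value g3 v) ?F" .
  show "((\<lambda>w. g2 w) \<longlongrightarrow> g2 (Complex \<sigma> v)) ?F"
    using \<open>v > 0\<close> by (intro hardy2_tendsto_compose[OF g(2) id]) auto
  have "((\<lambda>w. \<i> * (w + of_real \<sigma>)) \<longlongrightarrow> \<i> * (Complex \<sigma> v + of_real \<sigma>)) ?F"
    by (intro tendsto_intros id)
  moreover have "\<i> * (Complex \<sigma> v + of_real \<sigma>) = Complex (- v) (2 * \<sigma>)" by (simp add: complex_eq_iff)
  ultimately show "((\<lambda>w. g1 (\<i> * (w + of_real \<sigma>))) \<longlongrightarrow> g1 (Complex (- v) (2 * \<sigma>))) ?F"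
    using \<open>\<sigma> > 0\<close> by (intro hardy2_tendsto_compose[OF g(1)]) auto
qed

lemma strip_sum_limit_bottom:
  assumes g: "hardy2 N g1" "hardy2 N g3" and "\<bar>u\<bar> < \<sigma>" "\<alpha> > 0" and nt: "nt_limit_at g2 u"
  shows "(strip_sum \<sigma> g1 g2 g3 \<longlongrightarrow> strip_bottom \<sigma> g1 g2 g3 u) (nt_filter \<sigma> \<alpha> (Complex u 0))"
  unfolding strip_sum_def[abs_def] strip_bottom_def
proof (intro tendsto_add)
  let ?F = "nt_filter \<sigma> \<alpha> (Complex u 0)"
  have id: "((\<lambda>w. w) \<longlongrightarrow> Complex u 0) ?F" by (rule tendsto_ident_at)
  have "filterlim (\<lambda>w. w) (at (of_real u) within stolz \<alpha> u) ?F"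
    unfolding filterlim_at
  proof
    show "((\<lambda>w. w) \<longlongrightarrow> complex_of_real u) ?F" using id by (simp add: complex_of_real_def)
    show "\<forall>\<^sub>F w in ?F. w \<in> stolz \<alpha> u \<and> w \<noteq> complex_of_real u"
      using eventually_nt_filter
      by eventually_elim (use \<open>\<bar>u\<bar> < \<sigma>\<close> in \<open>auto simp: cone_bottom_iff stolz_def complex_eq_iff\<close>)
  qed
  from filterlim_compose[OF nt[unfolded nt_limit_at_def, rule_format, OF \<open>\<alpha> > 0\<close>] this]
  show "((\<lambda>w. g2 w) \<longlongrightarrow> boundary_value g2 u) ?F" .
  have "((\<lambda>w. \<i> * (w + of_real \<sigma>)) \<longlongrightarrow> \<i> * (Complex u 0 + of_real \<sigma>)) ?F"
    by (intro tendsto_intros id)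
  moreover have "\<i> * (Complex u 0 + of_real \<sigma>) = Complex 0 (\<sigma> + u)" by (simp add: complex_eq_iff)
  ultimately show "((\<lambda>w. g1 (\<i> * (w + of_real \<sigma>))) \<longlongrightarrow> g1 (Complex 0 (\<sigma> + u))) ?F"
    using \<open>\<bar>u\<bar> < \<sigma>\<close> by (intro hardy2_tendsto_compose[OF g(1)]) auto
  have "((\<lambda>w. - \<i> * (w - of_real \<sigma>)) \<longlongrightarrow> - \<i> * (Complex u 0 - of_real \<sigma>)) ?F"
    by (intro tendsto_intros id)
  moreover have "- \<i> * (Complex u 0 - of_real \<sigma>) = Complex 0 (\<sigma> - u)" by (simp add: complex_eq_iff)
  ultimately show "((\<lambda>w. g3 (- \<i> * (w - of_real \<sigma>))) \<longlongrightarrow> g3 (Complex 0 (\<sigma> - u))) ?F"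
    using \<open>\<bar>u\<bar> < \<sigma>\<close> by (intro hardy2_tendsto_compose[OF g(2)]) auto
qed

lemma AE_nt_limit_at: "hardy2 M f \<Longrightarrow> AE x in lborel. nt_limit_at f x"
  unfolding nt_limit_at_def by (rule hardy2_nontangential_limit)

lemma AE_lborel_reflect:
  fixes P :: "real \<Rightarrow> bool"
  assumes "AE x in lborel. P x"
  shows "AE x in lborel. P (- x)"
proof -
  obtain N where N: "N \<in> null_sets lborel" "{x. \<not> P x} \<subseteq> N"
    using assms by (auto simp: eventually_ae_filter)
  have [measurable]: "N \<in> sets borel" using N(1) by (auto simp: null_sets_def)
  define N' where "N' = {x. - x \<in> N}"
  have N'm [measurable]: "N' \<in> sets borel"
    unfolding N'_def by measurable
  have "emeasure lborel N' = (\<integral>\<^sup>+x. indicator N (- x) \<partial>lborel)"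
  proof -
    have "indicator N (- x) = (indicator N' x :: ennreal)" for x
      by (simp add: N'_def indicator_def)
    then show ?thesis by simp
  qed
  also have "\<dots> = (\<integral>\<^sup>+x. indicator N x \<partial>lborel)"
    by (rule nn_integral_reflect) measurable
  also have "\<dots> = 0" using N(1) by (simp add: null_sets_def)
  finally have "N' \<in> null_sets lborel" by (auto simp: null_sets_def)
  then show ?thesis
    by (rule AE_I'[rotated 0]) (use N(2) in \<open>auto simp: N'_def\<close>)
qed

lemma norm_powr_of_real: "cmod (z powr of_real a) = cmod z powr a" if "a \<noteq> 0"
proof (cases "z = 0")
  case False
  then have "cmod (z powr of_real a) = exp (a * ln (cmod z))"
    by (simp add: powr_def)
  then show ?thesis using False by (simp add: powr_def)
qed (use that in auto)

text \<open>
  If \<open>l = 0\<close> the moduli decide; otherwise \<open>l\<close> lies in the closed right half-plane without 0, away from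
  the branch cut.
\<close>

lemma tendsto_powr_right_half_plane:
  fixes K :: "'a \<Rightarrow> complex"
  assumes K: "(K \<longlongrightarrow> l) F" and pos: "\<forall>\<^sub>F w in F. 0 \<le> Re (K w)" and "a > 0" "F \<noteq> bot"
  shows "((\<lambda>w. K w powr of_real a) \<longlongrightarrow> l powr of_real a) F"
proof (cases "l = 0")
  case True
  have "((\<lambda>w. cmod (K w) powr a) \<longlongrightarrow> 0 powr a) F"
    using tendsto_norm[OF K] True \<open>a > 0\<close> by (intro tendsto_powr') auto
  then have "((\<lambda>w. cmod (K w powr of_real a)) \<longlongrightarrow> 0) F"
    using \<open>a > 0\<close> by (simp add: norm_powr_of_real)
  then show ?thesis
    using True by (simp add: tendsto_norm_zero_iff)
next
  case False
  have "0 \<le> Re l"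
    by (rule tendsto_lowerbound[OF tendsto_Re[OF K] pos]) (use \<open>F \<noteq> bot\<close> in simp)
  then have "l \<notin> \<real>\<^sub>\<le>\<^sub>0"
    using False by (auto simp: complex_nonpos_Reals_iff complex_eq_iff)
  then show ?thesis
    by (intro tendsto_powr_complex K tendsto_const)
qed

section \<open>Arc length and Lebesgue norms\<close>

lemma nn_integral_arc_measure:
  fixes \<phi> :: "complex \<Rightarrow> ennreal"
  assumes m: "(\<lambda>\<zeta>. \<phi> \<zeta> * indicator (bdry s t) \<zeta>) \<in> borel_measurable borel" and "s > 0"
  shows "(\<integral>\<^sup>+\<zeta>. \<phi> \<zeta> \<partial>arc_measure s t) = (\<integral>\<^sup>+v. indicator {t..} v * \<phi> (Complex (- s) v) \<partial>lborel)
    + (\<integral>\<^sup>+u. indicator {- s..s} u * \<phi> (Complex u t) \<partial>lborel) + (\<integral>\<^sup>+v. indicator {t..} v * \<phi> (Complex s v) \<partial>lborel)"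
proof -
  have sp: "space (lines_measure s t) = UNIV" by (simp add: lines_measure_def)
  have "(\<integral>\<^sup>+\<zeta>. \<phi> \<zeta> \<partial>arc_measure s t) = (\<integral>\<^sup>+\<zeta>. \<phi> \<zeta> * indicator (bdry s t) \<zeta> \<partial>lines_measure s t)"
    unfolding arc_measure_def by (rule nn_integral_restrict_space) (simp add: sp bdry_sets)
  also have "\<dots> = (\<integral>\<^sup>+v. \<phi> (Complex (- s) v) * indicator (bdry s t) (Complex (- s) v) \<partial>lborel)
      + (\<integral>\<^sup>+u. \<phi> (Complex u t) * indicator (bdry s t) (Complex u t) \<partial>lborel)
      + (\<integral>\<^sup>+v. \<phi> (Complex s v) * indicator (bdry s t) (Complex s v) \<partial>lborel)"
    by (rule nn_integral_lines_measure[OF m])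
  also have "(\<lambda>v. \<phi> (Complex (- s) v) * indicator (bdry s t) (Complex (- s) v)) = (\<lambda>v. indicator {t..} v * \<phi> (Complex (- s) v))"
    using \<open>s > 0\<close> by (auto simp: fun_eq_iff bdry_def Gamma1_def Gamma2_def Gamma3_def indicator_def)
  also have "(\<lambda>u. \<phi> (Complex u t) * indicator (bdry s t) (Complex u t)) = (\<lambda>u. indicator {- s..s} u * \<phi> (Complex u t))"
    using \<open>s > 0\<close> by (auto simp: fun_eq_iff bdry_def Gamma1_def Gamma2_def Gamma3_def indicator_def)
  also have "(\<lambda>v. \<phi> (Complex s v) * indicator (bdry s t) (Complex s v)) = (\<lambda>v. indicator {t..} v * \<phi> (Complex s v))"
    using \<open>s > 0\<close> by (auto simp: fun_eq_iff bdry_def Gamma1_def Gamma2_def Gamma3_def indicator_def)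
  finally show ?thesis .
qed

lemma nn_integral_gam_measure:
  fixes \<phi> :: "complex \<Rightarrow> ennreal"
  assumes m [measurable]: "\<phi> \<in> borel_measurable borel"
  shows "(\<integral>\<^sup>+\<zeta>. \<phi> \<zeta> \<partial>gam_measure \<sigma>) = (\<integral>\<^sup>+v. \<phi> (Complex (- \<sigma>) v) \<partial>lborel)
    + (\<integral>\<^sup>+u. \<phi> (Complex u 0) \<partial>lborel) + (\<integral>\<^sup>+v. \<phi> (Complex \<sigma> v) \<partial>lborel)"
proof -
  have gm [measurable]: "gam \<sigma> \<in> sets borel"
    unfolding gam_def gam1_def gam2_def gam3_def by measurable
  have sp: "space (lines_measure \<sigma> 0) = UNIV" by (simp add: lines_measure_def)
  have "gam \<sigma> \<in> sets (lines_measure \<sigma> 0)"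
    using gm by (auto simp: lines_measure_def)
  then have "(\<integral>\<^sup>+\<zeta>. \<phi> \<zeta> \<partial>gam_measure \<sigma>) = (\<integral>\<^sup>+\<zeta>. \<phi> \<zeta> * indicator (gam \<sigma>) \<zeta> \<partial>lines_measure \<sigma> 0)"
    unfolding gam_measure_def by (intro nn_integral_restrict_space) (simp add: sp)
  also have "\<dots> = (\<integral>\<^sup>+v. \<phi> (Complex (- \<sigma>) v) * indicator (gam \<sigma>) (Complex (- \<sigma>) v) \<partial>lborel)
      + (\<integral>\<^sup>+u. \<phi> (Complex u 0) * indicator (gam \<sigma>) (Complex u 0) \<partial>lborel)
      + (\<integral>\<^sup>+v. \<phi> (Complex \<sigma> v) * indicator (gam \<sigma>) (Complex \<sigma> v) \<partial>lborel)"
    by (rule nn_integral_lines_measure) measurable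
  finally show ?thesis
    by (simp add: gam_def gam1_def gam2_def gam3_def)
qed

lemma AE_lborel_null_borel:
  assumes "AE x in lborel. P (x::real)"
  obtains N where "N \<in> sets borel" "emeasure lborel N = 0" "\<And>x. x \<notin> N \<Longrightarrow> P x"
  using assms by (auto simp: eventually_ae_filter null_sets_def)

lemma AE_arc_measure:
  assumes "\<sigma> > 0"
    and left: "AE v in lborel. v > 0 \<longrightarrow> P (Complex (- \<sigma>) v)"
    and bottom: "AE u in lborel. \<bar>u\<bar> < \<sigma> \<longrightarrow> P (Complex u 0)"
    and right: "AE v in lborel. v > 0 \<longrightarrow> P (Complex \<sigma> v)"
  shows "AE \<zeta> in arc_measure \<sigma> 0. P \<zeta>"
proof -
  obtain N1 where N1: "N1 \<in> sets borel" "emeasure lborel N1 = 0" "\<And>v. v \<notin> N1 \<Longrightarrow> v > 0 \<longrightarrow> P (Complex (- \<sigma>) v)"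
    using AE_lborel_null_borel[OF left] by blast
  obtain N2 where N2: "N2 \<in> sets borel" "emeasure lborel N2 = 0" "\<And>u. u \<notin> N2 \<Longrightarrow> \<bar>u\<bar> < \<sigma> \<longrightarrow> P (Complex u 0)"
    using AE_lborel_null_borel[OF bottom] by blast
  obtain N3 where N3: "N3 \<in> sets borel" "emeasure lborel N3 = 0" "\<And>v. v \<notin> N3 \<Longrightarrow> v > 0 \<longrightarrow> P (Complex \<sigma> v)"
    using AE_lborel_null_borel[OF right] by blast
  note [measurable] = N1(1) N2(1) N3(1)
  \<comment> \<open>The corners join the exceptional set.\<close>
  define N where "N = {\<zeta>. Re \<zeta> = - \<sigma> \<and> Im \<zeta> \<in> N1} \<union> {\<zeta>. Im \<zeta> = 0 \<and> (Re \<zeta> \<in> N2 \<or> Re \<zeta> = \<sigma> \<or> Re \<zeta> = - \<sigma>)} \<union> {\<zeta>. Re \<zeta> = \<sigma> \<and> Im \<zeta> \<in> N3}"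
  have Nm [measurable]: "N \<in> sets borel"
    unfolding N_def by measurable
  have "emeasure (lines_measure \<sigma> 0) N = (\<integral>\<^sup>+\<zeta>. indicator N \<zeta> \<partial>lines_measure \<sigma> 0)"
    by (rule nn_integral_indicator[symmetric]) (auto simp: lines_measure_def)
  also have "\<dots> = (\<integral>\<^sup>+v. indicator N (Complex (- \<sigma>) v) \<partial>lborel) + (\<integral>\<^sup>+u. indicator N (Complex u 0) \<partial>lborel)
      + (\<integral>\<^sup>+v. indicator N (Complex \<sigma> v) \<partial>lborel)"
    by (rule nn_integral_lines_measure) measurable
  also have "(\<integral>\<^sup>+v. indicator N (Complex (- \<sigma>) v) \<partial>lborel) = (\<integral>\<^sup>+v. 0 \<partial>(lborel::real measure))"
  proof (rule nn_integral_cong_AE)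
    have "AE v in lborel. v \<notin> N1" using N1(1,2) by (intro AE_not_in) (auto simp: null_sets_def)
    then show "AE v in lborel. indicator N (Complex (- \<sigma>) v) = (0::ennreal)"
      using AE_lborel_singleton[of 0] by eventually_elim (use \<open>\<sigma> > 0\<close> in \<open>auto simp: N_def\<close>)
  qed
  also have "(\<integral>\<^sup>+u. indicator N (Complex u 0) \<partial>lborel) = (\<integral>\<^sup>+v. 0 \<partial>(lborel::real measure))"
  proof (rule nn_integral_cong_AE)
    have "AE v in lborel. v \<notin> N2" using N2(1,2) by (intro AE_not_in) (auto simp: null_sets_def)
    then show "AE v in lborel. indicator N (Complex v 0) = (0::ennreal)"
      using AE_lborel_singleton[of \<sigma>] AE_lborel_singleton[of "- \<sigma>"]
      by eventually_elim (use \<open>\<sigma> > 0\<close> in \<open>auto simp: N_def\<close>)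
  qed
  also have "(\<integral>\<^sup>+v. indicator N (Complex \<sigma> v) \<partial>lborel) = (\<integral>\<^sup>+v. 0 \<partial>(lborel::real measure))"
  proof (rule nn_integral_cong_AE)
    have "AE v in lborel. v \<notin> N3" using N3(1,2) by (intro AE_not_in) (auto simp: null_sets_def)
    then show "AE v in lborel. indicator N (Complex \<sigma> v) = (0::ennreal)"
      using AE_lborel_singleton[of 0] by eventually_elim (use \<open>\<sigma> > 0\<close> in \<open>auto simp: N_def\<close>)
  qed
  finally have "N \<in> null_sets (lines_measure \<sigma> 0)"
    by (auto simp: null_sets_def lines_measure_def)
  then have "AE \<zeta> in lines_measure \<sigma> 0. \<zeta> \<notin> N" by (rule AE_not_in)
  then have "AE \<zeta> in lines_measure \<sigma> 0. \<zeta> \<in> bdry \<sigma> 0 \<longrightarrow> P \<zeta>"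
  proof eventually_elim
    case (elim \<zeta>)
    show ?case
    proof
      assume "\<zeta> \<in> bdry \<sigma> 0"
      then consider "Re \<zeta> = - \<sigma>" "Im \<zeta> > 0" | "\<bar>Re \<zeta>\<bar> \<le> \<sigma>" "Im \<zeta> = 0" | "Re \<zeta> = \<sigma>" "Im \<zeta> > 0"
        by (auto simp: bdry_def Gamma1_def Gamma2_def Gamma3_def)
      then show "P \<zeta>"
      proof cases
        case 1
        then have "Im \<zeta> \<notin> N1" using elim by (auto simp: N_def)
        from N1(3)[OF this] 1 show ?thesis by (metis complex.collapse)
      next
        case 2
        then have "Re \<zeta> \<notin> N2" "Re \<zeta> \<noteq> \<sigma>" "Re \<zeta> \<noteq> - \<sigma>" using elim by (auto simp: N_def)
        with N2(3)[of "Re \<zeta>"] 2 have "P (Complex (Re \<zeta>) 0)" by auto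
        then show ?thesis using 2 by (metis complex.collapse)
      next
        case 3
        then have "Im \<zeta> \<notin> N3" using elim by (auto simp: N_def)
        from N3(3)[OF this] 3 show ?thesis by (metis complex.collapse)
      qed
    qed
  qed
  moreover have "bdry \<sigma> 0 \<inter> space (lines_measure \<sigma> 0) \<in> sets (lines_measure \<sigma> 0)"
    using bdry_sets[of \<sigma> 0] by (simp add: lines_measure_def)
  ultimately show ?thesis
    unfolding arc_measure_def by (simp add: AE_restrict_space_iff)
qed

lemma integral_lines_measure:
  fixes h :: "complex \<Rightarrow> complex"
  assumes m [measurable]: "h \<in> borel_measurable borel"
    and i: "integrable lborel (\<lambda>v. h (Complex (- s) v))" "integrable lborel (\<lambda>u. h (Complex u t))" "integrable lborel (\<lambda>v. h (Complex s v))"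
  shows "integrable (lines_measure s t) h"
    and "(LINT \<zeta>|lines_measure s t. h \<zeta>) = (LINT v|lborel. h (Complex (- s) v)) + (LINT u|lborel. h (Complex u t)) + (LINT v|lborel. h (Complex s v))"
proof -
  let ?D = "distr (count_space {1, 2, 3::nat} \<Otimes>\<^sub>M lborel) borel (\<lambda>(j, x). line s t j x)"
  let ?M = "count_space {1, 2, 3::nat} \<Otimes>\<^sub>M (lborel :: real measure)"
  have hD: "h \<in> borel_measurable ?D" by simp
  show int: "integrable (lines_measure s t) h"
  proof (rule integrableI_bounded)
    show "h \<in> borel_measurable (lines_measure s t)"
      unfolding lines_measure_def by (rule measurable_completion[OF hD])
    have "(\<integral>\<^sup>+\<zeta>. norm (h \<zeta>) \<partial>lines_measure s t) = (\<integral>\<^sup>+v. norm (h (Complex (- s) v)) \<partial>lborel) + (\<integral>\<^sup>+u. norm (h (Complex u t)) \<partial>lborel)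
      + (\<integral>\<^sup>+v. norm (h (Complex s v)) \<partial>lborel)"
      by (rule nn_integral_lines_measure) measurable
    also have "\<dots> < \<infinity>"
      using i by (simp add: integrable_iff_bounded)
    finally show "(\<integral>\<^sup>+\<zeta>. norm (h \<zeta>) \<partial>lines_measure s t) < \<infinity>" .
  qed
  have intD: "integrable ?D h"
    using int hD unfolding lines_measure_def by (simp add: integrable_completion)
  interpret pair_sigma_finite "count_space {1, 2, 3::nat}" "lborel :: real measure"
    by (intro pair_sigma_finite.intro sigma_finite_measure_count_space_finite sigma_finite_lborel) simp
  have intM: "integrable ?M (\<lambda>z. h (case z of (j, x) \<Rightarrow> line s t j x))"
    using intD by (subst (asm) integrable_distr_eq[OF line_measurable]) auto
  have "(LINT \<zeta>|lines_measure s t. h \<zeta>) = (LINT \<zeta>|?D. h \<zeta>)"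
    unfolding lines_measure_def by (rule integral_completion[OF hD])
  also have "\<dots> = (LINT z|?M. h (case z of (j, x) \<Rightarrow> line s t j x))"
    by (rule integral_distr[OF line_measurable]) simp
  also have "\<dots> = (LINT j|count_space {1, 2, 3::nat}. LINT x|lborel. h (line s t j x))"
    using integral_fst'[OF intM] by simp
  also have "\<dots> = (\<Sum>j\<in>{1, 2, 3}. LINT x|lborel. h (line s t j x))"
    by (rule lebesgue_integral_count_space_finite) simp
  finally show "(LINT \<zeta>|lines_measure s t. h \<zeta>) = (LINT v|lborel. h (Complex (- s) v)) + (LINT u|lborel. h (Complex u t)) + (LINT v|lborel. h (Complex s v))"
    by (simp add: line_def add.assoc)
qed

lemma bdry_integral_three_lines:
  fixes h :: "complex \<Rightarrow> complex"
  assumes m [measurable]: "h \<in> borel_measurable borel" and "\<sigma> > 0"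
    and i: "integrable lborel (\<lambda>v. restr {0<..} (\<lambda>v. h (Complex (- \<sigma>) v)) v)"
      "integrable lborel (\<lambda>u. restr {-\<sigma><..<\<sigma>} (\<lambda>u. h (Complex u 0)) u)"
      "integrable lborel (\<lambda>v. restr {0<..} (\<lambda>v. h (Complex \<sigma> v)) v)"
  shows "bdry_integrable \<sigma> 0 h"
    and "bdry_integral \<sigma> 0 h = - \<i> * (LINT v|lborel. restr {0<..} (\<lambda>v. h (Complex (- \<sigma>) v)) v)
      + (LINT u|lborel. restr {-\<sigma><..<\<sigma>} (\<lambda>u. h (Complex u 0)) u) + \<i> * (LINT v|lborel. restr {0<..} (\<lambda>v. h (Complex \<sigma> v)) v)"
proof -
  have bm [measurable]: "Gamma1 \<sigma> 0 \<in> sets borel" "Gamma2 \<sigma> 0 \<in> sets borel" "bdry \<sigma> 0 \<in> sets borel"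
    unfolding bdry_def Gamma1_def Gamma2_def Gamma3_def by measurable
  define k where "k \<zeta> = indicator (bdry \<sigma> 0) \<zeta> *\<^sub>R (h \<zeta> * tangent \<sigma> 0 \<zeta>)" for \<zeta>
  have [measurable]: "tangent \<sigma> 0 \<in> borel_measurable borel"
    unfolding tangent_def[abs_def] by measurable
  have km [measurable]: "k \<in> borel_measurable borel"
    unfolding k_def by measurable
  have e1: "AE v in lborel. - \<i> * restr {0<..} (\<lambda>v. h (Complex (- \<sigma>) v)) v = k (Complex (- \<sigma>) v)"
    using AE_lborel_singleton[of 0]
    by eventually_elim (auto simp: k_def restr_def tangent_def indicator_def bdry_def Gamma1_def Gamma2_def Gamma3_def)
  have e2: "AE u in lborel. restr {-\<sigma><..<\<sigma>} (\<lambda>u. h (Complex u 0)) u = k (Complex u 0)"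
    using AE_lborel_singleton[of \<sigma>] AE_lborel_singleton[of "- \<sigma>"]
    by eventually_elim (auto simp: k_def restr_def tangent_def indicator_def bdry_def Gamma1_def Gamma2_def Gamma3_def)
  have e3: "AE v in lborel. \<i> * restr {0<..} (\<lambda>v. h (Complex \<sigma> v)) v = k (Complex \<sigma> v)"
    using AE_lborel_singleton[of 0]
    by eventually_elim (use \<open>\<sigma> > 0\<close> in \<open>auto simp: k_def restr_def tangent_def indicator_def bdry_def Gamma1_def Gamma2_def Gamma3_def\<close>)
  have "integrable lborel (\<lambda>v. - \<i> * restr {0<..} (\<lambda>v. h (Complex (- \<sigma>) v)) v)" using i(1) by (rule integrable_mult_right)
  then have k1: "integrable lborel (\<lambda>v. k (Complex (- \<sigma>) v))"
    by (rule integrable_cong_AE_imp) (use e1 in auto)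
  have k2: "integrable lborel (\<lambda>u. k (Complex u 0))"
    by (rule integrable_cong_AE_imp[OF i(2)]) (use e2 in auto)
  have "integrable lborel (\<lambda>v. \<i> * restr {0<..} (\<lambda>v. h (Complex \<sigma> v)) v)" using i(3) by (rule integrable_mult_right)
  then have k3: "integrable lborel (\<lambda>v. k (Complex \<sigma> v))"
    by (rule integrable_cong_AE_imp) (use e3 in auto)
  note K = integral_lines_measure[OF km k1 k2 k3]
  have sp: "bdry \<sigma> 0 \<inter> space (lines_measure \<sigma> 0) \<in> sets (lines_measure \<sigma> 0)"
    using bdry_sets[of \<sigma> 0] by (simp add: lines_measure_def)
  show "bdry_integrable \<sigma> 0 h"
    unfolding bdry_integrable_def arc_measure_def integrable_restrict_space[OF sp] using K(1) by (simp add: k_def)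
  have "bdry_integral \<sigma> 0 h = (LINT \<zeta>|lines_measure \<sigma> 0. k \<zeta>)"
    unfolding bdry_integral_def arc_measure_def integral_restrict_space[OF sp] by (simp add: k_def)
  also have "\<dots> = (LINT v|lborel. - \<i> * restr {0<..} (\<lambda>v. h (Complex (- \<sigma>) v)) v)
      + (LINT u|lborel. restr {-\<sigma><..<\<sigma>} (\<lambda>u. h (Complex u 0)) u) + (LINT v|lborel. \<i> * restr {0<..} (\<lambda>v. h (Complex \<sigma> v)) v)"
    unfolding K(2) by (intro arg_cong2[of _ _ _ _ "(+)"] integral_cong_AE) (use e1 e2 e3 in \<open>auto simp: eq_commute\<close>)
  finally show "bdry_integral \<sigma> 0 h = - \<i> * (LINT v|lborel. restr {0<..} (\<lambda>v. h (Complex (- \<sigma>) v)) v)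
      + (LINT u|lborel. restr {-\<sigma><..<\<sigma>} (\<lambda>u. h (Complex u 0)) u) + \<i> * (LINT v|lborel. restr {0<..} (\<lambda>v. h (Complex \<sigma> v)) v)"
    by simp
qed

lemma Lp_norm_le_iff:
  assumes "p > 0" "h \<ge> 0"
  shows "Lp_norm p M f \<le> ennreal h \<longleftrightarrow> (\<integral>\<^sup>+\<zeta>. ennreal (cmod (f \<zeta>) powr p) \<partial>M) \<le> ennreal (h powr p)"
proof (cases "(\<integral>\<^sup>+\<zeta>. ennreal (cmod (f \<zeta>) powr p) \<partial>M)" rule: ennreal_cases)
  case (real r)
  have "r powr (1 / p) \<le> h \<longleftrightarrow> r \<le> h powr p"
  proof
    assume "r powr (1 / p) \<le> h"
    then have "(r powr (1 / p)) powr p \<le> h powr p" using assms by (intro powr_mono2) auto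
    then show "r \<le> h powr p" using real assms by (simp add: powr_powr)
  next
    assume "r \<le> h powr p"
    then have "r powr (1 / p) \<le> (h powr p) powr (1 / p)" using assms real by (intro powr_mono2) auto
    then show "r powr (1 / p) \<le> h" using assms by (simp add: powr_powr)
  qed
  then show ?thesis
    using real assms by (simp add: Lp_norm_def ennpowr_def ennreal_le_iff)
qed (auto simp: Lp_norm_def ennpowr_def top_unique)

lemma Lp_norm_tendsto_0:
  assumes "p > 0" and lim: "((\<lambda>\<tau>. \<integral>\<^sup>+\<zeta>. ennreal (cmod (f \<tau> \<zeta>) powr p) \<partial>M) \<longlongrightarrow> 0) F"
  shows "((\<lambda>\<tau>. Lp_norm p M (f \<tau>)) \<longlongrightarrow> 0) F"
proof (rule order_tendstoI)
  fix a :: ennreal assume "0 < a"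
  then obtain e where e: "0 < e" "ennreal e < a"
    by (metis dense ennreal_cases ennreal_less_zero_iff ennreal_0 less_top not_less_iff_gr_or_eq order_less_trans)
  have "\<forall>\<^sub>F \<tau> in F. (\<integral>\<^sup>+\<zeta>. ennreal (cmod (f \<tau> \<zeta>) powr p) \<partial>M) < ennreal (e powr p)"
    by (rule order_tendstoD[OF lim]) (use e in simp)
  then show "\<forall>\<^sub>F \<tau> in F. Lp_norm p M (f \<tau>) < a"
  proof eventually_elim
    case (elim \<tau>)
    then have "Lp_norm p M (f \<tau>) \<le> ennreal e"
      using e \<open>p > 0\<close> by (subst Lp_norm_le_iff) auto
    then show ?case using e(2) by (rule le_less_trans)
  qed
qed simp

lemma bdry_subset_half_strip: "0 < s \<Longrightarrow> s < \<sigma> \<Longrightarrow> 0 < t \<Longrightarrow> bdry s t \<subseteq> half_strip \<sigma> 0"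
  by (auto simp: bdry_def Gamma1_def Gamma2_def Gamma3_def half_strip_def)

lemma Hp_holomorphic: "F \<in> Hp p \<sigma> \<Longrightarrow> F holomorphic_on half_strip \<sigma> 0"
  by (auto simp: Hp_def Omega_plus_def dest: analytic_imp_holomorphic)

lemma Hp_side_integrals:
  assumes F: "F \<in> Hp p \<sigma>" and "p > 0" and st: "0 < s" "s < \<sigma>" "0 < t"
  shows "(\<integral>\<^sup>+v. indicator {t..} v * ennreal (cmod (F (Complex (- s) v)) powr p) \<partial>lborel)
    + (\<integral>\<^sup>+u. indicator {- s..s} u * ennreal (cmod (F (Complex u t)) powr p) \<partial>lborel)
    + (\<integral>\<^sup>+v. indicator {t..} v * ennreal (cmod (F (Complex s v)) powr p) \<partial>lborel) \<le> ennreal (enn2real (Hp_norm p \<sigma> F) powr p)"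
proof -
  have "Hp_norm p \<sigma> F < top" using F by (simp add: Hp_def)
  have "Lp_norm p (arc_measure s t) F \<le> Hp_norm p \<sigma> F"
    unfolding Hp_norm_def using st by (intro SUP_upper2[of s] SUP_upper2[of t]) auto
  also have "\<dots> = ennreal (enn2real (Hp_norm p \<sigma> F))"
    using \<open>Hp_norm p \<sigma> F < top\<close> by simp
  finally have le: "(\<integral>\<^sup>+\<zeta>. ennreal (cmod (F \<zeta>) powr p) \<partial>arc_measure s t) \<le> ennreal (enn2real (Hp_norm p \<sigma> F) powr p)"
    using \<open>p > 0\<close> by (subst (asm) Lp_norm_le_iff) auto
  have bm: "bdry s t \<in> sets borel"
    unfolding bdry_def Gamma1_def Gamma2_def Gamma3_def by measurable
  have "(\<lambda>\<zeta>. indicator (bdry s t) \<zeta> *\<^sub>R F \<zeta>) \<in> borel_measurable borel"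
    using bdry_subset_half_strip[OF st] holomorphic_on_imp_continuous_on[OF Hp_holomorphic[OF F]]
    by (intro borel_measurable_continuous_on_indicator bm) (rule continuous_on_subset)
  then have [measurable]: "(\<lambda>\<zeta>. indicator (bdry s t) \<zeta> *\<^sub>R F \<zeta>) \<in> borel_measurable borel" .
  have "(\<lambda>\<zeta>. ennreal (cmod (indicator (bdry s t) \<zeta> *\<^sub>R F \<zeta>) powr p)) \<in> borel_measurable borel"
    by measurable
  also have "(\<lambda>\<zeta>. ennreal (cmod (indicator (bdry s t) \<zeta> *\<^sub>R F \<zeta>) powr p)) = (\<lambda>\<zeta>. ennreal (cmod (F \<zeta>) powr p) * indicator (bdry s t) \<zeta>)"
    using \<open>p > 0\<close> by (auto simp: indicator_def fun_eq_iff)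
  finally show ?thesis
    using le st by (subst (asm) nn_integral_arc_measure) auto
qed

section \<open>Factorization\<close>

lemma strip_sum_holomorphic:
  assumes "hardy2 N g1" "hardy2 N g2" "hardy2 N g3"
  shows "strip_sum \<sigma> g1 g2 g3 holomorphic_on half_strip \<sigma> 0"
proof -
  have 1: "(\<lambda>w. g1 (\<i> * (w + of_real \<sigma>))) holomorphic_on half_strip \<sigma> 0"
    by (rule holomorphic_on_compose_gen[OF _ hardy2_holomorphic[OF assms(1)], unfolded o_def])
      (auto intro!: holomorphic_intros simp: half_strip_def)
  have 2: "g2 holomorphic_on half_strip \<sigma> 0"
    by (rule holomorphic_on_subset[OF hardy2_holomorphic[OF assms(2)]]) (auto simp: half_strip_def)
  have 3: "(\<lambda>w. g3 (- \<i> * (w - of_real \<sigma>))) holomorphic_on half_strip \<sigma> 0"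
    by (rule holomorphic_on_compose_gen[OF _ hardy2_holomorphic[OF assms(3)], unfolded o_def])
      (auto intro!: holomorphic_intros simp: half_strip_def)
  show ?thesis
    unfolding strip_sum_def[abs_def] by (intro holomorphic_on_add 1 2 3)
qed

text \<open>
  Added to a function with nonnegative real part, this makes the real part positive.
\<close>

definition positive_kernel :: "complex \<Rightarrow> complex" where
  "positive_kernel z = (if Im z > 0 then \<i> / (z + \<i>) else 0)"

lemma positive_kernel_hardy2: "hardy2 pi positive_kernel"
  unfolding hardy2_def
proof (intro conjI allI impI)
  have "(\<lambda>z. \<i> / (z + \<i>)) holomorphic_on upper_half_plane"
    by (intro holomorphic_intros) (auto simp: complex_eq_iff)
  then show hol: "positive_kernel holomorphic_on upper_half_plane"
    by (rule holomorphic_transform) (simp add: positive_kernel_def)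
  show "positive_kernel \<in> borel_measurable borel"
    by (rule holomorphic_extension_measurable[OF hol]) (simp add: positive_kernel_def)
  fix y :: real assume y: "y > 0"
  have "sqnorm (\<lambda>x. positive_kernel (Complex x y)) = (\<integral>\<^sup>+x. ennreal (1 / ((0 - x)\<^sup>2 + (y + 1)\<^sup>2)) \<partial>lborel)"
    unfolding sqnorm_def
    by (intro nn_integral_cong) (use y in \<open>simp add: positive_kernel_def norm_divide power_divide cmod_power2\<close>)
  also have "\<dots> = ennreal (pi / (y + 1))"
    using y by (intro nn_integral_inverse_quadratic) auto
  also have "\<dots> \<le> ennreal pi"
    using y by (intro ennreal_leI) (simp add: field_simps)
  finally show "sqnorm (\<lambda>x. positive_kernel (Complex x y)) \<le> ennreal pi" .
qed

lemma positive_kernel_Re: "Im z > 0 \<Longrightarrow> Re (positive_kernel z) > 0"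
  by (auto simp: positive_kernel_def Re_divide intro!: divide_pos_pos add_nonneg_pos)

text \<open>
  The values of \<open>K\<close> lie in the right half-plane, so \<open>C = F / (K\<^bsup>2/p\<^esup> (w + \<i>))\<close> is holomorphic, and
  \<open>|F|\<^bsup>p/2\<^esup> \<le> |K|\<close> gives \<open>|C| \<le> 1 / |w + \<i>|\<close>. This is square integrable along the sides, so \<open>C\<close> decomposes
  too.
\<close>

theorem Hp_factorization:
  assumes F: "F \<in> Hp p \<sigma>" and "p > 0" "\<sigma> > 0"
  obtains N k1 k2 k3 b1 b2 b3 where
    "hardy2 N k1" "hardy2 N k2" "hardy2 N k3" "hardy2 N b1" "hardy2 N b2" "hardy2 N b3"
    "\<And>w. w \<in> half_strip \<sigma> 0 \<Longrightarrow> cmod (F w) powr p \<le> (cmod (strip_sum \<sigma> k1 k2 k3 w))\<^sup>2"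
    "\<And>w. w \<in> half_strip \<sigma> 0 \<Longrightarrow> 0 < Re (strip_sum \<sigma> k1 k2 k3 w)"
    "\<And>w. w \<in> half_strip \<sigma> 0 \<Longrightarrow> F w = strip_sum \<sigma> b1 b2 b3 w * (w + \<i>) * strip_sum \<sigma> k1 k2 k3 w powr of_real (2 / p)"
proof -
  note hol = Hp_holomorphic[OF F]
  define H where "H = enn2real (Hp_norm p \<sigma> F) powr p"
  have H: "H \<ge> 0" by (simp add: H_def)
  define q where "q = p / 2"
  have q: "q > 0" using \<open>p > 0\<close> by (simp add: q_def)
  have sq: "ennreal ((cmod (complex_of_real (2 * cmod z powr q)))\<^sup>2) = 4 * ennreal (cmod z powr p)" for z
  proof -
    have "(cmod (complex_of_real (2 * cmod z powr q)))\<^sup>2 = 4 * (cmod z powr q * cmod z powr q)"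
      by (simp add: norm_mult power2_eq_square)
    also have "cmod z powr q * cmod z powr q = cmod z powr p"
      by (simp add: powr_add[symmetric] q_def)
    finally show ?thesis by (simp add: ennreal_mult)
  qed
  have "side_bound \<sigma> (4 * H) (\<lambda>z. complex_of_real (2 * cmod (F z) powr q))"
    unfolding side_bound_def
  proof (intro allI impI)
    fix s t :: real assume st: "0 < s \<and> s < \<sigma> \<and> 0 < t"
    let ?a = "\<integral>\<^sup>+v. indicator {t..} v * ennreal (cmod (F (Complex (- s) v)) powr p) \<partial>(lborel :: real measure)"
    let ?b = "\<integral>\<^sup>+u. indicator {- s..s} u * ennreal (cmod (F (Complex u t)) powr p) \<partial>(lborel :: real measure)"
    let ?c = "\<integral>\<^sup>+v. indicator {t..} v * ennreal (cmod (F (Complex s v)) powr p) \<partial>(lborel :: real measure)"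
    have sum: "?a + ?b + ?c \<le> ennreal H"
      unfolding H_def using st by (intro Hp_side_integrals F \<open>p > 0\<close>) auto
    have "?a \<le> ?a + ?b + ?c" "?b \<le> ?a + ?b + ?c" "?c \<le> ?a + ?b + ?c"
      by (auto simp: add_increasing add_increasing2 add.assoc)
    then have abc: "?a \<le> ennreal H" "?b \<le> ennreal H" "?c \<le> ennreal H"
      using sum order.trans by blast+
    have conv: "(\<integral>\<^sup>+x. indicator A x * ennreal ((cmod (complex_of_real (2 * cmod (g x) powr q)))\<^sup>2) \<partial>lborel) \<le> ennreal (4 * H)"
      if "(\<integral>\<^sup>+x. indicator A x * ennreal (cmod (g x) powr p) \<partial>lborel) \<le> ennreal H"
        "(\<lambda>x. indicator A x * ennreal (cmod (g x) powr p)) \<in> borel_measurable borel" for A :: "real set" and g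
    proof -
      have "(\<integral>\<^sup>+x. indicator A x * ennreal ((cmod (complex_of_real (2 * cmod (g x) powr q)))\<^sup>2) \<partial>lborel)
         = (\<integral>\<^sup>+x. 4 * (indicator A x * ennreal (cmod (g x) powr p)) \<partial>lborel)"
        unfolding sq by (simp add: mult.left_commute)
      also have "\<dots> = 4 * (\<integral>\<^sup>+x. indicator A x * ennreal (cmod (g x) powr p) \<partial>lborel)"
        using that(2) by (intro nn_integral_cmult) simp
      also have "\<dots> \<le> 4 * ennreal H" by (intro mult_left_mono that) auto
      finally show ?thesis using H by (simp add: ennreal_mult)
    qed
    have meas: "(\<lambda>x. indicator A x * ennreal (cmod (F (g x)) powr p)) \<in> borel_measurable borel"
      if "A \<in> sets borel" "continuous_on A g" "g ` A \<subseteq> half_strip \<sigma> 0" for A :: "real set" and g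
    proof -
      have "continuous_on A (\<lambda>x. F (g x))"
        using that by (intro continuous_on_compose2[OF holomorphic_on_imp_continuous_on[OF hol]]) auto
      then have [measurable]: "(\<lambda>x. indicator A x *\<^sub>R F (g x)) \<in> borel_measurable borel"
        using that(1) by (intro borel_measurable_continuous_on_indicator) auto
      have "(\<lambda>x. ennreal (cmod (indicator A x *\<^sub>R F (g x)) powr p)) \<in> borel_measurable borel"
        by measurable
      also have "(\<lambda>x. ennreal (cmod (indicator A x *\<^sub>R F (g x)) powr p)) = (\<lambda>x. indicator A x * ennreal (cmod (F (g x)) powr p))"
        using \<open>p > 0\<close> by (auto simp: indicator_def fun_eq_iff)
      finally show ?thesis .
    qed
    show "(\<integral>\<^sup>+v. indicator {t..} v * ennreal ((cmod (complex_of_real (2 * cmod (F (Complex (- s) v)) powr q)))\<^sup>2) \<partial>lborel) \<le> ennreal (4 * H) \<and>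
      (\<integral>\<^sup>+u. indicator {- s..s} u * ennreal ((cmod (complex_of_real (2 * cmod (F (Complex u t)) powr q)))\<^sup>2) \<partial>lborel) \<le> ennreal (4 * H) \<and>
      (\<integral>\<^sup>+v. indicator {t..} v * ennreal ((cmod (complex_of_real (2 * cmod (F (Complex s v)) powr q)))\<^sup>2) \<partial>lborel) \<le> ennreal (4 * H)"
      using st by (intro conjI conv abc meas) (auto intro!: continuous_intros simp: half_strip_def)
  qed
  from half_strip_majorant[OF hol this _ \<open>\<sigma> > 0\<close> q] H
  obtain N1 g1 g2 g3 where N1: "N1 \<ge> 0" and g: "hardy2 N1 g1" "hardy2 N1 g2" "hardy2 N1 g3"
    and maj: "\<And>w. w \<in> half_strip \<sigma> 0 \<Longrightarrow> cmod (F w) powr q \<le> Re (strip_sum \<sigma> g1 g2 g3 w)"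
    by auto
  define k2 where "k2 z = g2 z + positive_kernel z" for z
  have k2: "hardy2 (2 * N1 + 2 * pi) k2"
    unfolding k2_def using N1 by (intro hardy2_add g positive_kernel_hardy2) auto
  define K where "K = strip_sum \<sigma> g1 k2 g3"
  have K: "K w = strip_sum \<sigma> g1 g2 g3 w + positive_kernel w" for w
    by (simp add: K_def strip_sum_def k2_def)
  have Kpos: "0 < Re (K w)" and Kq: "cmod (F w) powr q \<le> cmod (K w)" if "w \<in> half_strip \<sigma> 0" for w
  proof -
    have "0 < Re (positive_kernel w)"
      using that by (intro positive_kernel_Re) (simp add: half_strip_def)
    moreover have "0 \<le> cmod (F w) powr q" by simp
    ultimately show "0 < Re (K w)" using maj[OF that] unfolding K plus_complex.sel by linarith
    have "cmod (F w) powr q \<le> Re (K w)"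
      using maj[OF that] \<open>0 < Re (positive_kernel w)\<close> by (simp add: K)
    also have "\<dots> \<le> cmod (K w)" by (rule complex_Re_le_cmod)
    finally show "cmod (F w) powr q \<le> cmod (K w)" .
  qed
  have Kp: "cmod (F w) powr p \<le> (cmod (K w))\<^sup>2" if "w \<in> half_strip \<sigma> 0" for w
  proof -
    have "cmod (F w) powr p = (cmod (F w) powr q)\<^sup>2"
      by (simp add: power2_eq_square powr_add[symmetric] q_def)
    also have "\<dots> \<le> (cmod (K w))\<^sup>2" by (intro power_mono Kq that) simp
    finally show ?thesis .
  qed
  have Khol: "K holomorphic_on half_strip \<sigma> 0"
  proof -
    have "hardy2 (2 * N1 + 2 * pi) g1" "hardy2 (2 * N1 + 2 * pi) g3"
      using g N1 by (auto intro: hardy2_mono)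
    from strip_sum_holomorphic[OF this(1) k2 this(2)] show ?thesis by (simp add: K_def)
  qed
  have nz: "K w \<notin> \<real>\<^sub>\<le>\<^sub>0" "K w \<noteq> 0" "w + \<i> \<noteq> 0" if "w \<in> half_strip \<sigma> 0" for w
    using Kpos[OF that] that by (auto simp: complex_nonpos_Reals_iff half_strip_def complex_eq_iff)
  define C where "C w = F w / (K w powr of_real (2 / p) * (w + \<i>))" for w
  have Chol: "C holomorphic_on half_strip \<sigma> 0"
    unfolding C_def using nz by (intro holomorphic_intros hol Khol) auto
  have Cb: "cmod (C w) \<le> 1 / cmod (w + \<i>)" if "w \<in> half_strip \<sigma> 0" for w
  proof -
    have "cmod (F w) = (cmod (F w) powr q) powr (2 / p)"
      using \<open>p > 0\<close> by (simp add: powr_powr q_def)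
    also have "\<dots> \<le> cmod (K w) powr (2 / p)"
      using \<open>p > 0\<close> by (intro powr_mono2 Kq that) auto
    also have "\<dots> = cmod (K w powr of_real (2 / p))"
      using \<open>p > 0\<close> by (subst norm_powr_of_real) auto
    finally have "cmod (F w) \<le> cmod (K w powr of_real (2 / p))" .
    moreover have "cmod (K w powr of_real (2 / p)) > 0" using nz[OF that] by simp
    ultimately have "cmod (F w) / cmod (K w powr of_real (2 / p)) \<le> 1" by simp
    then have "cmod (F w) / cmod (K w powr of_real (2 / p)) / cmod (w + \<i>) \<le> 1 / cmod (w + \<i>)"
      by (intro divide_right_mono) auto
    then show ?thesis by (simp add: C_def norm_divide norm_mult)
  qed
  have C2: "(cmod (C (Complex x y)))\<^sup>2 \<le> 1 / ((0 - y)\<^sup>2 + 1\<^sup>2)" "(cmod (C (Complex x y)))\<^sup>2 \<le> 1"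
    if "Complex x y \<in> half_strip \<sigma> 0" for x y
  proof -
    have y: "y > 0" using that by (simp add: half_strip_def)
    have "(cmod (C (Complex x y)))\<^sup>2 \<le> (1 / cmod (Complex x y + \<i>))\<^sup>2"
      by (intro power_mono Cb that) simp
    also have "\<dots> = 1 / (x\<^sup>2 + (y + 1)\<^sup>2)"
      by (simp add: power_divide cmod_power2)
    also have "\<dots> \<le> 1 / ((0 - y)\<^sup>2 + 1\<^sup>2)"
    proof (intro divide_left_mono mult_pos_pos)
      show "(0 - y)\<^sup>2 + 1\<^sup>2 \<le> x\<^sup>2 + (y + 1)\<^sup>2" using y by (simp add: power2_eq_square algebra_simps)
    qed (use y in \<open>auto intro: add_nonneg_pos\<close>)
    finally show le: "(cmod (C (Complex x y)))\<^sup>2 \<le> 1 / ((0 - y)\<^sup>2 + 1\<^sup>2)" .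
    also have "\<dots> \<le> 1" by (simp add: divide_le_eq_1 add_nonneg_pos)
    finally show "(cmod (C (Complex x y)))\<^sup>2 \<le> 1" .
  qed
  have "side_bound \<sigma> (pi + 2 * \<sigma>) C"
    unfolding side_bound_def
  proof (intro allI impI)
    fix s t :: real assume st: "0 < s \<and> s < \<sigma> \<and> 0 < t"
    have v: "(\<integral>\<^sup>+v. indicator {t..} v * ennreal ((cmod (C (Complex s' v)))\<^sup>2) \<partial>lborel) \<le> ennreal (pi + 2 * \<sigma>)"
      if s': "\<bar>s'\<bar> < \<sigma>" for s'
    proof -
      have "(\<integral>\<^sup>+v. indicator {t..} v * ennreal ((cmod (C (Complex s' v)))\<^sup>2) \<partial>lborel) \<le> (\<integral>\<^sup>+v. ennreal (1 / ((0 - v)\<^sup>2 + 1\<^sup>2)) \<partial>lborel)"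
        using s' st C2(1) by (intro nn_integral_mono) (auto simp: indicator_def half_strip_def intro!: ennreal_leI)
      also have "\<dots> = ennreal (pi / 1)" by (rule nn_integral_inverse_quadratic) simp
      also have "\<dots> \<le> ennreal (pi + 2 * \<sigma>)" using \<open>\<sigma> > 0\<close> by (intro ennreal_leI) auto
      finally show ?thesis .
    qed
    have "(\<integral>\<^sup>+u. indicator {- s..s} u * ennreal ((cmod (C (Complex u t)))\<^sup>2) \<partial>lborel) \<le> (\<integral>\<^sup>+u. indicator {- s..s} u \<partial>lborel)"
      using st C2(2) by (intro nn_integral_mono) (auto simp: indicator_def half_strip_def)
    also have "\<dots> \<le> ennreal (pi + 2 * \<sigma>)"
      using st by (auto intro!: ennreal_leI simp: add_increasing)
    finally show "(\<integral>\<^sup>+v. indicator {t..} v * ennreal ((cmod (C (Complex (- s) v)))\<^sup>2) \<partial>lborel) \<le> ennreal (pi + 2 * \<sigma>) \<and>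
       (\<integral>\<^sup>+u. indicator {- s..s} u * ennreal ((cmod (C (Complex u t)))\<^sup>2) \<partial>lborel) \<le> ennreal (pi + 2 * \<sigma>) \<and>
       (\<integral>\<^sup>+v. indicator {t..} v * ennreal ((cmod (C (Complex s v)))\<^sup>2) \<partial>lborel) \<le> ennreal (pi + 2 * \<sigma>)"
      using v[of "- s"] v[of s] st by auto
  qed
  from half_strip_decomposition[OF Chol this _ \<open>\<sigma> > 0\<close>] \<open>\<sigma> > 0\<close>
  obtain N2 b1 b2 b3 where N2: "N2 \<ge> 0" and b: "hardy2 N2 b1" "hardy2 N2 b2" "hardy2 N2 b3"
    and Csum: "\<And>w. w \<in> half_strip \<sigma> 0 \<Longrightarrow> C w = strip_sum \<sigma> b1 b2 b3 w"
    by (auto simp: add_nonneg_nonneg)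
  define N where "N = 2 * N1 + 2 * pi + N2"
  have le: "N1 \<le> N" "2 * N1 + 2 * pi \<le> N" "N2 \<le> N" using N1 N2 by (auto simp: N_def)
  show thesis
  proof (rule that[of N g1 k2 g3 b1 b2 b3])
    fix w assume w: "w \<in> half_strip \<sigma> 0"
    show "F w = strip_sum \<sigma> b1 b2 b3 w * (w + \<i>) * strip_sum \<sigma> g1 k2 g3 w powr of_real (2 / p)"
      using nz[OF w] unfolding Csum[OF w, symmetric] K_def[symmetric] by (simp add: C_def)
  qed (use g k2 b le Kp Kpos in \<open>auto intro: hardy2_mono simp: K_def\<close>)
qed

section \<open>Dominated convergence on a line\<close>

lemma powr_norm_diff_le:
  assumes "p > 0"
  shows "cmod (a - b) powr p \<le> 2 powr p * (cmod a powr p + cmod b powr p)"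
proof -
  have "cmod (a - b) \<le> 2 * max (cmod a) (cmod b)"
    using norm_triangle_ineq4[of a b] by auto
  then have "cmod (a - b) powr p \<le> (2 * max (cmod a) (cmod b)) powr p"
    using assms by (intro powr_mono2) auto
  also have "\<dots> = 2 powr p * max (cmod a) (cmod b) powr p"
    by (simp add: powr_mult)
  also have "\<dots> \<le> 2 powr p * (cmod a powr p + cmod b powr p)"
    by (intro mult_left_mono) (auto simp: max_def)
  finally show ?thesis .
qed

lemma square_le_diff_square: "(cmod a)\<^sup>2 \<le> 2 * (cmod (a - b))\<^sup>2 + 2 * (cmod b)\<^sup>2"
  using norm_add_square_le[of "a - b" b] by simp

text \<open>
  The varying majorants come from \<open>|Ft|\<^sup>p \<le> |Kt|\<^sup>2 \<le> 2 |Kt - K0|\<^sup>2 + 2 |K0|\<^sup>2\<close>.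
\<close>

lemma line_Lp_convergence:
  fixes Ft Kt :: "real \<Rightarrow> real \<Rightarrow> complex"
  assumes "p > 0" "d > 0"
    and Ft: "\<And>\<tau>. 0 < \<tau> \<Longrightarrow> \<tau> < d \<Longrightarrow> Ft \<tau> \<in> borel_measurable borel" and [measurable]: "f0 \<in> borel_measurable borel"
    and [measurable]: "\<And>\<tau>. Kt \<tau> \<in> borel_measurable borel" "K0 \<in> borel_measurable borel"
    and FK: "\<And>\<tau> x. 0 < \<tau> \<Longrightarrow> \<tau> < d \<Longrightarrow> cmod (Ft \<tau> x) powr p \<le> (cmod (Kt \<tau> x))\<^sup>2"
    and fK: "AE x in lborel. cmod (f0 x) powr p \<le> (cmod (K0 x))\<^sup>2"
    and lim: "AE x in lborel. ((\<lambda>\<tau>. Ft \<tau> x) \<longlongrightarrow> f0 x) (at_right 0)"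
    and K: "((\<lambda>\<tau>. sqnorm (\<lambda>x. Kt \<tau> x - K0 x)) \<longlongrightarrow> 0) (at_right 0)" and K0: "sqnorm K0 < top"
  shows "((\<lambda>\<tau>. \<integral>\<^sup>+x. ennreal (cmod (Ft \<tau> x - f0 x) powr p) \<partial>lborel) \<longlongrightarrow> 0) (at_right 0)"
proof (rule tendsto_at_right_0_sequentiallyI)
  fix \<tau>' :: "nat \<Rightarrow> real" assume \<tau>': "\<And>n. \<tau>' n > 0" "\<tau>' \<longlonglongrightarrow> 0"
  define \<tau> where "\<tau> n = min (\<tau>' n) (d / 2)" for n
  have \<tau>: "0 < \<tau> n" "\<tau> n < d" for n using \<tau>' \<open>d > 0\<close> by (auto simp: \<tau>_def min_def)
  have ev: "\<forall>\<^sub>F n in sequentially. \<tau> n = \<tau>' n"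
  proof -
    have "\<forall>\<^sub>F n in sequentially. \<tau>' n < d / 2"
      by (rule order_tendstoD(2)[OF \<tau>'(2)]) (use \<open>d > 0\<close> in simp)
    then show ?thesis by eventually_elim (simp add: \<tau>_def)
  qed
  have "\<tau> \<longlonglongrightarrow> 0"
    using \<tau>'(2) by (rule tendsto_cong[THEN iffD1, rotated]) (use ev in \<open>auto simp: eq_commute\<close>)
  then have fl: "filterlim \<tau> (at_right 0) sequentially"
    using \<tau>(1) by (auto simp: filterlim_at less_imp_neq[THEN not_sym] intro!: always_eventually)
  note [measurable] = Ft[OF \<tau>]
  define c where "c = 2 powr p"
  have c: "c > 0" by (simp add: c_def)
  have "(\<lambda>n. \<integral>\<^sup>+x. ennreal (cmod (Ft (\<tau> n) x - f0 x) powr p) \<partial>lborel) \<longlonglongrightarrow> 0"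
  proof (rule nn_integral_generalized_dominated[where H = "\<lambda>x. ennreal (3 * c) * ennreal ((cmod (K0 x))\<^sup>2)"
        and E = "\<lambda>n x. ennreal (2 * c) * ennreal ((cmod (Kt (\<tau> n) x - K0 x))\<^sup>2)"])
    let ?H = "\<lambda>x. ennreal (3 * c) * ennreal ((cmod (K0 x))\<^sup>2)"
    let ?E = "\<lambda>n x. ennreal (2 * c) * ennreal ((cmod (Kt (\<tau> n) x - K0 x))\<^sup>2)"
    show "(\<lambda>x. ennreal (cmod (Ft (\<tau> n) x - f0 x) powr p)) \<in> borel_measurable lborel" for n by measurable
    show "?H \<in> borel_measurable lborel" by measurable
    show "?E n \<in> borel_measurable lborel" for n by measurable
    show "AE x in lborel. (\<lambda>n. ennreal (cmod (Ft (\<tau> n) x - f0 x) powr p)) \<longlonglongrightarrow> 0"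
      using lim
    proof eventually_elim
      case (elim x)
      have "(\<lambda>n. Ft (\<tau> n) x) \<longlonglongrightarrow> f0 x" by (rule filterlim_compose[OF elim fl])
      then have "(\<lambda>n. cmod (Ft (\<tau> n) x - f0 x)) \<longlonglongrightarrow> 0" by (simp add: LIM_zero tendsto_norm_zero)
      then have "(\<lambda>n. cmod (Ft (\<tau> n) x - f0 x) powr p) \<longlonglongrightarrow> 0 powr p"
        using \<open>p > 0\<close> by (intro tendsto_powr') auto
      then show ?case using tendsto_ennrealI by fastforce
    qed
    show "\<forall>\<^sub>F n in sequentially. AE x in lborel. ennreal (cmod (Ft (\<tau> n) x - f0 x) powr p) \<le> ?H x + ?E n x"
    proof (rule always_eventually, rule allI)
      fix n
      show "AE x in lborel. ennreal (cmod (Ft (\<tau> n) x - f0 x) powr p) \<le> ?H x + ?E n x"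
        using fK
      proof eventually_elim
        case (elim x)
        have "cmod (Ft (\<tau> n) x - f0 x) powr p \<le> c * (cmod (Ft (\<tau> n) x) powr p + cmod (f0 x) powr p)"
          unfolding c_def by (rule powr_norm_diff_le[OF \<open>p > 0\<close>])
        also have "\<dots> \<le> c * ((2 * (cmod (Kt (\<tau> n) x - K0 x))\<^sup>2 + 2 * (cmod (K0 x))\<^sup>2) + (cmod (K0 x))\<^sup>2)"
          using c elim FK[OF \<tau>, of n x] square_le_diff_square[of "Kt (\<tau> n) x" "K0 x"]
          by (intro mult_left_mono add_mono) auto
        also have "\<dots> = 3 * c * (cmod (K0 x))\<^sup>2 + 2 * c * (cmod (Kt (\<tau> n) x - K0 x))\<^sup>2"
          by (simp add: algebra_simps)
        finally show ?case
          using c by (simp flip: ennreal_mult ennreal_plus)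
      qed
    qed
    have "(\<integral>\<^sup>+x. ?H x \<partial>lborel) = ennreal (3 * c) * sqnorm K0"
      unfolding sqnorm_def by (rule nn_integral_cmult) measurable
    then show "(\<integral>\<^sup>+x. ?H x \<partial>lborel) < top" using K0 by (simp add: ennreal_mult_less_top)
    have eq: "(\<integral>\<^sup>+x. ?E n x \<partial>lborel) = ennreal (2 * c) * sqnorm (\<lambda>x. Kt (\<tau> n) x - K0 x)" for n
      unfolding sqnorm_def by (rule nn_integral_cmult) measurable
    have "(\<lambda>n. ennreal (2 * c) * sqnorm (\<lambda>x. Kt (\<tau> n) x - K0 x)) \<longlonglongrightarrow> ennreal (2 * c) * 0"
      by (intro ennreal_tendsto_cmult filterlim_compose[OF K fl]) simp
    then show "(\<lambda>n. \<integral>\<^sup>+x. ?E n x \<partial>lborel) \<longlonglongrightarrow> 0" unfolding eq by simp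
  qed
  moreover have "\<forall>\<^sub>F n in sequentially. (\<integral>\<^sup>+x. ennreal (cmod (Ft (\<tau> n) x - f0 x) powr p) \<partial>lborel) = (\<integral>\<^sup>+x. ennreal (cmod (Ft (\<tau>' n) x - f0 x) powr p) \<partial>lborel)"
    using ev by eventually_elim simp
  ultimately show "(\<lambda>n. \<integral>\<^sup>+x. ennreal (cmod (Ft (\<tau>' n) x - f0 x) powr p) \<partial>lborel) \<longlonglongrightarrow> 0"
    by (rule Lim_transform_eventually)
qed

lemma line_integral_convergence:
  fixes U Kt :: "nat \<Rightarrow> real \<Rightarrow> complex"
  assumes [measurable]: "\<And>n. U n \<in> borel_measurable borel" "U0 \<in> borel_measurable borel"
      "\<And>n. Kt n \<in> borel_measurable borel" "K0 \<in> borel_measurable borel" "\<phi> \<in> borel_measurable borel"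
    and "C > 0" and \<phi>0: "\<And>x. \<phi> x \<ge> (0::real)"
    and UK: "\<And>n. AE x in lborel. cmod (U n x) \<le> C * (\<phi> x + (cmod (Kt n x))\<^sup>2)"
    and U0K: "AE x in lborel. cmod (U0 x) \<le> C * (\<phi> x + (cmod (K0 x))\<^sup>2)"
    and lim: "AE x in lborel. (\<lambda>n. U n x) \<longlonglongrightarrow> U0 x"
    and K: "(\<lambda>n. sqnorm (\<lambda>x. Kt n x - K0 x)) \<longlonglongrightarrow> 0" and K0: "sqnorm K0 < top"
    and \<phi>: "(\<integral>\<^sup>+x. ennreal (\<phi> x) \<partial>lborel) < top"
    and iU: "\<And>n. integrable lborel (U n)"
  shows "integrable lborel U0" and "(\<lambda>n. LINT x|lborel. U n x) \<longlonglongrightarrow> (LINT x|lborel. U0 x)"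
proof -
  have fin: "(\<integral>\<^sup>+x. ennreal a * ennreal (\<phi> x) + ennreal b * ennreal ((cmod (K0 x))\<^sup>2) \<partial>lborel) < top" for a b
  proof -
    have "(\<integral>\<^sup>+x. ennreal a * ennreal (\<phi> x) + ennreal b * ennreal ((cmod (K0 x))\<^sup>2) \<partial>lborel)
       = ennreal a * (\<integral>\<^sup>+x. ennreal (\<phi> x) \<partial>lborel) + ennreal b * sqnorm K0"
      unfolding sqnorm_def by (simp add: nn_integral_add nn_integral_cmult)
    also have "\<dots> < top" using \<phi> K0 by (simp add: ennreal_mult_less_top)
    finally show ?thesis .
  qed
  show i0: "integrable lborel U0"
  proof (rule integrableI_bounded)
    have "(\<integral>\<^sup>+x. norm (U0 x) \<partial>lborel) \<le> (\<integral>\<^sup>+x. ennreal C * ennreal (\<phi> x) + ennreal C * ennreal ((cmod (K0 x))\<^sup>2) \<partial>lborel)"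
    proof (rule nn_integral_mono_AE)
      show "AE x in lborel. ennreal (norm (U0 x)) \<le> ennreal C * ennreal (\<phi> x) + ennreal C * ennreal ((cmod (K0 x))\<^sup>2)"
        using U0K
      proof eventually_elim
        case (elim x)
        then show ?case
          using \<open>C > 0\<close> \<phi>0 by (simp flip: ennreal_mult ennreal_plus add: distrib_left)
      qed
    qed
    then show "(\<integral>\<^sup>+x. norm (U0 x) \<partial>lborel) < \<infinity>" using fin[of C C] by (auto intro: le_less_trans)
  qed simp
  have "(\<lambda>n. \<integral>\<^sup>+x. ennreal (cmod (U n x - U0 x)) \<partial>lborel) \<longlonglongrightarrow> 0"
  proof (rule nn_integral_generalized_dominated[where H = "\<lambda>x. ennreal (2 * C) * ennreal (\<phi> x) + ennreal (3 * C) * ennreal ((cmod (K0 x))\<^sup>2)"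
        and E = "\<lambda>n x. ennreal (2 * C) * ennreal ((cmod (Kt n x - K0 x))\<^sup>2)"])
    let ?H = "\<lambda>x. ennreal (2 * C) * ennreal (\<phi> x) + ennreal (3 * C) * ennreal ((cmod (K0 x))\<^sup>2)"
    let ?E = "\<lambda>n x. ennreal (2 * C) * ennreal ((cmod (Kt n x - K0 x))\<^sup>2)"
    show "(\<lambda>x. ennreal (cmod (U n x - U0 x))) \<in> borel_measurable lborel" for n by measurable
    show "?H \<in> borel_measurable lborel" by measurable
    show "?E n \<in> borel_measurable lborel" for n by measurable
    show "AE x in lborel. (\<lambda>n. ennreal (cmod (U n x - U0 x))) \<longlonglongrightarrow> 0"
      using lim
    proof eventually_elim
      case (elim x)
      then have "(\<lambda>n. cmod (U n x - U0 x)) \<longlonglongrightarrow> 0" by (simp add: LIM_zero tendsto_norm_zero)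
      then show ?case using tendsto_ennrealI by fastforce
    qed
    show "\<forall>\<^sub>F n in sequentially. AE x in lborel. ennreal (cmod (U n x - U0 x)) \<le> ?H x + ?E n x"
    proof (rule always_eventually, rule allI)
      fix n
      show "AE x in lborel. ennreal (cmod (U n x - U0 x)) \<le> ?H x + ?E n x"
        using U0K UK[of n]
      proof eventually_elim
        case (elim x)
        have "cmod (U n x - U0 x) \<le> cmod (U n x) + cmod (U0 x)" by (rule norm_triangle_ineq4)
        also have "\<dots> \<le> C * (\<phi> x + (2 * (cmod (Kt n x - K0 x))\<^sup>2 + 2 * (cmod (K0 x))\<^sup>2)) + C * (\<phi> x + (cmod (K0 x))\<^sup>2)"
          using \<open>C > 0\<close> elim square_le_diff_square[of "Kt n x" "K0 x"]
          by (intro add_mono order.trans[OF elim(2)] elim(1) mult_left_mono add_left_mono) auto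
        also have "\<dots> = (2 * C * \<phi> x + 3 * C * (cmod (K0 x))\<^sup>2) + 2 * C * (cmod (Kt n x - K0 x))\<^sup>2"
          by (simp add: algebra_simps)
        finally show ?case
          using \<open>C > 0\<close> \<phi>0[of x] by (simp flip: ennreal_mult ennreal_plus)
      qed
    qed
    show "(\<integral>\<^sup>+x. ?H x \<partial>lborel) < top" by (rule fin)
    have eq: "(\<integral>\<^sup>+x. ?E n x \<partial>lborel) = ennreal (2 * C) * sqnorm (\<lambda>x. Kt n x - K0 x)" for n
      unfolding sqnorm_def by (rule nn_integral_cmult) measurable
    have "(\<lambda>n. ennreal (2 * C) * sqnorm (\<lambda>x. Kt n x - K0 x)) \<longlonglongrightarrow> ennreal (2 * C) * 0"
      by (intro ennreal_tendsto_cmult K) simp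
    then show "(\<lambda>n. \<integral>\<^sup>+x. ?E n x \<partial>lborel) \<longlonglongrightarrow> 0" unfolding eq by simp
  qed
  then show "(\<lambda>n. LINT x|lborel. U n x) \<longlonglongrightarrow> (LINT x|lborel. U0 x)"
    by (intro tendsto_L1_int[OF iU i0]) simp
qed

section \<open>Decay of the Cauchy kernel\<close>

text \<open>
  If \<open>a\<close> is at most \<open>y\<^bsup>-1/p\<^esup>\<close>, the first term dominates, otherwise the second. The exponent of the first
  term is less than -1, so that \<open>y = 1 + |x|\<close> gives an integrable function.
\<close>

lemma young_decay:
  fixes a p y :: real
  assumes "a \<ge> 0" "p \<ge> 1" "y \<ge> 1"
  shows "a / y \<le> y powr (- 1 - 1 / p) + a powr p"
proof (cases "a \<le> y powr (- 1 / p)")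
  case True
  then have "a / y \<le> y powr (- 1 / p) / y" using assms by (intro divide_right_mono) auto
  also have "\<dots> = y powr (- 1 - 1 / p)" using assms by (simp add: powr_diff powr_minus_divide)
  finally show ?thesis by (simp add: add_increasing2)
next
  case False
  then have a: "a > y powr (- 1 / p)" by simp
  have "0 < y powr (- 1 / p)" using assms by simp
  with a have "a > 0" by linarith
  have "1 / y = y powr (- 1)" using assms by (simp add: powr_minus divide_inverse)
  also have "\<dots> \<le> y powr (- 1 / p * (p - 1))"
    using assms by (intro powr_mono) (auto simp: field_simps)
  also have "\<dots> = (y powr (- 1 / p)) powr (p - 1)" by (simp add: powr_powr)
  also have "\<dots> \<le> a powr (p - 1)" using a assms by (intro powr_mono2) auto
  finally have "a * (1 / y) \<le> a * a powr (p - 1)" using \<open>a > 0\<close> by (intro mult_left_mono) auto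
  also have "a * a powr (p - 1) = a powr p"
    using \<open>a > 0\<close> by (simp add: powr_diff)
  finally show ?thesis using assms by (simp add: add_increasing)
qed

lemma nn_integral_decay:
  assumes "p > 0"
  shows "(\<integral>\<^sup>+x. ennreal ((1 + \<bar>x\<bar>) powr (- 1 - 1 / p)) \<partial>lborel) < top"
proof -
  let ?h = "\<lambda>x::real. ennreal ((1 + x) powr (- 1 - 1 / p)) * indicator {0..} x"
  have half: "(\<integral>\<^sup>+x. ?h x \<partial>lborel) = ennreal (0 - (- p * (1 + 0) powr (- 1 / p)))"
  proof (rule nn_integral_FTC_atLeast)
    show "((\<lambda>x. - p * (1 + x) powr (- 1 / p)) \<longlongrightarrow> 0) at_top"
      using assms by real_asymp
    fix x :: real assume "0 \<le> x"
    then show "((\<lambda>x. - p * (1 + x) powr (- 1 / p)) has_real_derivative (1 + x) powr (- 1 - 1 / p)) (at x)"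
      using assms by (auto intro!: derivative_eq_intros simp: powr_diff powr_minus_divide)
  qed auto
  have "(\<integral>\<^sup>+x. ennreal ((1 + \<bar>x\<bar>) powr (- 1 - 1 / p)) \<partial>lborel) \<le> (\<integral>\<^sup>+x. ?h x + ?h (- x) \<partial>lborel)"
    by (intro nn_integral_mono) (auto simp: indicator_def)
  also have "\<dots> = (\<integral>\<^sup>+x. ?h x \<partial>lborel) + (\<integral>\<^sup>+x. ?h (- x) \<partial>lborel)"
    by (intro nn_integral_add) measurable
  also have "(\<integral>\<^sup>+x. ?h (- x) \<partial>lborel) = (\<integral>\<^sup>+x. ?h x \<partial>lborel)"
    by (rule nn_integral_reflect) measurable
  also have "(\<integral>\<^sup>+x. ?h x \<partial>lborel) + (\<integral>\<^sup>+x. ?h x \<partial>lborel) < top" unfolding half by simp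
  finally show ?thesis .
qed

lemma weighted_line_convergence:
  fixes T Kt c :: "nat \<Rightarrow> real \<Rightarrow> complex"
  assumes [measurable]: "\<And>n. T n \<in> borel_measurable borel" "T0 \<in> borel_measurable borel"
      "\<And>n. Kt n \<in> borel_measurable borel" "K0 \<in> borel_measurable borel"
      "\<And>n. c n \<in> borel_measurable borel" "c0 \<in> borel_measurable borel"
    and "C > 0" "p \<ge> 1"
    and TK: "\<And>n. AE x in lborel. cmod (T n x) powr p \<le> (cmod (Kt n x))\<^sup>2"
    and T0K: "AE x in lborel. cmod (T0 x) powr p \<le> (cmod (K0 x))\<^sup>2"
    and lim: "AE x in lborel. (\<lambda>n. T n x * c n x) \<longlonglongrightarrow> T0 x * c0 x"
    and c: "\<And>n x. T n x \<noteq> 0 \<Longrightarrow> cmod (c n x) \<le> C / (1 + \<bar>x\<bar>)"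
    and c0: "\<And>x. T0 x \<noteq> 0 \<Longrightarrow> cmod (c0 x) \<le> C / (1 + \<bar>x\<bar>)"
    and K: "(\<lambda>n. sqnorm (\<lambda>x. Kt n x - K0 x)) \<longlonglongrightarrow> 0" and K0: "sqnorm K0 < top"
    and iT: "\<And>n. integrable lborel (\<lambda>x. T n x * c n x)"
  shows "integrable lborel (\<lambda>x. T0 x * c0 x)"
    and "(\<lambda>n. LINT x|lborel. T n x * c n x) \<longlonglongrightarrow> (LINT x|lborel. T0 x * c0 x)"
proof -
  have le: "cmod (a * b) \<le> C * ((1 + \<bar>x\<bar>) powr (- 1 - 1 / p) + (cmod K)\<^sup>2)"
    if "cmod a powr p \<le> (cmod K)\<^sup>2" "a \<noteq> 0 \<Longrightarrow> cmod b \<le> C / (1 + \<bar>x\<bar>)" for a b K :: complex and x :: real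
  proof -
    have "cmod (a * b) \<le> cmod a * (C / (1 + \<bar>x\<bar>))"
      using that(2) mult_left_mono[of "cmod b" "C / (1 + \<bar>x\<bar>)" "cmod a"]
      by (cases "a = 0") (simp_all add: norm_mult)
    also have "\<dots> = C * (cmod a / (1 + \<bar>x\<bar>))" by simp
    also have "\<dots> \<le> C * ((1 + \<bar>x\<bar>) powr (- 1 - 1 / p) + cmod a powr p)"
      using \<open>C > 0\<close> \<open>p \<ge> 1\<close> by (intro mult_left_mono young_decay) auto
    also have "\<dots> \<le> C * ((1 + \<bar>x\<bar>) powr (- 1 - 1 / p) + (cmod K)\<^sup>2)"
      using \<open>C > 0\<close> that(1) by (intro mult_left_mono add_left_mono) auto
    finally show ?thesis .
  qed
  have 1: "AE x in lborel. cmod (T n x * c n x) \<le> C * ((1 + \<bar>x\<bar>) powr (- 1 - 1 / p) + (cmod (Kt n x))\<^sup>2)" for n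
    using TK[of n] by eventually_elim (intro le c)
  have 2: "AE x in lborel. cmod (T0 x * c0 x) \<le> C * ((1 + \<bar>x\<bar>) powr (- 1 - 1 / p) + (cmod (K0 x))\<^sup>2)"
    using T0K by eventually_elim (intro le c0)
  have 4: "(\<lambda>x. T n x * c n x) \<in> borel_measurable borel" "(\<lambda>x. T0 x * c0 x) \<in> borel_measurable borel"
     "(\<lambda>x::real. (1 + \<bar>x\<bar>) powr (- 1 - 1 / p)) \<in> borel_measurable borel" for n
    by measurable
  note conv = line_integral_convergence[OF 4(1) 4(2) assms(3,4) 4(3) \<open>C > 0\<close> _ 1 2 lim K K0 nn_integral_decay iT]
  show "integrable lborel (\<lambda>x. T0 x * c0 x)" by (rule conv(1)) (use \<open>p \<ge> 1\<close> in auto)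
  show "(\<lambda>n. LINT x|lborel. T n x * c n x) \<longlonglongrightarrow> (LINT x|lborel. T0 x * c0 x)"
    by (rule conv(2)) (use \<open>p \<ge> 1\<close> in auto)
qed

text \<open>
  One distance for the boundary itself (\<open>\<tau> = 0\<close>) and for all inset boundaries up to \<open>\<delta>\<close>, so that the Cauchy
  kernels along them have a common bound.
\<close>

definition uniformly_off_boundary :: "real \<Rightarrow> real \<Rightarrow> real \<Rightarrow> complex \<Rightarrow> bool" where
  "uniformly_off_boundary \<sigma> \<delta> d w \<longleftrightarrow>
    (\<forall>\<tau> \<zeta>. 0 \<le> \<tau> \<and> \<tau> < \<delta> \<and> (\<bar>Re \<zeta>\<bar> = \<sigma> - \<tau> \<and> Im \<zeta> \<ge> 0 \<or> \<bar>Re \<zeta>\<bar> \<le> \<sigma> \<and> Im \<zeta> = \<tau>) \<longrightarrow> d \<le> cmod (\<zeta> - w))"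

lemma cauchy_kernel_decay:
  assumes "0 < d" "d \<le> cmod (\<zeta> - w)" "\<bar>x\<bar> \<le> cmod \<zeta>"
  shows "cmod (1 / (\<zeta> - w)) \<le> ((1 + cmod w) / d + 1) / (1 + \<bar>x\<bar>)"
proof -
  have "1 + \<bar>x\<bar> \<le> 1 + cmod w + cmod (\<zeta> - w)"
    using assms(3) norm_triangle_ineq[of "\<zeta> - w" w] by simp
  also have "1 + cmod w = (1 + cmod w) / d * d" using assms by simp
  also have "(1 + cmod w) / d * d \<le> (1 + cmod w) / d * cmod (\<zeta> - w)"
    using assms by (intro mult_left_mono) auto
  finally have "1 + \<bar>x\<bar> \<le> ((1 + cmod w) / d + 1) * cmod (\<zeta> - w)" by (simp add: algebra_simps)
  moreover have "0 < cmod (\<zeta> - w)" using assms by linarith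
  ultimately show ?thesis by (simp add: norm_divide field_simps add_pos_nonneg)
qed

section \<open>The boundary function\<close>

lemma transport_left:
  assumes "0 < \<tau>" "\<tau> < \<sigma>"
  shows "transport \<sigma> (\<sigma> - \<tau>) \<tau> F (Complex (- \<sigma>) v) = restr {\<tau><..} (\<lambda>v. F (Complex (\<tau> - \<sigma>) v)) v"
  using assms by (auto simp: transport_def restr_def gam1_def gam2_def gam3_def Complex_plus indicator_def)

lemma transport_bottom:
  assumes "0 < \<tau>" "\<tau> < \<sigma>"
  shows "transport \<sigma> (\<sigma> - \<tau>) \<tau> F (Complex u 0) = restr {\<tau> - \<sigma>..\<sigma> - \<tau>} (\<lambda>u. F (Complex u \<tau>)) u"
  using assms by (auto simp: transport_def restr_def gam1_def gam2_def gam3_def Complex_plus indicator_def)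

lemma transport_right:
  assumes "0 < \<tau>" "\<tau> < \<sigma>"
  shows "transport \<sigma> (\<sigma> - \<tau>) \<tau> F (Complex \<sigma> v) = restr {\<tau><..} (\<lambda>v. F (Complex (\<sigma> - \<tau>) v)) v"
proof -
  have "Complex \<sigma> v - of_real \<tau> = Complex (\<sigma> - \<tau>) v" by (simp add: complex_eq_iff)
  then show ?thesis
    using assms by (auto simp: transport_def restr_def gam1_def gam2_def gam3_def indicator_def)
qed

lemma transport_measurable:
  assumes F: "F holomorphic_on half_strip \<sigma> 0" and \<tau>: "0 < \<tau>" "\<tau> < \<sigma>"
  shows "transport \<sigma> (\<sigma> - \<tau>) \<tau> F \<in> borel_measurable borel"
proof -
  define S1 S2 S3 where "S1 = gam1 \<sigma> \<inter> {w. Im w > \<tau>}" and "S2 = gam2 \<inter> {w. \<bar>Re w\<bar> \<le> \<sigma> - \<tau>}" and "S3 = gam3 \<sigma> \<inter> {w. Im w > \<tau>}"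
  have S: "S1 \<in> sets borel" "S2 \<in> sets borel" "S3 \<in> sets borel"
    unfolding S1_def S2_def S3_def gam1_def gam2_def gam3_def by measurable
  note cF = holomorphic_on_imp_continuous_on[OF F]
  have c: "continuous_on S1 (\<lambda>\<zeta>. F (\<zeta> + of_real \<tau>))" "continuous_on S2 (\<lambda>\<zeta>. F (\<zeta> + \<i> * of_real \<tau>))"
    "continuous_on S3 (\<lambda>\<zeta>. F (\<zeta> - of_real \<tau>))"
    using \<tau> by (auto intro!: continuous_on_compose2[OF cF] continuous_intros
        simp: S1_def S2_def S3_def gam1_def gam2_def gam3_def half_strip_def)
  have [measurable]: "(\<lambda>\<zeta>. indicator S1 \<zeta> *\<^sub>R F (\<zeta> + of_real \<tau>)) \<in> borel_measurable borel"
    "(\<lambda>\<zeta>. indicator S2 \<zeta> *\<^sub>R F (\<zeta> + \<i> * of_real \<tau>)) \<in> borel_measurable borel"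
    "(\<lambda>\<zeta>. indicator S3 \<zeta> *\<^sub>R F (\<zeta> - of_real \<tau>)) \<in> borel_measurable borel"
    by (intro borel_measurable_continuous_on_indicator S c)+
  have "transport \<sigma> (\<sigma> - \<tau>) \<tau> F = (\<lambda>\<zeta>. indicator S1 \<zeta> *\<^sub>R F (\<zeta> + of_real \<tau>) + indicator S2 \<zeta> *\<^sub>R F (\<zeta> + \<i> * of_real \<tau>)
      + indicator S3 \<zeta> *\<^sub>R F (\<zeta> - of_real \<tau>))"
    using \<tau> by (auto simp: fun_eq_iff transport_def S1_def S2_def S3_def gam1_def gam2_def gam3_def indicator_def)
  then show ?thesis by simp
qed

definition approach :: "real \<Rightarrow> nat \<Rightarrow> real" where
  "approach \<sigma> n = \<sigma> / (real n + 2)"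

lemma approach:
  assumes "\<sigma> > 0"
  shows "0 < approach \<sigma> n" "approach \<sigma> n < \<sigma>" "filterlim (approach \<sigma>) (at_right 0) sequentially"
proof -
  show "0 < approach \<sigma> n" "approach \<sigma> n < \<sigma>"
    using assms by (auto simp: approach_def field_simps intro: add_pos_nonneg)
  show "filterlim (approach \<sigma>) (at_right 0) sequentially"
    unfolding approach_def[abs_def] using assms by real_asymp
qed

text \<open>
  As for \<open>boundary_value\<close>, a limit along a fixed sequence of insets is measurable by construction.
\<close>

definition boundary_trace :: "real \<Rightarrow> (complex \<Rightarrow> complex) \<Rightarrow> complex \<Rightarrow> complex" where
  "boundary_trace \<sigma> F \<zeta> = lim (\<lambda>n. transport \<sigma> (\<sigma> - approach \<sigma> n) (approach \<sigma> n) F \<zeta>)"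

lemma boundary_trace_measurable:
  assumes "F holomorphic_on half_strip \<sigma> 0" "\<sigma> > 0"
  shows "boundary_trace \<sigma> F \<in> borel_measurable borel"
  unfolding boundary_trace_def
  by (rule borel_measurable_lim_metric) (intro transport_measurable assms approach)

lemma boundary_trace_eq:
  assumes "((\<lambda>\<tau>. transport \<sigma> (\<sigma> - \<tau>) \<tau> F \<zeta>) \<longlongrightarrow> l) (at_right 0)" "\<sigma> > 0"
  shows "boundary_trace \<sigma> F \<zeta> = l"
  unfolding boundary_trace_def
  by (rule limI) (rule filterlim_compose[OF assms(1) approach(3)[OF assms(2)]])

context
  fixes \<sigma> p N :: real and F k1 k2 k3 b1 b2 b3 :: "complex \<Rightarrow> complex"
  assumes \<sigma>: "\<sigma> > 0" and p: "p > 0" and F: "F \<in> Hp p \<sigma>"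
    and k: "hardy2 N k1" "hardy2 N k2" "hardy2 N k3" and b: "hardy2 N b1" "hardy2 N b2" "hardy2 N b3"
    and maj: "\<And>w. w \<in> half_strip \<sigma> 0 \<Longrightarrow> cmod (F w) powr p \<le> (cmod (strip_sum \<sigma> k1 k2 k3 w))\<^sup>2"
    and pos: "\<And>w. w \<in> half_strip \<sigma> 0 \<Longrightarrow> 0 < Re (strip_sum \<sigma> k1 k2 k3 w)"
    and fac: "\<And>w. w \<in> half_strip \<sigma> 0 \<Longrightarrow> F w = strip_sum \<sigma> b1 b2 b3 w * (w + \<i>) * strip_sum \<sigma> k1 k2 k3 w powr of_real (2 / p)"
begin

lemma factor_limit:
  assumes "(strip_sum \<sigma> k1 k2 k3 \<longlongrightarrow> \<kappa>) (nt_filter \<sigma> \<alpha> \<zeta>)" "(strip_sum \<sigma> b1 b2 b3 \<longlongrightarrow> \<beta>) (nt_filter \<sigma> \<alpha> \<zeta>)"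
    and ne: "nt_filter \<sigma> \<alpha> \<zeta> \<noteq> bot"
  shows "(F \<longlongrightarrow> \<beta> * (\<zeta> + \<i>) * \<kappa> powr of_real (2 / p)) (nt_filter \<sigma> \<alpha> \<zeta>)"
    and "cmod (\<beta> * (\<zeta> + \<i>) * \<kappa> powr of_real (2 / p)) powr p \<le> (cmod \<kappa>)\<^sup>2"
proof -
  let ?F = "nt_filter \<sigma> \<alpha> \<zeta>"
  have ev: "\<forall>\<^sub>F w in ?F. w \<in> half_strip \<sigma> 0"
    using eventually_nt_filter by eventually_elim simp
  have "((\<lambda>w. strip_sum \<sigma> b1 b2 b3 w * (w + \<i>) * strip_sum \<sigma> k1 k2 k3 w powr of_real (2 / p))
      \<longlongrightarrow> \<beta> * (\<zeta> + \<i>) * \<kappa> powr of_real (2 / p)) ?F"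
    using p by (intro tendsto_mult tendsto_add tendsto_ident_at tendsto_const assms tendsto_powr_right_half_plane)
      (use ev pos in \<open>auto elim!: eventually_mono intro: less_imp_le\<close>)
  then show lim: "(F \<longlongrightarrow> \<beta> * (\<zeta> + \<i>) * \<kappa> powr of_real (2 / p)) ?F"
    by (rule Lim_transform_eventually) (use ev fac in \<open>auto elim!: eventually_mono\<close>)
  have "((\<lambda>w. cmod (F w) powr p) \<longlongrightarrow> cmod (\<beta> * (\<zeta> + \<i>) * \<kappa> powr of_real (2 / p)) powr p) ?F"
    using p by (intro tendsto_powr' tendsto_norm lim tendsto_const) auto
  moreover have "((\<lambda>w. (cmod (strip_sum \<sigma> k1 k2 k3 w))\<^sup>2) \<longlongrightarrow> (cmod \<kappa>)\<^sup>2) ?F"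
    by (intro tendsto_intros assms)
  ultimately show "cmod (\<beta> * (\<zeta> + \<i>) * \<kappa> powr of_real (2 / p)) powr p \<le> (cmod \<kappa>)\<^sup>2"
    using tendsto_le[OF ne] ev maj by (smt (verit) eventually_mono)
qed

lemma trace_at_point:
  assumes bd: "\<zeta> \<in> bdry \<sigma> 0 - {- of_real \<sigma>, of_real \<sigma>}"
    and path: "\<And>\<alpha>. \<alpha> > 0 \<Longrightarrow> filterlim c (nt_filter \<sigma> \<alpha> \<zeta>) (at_right 0)"
    and \<kappa>: "\<And>\<alpha>. \<alpha> > 0 \<Longrightarrow> (strip_sum \<sigma> k1 k2 k3 \<longlongrightarrow> \<kappa>) (nt_filter \<sigma> \<alpha> \<zeta>)"
    and \<beta>: "\<And>\<alpha>. \<alpha> > 0 \<Longrightarrow> (strip_sum \<sigma> b1 b2 b3 \<longlongrightarrow> \<beta>) (nt_filter \<sigma> \<alpha> \<zeta>)"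
    and tr: "\<forall>\<^sub>F \<tau> in at_right 0. F (c \<tau>) = transport \<sigma> (\<sigma> - \<tau>) \<tau> F \<zeta>"
  shows "has_nt_limit \<sigma> F \<zeta> (boundary_trace \<sigma> F \<zeta>) \<and>
    ((\<lambda>\<tau>. transport \<sigma> (\<sigma> - \<tau>) \<tau> F \<zeta>) \<longlongrightarrow> boundary_trace \<sigma> F \<zeta>) (at_right 0) \<and>
    cmod (boundary_trace \<sigma> F \<zeta>) powr p \<le> (cmod \<kappa>)\<^sup>2"
proof -
  define l where "l = \<beta> * (\<zeta> + \<i>) * \<kappa> powr of_real (2 / p)"
  have ne: "nt_filter \<sigma> \<alpha> \<zeta> \<noteq> bot" if "\<alpha> > 0" for \<alpha>
    using path[OF that] by (auto simp: filterlim_def filtermap_bot_iff bot_unique)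
  note L = factor_limit[OF \<kappa> \<beta> ne, folded l_def]
  have "((\<lambda>\<tau>. F (c \<tau>)) \<longlongrightarrow> l) (at_right 0)"
    by (rule filterlim_compose[OF L(1) path[OF zero_less_one]]) (rule zero_less_one)+
  then have lim: "((\<lambda>\<tau>. transport \<sigma> (\<sigma> - \<tau>) \<tau> F \<zeta>) \<longlongrightarrow> l) (at_right 0)"
    by (rule Lim_transform_eventually[OF _ tr])
  from boundary_trace_eq[OF this \<sigma>] have eq: "boundary_trace \<sigma> F \<zeta> = l" .
  have "has_nt_limit \<sigma> F \<zeta> l"
    unfolding has_nt_limit_def using bd L(1) by blast
  moreover have "cmod l powr p \<le> (cmod \<kappa>)\<^sup>2"
    by (rule L(2)) (rule zero_less_one)+
  ultimately show ?thesis unfolding eq using lim by blast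
qed

lemma trace_left:
  "AE v in lborel. v > 0 \<longrightarrow> has_nt_limit \<sigma> F (Complex (- \<sigma>) v) (boundary_trace \<sigma> F (Complex (- \<sigma>) v)) \<and>
     ((\<lambda>\<tau>. transport \<sigma> (\<sigma> - \<tau>) \<tau> F (Complex (- \<sigma>) v)) \<longlongrightarrow> boundary_trace \<sigma> F (Complex (- \<sigma>) v)) (at_right 0) \<and>
     cmod (boundary_trace \<sigma> F (Complex (- \<sigma>) v)) powr p \<le> (cmod (strip_left \<sigma> k1 k2 k3 v))\<^sup>2"
  using AE_lborel_reflect[OF AE_nt_limit_at[OF k(1)]] AE_lborel_reflect[OF AE_nt_limit_at[OF b(1)]]
proof eventually_elim
  case (elim v)
  show ?case
  proof
    assume v: "v > 0"
    show "has_nt_limit \<sigma> F (Complex (- \<sigma>) v) (boundary_trace \<sigma> F (Complex (- \<sigma>) v)) \<and>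
     ((\<lambda>\<tau>. transport \<sigma> (\<sigma> - \<tau>) \<tau> F (Complex (- \<sigma>) v)) \<longlongrightarrow> boundary_trace \<sigma> F (Complex (- \<sigma>) v)) (at_right 0) \<and>
     cmod (boundary_trace \<sigma> F (Complex (- \<sigma>) v)) powr p \<le> (cmod (strip_left \<sigma> k1 k2 k3 v))\<^sup>2"
    proof (rule trace_at_point[OF _ normal_approach_left[OF v \<sigma>] strip_sum_limit_left[OF k(2,3) v \<sigma> _ elim(1)]
          strip_sum_limit_left[OF b(2,3) v \<sigma> _ elim(2)]])
      show "Complex (- \<sigma>) v \<in> bdry \<sigma> 0 - {- of_real \<sigma>, of_real \<sigma>}"
        using v by (auto simp: bdry_def Gamma1_def complex_eq_iff)
      have "0 < min v \<sigma>" using v \<sigma> by simp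
      from eventually_at_right_real[OF this]
      show "\<forall>\<^sub>F \<tau> in at_right 0. F (Complex (\<tau> - \<sigma>) v) = transport \<sigma> (\<sigma> - \<tau>) \<tau> F (Complex (- \<sigma>) v)"
        by eventually_elim (auto simp: transport_left restr_def)
    qed
  qed
qed

lemma trace_right:
  "AE v in lborel. v > 0 \<longrightarrow> has_nt_limit \<sigma> F (Complex \<sigma> v) (boundary_trace \<sigma> F (Complex \<sigma> v)) \<and>
     ((\<lambda>\<tau>. transport \<sigma> (\<sigma> - \<tau>) \<tau> F (Complex \<sigma> v)) \<longlongrightarrow> boundary_trace \<sigma> F (Complex \<sigma> v)) (at_right 0) \<and>
     cmod (boundary_trace \<sigma> F (Complex \<sigma> v)) powr p \<le> (cmod (strip_right \<sigma> k1 k2 k3 v))\<^sup>2"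
  using AE_nt_limit_at[OF k(3)] AE_nt_limit_at[OF b(3)]
proof eventually_elim
  case (elim v)
  show ?case
  proof
    assume v: "v > 0"
    show "has_nt_limit \<sigma> F (Complex \<sigma> v) (boundary_trace \<sigma> F (Complex \<sigma> v)) \<and>
     ((\<lambda>\<tau>. transport \<sigma> (\<sigma> - \<tau>) \<tau> F (Complex \<sigma> v)) \<longlongrightarrow> boundary_trace \<sigma> F (Complex \<sigma> v)) (at_right 0) \<and>
     cmod (boundary_trace \<sigma> F (Complex \<sigma> v)) powr p \<le> (cmod (strip_right \<sigma> k1 k2 k3 v))\<^sup>2"
    proof (rule trace_at_point[OF _ normal_approach_right[OF v \<sigma>] strip_sum_limit_right[OF k(1,2) v \<sigma> _ elim(1)]
          strip_sum_limit_right[OF b(1,2) v \<sigma> _ elim(2)]])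
      show "Complex \<sigma> v \<in> bdry \<sigma> 0 - {- of_real \<sigma>, of_real \<sigma>}"
        using v by (auto simp: bdry_def Gamma3_def complex_eq_iff)
      have "0 < min v \<sigma>" using v \<sigma> by simp
      from eventually_at_right_real[OF this]
      show "\<forall>\<^sub>F \<tau> in at_right 0. F (Complex (\<sigma> - \<tau>) v) = transport \<sigma> (\<sigma> - \<tau>) \<tau> F (Complex \<sigma> v)"
        by eventually_elim (auto simp: transport_right restr_def)
    qed
  qed
qed

lemma trace_bottom:
  "AE u in lborel. \<bar>u\<bar> < \<sigma> \<longrightarrow> has_nt_limit \<sigma> F (Complex u 0) (boundary_trace \<sigma> F (Complex u 0)) \<and>
     ((\<lambda>\<tau>. transport \<sigma> (\<sigma> - \<tau>) \<tau> F (Complex u 0)) \<longlongrightarrow> boundary_trace \<sigma> F (Complex u 0)) (at_right 0) \<and>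
     cmod (boundary_trace \<sigma> F (Complex u 0)) powr p \<le> (cmod (strip_bottom \<sigma> k1 k2 k3 u))\<^sup>2"
  using AE_nt_limit_at[OF k(2)] AE_nt_limit_at[OF b(2)]
proof eventually_elim
  case (elim u)
  show ?case
  proof
    assume u: "\<bar>u\<bar> < \<sigma>"
    show "has_nt_limit \<sigma> F (Complex u 0) (boundary_trace \<sigma> F (Complex u 0)) \<and>
     ((\<lambda>\<tau>. transport \<sigma> (\<sigma> - \<tau>) \<tau> F (Complex u 0)) \<longlongrightarrow> boundary_trace \<sigma> F (Complex u 0)) (at_right 0) \<and>
     cmod (boundary_trace \<sigma> F (Complex u 0)) powr p \<le> (cmod (strip_bottom \<sigma> k1 k2 k3 u))\<^sup>2"
    proof (rule trace_at_point[OF _ normal_approach_bottom[OF u] strip_sum_limit_bottom[OF k(1,3) u _ elim(1)]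
          strip_sum_limit_bottom[OF b(1,3) u _ elim(2)]])
      show "Complex u 0 \<in> bdry \<sigma> 0 - {- of_real \<sigma>, of_real \<sigma>}"
        using u by (auto simp: bdry_def Gamma2_def complex_eq_iff)
      have "0 < \<sigma> - \<bar>u\<bar>" using u by simp
      from eventually_at_right_real[OF this]
      show "\<forall>\<^sub>F \<tau> in at_right 0. F (Complex u \<tau>) = transport \<sigma> (\<sigma> - \<tau>) \<tau> F (Complex u 0)"
        by eventually_elim (use u in \<open>auto simp: transport_bottom restr_def indicator_def\<close>)
    qed
  qed
qed

theorem trace_nontangential:
  "AE \<zeta> in arc_measure \<sigma> 0. has_nt_limit \<sigma> F \<zeta> (boundary_trace \<sigma> F \<zeta>)"
  by (rule AE_arc_measure[OF \<sigma>]; rule eventually_mono, rule trace_left trace_bottom trace_right, blast)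

lemma restr_norm_powr: "cmod (restr S f x) powr p = indicator S x * cmod (f x) powr p"
  using p by (simp add: restr_def indicator_def)

lemma restr_norm_square: "(cmod (restr S f x))\<^sup>2 = indicator S x * (cmod (f x))\<^sup>2"
  by (simp add: restr_def indicator_def)

text \<open>
  Fatou's lemma, as the integrals over the inset boundaries are bounded by the norm of \<open>F\<close>.
\<close>

theorem trace_norm_le:
  "Lp_norm p (arc_measure \<sigma> 0) (boundary_trace \<sigma> F) \<le> Hp_norm p \<sigma> F"
  "boundary_trace \<sigma> F \<in> Lp p (arc_measure \<sigma> 0)"
proof -
  note hol = Hp_holomorphic[OF F]
  have [measurable]: "bdry \<sigma> 0 \<in> sets borel"
    unfolding bdry_def Gamma1_def Gamma2_def Gamma3_def by measurable
  have am: "f \<in> borel_measurable (arc_measure \<sigma> 0)" if "f \<in> borel_measurable borel" for f :: "complex \<Rightarrow> complex"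
    unfolding arc_measure_def lines_measure_def
    by (intro measurable_restrict_space1 measurable_completion) (use that in simp)
  have fin: "Hp_norm p \<sigma> F < top" using F by (simp add: Hp_def)
  let ?H = "enn2real (Hp_norm p \<sigma> F)"
  let ?T = "\<lambda>n. transport \<sigma> (\<sigma> - approach \<sigma> n) (approach \<sigma> n) F"
  note \<tau> = approach(1,2)[OF \<sigma>]
  note [measurable] = transport_measurable[OF hol \<tau>]
  have "(\<integral>\<^sup>+\<zeta>. ennreal (cmod (boundary_trace \<sigma> F \<zeta>) powr p) \<partial>arc_measure \<sigma> 0) \<le> ennreal (?H powr p)"
  proof (rule nn_integral_limit_le)
    show "(\<lambda>\<zeta>. ennreal (cmod (?T n \<zeta>) powr p)) \<in> borel_measurable (arc_measure \<sigma> 0)" for n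
      using am[OF transport_measurable[OF hol \<tau>[of n]]] by measurable
    have "AE \<zeta> in arc_measure \<sigma> 0. ((\<lambda>\<tau>. transport \<sigma> (\<sigma> - \<tau>) \<tau> F \<zeta>) \<longlongrightarrow> boundary_trace \<sigma> F \<zeta>) (at_right 0)"
      by (rule AE_arc_measure[OF \<sigma>]; rule eventually_mono, rule trace_left trace_bottom trace_right, blast)
    then show "AE \<zeta> in arc_measure \<sigma> 0. (\<lambda>n. ennreal (cmod (?T n \<zeta>) powr p)) \<longlonglongrightarrow> ennreal (cmod (boundary_trace \<sigma> F \<zeta>) powr p)"
    proof eventually_elim
      case (elim \<zeta>)
      have "(\<lambda>n. ?T n \<zeta>) \<longlonglongrightarrow> boundary_trace \<sigma> F \<zeta>"
        by (rule filterlim_compose[OF elim approach(3)[OF \<sigma>]])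
      then show ?case
        using p by (intro tendsto_ennrealI tendsto_powr' tendsto_norm tendsto_const) auto
    qed
    show "\<forall>\<^sub>F n in sequentially. (\<integral>\<^sup>+\<zeta>. ennreal (cmod (?T n \<zeta>) powr p) \<partial>arc_measure \<sigma> 0) \<le> ennreal (?H powr p)"
    proof (intro always_eventually allI)
      fix n
      let ?\<tau> = "approach \<sigma> n"
      have "(\<integral>\<^sup>+\<zeta>. ennreal (cmod (?T n \<zeta>) powr p) \<partial>arc_measure \<sigma> 0) =
          (\<integral>\<^sup>+v. indicator {0..} v * ennreal (cmod (?T n (Complex (- \<sigma>) v)) powr p) \<partial>lborel)
          + (\<integral>\<^sup>+u. indicator {- \<sigma>..\<sigma>} u * ennreal (cmod (?T n (Complex u 0)) powr p) \<partial>lborel)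
          + (\<integral>\<^sup>+v. indicator {0..} v * ennreal (cmod (?T n (Complex \<sigma> v)) powr p) \<partial>lborel)"
        by (rule nn_integral_arc_measure[OF _ \<sigma>]) measurable
      also have "\<dots> \<le> (\<integral>\<^sup>+v. indicator {?\<tau>..} v * ennreal (cmod (F (Complex (- (\<sigma> - ?\<tau>)) v)) powr p) \<partial>lborel)
          + (\<integral>\<^sup>+u. indicator {- (\<sigma> - ?\<tau>)..\<sigma> - ?\<tau>} u * ennreal (cmod (F (Complex u ?\<tau>)) powr p) \<partial>lborel)
          + (\<integral>\<^sup>+v. indicator {?\<tau>..} v * ennreal (cmod (F (Complex (\<sigma> - ?\<tau>) v)) powr p) \<partial>lborel)"
        unfolding transport_left[OF \<tau>] transport_bottom[OF \<tau>] transport_right[OF \<tau>] restr_norm_powr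
        by (intro add_mono nn_integral_mono) (auto simp: indicator_def)
      also have "\<dots> \<le> ennreal (?H powr p)"
        using \<tau>[of n] by (intro Hp_side_integrals[OF F p]) auto
      finally show "(\<integral>\<^sup>+\<zeta>. ennreal (cmod (?T n \<zeta>) powr p) \<partial>arc_measure \<sigma> 0) \<le> ennreal (?H powr p)" .
    qed
  qed
  then have "Lp_norm p (arc_measure \<sigma> 0) (boundary_trace \<sigma> F) \<le> ennreal ?H"
    using p by (subst Lp_norm_le_iff) auto
  then show "Lp_norm p (arc_measure \<sigma> 0) (boundary_trace \<sigma> F) \<le> Hp_norm p \<sigma> F"
    using fin by simp
  then show "boundary_trace \<sigma> F \<in> Lp p (arc_measure \<sigma> 0)"
    using am[OF boundary_trace_measurable[OF hol \<sigma>]] fin by (auto simp: Lp_def intro: le_less_trans)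
qed

text \<open>
  What mean convergence and Cauchy's formula need to know about a side, so that the three sides can be
  treated alike: \<open>pt x\<close> is the boundary point with free coordinate \<open>x\<close>, \<open>nearby \<tau> x\<close> the point of the inset
  side opposite to it, \<open>I \<tau>\<close> the range of the free coordinate on the inset side, \<open>S\<close> that on the boundary and
  \<open>K\<close> the boundary function of the majorant.
\<close>

definition boundary_side ::
    "(real \<Rightarrow> complex) \<Rightarrow> (real \<Rightarrow> real \<Rightarrow> complex) \<Rightarrow> (real \<Rightarrow> real set) \<Rightarrow> real set \<Rightarrow> (real \<Rightarrow> complex) \<Rightarrow> bool" where
  "boundary_side pt nearby I S K \<longleftrightarrow>
    pt \<in> borel_measurable borel \<and> (\<forall>\<tau>. nearby \<tau> \<in> borel_measurable borel \<and> I \<tau> \<in> sets borel) \<and>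
    S \<in> sets borel \<and> K \<in> borel_measurable borel \<and>
    (\<forall>\<tau> x. 0 < \<tau> \<and> \<tau> < \<sigma> \<longrightarrow> transport \<sigma> (\<sigma> - \<tau>) \<tau> F (pt x) = restr (I \<tau>) (\<lambda>x. F (nearby \<tau> x)) x \<and>
      (x \<in> I \<tau> \<longrightarrow> x \<in> S \<and> nearby \<tau> x \<in> half_strip \<sigma> 0)) \<and>
    (AE x in lborel. (indicator (bdry \<sigma> 0) (pt x) :: complex) = indicator S x) \<and>
    (AE x in lborel. x \<in> S \<longrightarrow> ((\<lambda>\<tau>. transport \<sigma> (\<sigma> - \<tau>) \<tau> F (pt x)) \<longlongrightarrow> boundary_trace \<sigma> F (pt x)) (at_right 0) \<and>
      cmod (boundary_trace \<sigma> F (pt x)) powr p \<le> (cmod (K x))\<^sup>2) \<and>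
    sqnorm (restr S K) < top \<and>
    ((\<lambda>\<tau>. sqnorm (\<lambda>x. restr (I \<tau>) (\<lambda>x. strip_sum \<sigma> k1 k2 k3 (nearby \<tau> x)) x - restr S K x)) \<longlongrightarrow> 0) (at_right 0)"

lemma left_side: "boundary_side (Complex (- \<sigma>)) (\<lambda>\<tau>. Complex (\<tau> - \<sigma>)) (\<lambda>\<tau>. {\<tau><..}) {0<..} (strip_left \<sigma> k1 k2 k3)"
  unfolding boundary_side_def
proof (intro conjI allI strip_measurable[OF \<sigma> k] strip_left_convergence[OF \<sigma> k])
  show "AE x in lborel. (indicator (bdry \<sigma> 0) (Complex (- \<sigma>) x) :: complex) = indicator {0<..} x"
    using AE_lborel_singleton[of 0]
    by eventually_elim (use \<sigma> in \<open>auto simp: indicator_def bdry_def Gamma1_def Gamma2_def Gamma3_def\<close>)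
  show "AE x in lborel. x \<in> {0<..} \<longrightarrow> ((\<lambda>\<tau>. transport \<sigma> (\<sigma> - \<tau>) \<tau> F (Complex (- \<sigma>) x)) \<longlongrightarrow> boundary_trace \<sigma> F (Complex (- \<sigma>) x)) (at_right 0) \<and>
      cmod (boundary_trace \<sigma> F (Complex (- \<sigma>) x)) powr p \<le> (cmod (strip_left \<sigma> k1 k2 k3 x))\<^sup>2"
    using trace_left by eventually_elim simp
qed (auto simp: transport_left half_strip_def)

lemma right_side: "boundary_side (Complex \<sigma>) (\<lambda>\<tau>. Complex (\<sigma> - \<tau>)) (\<lambda>\<tau>. {\<tau><..}) {0<..} (strip_right \<sigma> k1 k2 k3)"
  unfolding boundary_side_def
proof (intro conjI allI strip_measurable[OF \<sigma> k] strip_right_convergence[OF \<sigma> k])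
  show "AE x in lborel. (indicator (bdry \<sigma> 0) (Complex \<sigma> x) :: complex) = indicator {0<..} x"
    using AE_lborel_singleton[of 0]
    by eventually_elim (use \<sigma> in \<open>auto simp: indicator_def bdry_def Gamma1_def Gamma2_def Gamma3_def\<close>)
  show "AE x in lborel. x \<in> {0<..} \<longrightarrow> ((\<lambda>\<tau>. transport \<sigma> (\<sigma> - \<tau>) \<tau> F (Complex \<sigma> x)) \<longlongrightarrow> boundary_trace \<sigma> F (Complex \<sigma> x)) (at_right 0) \<and>
      cmod (boundary_trace \<sigma> F (Complex \<sigma> x)) powr p \<le> (cmod (strip_right \<sigma> k1 k2 k3 x))\<^sup>2"
    using trace_right by eventually_elim simp
qed (auto simp: transport_right half_strip_def)

lemma bottom_side: "boundary_side (\<lambda>u. Complex u 0) (\<lambda>\<tau> u. Complex u \<tau>) (\<lambda>\<tau>. {\<tau> - \<sigma>..\<sigma> - \<tau>}) {-\<sigma><..<\<sigma>} (strip_bottom \<sigma> k1 k2 k3)"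
  unfolding boundary_side_def
proof (intro conjI allI strip_measurable[OF \<sigma> k] strip_bottom_convergence[OF \<sigma> k])
  show "AE x in lborel. (indicator (bdry \<sigma> 0) (Complex x 0) :: complex) = indicator {-\<sigma><..<\<sigma>} x"
    using AE_lborel_singleton[of \<sigma>] AE_lborel_singleton[of "- \<sigma>"]
    by eventually_elim (auto simp: indicator_def bdry_def Gamma1_def Gamma2_def Gamma3_def)
  show "AE x in lborel. x \<in> {-\<sigma><..<\<sigma>} \<longrightarrow> ((\<lambda>\<tau>. transport \<sigma> (\<sigma> - \<tau>) \<tau> F (Complex x 0)) \<longlongrightarrow> boundary_trace \<sigma> F (Complex x 0)) (at_right 0) \<and>
      cmod (boundary_trace \<sigma> F (Complex x 0)) powr p \<le> (cmod (strip_bottom \<sigma> k1 k2 k3 x))\<^sup>2"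
    using trace_bottom by eventually_elim (simp add: abs_less_iff)
qed (auto simp: transport_bottom half_strip_def)

lemma side_Lp_convergence:
  assumes "boundary_side pt nearby I S K"
  shows "((\<lambda>\<tau>. \<integral>\<^sup>+x. ennreal (cmod (transport \<sigma> (\<sigma> - \<tau>) \<tau> F (pt x) -
     indicator (bdry \<sigma> 0) (pt x) * boundary_trace \<sigma> F (pt x)) powr p) \<partial>lborel) \<longlongrightarrow> 0) (at_right 0)"
proof (rule line_Lp_convergence[OF p \<sigma>, where Kt = "\<lambda>\<tau>. restr (I \<tau>) (\<lambda>x. strip_sum \<sigma> k1 k2 k3 (nearby \<tau> x))"
      and ?K0.0 = "restr S K"])
  have [measurable]: "pt \<in> borel_measurable borel" "\<And>\<tau>. nearby \<tau> \<in> borel_measurable borel" "\<And>\<tau>. I \<tau> \<in> sets borel"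
      "S \<in> sets borel" "K \<in> borel_measurable borel"
    and T: "\<And>\<tau> x. 0 < \<tau> \<Longrightarrow> \<tau> < \<sigma> \<Longrightarrow> transport \<sigma> (\<sigma> - \<tau>) \<tau> F (pt x) = restr (I \<tau>) (\<lambda>x. F (nearby \<tau> x)) x"
    and I: "\<And>\<tau> x. 0 < \<tau> \<Longrightarrow> \<tau> < \<sigma> \<Longrightarrow> x \<in> I \<tau> \<Longrightarrow> x \<in> S \<and> nearby \<tau> x \<in> half_strip \<sigma> 0"
    and S: "AE x in lborel. (indicator (bdry \<sigma> 0) (pt x) :: complex) = indicator S x"
    and tr: "AE x in lborel. x \<in> S \<longrightarrow> ((\<lambda>\<tau>. transport \<sigma> (\<sigma> - \<tau>) \<tau> F (pt x)) \<longlongrightarrow> boundary_trace \<sigma> F (pt x)) (at_right 0) \<and>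
      cmod (boundary_trace \<sigma> F (pt x)) powr p \<le> (cmod (K x))\<^sup>2"
    and K: "sqnorm (restr S K) < top" "((\<lambda>\<tau>. sqnorm (\<lambda>x. restr (I \<tau>) (\<lambda>x. strip_sum \<sigma> k1 k2 k3 (nearby \<tau> x)) x - restr S K x)) \<longlongrightarrow> 0) (at_right 0)"
    using assms unfolding boundary_side_def by blast+
  note [measurable] = strip_measurable[OF \<sigma> k] boundary_trace_measurable[OF Hp_holomorphic[OF F] \<sigma>]
  have [measurable]: "bdry \<sigma> 0 \<in> sets borel"
    unfolding bdry_def Gamma1_def Gamma2_def Gamma3_def by measurable
  show "(\<lambda>x. transport \<sigma> (\<sigma> - \<tau>) \<tau> F (pt x)) \<in> borel_measurable borel" if "0 < \<tau>" "\<tau> < \<sigma>" for \<tau>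
    by (rule measurable_compose[OF _ transport_measurable[OF Hp_holomorphic[OF F] that]]) measurable
  show "(\<lambda>x. indicator (bdry \<sigma> 0) (pt x) * boundary_trace \<sigma> F (pt x)) \<in> borel_measurable borel"
    by measurable
  show "restr (I \<tau>) (\<lambda>x. strip_sum \<sigma> k1 k2 k3 (nearby \<tau> x)) \<in> borel_measurable borel" for \<tau> by measurable
  show "restr S K \<in> borel_measurable borel" by measurable
  show "cmod (transport \<sigma> (\<sigma> - \<tau>) \<tau> F (pt x)) powr p \<le> (cmod (restr (I \<tau>) (\<lambda>x. strip_sum \<sigma> k1 k2 k3 (nearby \<tau> x)) x))\<^sup>2"
    if "0 < \<tau>" "\<tau> < \<sigma>" for \<tau> x
    unfolding T[OF that] restr_norm_powr restr_norm_square
    using I[OF that] maj by (auto simp: indicator_def)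
  show "AE x in lborel. cmod (indicator (bdry \<sigma> 0) (pt x) * boundary_trace \<sigma> F (pt x)) powr p \<le> (cmod (restr S K x))\<^sup>2"
    using tr S by eventually_elim (use p in \<open>auto simp: restr_def indicator_def\<close>)
  show "AE x in lborel. ((\<lambda>\<tau>. transport \<sigma> (\<sigma> - \<tau>) \<tau> F (pt x)) \<longlongrightarrow> indicator (bdry \<sigma> 0) (pt x) * boundary_trace \<sigma> F (pt x)) (at_right 0)"
    using tr S
  proof eventually_elim
    case (elim x)
    show ?case
    proof (cases "x \<in> S")
      case True
      then show ?thesis using elim by simp
    next
      case False
      have "\<forall>\<^sub>F \<tau> in at_right 0. 0 = transport \<sigma> (\<sigma> - \<tau>) \<tau> F (pt x)"
        using eventually_at_right_real[OF \<sigma>] by eventually_elim (use False I in \<open>auto simp: T restr_def indicator_def\<close>)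
      then show ?thesis
        using False elim by (auto intro: Lim_transform_eventually[OF tendsto_const])
    qed
  qed
  show "sqnorm (restr S K) < top"
    "((\<lambda>\<tau>. sqnorm (\<lambda>x. restr (I \<tau>) (\<lambda>x. strip_sum \<sigma> k1 k2 k3 (nearby \<tau> x)) x - restr S K x)) \<longlongrightarrow> 0) (at_right 0)"
    by (rule K)+
qed

theorem trace_Lp_convergence:
  "((\<lambda>\<tau>. Lp_norm p (gam_measure \<sigma>)
      (\<lambda>\<zeta>. transport \<sigma> (\<sigma> - \<tau>) \<tau> F \<zeta> - indicator (bdry \<sigma> 0) \<zeta> * boundary_trace \<sigma> F \<zeta>)) \<longlongrightarrow> 0) (at_right 0)"
proof (rule Lp_norm_tendsto_0[OF p])
  note [measurable] = boundary_trace_measurable[OF Hp_holomorphic[OF F] \<sigma>]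
  have [measurable]: "bdry \<sigma> 0 \<in> sets borel"
    unfolding bdry_def Gamma1_def Gamma2_def Gamma3_def by measurable
  let ?D = "\<lambda>\<tau> \<zeta>. ennreal (cmod (transport \<sigma> (\<sigma> - \<tau>) \<tau> F \<zeta> - indicator (bdry \<sigma> 0) \<zeta> * boundary_trace \<sigma> F \<zeta>) powr p)"
  have lim: "((\<lambda>\<tau>. (\<integral>\<^sup>+v. ?D \<tau> (Complex (- \<sigma>) v) \<partial>lborel) + (\<integral>\<^sup>+u. ?D \<tau> (Complex u 0) \<partial>lborel)
      + (\<integral>\<^sup>+v. ?D \<tau> (Complex \<sigma> v) \<partial>lborel)) \<longlongrightarrow> 0) (at_right 0)"
    using tendsto_add[OF tendsto_add[OF side_Lp_convergence[OF left_side] side_Lp_convergence[OF bottom_side]]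
      side_Lp_convergence[OF right_side]] by simp
  show "((\<lambda>\<tau>. \<integral>\<^sup>+\<zeta>. ?D \<tau> \<zeta> \<partial>gam_measure \<sigma>) \<longlongrightarrow> 0) (at_right 0)"
  proof (rule Lim_transform_eventually[OF lim], rule eventually_mono[OF eventually_at_right_real[OF \<sigma>]])
    fix \<tau> assume "\<tau> \<in> {0<..<\<sigma>}"
    then have \<tau>: "0 < \<tau>" "\<tau> < \<sigma>" by auto
    note [measurable] = transport_measurable[OF Hp_holomorphic[OF F] \<tau>]
    show "(\<integral>\<^sup>+v. ?D \<tau> (Complex (- \<sigma>) v) \<partial>lborel) + (\<integral>\<^sup>+u. ?D \<tau> (Complex u 0) \<partial>lborel)
      + (\<integral>\<^sup>+v. ?D \<tau> (Complex \<sigma> v) \<partial>lborel) = (\<integral>\<^sup>+\<zeta>. ?D \<tau> \<zeta> \<partial>gam_measure \<sigma>)"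
      by (rule nn_integral_gam_measure[symmetric]) measurable
  qed
qed

section \<open>Cauchy's formula\<close>

context
  fixes \<delta> d :: real and w L :: complex
  assumes p1: "p \<ge> 1" and \<delta>: "0 < \<delta>" "\<delta> \<le> \<sigma>" and d: "0 < d" and off: "uniformly_off_boundary \<sigma> \<delta> d w"
    and rect: "\<And>\<tau> R. 0 < \<tau> \<Longrightarrow> \<tau> < \<delta> \<Longrightarrow> R \<ge> \<bar>Im w\<bar> + \<sigma> + 1 \<Longrightarrow>
      rect_integral (\<lambda>\<zeta>. F \<zeta> / (\<zeta> - w)) (\<tau> - \<sigma>) (\<sigma> - \<tau>) \<tau> R = L"
begin

definition inset :: "nat \<Rightarrow> real" where "inset n = approach \<delta> n"

definition cut :: "nat \<Rightarrow> real" where "cut n = real n + \<bar>Im w\<bar> + \<sigma> + 1"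

lemma inset: "0 < inset n" "inset n < \<delta>" "inset n < \<sigma>" "filterlim inset (at_right 0) sequentially" "inset \<longlonglongrightarrow> 0"
proof -
  show 1: "0 < inset n" "inset n < \<delta>" "filterlim inset (at_right 0) sequentially"
    unfolding inset_def[abs_def] using approach[OF \<delta>(1)] by auto
  show "inset n < \<sigma>" using 1(2) \<delta>(2) by linarith
  show "inset \<longlonglongrightarrow> 0" using 1(3) by (simp add: filterlim_at)
qed

lemma cut: "inset n < cut n" "real n + 1 \<le> cut n - Im w" "\<forall>\<^sub>F n in sequentially. x \<le> cut n"
proof -
  show "inset n < cut n" "real n + 1 \<le> cut n - Im w" using inset(3)[of n] \<sigma> by (auto simp: cut_def)
  have "\<forall>\<^sub>F n in sequentially. x \<le> real n"
    by (rule eventually_sequentiallyI[of "nat \<lceil>x\<rceil>"]) linarith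
  then show "\<forall>\<^sub>F n in sequentially. x \<le> cut n"
    by eventually_elim (use \<sigma> in \<open>auto simp: cut_def\<close>)
qed

lemma restr_quotient: "restr S (\<lambda>x. f x / g x) x = restr S f x * (1 / g x)"
  by (simp add: restr_def scaleR_conv_of_real)

text \<open>
  The intervals \<open>J n\<close> cut the inset sides down to the sides of a rectangle. By the assumptions \<open>far\<close>
  the Cauchy kernel is bounded by a multiple of \<open>1 / (1 + |x|)\<close>.
\<close>

lemma side_limit:
  fixes lo hi :: "nat \<Rightarrow> real"
  defines "J \<equiv> \<lambda>n. {lo n..hi n}"
  assumes "boundary_side pt nearby I S K"
    and JI: "\<And>n. AE x in lborel. x \<in> J n \<longrightarrow> x \<in> I (inset n)"
    and J: "\<And>n x. x \<in> J n \<Longrightarrow> x \<in> S \<and> nearby (inset n) x \<in> half_strip \<sigma> 0"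
    and ev: "\<And>x. x \<in> S \<Longrightarrow> \<forall>\<^sub>F n in sequentially. x \<in> I (inset n) \<longleftrightarrow> x \<in> J n"
    and cont: "\<And>\<tau>. continuous_on UNIV (nearby \<tau>)" and approach: "\<And>x. (\<lambda>n. nearby (inset n) x) \<longlonglongrightarrow> pt x"
    and far: "\<And>n x. x \<in> J n \<Longrightarrow> d \<le> cmod (nearby (inset n) x - w) \<and> \<bar>x\<bar> \<le> cmod (nearby (inset n) x)"
      "\<And>x. x \<in> S \<Longrightarrow> d \<le> cmod (pt x - w) \<and> \<bar>x\<bar> \<le> cmod (pt x)"
  shows "integrable lborel (restr S (\<lambda>x. boundary_trace \<sigma> F (pt x) / (pt x - w)))"
    and "(\<lambda>n. integral (J n) (\<lambda>x. F (nearby (inset n) x) / (nearby (inset n) x - w)))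
      \<longlonglongrightarrow> (LINT x|lborel. restr S (\<lambda>x. boundary_trace \<sigma> F (pt x) / (pt x - w)) x)"
proof -
  have m [measurable]: "pt \<in> borel_measurable borel" "\<And>\<tau>. nearby \<tau> \<in> borel_measurable borel" "\<And>\<tau>. I \<tau> \<in> sets borel"
      "S \<in> sets borel" "K \<in> borel_measurable borel"
    and T: "\<And>\<tau> x. 0 < \<tau> \<Longrightarrow> \<tau> < \<sigma> \<Longrightarrow> transport \<sigma> (\<sigma> - \<tau>) \<tau> F (pt x) = restr (I \<tau>) (\<lambda>x. F (nearby \<tau> x)) x"
    and tr: "AE x in lborel. x \<in> S \<longrightarrow> ((\<lambda>\<tau>. transport \<sigma> (\<sigma> - \<tau>) \<tau> F (pt x)) \<longlongrightarrow> boundary_trace \<sigma> F (pt x)) (at_right 0) \<and>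
      cmod (boundary_trace \<sigma> F (pt x)) powr p \<le> (cmod (K x))\<^sup>2"
    and K: "sqnorm (restr S K) < top" "((\<lambda>\<tau>. sqnorm (\<lambda>x. restr (I \<tau>) (\<lambda>x. strip_sum \<sigma> k1 k2 k3 (nearby \<tau> x)) x - restr S K x)) \<longlongrightarrow> 0) (at_right 0)"
    using assms(2) unfolding boundary_side_def by blast+
  note [measurable] = strip_measurable[OF \<sigma> k] boundary_trace_measurable[OF Hp_holomorphic[OF F] \<sigma>]
  let ?T = "\<lambda>n. restr (J n) (\<lambda>x. F (nearby (inset n) x))" and ?B = "restr S (\<lambda>x. boundary_trace \<sigma> F (pt x))"
  let ?Kt = "\<lambda>n. restr (I (inset n)) (\<lambda>x. strip_sum \<sigma> k1 k2 k3 (nearby (inset n) x))"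
  have C: "0 < (1 + cmod w) / d + 1" using d by (intro add_nonneg_pos divide_nonneg_pos) auto
  have cF: "continuous_on (J n) (\<lambda>x. F (nearby (inset n) x))" for n
    using J by (intro continuous_on_compose2[OF holomorphic_on_imp_continuous_on[OF Hp_holomorphic[OF F]]]
        continuous_on_subset[OF cont]) auto
  have cq: "continuous_on (J n) (\<lambda>x. F (nearby (inset n) x) / (nearby (inset n) x - w))" for n
  proof (intro continuous_on_divide cF continuous_on_diff continuous_on_const continuous_on_subset[OF cont] ballI)
    show "nearby (inset n) x - w \<noteq> 0" if "x \<in> J n" for x using far(1)[OF that] d by auto
  qed simp
  have mT: "?T n \<in> borel_measurable borel" for n
    unfolding restr_def[abs_def] by (intro borel_measurable_continuous_on_indicator cF) (simp add: J_def)
  have mB: "?B \<in> borel_measurable borel" "?Kt n \<in> borel_measurable borel" "restr S K \<in> borel_measurable borel"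
    "(\<lambda>x. 1 / (nearby (inset n) x - w)) \<in> borel_measurable borel" "(\<lambda>x. 1 / (pt x - w)) \<in> borel_measurable borel" for n
    by measurable
  have TK: "AE x in lborel. cmod (?T n x) powr p \<le> (cmod (?Kt n x))\<^sup>2" for n
    using JI[of n] unfolding restr_norm_powr restr_norm_square
    by eventually_elim (use J maj in \<open>auto simp: indicator_def\<close>)
  have BK: "AE x in lborel. cmod (?B x) powr p \<le> (cmod (restr S K x))\<^sup>2"
    using tr unfolding restr_norm_powr restr_norm_square by eventually_elim (auto simp: indicator_def)
  have lim: "AE x in lborel. (\<lambda>n. ?T n x * (1 / (nearby (inset n) x - w))) \<longlonglongrightarrow> ?B x * (1 / (pt x - w))"
    using tr
  proof eventually_elim
    case (elim x)
    show ?case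
    proof (cases "x \<in> S")
      case True
      then have "((\<lambda>\<tau>. transport \<sigma> (\<sigma> - \<tau>) \<tau> F (pt x)) \<longlongrightarrow> ?B x) (at_right 0)"
        using elim by (simp add: restr_def)
      then have "(\<lambda>n. transport \<sigma> (\<sigma> - inset n) (inset n) F (pt x)) \<longlonglongrightarrow> ?B x"
        by (rule filterlim_compose[OF _ inset(4)])
      then have "(\<lambda>n. ?T n x) \<longlonglongrightarrow> ?B x"
        by (rule Lim_transform_eventually)
          (use ev[OF True] in eventually_elim, simp add: T[OF inset(1,3)] restr_def indicator_def)
      then show ?thesis
        using far(2)[OF True] d by (intro tendsto_mult tendsto_divide tendsto_diff tendsto_const approach) auto
    next
      case False
      then have "?T n x = 0" "?B x = 0" for n using J by (auto simp: restr_def indicator_def)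
      then show ?thesis by simp
    qed
  qed
  have c: "cmod (1 / (nearby (inset n) x - w)) \<le> ((1 + cmod w) / d + 1) / (1 + \<bar>x\<bar>)" if "?T n x \<noteq> 0" for n x
    using that far(1)[of x n] by (intro cauchy_kernel_decay d) (auto simp: restr_def indicator_def split: if_splits)
  have c': "cmod (1 / (pt x - w)) \<le> ((1 + cmod w) / d + 1) / (1 + \<bar>x\<bar>)" if "?B x \<noteq> 0" for x
    using that far(2)[of x] by (intro cauchy_kernel_decay d) (auto simp: restr_def indicator_def split: if_splits)
  have Kn: "(\<lambda>n. sqnorm (\<lambda>x. ?Kt n x - restr S K x)) \<longlonglongrightarrow> 0"
    by (rule filterlim_compose[OF K(2) inset(4)])
  have int: "integrable lborel (\<lambda>x. ?T n x * (1 / (nearby (inset n) x - w)))"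
    "integral (J n) (\<lambda>x. F (nearby (inset n) x) / (nearby (inset n) x - w)) = (LINT x|lborel. ?T n x * (1 / (nearby (inset n) x - w)))" for n
    using continuous_integral_lborel[OF cq[of n, unfolded J_def]]
    unfolding J_def restr_quotient[symmetric] by (simp_all add: restr_def scaleR_conv_of_real)
  note conv = weighted_line_convergence[OF mT mB C p1 TK BK lim c c' Kn K(1) int(1)]
  show "integrable lborel (restr S (\<lambda>x. boundary_trace \<sigma> F (pt x) / (pt x - w)))"
    unfolding restr_quotient[abs_def] by (rule conv(1))
  show "(\<lambda>n. integral (J n) (\<lambda>x. F (nearby (inset n) x) / (nearby (inset n) x - w)))
      \<longlonglongrightarrow> (LINT x|lborel. restr S (\<lambda>x. boundary_trace \<sigma> F (pt x) / (pt x - w)) x)"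
    unfolding int(2) restr_quotient by (rule conv(2))
qed

lemma off_boundary:
  assumes "0 \<le> \<tau>" "\<tau> < \<delta>"
  shows "v \<ge> 0 \<Longrightarrow> d \<le> cmod (Complex (\<tau> - \<sigma>) v - w)" "v \<ge> 0 \<Longrightarrow> d \<le> cmod (Complex (\<sigma> - \<tau>) v - w)"
    "\<bar>u\<bar> \<le> \<sigma> \<Longrightarrow> d \<le> cmod (Complex u \<tau> - w)"
  using off[unfolded uniformly_off_boundary_def, rule_format, of \<tau> "Complex (\<tau> - \<sigma>) v"]
    off[unfolded uniformly_off_boundary_def, rule_format, of \<tau> "Complex (\<sigma> - \<tau>) v"]
    off[unfolded uniformly_off_boundary_def, rule_format, of \<tau> "Complex u \<tau>"] assms \<delta> by auto

lemma coordinate_le_cmod: "\<bar>v\<bar> \<le> cmod (Complex a v)" "\<bar>v\<bar> \<le> cmod (Complex v a)"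
  using abs_Im_le_cmod[of "Complex a v"] abs_Re_le_cmod[of "Complex v a"] by auto

lemma eventually_in_cut:
  assumes "x > 0"
  shows "\<forall>\<^sub>F n in sequentially. x \<in> {inset n<..} \<longleftrightarrow> x \<in> {inset n..cut n}"
  using order_tendstoD(2)[OF inset(5) assms] cut(3)[of x] by eventually_elim auto

lemma AE_cut: "AE x in lborel. x \<in> {inset n..cut n} \<longrightarrow> x \<in> {inset n<..}"
  using AE_lborel_singleton[of "inset n"] by eventually_elim auto

lemma left_side_limit:
  shows "integrable lborel (restr {0<..} (\<lambda>v. boundary_trace \<sigma> F (Complex (- \<sigma>) v) / (Complex (- \<sigma>) v - w)))" (is ?A)
    and "(\<lambda>n. integral {inset n..cut n} (\<lambda>v. F (Complex (inset n - \<sigma>) v) / (Complex (inset n - \<sigma>) v - w)))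
    \<longlonglongrightarrow> (LINT v|lborel. restr {0<..} (\<lambda>v. boundary_trace \<sigma> F (Complex (- \<sigma>) v) / (Complex (- \<sigma>) v - w)) v)" (is ?B)
proof -
  have J: "x \<in> {0<..} \<and> Complex (inset n - \<sigma>) x \<in> half_strip \<sigma> 0" if "x \<in> {inset n..cut n}" for n x
    using that inset(1-3)[of n] by (auto simp: half_strip_def)
  have c: "continuous_on UNIV (Complex (\<tau> - \<sigma>))" for \<tau>
    unfolding Complex_eq by (intro continuous_intros)
  have l: "(\<lambda>n. Complex (inset n - \<sigma>) x) \<longlonglongrightarrow> Complex (- \<sigma>) x" for x
  proof -
    have "(\<lambda>n. Complex (inset n - \<sigma>) x) \<longlonglongrightarrow> Complex (0 - \<sigma>) x"
      unfolding Complex_eq by (intro tendsto_intros inset(5))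
    then show ?thesis by simp
  qed
  have far: "d \<le> cmod (Complex (inset n - \<sigma>) x - w) \<and> \<bar>x\<bar> \<le> cmod (Complex (inset n - \<sigma>) x)" if "x \<in> {inset n..cut n}" for n x
    using that inset(1-3)[of n] by (intro conjI coordinate_le_cmod off_boundary(1)) auto
  have far': "d \<le> cmod (Complex (- \<sigma>) x - w) \<and> \<bar>x\<bar> \<le> cmod (Complex (- \<sigma>) x)" if "x \<in> {0<..}" for x
    using that off_boundary(1)[of 0 x] \<delta> by (intro conjI coordinate_le_cmod) auto
  note lim = side_limit[OF left_side AE_cut J eventually_in_cut c l far far']
  show ?A ?B by (rule lim; simp)+
qed

lemma right_side_limit:
  shows "integrable lborel (restr {0<..} (\<lambda>v. boundary_trace \<sigma> F (Complex \<sigma> v) / (Complex \<sigma> v - w)))" (is ?A)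
    and "(\<lambda>n. integral {inset n..cut n} (\<lambda>v. F (Complex (\<sigma> - inset n) v) / (Complex (\<sigma> - inset n) v - w)))
    \<longlonglongrightarrow> (LINT v|lborel. restr {0<..} (\<lambda>v. boundary_trace \<sigma> F (Complex \<sigma> v) / (Complex \<sigma> v - w)) v)" (is ?B)
proof -
  have J: "x \<in> {0<..} \<and> Complex (\<sigma> - inset n) x \<in> half_strip \<sigma> 0" if "x \<in> {inset n..cut n}" for n x
    using that inset(1-3)[of n] by (auto simp: half_strip_def)
  have c: "continuous_on UNIV (Complex (\<sigma> - \<tau>))" for \<tau>
    unfolding Complex_eq by (intro continuous_intros)
  have l: "(\<lambda>n. Complex (\<sigma> - inset n) x) \<longlonglongrightarrow> Complex \<sigma> x" for x
  proof -
    have "(\<lambda>n. Complex (\<sigma> - inset n) x) \<longlonglongrightarrow> Complex (\<sigma> - 0) x"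
      unfolding Complex_eq by (intro tendsto_intros inset(5))
    then show ?thesis by simp
  qed
  have far: "d \<le> cmod (Complex (\<sigma> - inset n) x - w) \<and> \<bar>x\<bar> \<le> cmod (Complex (\<sigma> - inset n) x)" if "x \<in> {inset n..cut n}" for n x
    using that inset(1-3)[of n] by (intro conjI coordinate_le_cmod off_boundary(2)) auto
  have far': "d \<le> cmod (Complex \<sigma> x - w) \<and> \<bar>x\<bar> \<le> cmod (Complex \<sigma> x)" if "x \<in> {0<..}" for x
    using that off_boundary(2)[of 0 x] \<delta> by (intro conjI coordinate_le_cmod) auto
  note lim = side_limit[OF right_side AE_cut J eventually_in_cut c l far far']
  show ?A ?B by (rule lim; simp)+
qed

lemma bottom_side_limit:
  shows "integrable lborel (restr {-\<sigma><..<\<sigma>} (\<lambda>u. boundary_trace \<sigma> F (Complex u 0) / (Complex u 0 - w)))" (is ?A)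
    and "(\<lambda>n. integral {inset n - \<sigma>..\<sigma> - inset n} (\<lambda>u. F (Complex u (inset n)) / (Complex u (inset n) - w)))
    \<longlonglongrightarrow> (LINT u|lborel. restr {-\<sigma><..<\<sigma>} (\<lambda>u. boundary_trace \<sigma> F (Complex u 0) / (Complex u 0 - w)) u)" (is ?B)
proof -
  have J: "x \<in> {-\<sigma><..<\<sigma>} \<and> Complex x (inset n) \<in> half_strip \<sigma> 0" if "x \<in> {inset n - \<sigma>..\<sigma> - inset n}" for n x
    using that inset(1-3)[of n] by (auto simp: half_strip_def)
  have c: "continuous_on UNIV (\<lambda>u. Complex u \<tau>)" for \<tau>
    unfolding Complex_eq by (intro continuous_intros)
  have l: "(\<lambda>n. Complex x (inset n)) \<longlonglongrightarrow> Complex x 0" for x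
  proof -
    have "(\<lambda>n. Complex x (inset n)) \<longlonglongrightarrow> Complex x 0"
      unfolding Complex_eq by (intro tendsto_intros inset(5))
    then show ?thesis by simp
  qed
  have far: "d \<le> cmod (Complex x (inset n) - w) \<and> \<bar>x\<bar> \<le> cmod (Complex x (inset n))" if "x \<in> {inset n - \<sigma>..\<sigma> - inset n}" for n x
    using that inset(1-3)[of n] by (intro conjI coordinate_le_cmod off_boundary(3)) auto
  have far': "d \<le> cmod (Complex x 0 - w) \<and> \<bar>x\<bar> \<le> cmod (Complex x 0)" if "x \<in> {-\<sigma><..<\<sigma>}" for x
    using that off_boundary(3)[of 0 x] \<delta> by (intro conjI coordinate_le_cmod) auto
  note lim = side_limit[OF bottom_side AE_I2 J _ c l far far']
  show ?A ?B by (rule lim; simp)+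
qed

text \<open>
  On the top side the kernel is at most \<open>1 / (n + 1)\<close>, while the integral of \<open>|F| \<le> 1 + |F|\<^sup>p\<close> stays
  bounded.
\<close>

lemma top_side_limit:
  "(\<lambda>n. integral {inset n - \<sigma>..\<sigma> - inset n} (\<lambda>u. F (Complex u (cut n)) / (Complex u (cut n) - w))) \<longlonglongrightarrow> 0"
proof (rule Lim_null_comparison)
  let ?H = "enn2real (Hp_norm p \<sigma> F) powr p"
  show "(\<lambda>n. (2 * \<sigma> + ?H) / (real n + 1)) \<longlonglongrightarrow> 0"
  proof -
    have "(\<lambda>n. c / (real n + 1)) \<longlonglongrightarrow> 0" for c :: real by real_asymp
    then show ?thesis .
  qed
  show "\<forall>\<^sub>F n in sequentially. cmod (integral {inset n - \<sigma>..\<sigma> - inset n} (\<lambda>u. F (Complex u (cut n)) / (Complex u (cut n) - w)))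
      \<le> (2 * \<sigma> + ?H) / (real n + 1)"
  proof (rule always_eventually, rule allI)
    fix n
    note i = inset(1-3)[of n] cut(1,2)[of n]
    let ?A = "{inset n - \<sigma>..\<sigma> - inset n}" and ?z = "\<lambda>u. Complex u (cut n)"
    let ?g = "\<lambda>u. F (?z u) / (?z u - w)"
    have far: "real n + 1 \<le> cmod (?z u - w)" for u
      using i abs_Im_le_cmod[of "?z u - w"] by simp
    have cont: "continuous_on ?A (\<lambda>u. F (?z u))"
      by (intro continuous_on_horizontal[OF Hp_holomorphic[OF F]]) (use i in \<open>auto simp: half_strip_def\<close>)
    have cz: "continuous_on ?A ?z" unfolding Complex_eq by (intro continuous_intros)
    have nz: "?z u - w \<noteq> 0" for u
    proof -
      have "0 < cmod (?z u - w)" by (rule less_le_trans[OF _ far]) simp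
      then show ?thesis by simp
    qed
    have "ennreal (cmod (integral ?A ?g)) \<le> (\<integral>\<^sup>+u. indicator ?A u * (ennreal (1 / (real n + 1)) * (1 + ennreal (cmod (F (?z u)) powr p))) \<partial>lborel)"
    proof (rule norm_integral_le_nn_integral)
      show "continuous_on ?A ?g" using nz by (intro continuous_on_divide continuous_on_diff cont cz continuous_on_const) auto
      fix u
      have "cmod (?g u) \<le> cmod (F (?z u)) / (real n + 1)"
        unfolding norm_divide by (intro divide_left_mono far mult_pos_pos less_le_trans[OF _ far[of u]]) auto
      also have "\<dots> \<le> (1 + cmod (F (?z u)) powr p) / (real n + 1)"
      proof (intro divide_right_mono)
        show "cmod (F (?z u)) \<le> 1 + cmod (F (?z u)) powr p"
          using young_decay[of "cmod (F (?z u))" p 1] p1 by simp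
      qed simp
      finally show "ennreal (cmod (?g u)) \<le> ennreal (1 / (real n + 1)) * (1 + ennreal (cmod (F (?z u)) powr p))"
        by (simp flip: ennreal_mult ennreal_plus ennreal_1)
    qed
    also have "\<dots> = (\<integral>\<^sup>+u. ennreal (1 / (real n + 1)) * (indicator ?A u + indicator ?A u * ennreal (cmod (F (?z u)) powr p)) \<partial>lborel)"
      by (intro nn_integral_cong) (simp add: distrib_left mult.left_commute mult.commute)
    also have "\<dots> = ennreal (1 / (real n + 1)) * ((\<integral>\<^sup>+u. indicator ?A u \<partial>lborel) + (\<integral>\<^sup>+u. indicator ?A u * ennreal (cmod (F (?z u)) powr p) \<partial>lborel))"
    proof -
      have "(\<lambda>u. indicator ?A u *\<^sub>R F (?z u)) \<in> borel_measurable borel"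
        by (intro borel_measurable_continuous_on_indicator cont) auto
      then have "(\<lambda>u. ennreal (cmod (indicator ?A u *\<^sub>R F (?z u)) powr p)) \<in> borel_measurable borel" by measurable
      also have "(\<lambda>u. ennreal (cmod (indicator ?A u *\<^sub>R F (?z u)) powr p)) = (\<lambda>u. indicator ?A u * ennreal (cmod (F (?z u)) powr p))"
        using p by (auto simp: indicator_def fun_eq_iff)
      finally have [measurable]: "(\<lambda>u. indicator ?A u * ennreal (cmod (F (?z u)) powr p)) \<in> borel_measurable borel" .
      show ?thesis by (simp add: nn_integral_cmult nn_integral_add)
    qed
    also have "\<dots> \<le> ennreal (1 / (real n + 1)) * (ennreal (2 * \<sigma>) + ennreal ?H)"
    proof (intro mult_left_mono add_mono)
      show "(\<integral>\<^sup>+u. indicator ?A u \<partial>lborel) \<le> ennreal (2 * \<sigma>)"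
        using i by (auto intro!: ennreal_leI)
      have "(\<integral>\<^sup>+u. indicator ?A u * ennreal (cmod (F (?z u)) powr p) \<partial>lborel)
        \<le> (\<integral>\<^sup>+v. indicator {cut n..} v * ennreal (cmod (F (Complex (- (\<sigma> - inset n)) v)) powr p) \<partial>lborel)
          + (\<integral>\<^sup>+u. indicator {- (\<sigma> - inset n)..\<sigma> - inset n} u * ennreal (cmod (F (?z u)) powr p) \<partial>lborel)
          + (\<integral>\<^sup>+v. indicator {cut n..} v * ennreal (cmod (F (Complex (\<sigma> - inset n) v)) powr p) \<partial>lborel)"
        by (simp add: add_increasing add_increasing2 add.assoc)
      also have "\<dots> \<le> ennreal ?H"
        by (rule Hp_side_integrals[OF F p]) (use i in auto)
      finally show "(\<integral>\<^sup>+u. indicator ?A u * ennreal (cmod (F (?z u)) powr p) \<partial>lborel) \<le> ennreal ?H" .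
    qed auto
    also have "\<dots> = ennreal ((2 * \<sigma> + ?H) / (real n + 1))"
      using \<sigma> by (simp flip: ennreal_plus ennreal_mult)
    finally show "cmod (integral ?A ?g) \<le> (2 * \<sigma> + ?H) / (real n + 1)"
      using \<sigma> by (subst (asm) ennreal_le_iff) auto
  qed
qed

lemma boundary_cauchy_integral:
  "bdry_integrable \<sigma> 0 (\<lambda>\<zeta>. boundary_trace \<sigma> F \<zeta> / (\<zeta> - w))"
  "bdry_integral \<sigma> 0 (\<lambda>\<zeta>. boundary_trace \<sigma> F \<zeta> / (\<zeta> - w)) = L"
proof -
  have [measurable]: "boundary_trace \<sigma> F \<in> borel_measurable borel"
    by (rule boundary_trace_measurable[OF Hp_holomorphic[OF F] \<sigma>])
  have m: "(\<lambda>\<zeta>. boundary_trace \<sigma> F \<zeta> / (\<zeta> - w)) \<in> borel_measurable borel" by measurable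
  note three = bdry_integral_three_lines[OF m \<sigma> left_side_limit(1) bottom_side_limit(1) right_side_limit(1)]
  show "bdry_integrable \<sigma> 0 (\<lambda>\<zeta>. boundary_trace \<sigma> F \<zeta> / (\<zeta> - w))" by (rule three(1))
  have eq: "rect_integral (\<lambda>\<zeta>. F \<zeta> / (\<zeta> - w)) (inset n - \<sigma>) (\<sigma> - inset n) (inset n) (cut n) = L" for n
    using inset(1-3)[of n] by (intro rect) (auto simp: cut_def)
  note lim = tendsto_diff[OF tendsto_diff[OF tendsto_add[OF bottom_side_limit(2) tendsto_mult[OF tendsto_const[of \<i>] right_side_limit(2)]]
      top_side_limit] tendsto_mult[OF tendsto_const[of \<i>] left_side_limit(2)], unfolded eq[unfolded rect_integral_def]]
  from LIMSEQ_unique[OF lim tendsto_const[of L]]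
  show "bdry_integral \<sigma> 0 (\<lambda>\<zeta>. boundary_trace \<sigma> F \<zeta> / (\<zeta> - w)) = L"
    unfolding three(2) by (simp add: algebra_simps)
qed

end

lemma inset_rectangle:
  assumes "0 < \<tau>"
  shows "cbox (Complex (\<tau> - \<sigma>) \<tau>) (Complex (\<sigma> - \<tau>) R) \<subseteq> half_strip \<sigma> 0"
  using assms by (auto simp: in_cbox_complex_iff half_strip_def)

theorem cauchy_formula_inside:
  assumes "p \<ge> 1" and w: "w \<in> half_strip \<sigma> 0"
  shows "bdry_integrable \<sigma> 0 (\<lambda>\<zeta>. boundary_trace \<sigma> F \<zeta> / (\<zeta> - w))"
    and "bdry_integral \<sigma> 0 (\<lambda>\<zeta>. boundary_trace \<sigma> F \<zeta> / (\<zeta> - w)) = 2 * pi * \<i> * F w"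
proof -
  define d where "d = min ((\<sigma> - \<bar>Re w\<bar>) / 2) (Im w / 2)"
  have d: "0 < d" "2 * d \<le> \<sigma> - \<bar>Re w\<bar>" "2 * d \<le> Im w" "d \<le> \<sigma>"
    using w by (auto simp: d_def half_strip_def min_def)
  have "uniformly_off_boundary \<sigma> d d w"
    unfolding uniformly_off_boundary_def
  proof (intro allI impI)
    fix \<tau> \<zeta> assume A: "0 \<le> \<tau> \<and> \<tau> < d \<and> (\<bar>Re \<zeta>\<bar> = \<sigma> - \<tau> \<and> 0 \<le> Im \<zeta> \<or> \<bar>Re \<zeta>\<bar> \<le> \<sigma> \<and> Im \<zeta> = \<tau>)"
    have "d \<le> \<bar>Re (\<zeta> - w)\<bar> \<or> d \<le> \<bar>Im (\<zeta> - w)\<bar>" using A d by auto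
    then show "d \<le> cmod (\<zeta> - w)" using abs_Re_le_cmod[of "\<zeta> - w"] abs_Im_le_cmod[of "\<zeta> - w"] by linarith
  qed
  moreover have "rect_integral (\<lambda>\<zeta>. F \<zeta> / (\<zeta> - w)) (\<tau> - \<sigma>) (\<sigma> - \<tau>) \<tau> R = 2 * pi * \<i> * F w"
    if "0 < \<tau>" "\<tau> < d" "R \<ge> \<bar>Im w\<bar> + \<sigma> + 1" for \<tau> R
    using that d by (intro rect_integral_Cauchy[OF _ _ convex_half_strip open_half_strip Hp_holomorphic[OF F] inset_rectangle]) auto
  ultimately show "bdry_integrable \<sigma> 0 (\<lambda>\<zeta>. boundary_trace \<sigma> F \<zeta> / (\<zeta> - w))"
    "bdry_integral \<sigma> 0 (\<lambda>\<zeta>. boundary_trace \<sigma> F \<zeta> / (\<zeta> - w)) = 2 * pi * \<i> * F w"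
    using boundary_cauchy_integral[OF assms(1) d(1,4,1)] by blast+
qed

theorem cauchy_formula_outside:
  assumes "p \<ge> 1" and w: "w \<notin> closure (half_strip \<sigma> 0)"
  shows "bdry_integrable \<sigma> 0 (\<lambda>\<zeta>. boundary_trace \<sigma> F \<zeta> / (\<zeta> - w))"
    and "bdry_integral \<sigma> 0 (\<lambda>\<zeta>. boundary_trace \<sigma> F \<zeta> / (\<zeta> - w)) = 0"
proof -
  define d where "d = max (\<bar>Re w\<bar> - \<sigma>) (- Im w)"
  have d: "0 < d" using w unfolding closure_half_strip[OF \<sigma>] by (auto simp: d_def)
  have "uniformly_off_boundary \<sigma> \<sigma> d w"
    unfolding uniformly_off_boundary_def
  proof (intro allI impI)
    fix \<tau> \<zeta> assume A: "0 \<le> \<tau> \<and> \<tau> < \<sigma> \<and> (\<bar>Re \<zeta>\<bar> = \<sigma> - \<tau> \<and> 0 \<le> Im \<zeta> \<or> \<bar>Re \<zeta>\<bar> \<le> \<sigma> \<and> Im \<zeta> = \<tau>)"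
    have "d \<le> \<bar>Re (\<zeta> - w)\<bar> \<or> d \<le> \<bar>Im (\<zeta> - w)\<bar>" using A by (auto simp: d_def max_def)
    then show "d \<le> cmod (\<zeta> - w)" using abs_Re_le_cmod[of "\<zeta> - w"] abs_Im_le_cmod[of "\<zeta> - w"] by linarith
  qed
  moreover have "rect_integral (\<lambda>\<zeta>. F \<zeta> / (\<zeta> - w)) (\<tau> - \<sigma>) (\<sigma> - \<tau>) \<tau> R = 0"
    if "0 < \<tau>" "\<tau> < \<sigma>" "R \<ge> \<bar>Im w\<bar> + \<sigma> + 1" for \<tau> R
  proof (rule rect_integral_zero[OF _ _ convex_half_strip _ inset_rectangle])
    show "(\<lambda>\<zeta>. F \<zeta> / (\<zeta> - w)) holomorphic_on half_strip \<sigma> 0"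
      using w closure_subset by (intro holomorphic_intros Hp_holomorphic[OF F]) auto
  qed (use that in auto)
  ultimately show "bdry_integrable \<sigma> 0 (\<lambda>\<zeta>. boundary_trace \<sigma> F \<zeta> / (\<zeta> - w))"
    "bdry_integral \<sigma> 0 (\<lambda>\<zeta>. boundary_trace \<sigma> F \<zeta> / (\<zeta> - w)) = 0"
    using boundary_cauchy_integral[OF assms(1) \<sigma> order.refl d] by blast+
qed

end

section \<open>Boundary values, mean convergence and Cauchy representation\<close>

theorem theorem6p13:
  fixes \<sigma> p :: real and F :: "complex \<Rightarrow> complex"
  assumes "\<sigma> > 0" and "p > 0" and "F \<in> Hp p \<sigma>"
  shows "\<exists>f :: complex \<Rightarrow> complex.
    (AE \<zeta> in arc_measure \<sigma> 0. has_nt_limit \<sigma> F \<zeta> (f \<zeta>)) \<and>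
    f \<in> Lp p (arc_measure \<sigma> 0) \<and>
    Lp_norm p (arc_measure \<sigma> 0) f \<le> Hp_norm p \<sigma> F \<and>
    ((\<lambda>\<tau>. Lp_norm p (gam_measure \<sigma>)
        (\<lambda>\<zeta>. transport \<sigma> (\<sigma> - \<tau>) \<tau> F \<zeta> - indicator (bdry \<sigma> 0) \<zeta> * f \<zeta>))
      \<longlongrightarrow> 0) (at_right 0) \<and>
    (p \<ge> 1 \<longrightarrow>
      (\<forall>w\<in>Omega_plus \<sigma>. bdry_integrable \<sigma> 0 (\<lambda>\<zeta>. f \<zeta> / (\<zeta> - w)) \<and>
         1 / (2 * of_real pi * \<i>) * bdry_integral \<sigma> 0 (\<lambda>\<zeta>. f \<zeta> / (\<zeta> - w)) = F w) \<and>
      (\<forall>w\<in>Omega_minus \<sigma>. bdry_integrable \<sigma> 0 (\<lambda>\<zeta>. f \<zeta> / (\<zeta> - w)) \<and>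
         1 / (2 * of_real pi * \<i>) * bdry_integral \<sigma> 0 (\<lambda>\<zeta>. f \<zeta> / (\<zeta> - w)) = 0))"
proof -
  from Hp_factorization[OF assms(3,2,1)]
  obtain N k1 k2 k3 b1 b2 b3 where k: "hardy2 N k1" "hardy2 N k2" "hardy2 N k3"
    and b: "hardy2 N b1" "hardy2 N b2" "hardy2 N b3"
    and maj: "\<And>w. w \<in> half_strip \<sigma> 0 \<Longrightarrow> cmod (F w) powr p \<le> (cmod (strip_sum \<sigma> k1 k2 k3 w))\<^sup>2"
    and pos: "\<And>w. w \<in> half_strip \<sigma> 0 \<Longrightarrow> 0 < Re (strip_sum \<sigma> k1 k2 k3 w)"
    and fac: "\<And>w. w \<in> half_strip \<sigma> 0 \<Longrightarrow> F w = strip_sum \<sigma> b1 b2 b3 w * (w + \<i>) * strip_sum \<sigma> k1 k2 k3 w powr of_real (2 / p)"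
    by blast
  note facts = assms k b maj pos fac
  show ?thesis
  proof (intro exI[of _ "boundary_trace \<sigma> F"] conjI impI ballI)
    show "AE \<zeta> in arc_measure \<sigma> 0. has_nt_limit \<sigma> F \<zeta> (boundary_trace \<sigma> F \<zeta>)"
      by (rule trace_nontangential[OF facts])
    show "boundary_trace \<sigma> F \<in> Lp p (arc_measure \<sigma> 0)"
      by (rule trace_norm_le(2)[OF facts])
    show "Lp_norm p (arc_measure \<sigma> 0) (boundary_trace \<sigma> F) \<le> Hp_norm p \<sigma> F"
      by (rule trace_norm_le(1)[OF facts])
    show "((\<lambda>\<tau>. Lp_norm p (gam_measure \<sigma>)
        (\<lambda>\<zeta>. transport \<sigma> (\<sigma> - \<tau>) \<tau> F \<zeta> - indicator (bdry \<sigma> 0) \<zeta> * boundary_trace \<sigma> F \<zeta>)) \<longlongrightarrow> 0) (at_right 0)"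
      by (rule trace_Lp_convergence[OF facts])
  next
    fix w assume "p \<ge> 1" "w \<in> Omega_plus \<sigma>"
    then have w: "p \<ge> 1" "w \<in> half_strip \<sigma> 0" by (auto simp: Omega_plus_def)
    show "bdry_integrable \<sigma> 0 (\<lambda>\<zeta>. boundary_trace \<sigma> F \<zeta> / (\<zeta> - w))"
      by (rule cauchy_formula_inside(1)[OF facts w])
    show "1 / (2 * of_real pi * \<i>) * bdry_integral \<sigma> 0 (\<lambda>\<zeta>. boundary_trace \<sigma> F \<zeta> / (\<zeta> - w)) = F w"
      by (subst cauchy_formula_inside(2)[OF facts w]) auto
  next
    fix w assume "p \<ge> 1" "w \<in> Omega_minus \<sigma>"
    then have w: "p \<ge> 1" "w \<notin> closure (half_strip \<sigma> 0)" by (auto simp: Omega_minus_def)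
    show "bdry_integrable \<sigma> 0 (\<lambda>\<zeta>. boundary_trace \<sigma> F \<zeta> / (\<zeta> - w))"
      by (rule cauchy_formula_outside(1)[OF facts w])
    show "1 / (2 * of_real pi * \<i>) * bdry_integral \<sigma> 0 (\<lambda>\<zeta>. boundary_trace \<sigma> F \<zeta> / (\<zeta> - w)) = 0"
      by (subst cauchy_formula_outside(2)[OF facts w]) auto
  qed
qed

end
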